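(* Let $q$ be a prime power and let $r,s,d$ be integers with $1<s<r$, $d>s$ and $q>2d^s(d+1)^s$. Let $h^*:=r-s+1$. The average-case complexity $E$ of the SVS (Search on Vertical Strips) algorithm is bounded in the following way: $$E\le\tau(d,s,q)\Big(\mu_d^{-1}+h^*(1-\mu_d)^{h^*}+\frac{3h^*e^{h^*}}{(d+1)!}+\mathcal{O}\Big(\frac{r(d+1)^{2r}}{q}\Big)\Big)\quad\text{for } d\text{ odd},$$ $$E\le\tau(d,s,q)\Big(\mu_{d+1}^{-1}+h^*(1-\mu_{d+1})^{h^*}+\frac{3h^*e^{h^*}}{(d+1)!}+\mathcal{O}\Big(\frac{r(d+1)^{2r}}{q}\Big)\Big)\quad\text{for } d\text{ even},$$ where $\tau(d,s,q)$ is the cost of the search in a vertical strip. Further, the probability $P$ of failure of the SVS algorithm can be bounded as follows: $$\big|P-(1-\mu_d)^{h^*}\big|\le\frac{e^{h^*}}{(d+1)!}+\mathcal{O}\Big(\frac{r(d+1)^{2r}}{q}\Big)\quad\text{for } d\text{ odd},$$ $$\big|P-(1-\mu_{d+1})^{h^*}\big|\le\frac{e^{h^*}}{(d+1)!}+\mathcal{O}\Big(\frac{r(d+1)^{2r}}{q}\Big)\quad\text{for } d\text{ even}.$$ In all cases the constant underlying the $\mathcal{O}$-notation is independent of $r$, $s$, $d$ and $q$.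
   Context: Notation. $\mathbb{F}_q$ is the finite field with $q$ elements, $\overline{\mathbb{F}}_q$ its algebraic closure. $\mathcal{F}_d$ is the set of all polynomials in $\mathbb{F}_q[X_1,\ldots,X_r]$ of degree at most $d$ (including zero), $\mathcal{F}_d^s$ its $s$-fold Cartesian product. For $\boldsymbol F_s=(F_1,\ldots,F_s)\in\mathcal{F}_d^s$ and $\boldsymbol a\in\mathbb{F}_q^{r-s}$, $\boldsymbol F_s(\boldsymbol a,-):=(F_i(\boldsymbol a,X_{r-s+1},\ldots,X_r))_{1\le i\le s}$. For $m\in\mathbb{N}$, $\mu_m:=\sum_{j=1}^m\frac{(-1)^{j-1}}{j!}$; $e$ is the basis of the natural logarithm. $\mathsf{F}_{h^*}$ is the set of $h^*$-tuples of pairwise distinct elements of $\mathbb{F}_q^{r-s}$. Polynomials $G_1,\ldots,G_s$ in a polynomial ring $R$ over a field form a reduced regular sequence if $(G_1,\ldots,G_s)\ne R$, $G_1\ne0$, each $G_i$ ($2\le i\le s$) is neither zero nor a zero divisor in $R/(G_1,\ldots,G_{i-1})$, and each ideal $(G_1,\ldots,G_i)$ ($1\le i\le s$) is radical. We say $\boldsymbol F_s(\boldsymbol a,-)$ satisfies $(\mathsf{H})$ if it forms a reduced regular sequence in $\overline{\mathbb{F}}_q[X_{r-s+1},\ldots,X_r]$. SVS algorithm. Input: $\boldsymbol F_s\in\mathcal{F}_d^s$. For $i=1,2,\ldots,h^*$: choose at random $\boldsymbol a_i\in\mathbb{F}_q^{r-s}\setminus\{\boldsymbol a_1,\ldots,\boldsymbol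 a_{i-1}\}$ and apply a zero-dimensional solver to search for a common zero $\boldsymbol x\in\mathbb{F}_q^s$ of $\boldsymbol F_s(\boldsymbol a_i,-)$ (a search in the vertical strip $\{\boldsymbol a_i\}\times\mathbb{F}_q^s$); if one is found, stop and return $(\boldsymbol a_i,\boldsymbol x)$. If no zero is found for $i=1,\ldots,h^*$, return "Failure". Solver and cost model. The solver is a (probabilistic) procedure using random parameters $\omega$ from a finite set $\Omega_d$ with the uniform probability. Each search (including the computation of the coefficients of the specialization $\boldsymbol F_s(\boldsymbol a_i,-)$) is truncated after $\tau(d,s,q)$ arithmetic operations in $\mathbb{F}_q$, so it costs at most $\tau(d,s,q)$; the solver only outputs true zeros. If $\boldsymbol F_s(\boldsymbol a,-)$ has a zero in $\mathbb{F}_q^s$ and satisfies $(\mathsf{H})$, then the proportion of $\omega\in\Omega_d$ for which the solver fails to find an $\mathbb{F}_q$-rational zero of $\boldsymbol F_s(\boldsymbol a,-)$ is $\mathcal{O}(q^{-1})$, with an absolute constant. The cost of random generation of the $\boldsymbol a_i$ is ignored. $X(\underline{\boldsymbol a},\boldsymbol F_s,\omega)$ denotes the number of arithmetic operations in $\mathbb{F}_q$ performed by the algorithm on input $\boldsymbol F_s$, with vertical strips given by $\underline{\boldsymbol a}=(\boldsymbol a_1,\ldots,\boldsymbol a_{h^*})\in\mathsf{F}_{h^*}$ and solver parameters $\omega$. The average-case complexity is the expected value $$E:=\frac{1}{|\mathsf{F}_{h^*}||\mathcal{F}_d^s||\Omega_d|}\sum_{(\underline{\boldsymbol a},\boldsymbol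 F_s,\omega)\in\mathsf{F}_{h^*}\times\mathcal{F}_d^s\times\Omega_d}X(\underline{\boldsymbol a},\boldsymbol F_s,\omega),$$ and the probability $P$ of failure is the probability, with respect to the uniform probability on $\mathsf{F}_{h^*}\times\mathcal{F}_d^s\times\Omega_d$, that the algorithm returns "Failure". *)

theory Defs
  imports Complex_Main "HOL-Library.FuncSet" "HOL-Algebra.QuotRing" "HOL-Algebra.Algebraic_Closure"
begin

text \<open>Polynomials are represented as in \<^theory>\<open>HOL-Algebra.Indexed_Polynomials\<close>: a monomial is a
  multiset of variable indices and a polynomial maps monomials to coefficients.  That theory
  provides the carrier and the addition; the multiplication is the usual convolution.\<close>

definition mpoly_ring :: "('a, 'b) ring_scheme \<Rightarrow> 'c set \<Rightarrow> ('c multiset \<Rightarrow> 'a) ring" where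
  "mpoly_ring R I =
     \<lparr> carrier = ring.indexed_pset R I (carrier R),
       monoid.mult = (\<lambda>f g m. \<Oplus>\<^bsub>R\<^esub>n\<in>{n. n \<subseteq># m}. f n \<otimes>\<^bsub>R\<^esub> g (m - n)),
       one = ring.indexed_const R \<one>\<^bsub>R\<^esub>,
       zero = ring.indexed_const R \<zero>\<^bsub>R\<^esub>,
       add = ring.indexed_padd R \<rparr>"

text \<open>From here on the finite field with \<open>q\<close> elements is a finite subfield \<open>K\<close> of an algebraic
  closure \<open>L\<close> of \<open>K\<close>.  Fields are records rather than type class instances, because one constant
  has to work for all \<open>q\<close> and types cannot be quantified within a proposition.  The carrier type \<open>'a\<close>
  is no restriction: every algebraic closure of a finite field is countable, so that \<open>'a = nat\<close>
  covers all of them at once.\<close>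

definition polys_le :: "('a, 'b) ring_scheme \<Rightarrow> 'a set \<Rightarrow> 'c set \<Rightarrow> nat \<Rightarrow> ('c multiset \<Rightarrow> 'a) set" where
  "polys_le L K I d = {f \<in> ring.indexed_pset L I K. \<forall>m. f m \<noteq> \<zero>\<^bsub>L\<^esub> \<longrightarrow> size m \<le> d}"

definition monomial_eval :: "('a, 'b) ring_scheme \<Rightarrow> ('c \<Rightarrow> 'a) \<Rightarrow> 'c multiset \<Rightarrow> 'a" where
  "monomial_eval L x m = (\<Otimes>\<^bsub>L\<^esub>i\<in>set_mset m. x i [^]\<^bsub>L\<^esub> count m i)"

definition mpoly_eval :: "('a, 'b) ring_scheme \<Rightarrow> ('c \<Rightarrow> 'a) \<Rightarrow> ('c multiset \<Rightarrow> 'a) \<Rightarrow> 'a" where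
  "mpoly_eval L x f = (\<Oplus>\<^bsub>L\<^esub>m\<in>{m. f m \<noteq> \<zero>\<^bsub>L\<^esub>}. f m \<otimes>\<^bsub>L\<^esub> monomial_eval L x m)"

text \<open>Substitution of \<open>a i\<close> for the variable with index \<open>i\<close>, for all \<open>i \<in> A\<close>; the other variables
  are kept.\<close>

definition mpoly_specialize ::
  "('a, 'b) ring_scheme \<Rightarrow> 'c set \<Rightarrow> ('c \<Rightarrow> 'a) \<Rightarrow> ('c multiset \<Rightarrow> 'a) \<Rightarrow> ('c multiset \<Rightarrow> 'a)" where
  "mpoly_specialize L A a f =
     (\<lambda>m. if set_mset m \<inter> A = {}
          then \<Oplus>\<^bsub>L\<^esub>n\<in>{n. set_mset n \<subseteq> A \<and> f (m + n) \<noteq> \<zero>\<^bsub>L\<^esub>}. f (m + n) \<otimes>\<^bsub>L\<^esub> monomial_eval L a n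
          else \<zero>\<^bsub>L\<^esub>)"


definition radical_ideal :: "('a, 'b) ring_scheme \<Rightarrow> 'a set \<Rightarrow> bool" where
  "radical_ideal R I \<longleftrightarrow> ideal I R \<and> (\<forall>x\<in>carrier R. \<forall>n::nat. x [^]\<^bsub>R\<^esub> n \<in> I \<longrightarrow> x \<in> I)"

definition zero_divisor :: "('a, 'b) ring_scheme \<Rightarrow> 'a \<Rightarrow> bool" where
  "zero_divisor R x \<longleftrightarrow> (\<exists>y\<in>carrier R. y \<noteq> \<zero>\<^bsub>R\<^esub> \<and> x \<otimes>\<^bsub>R\<^esub> y = \<zero>\<^bsub>R\<^esub>)"

definition reduced_regular_sequence :: "('a, 'b) ring_scheme \<Rightarrow> nat \<Rightarrow> (nat \<Rightarrow> 'a) \<Rightarrow> bool" where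
  "reduced_regular_sequence R s G \<longleftrightarrow>
     (\<forall>i\<in>{1..s}. G i \<in> carrier R) \<and>
     Idl\<^bsub>R\<^esub> (G ` {1..s}) \<noteq> carrier R \<and>
     G 1 \<noteq> \<zero>\<^bsub>R\<^esub> \<and>
     (\<forall>i\<in>{2..s}. let I = Idl\<^bsub>R\<^esub> (G ` {1..i-1}); g = I +>\<^bsub>R\<^esub> G i
                 in g \<noteq> \<zero>\<^bsub>R Quot I\<^esub> \<and> \<not> zero_divisor (R Quot I) g) \<and>
     (\<forall>i\<in>{1..s}. radical_ideal R (Idl\<^bsub>R\<^esub> (G ` {1..i})))"


text \<open>The variables are indexed by \<open>{1..r}\<close>.  A vertical strip is given by a point with coordinates
  indexed by \<open>{1..r-s}\<close>; the points within a strip have coordinates indexed by \<open>{r-s+1..r}\<close>, that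
  is, by the variables that are left after specialization.\<close>

type_synonym 'a mpoly_system = "nat \<Rightarrow> nat multiset \<Rightarrow> 'a"

definition systems :: "('a, 'b) ring_scheme \<Rightarrow> 'a set \<Rightarrow> nat set \<Rightarrow> nat \<Rightarrow> nat \<Rightarrow> 'a mpoly_system set" where
  "systems L K I s d = {1..s} \<rightarrow>\<^sub>E polys_le L K I d"

definition strips :: "'a set \<Rightarrow> nat \<Rightarrow> nat \<Rightarrow> (nat \<Rightarrow> 'a) set" where
  "strips K r s = {1..r-s} \<rightarrow>\<^sub>E K"

definition strip_tuples :: "'a set \<Rightarrow> nat \<Rightarrow> nat \<Rightarrow> nat \<Rightarrow> (nat \<Rightarrow> 'a) list set" where
  "strip_tuples K r s h = {as. length as = h \<and> distinct as \<and> set as \<subseteq> strips K r s}"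

definition specialize :: "('a, 'b) ring_scheme \<Rightarrow> nat \<Rightarrow> nat \<Rightarrow> 'a mpoly_system \<Rightarrow> (nat \<Rightarrow> 'a) \<Rightarrow> 'a mpoly_system" where
  "specialize L r s F a = (\<lambda>i\<in>{1..s}. mpoly_specialize L {1..r-s} a (F i))"

definition rational_zeros ::
  "('a, 'b) ring_scheme \<Rightarrow> 'a set \<Rightarrow> nat \<Rightarrow> nat \<Rightarrow> 'a mpoly_system \<Rightarrow> (nat \<Rightarrow> 'a) set" where
  "rational_zeros L K r s G =
     {x \<in> {r-s+1..r} \<rightarrow>\<^sub>E K. \<forall>i\<in>{1..s}. mpoly_eval L x (G i) = \<zero>\<^bsub>L\<^esub>}"

definition cond_H :: "('a, 'b) ring_scheme \<Rightarrow> nat \<Rightarrow> nat \<Rightarrow> 'a mpoly_system \<Rightarrow> bool" where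
  "cond_H L r s G \<longleftrightarrow> reduced_regular_sequence (mpoly_ring L {r-s+1..r}) s G"


text \<open>A solver receives a system in the remaining variables and a random parameter; it returns a
  zero, or \<open>None\<close>, together with the number of arithmetic operations it performs.  The function
  \<open>spec_cost\<close> counts the operations used for the coefficients of the specialization.\<close>

type_synonym ('a, 'w) zero_solver = "'a mpoly_system \<Rightarrow> 'w \<Rightarrow> (nat \<Rightarrow> 'a) option \<times> nat"
type_synonym 'a spec_cost = "'a mpoly_system \<Rightarrow> (nat \<Rightarrow> 'a) \<Rightarrow> nat"

definition strip_search ::
  "('a, 'b) ring_scheme \<Rightarrow> nat \<Rightarrow> nat \<Rightarrow> nat \<Rightarrow> ('a, 'w) zero_solver \<Rightarrow> 'a spec_cost
   \<Rightarrow> 'a mpoly_system \<Rightarrow> 'w \<Rightarrow> (nat \<Rightarrow> 'a) \<Rightarrow> (nat \<Rightarrow> 'a) option \<times> nat" where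
  "strip_search L r s t solver spec_cost F \<omega> a =
     (let (res, c) = solver (specialize L r s F a) \<omega>; n = spec_cost F a + c
      in if n \<le> t then (res, n) else (None, t))"

text \<open>The result (\<open>None\<close> is ``Failure'') and the number of operations of the algorithm that searches
  the given strips successively.\<close>

primrec svs :: "('b \<Rightarrow> 'x option \<times> nat) \<Rightarrow> 'b list \<Rightarrow> ('b \<times> 'x) option \<times> nat" where
  "svs search [] = (None, 0)"
| "svs search (a # as) =
     (case search a of
        (Some x, c) \<Rightarrow> (Some (a, x), c)
      | (None, c) \<Rightarrow> (let (res, c') = svs search as in (res, c + c')))"

definition svs_run ::
  "('a, 'b) ring_scheme \<Rightarrow> nat \<Rightarrow> nat \<Rightarrow> nat \<Rightarrow> ('a, 'w) zero_solver \<Rightarrow> 'a spec_cost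
   \<Rightarrow> (nat \<Rightarrow> 'a) list \<Rightarrow> 'a mpoly_system \<Rightarrow> 'w \<Rightarrow> ((nat \<Rightarrow> 'a) \<times> (nat \<Rightarrow> 'a)) option \<times> nat" where
  "svs_run L r s t solver spec_cost as F \<omega> = svs (strip_search L r s t solver spec_cost F \<omega>) as"

definition average_cost ::
  "('a, 'b) ring_scheme \<Rightarrow> 'a set \<Rightarrow> nat \<Rightarrow> nat \<Rightarrow> nat \<Rightarrow> nat \<Rightarrow> nat
   \<Rightarrow> ('a, 'w) zero_solver \<Rightarrow> 'a spec_cost \<Rightarrow> 'w set \<Rightarrow> real" where
  "average_cost L K r s d h t solver spec_cost \<Omega> =
     (\<Sum>(as, F, \<omega>)\<in>strip_tuples K r s h \<times> systems L K {1..r} s d \<times> \<Omega>.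
        real (snd (svs_run L r s t solver spec_cost as F \<omega>)))
     / (real (card (strip_tuples K r s h)) * real (card (systems L K {1..r} s d)) * real (card \<Omega>))"

definition failure_prob ::
  "('a, 'b) ring_scheme \<Rightarrow> 'a set \<Rightarrow> nat \<Rightarrow> nat \<Rightarrow> nat \<Rightarrow> nat \<Rightarrow> nat
   \<Rightarrow> ('a, 'w) zero_solver \<Rightarrow> 'a spec_cost \<Rightarrow> 'w set \<Rightarrow> real" where
  "failure_prob L K r s d h t solver spec_cost \<Omega> =
     real (card {(as, F, \<omega>) \<in> strip_tuples K r s h \<times> systems L K {1..r} s d \<times> \<Omega>.
                   fst (svs_run L r s t solver spec_cost as F \<omega>) = None})
     / (real (card (strip_tuples K r s h)) * real (card (systems L K {1..r} s d)) * real (card \<Omega>))"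

definition outputs_true_zeros ::
  "('a, 'b) ring_scheme \<Rightarrow> 'a set \<Rightarrow> nat \<Rightarrow> nat \<Rightarrow> nat \<Rightarrow> ('a, 'w) zero_solver \<Rightarrow> 'w set \<Rightarrow> bool" where
  "outputs_true_zeros L K r s d solver \<Omega> \<longleftrightarrow>
     (\<forall>G\<in>systems L K {r-s+1..r} s d. \<forall>\<omega>\<in>\<Omega>. \<forall>x.
        fst (solver G \<omega>) = Some x \<longrightarrow> x \<in> rational_zeros L K r s G)"

text \<open>The (truncated) search overlooks existing zeros with probability at most \<open>c / q\<close>, provided
  that the specialized system satisfies \<open>cond_H\<close>.\<close>

definition solver_reliable ::
  "('a, 'b) ring_scheme \<Rightarrow> 'a set \<Rightarrow> nat \<Rightarrow> nat \<Rightarrow> nat \<Rightarrow> nat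
   \<Rightarrow> ('a, 'w) zero_solver \<Rightarrow> 'a spec_cost \<Rightarrow> 'w set \<Rightarrow> real \<Rightarrow> bool" where
  "solver_reliable L K r s d t solver spec_cost \<Omega> c \<longleftrightarrow>
     (\<forall>F\<in>systems L K {1..r} s d. \<forall>a\<in>strips K r s.
        rational_zeros L K r s (specialize L r s F a) \<noteq> {} \<and> cond_H L r s (specialize L r s F a) \<longrightarrow>
        real (card {\<omega>\<in>\<Omega>. fst (strip_search L r s t solver spec_cost F \<omega> a) = None}) / real (card \<Omega>)
          \<le> c / real (card K))"

definition mu :: "nat \<Rightarrow> real" where
  "mu m = (\<Sum>j=1..m. (-1) ^ (j - 1) / fact j)"

end

theory Submission
  imports Defs "HOL-Library.Poly_Mapping" "HOL-Library.Multiset_Order" "Jordan_Normal_Form.Char_Poly"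
    "HOL-Algebra.Algebraic_Closure_Type"
begin

text \<open>
  The outcome of the algorithm is governed by the number of strips that contain a rational zero.
  If zeros at distinct points were independent events of probability \<open>q^(-s)\<close>, a strip would be
  empty with probability \<open>(1 - q^(-s))^(q^s)\<close>, hence nearly \<open>exp (-1)\<close>, and different strips would
  be independent.  Three facts make this precise enough.

  Few points impose independent conditions.  For \<open>h = r - s + 1\<close> strips in general position, linear
  forms separate the strips; multiplying them by linear forms that separate points within a strip
  gives interpolating polynomials of degree at most \<open>d\<close> for any set of points with at most \<open>d\<close> points
  in each strip, and \<open>d + 1\<close> in one of them (\<open>exists_interpolant\<close>).  Therefore the joint moments
  of the numbers of zeros agree with those of the independent model, up to order \<open>d\<close> in each strip.
  The Bonferroni inequalities turn this into the probability of no zero, with an error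
  that comes from the terms of order \<open>d + 1\<close> (\<open>no_zero_probability_mu\<close>).  The numbers \<open>mu d\<close> and
  \<open>mu (d + 1)\<close> differ by \<open>1 / fact (d + 1)\<close>, so that both may be used irrespective of the parity
  of \<open>d\<close>.  Lists of strips that are not in general position are counted by a determinant: it vanishes
  for at most \<open>r - s\<close> translates along the identity matrix (\<open>card_not_separated\<close>).

  Almost every specialized system is a reduced regular sequence.  Specialization preserves the uniform
  distribution, so only systems \<open>G\<close> of \<open>s\<close> polynomials in \<open>s\<close> variables matter.  Dividing
  exponents by \<open>d\<close> with remainder and replacing \<open>d\<close>-th powers of variables by the polynomials \<open>G v\<close>
  gives a linear map that is bijective in each degree for all but few members of each pencil
  \<open>G v + t * mon {#v, ..., v#}\<close>, because each exception \<open>t\<close> is an eigenvalue of one endomorphism.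
  Bijectivity makes the polynomial ring free over the subring generated by \<open>G\<close>, from which
  regularity is immediate (\<open>I_regular\<close>).  Radicality follows from a Jacobian determinant without
  zeros among the common zeros of \<open>G\<close> (\<open>radical_if_jacobian\<close>), and descends to the initial segments of
  the sequence (\<open>radical_subset\<close>).  Systems with a singular common zero are rare since a translation by
  constants moves only few points to singular values (\<open>card_not_good_system\<close>).

  Failing is almost the same as having no zero.  The solver returns true zeros only, and it
  overlooks zeros with probability \<open>O(1/q)\<close> apart from the exceptional systems
  (\<open>p_no_zero\<close>).  So the first \<open>i\<close> searches fail with probability close to \<open>(1 - mu m)^i\<close>, and the expected
  number of searches is bounded by the sum of these probabilities, a geometric series.

  The polynomial arguments are carried out over a field that is a type.  The records of the statement are
  connected with such types by \<open>field_rep\<close>; as a type cannot be chosen inside a proof, the type is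
  built in advance from a hypothetical counterexample (\<open>tame\<close>).
\<close>

section \<open>Linear dependence\<close>

context vector_space
begin

lemma exists_linear_relation:
  assumes "finite A" "finite B" "card B < card A" "\<And>i. i \<in> A \<Longrightarrow> v i \<in> span B"
  obtains c i where "(\<Sum>i\<in>A. c i *s v i) = 0" "i \<in> A" "c i \<noteq> 0"
proof (cases "inj_on v A")
  case False
  then obtain i j where ij: "i \<in> A" "j \<in> A" "i \<noteq> j" "v i = v j" by (auto simp: inj_on_def)
  have "(\<Sum>k\<in>A. (if k = i then 1 else if k = j then -1 else 0) *s v k)
      = (\<Sum>k\<in>{i,j}. (if k = i then 1 else if k = j then -1 else 0) *s v k)"
    using ij assms(1) by (intro sum.mono_neutral_right) auto
  also have "\<dots> = 0" using ij by simp
  finally show ?thesis using ij(1) that[of "\<lambda>k. if k = i then 1 else if k = j then -1 else 0" i] by simp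
next
  case True
  have "dependent (v ` A)"
  proof (rule ccontr)
    assume "independent (v ` A)"
    moreover have "v ` A \<subseteq> span B" using assms(4) by auto
    ultimately have "card (v ` A) \<le> card B" using independent_span_bound[OF assms(2)] by blast
    then show False using assms(3) card_image[OF True] by simp
  qed
  then obtain u w where u: "w \<in> v ` A" "u w \<noteq> 0" "(\<Sum>w\<in>v ` A. u w *s w) = 0"
    using dependent_finite[of "v ` A"] assms(1) by auto
  then obtain i where i: "i \<in> A" "w = v i" by auto
  have "(\<Sum>i\<in>A. u (v i) *s v i) = 0" using u(3) sum.reindex[OF True, of "\<lambda>w. u w *s w"] by simp
  then show ?thesis using that[of "\<lambda>i. u (v i)" i] u i by simp
qed

lemma eigenvectors_independent:
  assumes "finite T" and "\<And>x y. \<Psi> (x + y) = \<Psi> x + \<Psi> y" and "\<And>c x. \<Psi> (c *s x) = c *s \<Psi> x"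
    and "\<And>t. t \<in> T \<Longrightarrow> f t \<noteq> 0 \<and> \<Psi> (f t) = t *s f t"
    and "(\<Sum>t\<in>T. c t *s f t) = 0" "t \<in> T"
  shows "c t = 0"
  using assms(1,4,5,6)
proof (induction T arbitrary: c t rule: finite_induct)
  case (insert t0 T)
  have sum\<Psi>: "\<Psi> (sum g S) = (\<Sum>s\<in>S. \<Psi> (g s))" if "finite S" for g and S :: "'a set"
    using that
  proof (induction S rule: finite_induct)
    case empty
    have "\<Psi> (0 *s 0) = 0 *s \<Psi> 0" by (rule assms(3))
    then show ?case by simp
  qed (simp add: assms(2))
  let ?s = "\<Sum>t\<in>T. c t *s f t"
  have e1: "c t0 *s f t0 + ?s = 0" using insert by simp
  have "\<Psi> (c t0 *s f t0 + ?s) = 0" using assms(3)[of 0 0] by (simp add: e1)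
  then have e2: "t0 *s (c t0 *s f t0) + (\<Sum>t\<in>T. t *s (c t *s f t)) = 0"
    using insert.prems(1) by (simp add: assms(2,3) sum\<Psi>[OF insert.hyps(1)] mult.commute)
  have e3: "t0 *s (c t0 *s f t0) + (\<Sum>t\<in>T. t0 *s (c t *s f t)) = 0"
  proof -
    have "t0 *s (c t0 *s f t0) + (\<Sum>t\<in>T. t0 *s (c t *s f t)) = t0 *s (c t0 *s f t0 + ?s)"
      by (simp add: scale_right_distrib scale_sum_right)
    then show ?thesis using e1 by simp
  qed
  have "(\<Sum>t\<in>T. t *s (c t *s f t)) = (\<Sum>t\<in>T. t0 *s (c t *s f t))"
    using e2 e3 by (metis add_left_imp_eq)
  then have "(\<Sum>t\<in>T. ((t - t0) * c t) *s f t) = 0"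
    by (simp add: scale_left_diff_distrib sum_subtractf left_diff_distrib)
  then have z: "(t - t0) * c t = 0" if "t \<in> T" for t
    using insert.IH[of "\<lambda>t. (t - t0) * c t" t] insert.prems(1) that by simp
  have z': "c t = 0" if "t \<in> T" for t using z[OF that] insert.hyps that by auto
  then have "c t0 *s f t0 = 0" using e1 by (simp add: sum.neutral)
  then have "c t0 = 0" using insert.prems(1) by simp
  then show ?case using z' insert.prems(3) by auto
qed simp

lemma card_eigenvalues_le:
  assumes "finite T" "finite B" and "\<And>x y. \<Psi> (x + y) = \<Psi> x + \<Psi> y" and "\<And>c x. \<Psi> (c *s x) = c *s \<Psi> x"
    and "\<And>t. t \<in> T \<Longrightarrow> f t \<noteq> 0 \<and> \<Psi> (f t) = t *s f t \<and> f t \<in> span B"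
  shows "card T \<le> card B"
proof (rule ccontr)
  assume "\<not> card T \<le> card B"
  then obtain c t where "(\<Sum>t\<in>T. c t *s f t) = 0" "t \<in> T" "c t \<noteq> 0"
    using exists_linear_relation[OF assms(1,2), of f] assms(5) by (metis not_le)
  then show False using eigenvectors_independent[OF assms(1,3,4), of f c t] assms(5) by blast
qed

end

section \<open>Polynomials\<close>

type_synonym 'f pol = "nat multiset \<Rightarrow>\<^sub>0 'f"

abbreviation coef :: "'f::zero pol \<Rightarrow> nat multiset \<Rightarrow> 'f" where "coef \<equiv> Poly_Mapping.lookup"
abbreviation supp :: "'f::zero pol \<Rightarrow> nat multiset set" where "supp \<equiv> Poly_Mapping.keys"

definition Cst :: "'f::field \<Rightarrow> 'f pol" where "Cst c = Poly_Mapping.single {#} c"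
definition mon :: "nat multiset \<Rightarrow> 'f::field pol" where "mon m = Poly_Mapping.single m 1"
abbreviation Var :: "nat \<Rightarrow> 'f::field pol" where "Var v \<equiv> mon {#v#}"

lemma Cst_0 [simp]: "Cst 0 = 0" and Cst_1 [simp]: "Cst 1 = 1"
  by (simp_all add: Cst_def)
lemma Cst_add: "Cst (a + b) = Cst a + Cst b" by (simp add: Cst_def single_add)
lemma Cst_diff: "Cst (a - b) = Cst a - Cst b" by (simp add: Cst_def single_diff)
lemma Cst_uminus: "Cst (- a) = - Cst a" by (simp add: Cst_def single_uminus)
lemma Cst_mult: "Cst (a * b) = Cst a * Cst b" by (simp add: Cst_def mult_single)
lemma Cst_eq_0 [simp]: "Cst a = 0 \<longleftrightarrow> a = 0"
  unfolding Cst_def by (metis lookup_single_eq lookup_zero single_zero)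
lemma mon_add: "mon (a + b) = mon a * mon b" by (simp add: mon_def mult_single)
lemma mon_empty [simp]: "mon {#} = 1" by (simp add: mon_def)
lemma mon_nz [simp]: "mon m \<noteq> (0 :: 'f::field pol)"
  unfolding mon_def by (metis lookup_single_eq lookup_zero zero_neq_one)
lemma Cst_mon: "Cst c * mon m = Poly_Mapping.single m c" by (simp add: Cst_def mon_def mult_single)
lemma coef_mon: "coef (mon m) n = (if m = n then 1 else 0)"
  by (simp add: mon_def lookup_single when_def)
lemma coef_Cst_mult [simp]: "coef (Cst c * f) m = c * coef f m"
  unfolding Cst_def mult_map_scale_conv_mult[symmetric] by (simp add: Poly_Mapping.map.rep_eq when_def)

interpretation pol: vector_space "\<lambda>(c::'f::field) (f::'f pol). Cst c * f"
  by unfold_locales (simp_all add: algebra_simps Cst_add Cst_mult)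

definition on :: "nat multiset set \<Rightarrow> 'f::field pol set" where "on B = {f. supp f \<subseteq> B}"

lemma on_iff: "f \<in> on B \<longleftrightarrow> (\<forall>m. coef f m \<noteq> 0 \<longrightarrow> m \<in> B)"
  by (auto simp: on_def in_keys_iff)
lemma on_0 [simp]: "0 \<in> on B" by (simp add: on_def)
lemma on_add: "f \<in> on B \<Longrightarrow> g \<in> on B \<Longrightarrow> f + g \<in> on B"
  by (auto simp: on_iff lookup_add) (metis add.right_neutral)
lemma on_diff: "f \<in> on B \<Longrightarrow> g \<in> on B \<Longrightarrow> f - g \<in> on B"
  by (auto simp: on_iff lookup_minus) (metis diff_zero)
lemma on_uminus: "f \<in> on B \<Longrightarrow> - f \<in> on B"
  by (auto simp: on_iff)
lemma on_Cst_mult: "f \<in> on B \<Longrightarrow> Cst c * f \<in> on B"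
  by (auto simp: on_iff)
lemma on_sum: "(\<And>i. i \<in> A \<Longrightarrow> f i \<in> on B) \<Longrightarrow> (\<Sum>i\<in>A. f i) \<in> on B"
  by (induction A rule: infinite_finite_induct) (auto intro: on_add)
lemma on_mon [simp]: "mon m \<in> on B \<longleftrightarrow> m \<in> B"
  by (auto simp: on_iff coef_mon)
lemma on_mono: "f \<in> on A \<Longrightarrow> A \<subseteq> B \<Longrightarrow> f \<in> on B"
  by (auto simp: on_def)
lemma on_mult: "f \<in> on A \<Longrightarrow> g \<in> on B \<Longrightarrow> (\<And>a b. a \<in> A \<Longrightarrow> b \<in> B \<Longrightarrow> a + b \<in> C) \<Longrightarrow> f * g \<in> on C"
  using keys_mult[of f g] by (fastforce simp: on_def)

definition lin :: "(nat multiset \<Rightarrow> 'f pol) \<Rightarrow> 'f::field pol \<Rightarrow> 'f pol" where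
  "lin b f = (\<Sum>m\<in>supp f. Cst (coef f m) * b m)"

lemma lin_superset:
  assumes "finite A" "supp f \<subseteq> A"
  shows "lin b f = (\<Sum>m\<in>A. Cst (coef f m) * b m)"
  unfolding lin_def by (intro sum.mono_neutral_left) (use assms in \<open>auto simp: in_keys_iff\<close>)

lemma lin_add: "lin b (f + g) = lin b f + lin b g"
proof -
  let ?A = "supp f \<union> supp g"
  have "supp (f + g) \<subseteq> ?A" by (rule keys_add)
  then show ?thesis
    using lin_superset[of ?A "f + g" b] lin_superset[of ?A f b] lin_superset[of ?A g b]
    by (simp add: lookup_add Cst_add distrib_right sum.distrib)
qed

lemma lin_Cst_mult: "lin b (Cst c * f) = Cst c * lin b f"
proof -
  have "supp (Cst c * f) \<subseteq> supp f" by (auto simp: in_keys_iff)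
  then have "lin b (Cst c * f) = (\<Sum>m\<in>supp f. Cst (coef (Cst c * f) m) * b m)"
    by (intro lin_superset) auto
  also have "\<dots> = (\<Sum>m\<in>supp f. Cst c * (Cst (coef f m) * b m))"
    by (intro sum.cong refl) (simp only: coef_Cst_mult Cst_mult mult.assoc)
  finally show ?thesis by (simp only: lin_def sum_distrib_left)
qed

lemma lin_0 [simp]: "lin b 0 = 0" by (simp add: lin_def)
lemma lin_uminus: "lin b (- f) = - lin b f"
  using lin_Cst_mult[of b "-1" f] by (simp add: Cst_uminus)
lemma lin_diff: "lin b (f - g) = lin b f - lin b g"
  using lin_add[of b f "- g"] by (simp add: lin_uminus)
lemma lin_sum: "lin b (\<Sum>i\<in>A. f i) = (\<Sum>i\<in>A. lin b (f i))"
  by (induction A rule: infinite_finite_induct) (auto simp: lin_add)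
lemma lin_mon [simp]: "lin b (mon m) = b m"
  by (simp add: lin_def mon_def)

lemma lin_id: "lin mon f = f"
proof (rule poly_mapping_eqI)
  fix k
  have "coef (lin mon f) k = (\<Sum>m\<in>supp f. if m = k then coef f m else 0)"
    by (simp add: lin_def lookup_sum coef_mon if_distrib cong: if_cong)
  also have "\<dots> = coef f k" by (simp add: sum.delta in_keys_iff)
  finally show "coef (lin mon f) k = coef f k" .
qed

lemma pol_expand: "f = (\<Sum>m\<in>supp f. Cst (coef f m) * mon m)"
  using lin_id[of f] by (simp add: lin_def)

lemma lin_cong: "f \<in> on B \<Longrightarrow> (\<And>m. m \<in> B \<Longrightarrow> b m = b' m) \<Longrightarrow> lin b f = lin b' f"
  by (auto simp: lin_def on_def intro!: sum.cong)

lemma lin_on: "f \<in> on A \<Longrightarrow> (\<And>m. m \<in> A \<Longrightarrow> b m \<in> on B) \<Longrightarrow> lin b f \<in> on B"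
  unfolding lin_def by (intro on_sum on_Cst_mult) (auto simp: on_def)

lemma lin_lin: "lin b (lin b' f) = lin (\<lambda>m. lin b (b' m)) f"
  by (simp add: lin_def[of b' f] lin_def[of "\<lambda>m. lin b (b' m)"] lin_sum lin_Cst_mult)

lemma lin_mult_right: "lin b f * g = lin (\<lambda>m. b m * g) f"
  by (simp add: lin_def sum_distrib_right mult.assoc)

lemma mult_eq_lin: "f * g = lin (\<lambda>m. mon m * g) f"
  using lin_mult_right[of mon f g] by (simp add: lin_id)

lemma lin_fun_add: "lin (\<lambda>m. b m + b' m) f = lin b f + lin b' f"
  by (simp add: lin_def distrib_left sum.distrib)
lemma lin_fun_Cst: "lin (\<lambda>m. Cst c * b m) f = Cst c * lin b f"
  by (simp add: lin_def sum_distrib_left ac_simps)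

lemma on_in_span: "f \<in> on B \<Longrightarrow> f \<in> pol.span (mon ` B)"
  by (subst pol_expand, intro pol.span_sum pol.span_scale pol.span_base) (auto simp: on_def)

text \<open>Both directions of the dimension argument for an endomorphism of a space spanned by finitely
  many monomials.\<close>

lemma lin_surj_if_inj:
  assumes fin: "finite B" and pres: "\<And>m. m \<in> B \<Longrightarrow> b m \<in> on B"
    and inj: "\<And>f. f \<in> on B \<Longrightarrow> lin b f = 0 \<Longrightarrow> f = 0" and g: "g \<in> on B"
  obtains f where "f \<in> on B" "lin b f = g"
proof -
  let ?v = "\<lambda>x. case x of None \<Rightarrow> g | Some m \<Rightarrow> b m"
  let ?A = "insert None (Some ` B)"
  have card: "card (mon ` B :: 'a pol set) < card ?A"
    using fin card_image_le[OF fin, of "mon :: _ \<Rightarrow> 'a pol"] by (simp add: card_image)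
  have v: "?v i \<in> pol.span (mon ` B)" if "i \<in> ?A" for i
    using that g pres by (auto intro: on_in_span)
  obtain c i where c: "(\<Sum>i\<in>?A. Cst (c i) * ?v i) = 0" "i \<in> ?A" "c i \<noteq> 0"
    by (rule pol.exists_linear_relation[OF _ _ card v]) (use fin in simp, use fin in simp, assumption, rule that)
  define f where "f = (\<Sum>m\<in>B. Cst (c (Some m)) * mon m)"
  have f: "f \<in> on B" unfolding f_def by (intro on_sum on_Cst_mult) auto
  have lf: "lin b f = (\<Sum>m\<in>B. Cst (c (Some m)) * b m)"
    by (simp add: f_def lin_sum lin_Cst_mult)
  have rel: "Cst (c None) * g + lin b f = 0"
    using c(1) fin by (simp add: lf sum.reindex)
  have coef_f: "coef f m = c (Some m)" if "m \<in> B" for m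
    using that fin by (simp add: f_def lookup_sum coef_mon if_distrib sum.delta cong: if_cong)
  have nz: "c None \<noteq> 0"
  proof
    assume c0: "c None = 0"
    then have "f = 0" using rel inj[OF f] by simp
    then have "c (Some m) = 0" if "m \<in> B" for m using coef_f[OF that] by simp
    then show False using c(2,3) c0 by auto
  qed
  have "lin b (Cst (- inverse (c None)) * f) = Cst (- inverse (c None)) * (- (Cst (c None) * g))"
    using rel by (metis add_eq_0_iff lin_Cst_mult)
  also have "\<dots> = Cst (inverse (c None) * c None) * g"
    by (simp only: Cst_uminus Cst_mult mult.assoc minus_mult_minus)
  also have "\<dots> = g" using nz by simp
  finally show ?thesis using that on_Cst_mult[OF f] by blast
qed

lemma lin_inj_if_surj:
  assumes fin: "finite B" and surj: "\<And>m. m \<in> B \<Longrightarrow> \<exists>f\<in>on B. lin b f = mon m"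
    and f: "f \<in> on B" "lin b f = 0"
  shows "f = 0"
proof (rule ccontr)
  assume "f \<noteq> 0"
  then obtain m0 where "m0 \<in> supp f" by fastforce
  then have m0: "coef f m0 \<noteq> 0" by (simp add: in_keys_iff)
  then have m0B: "m0 \<in> B" using f by (auto simp: on_iff)
  let ?B = "B - {m0}"
  have f_lin: "lin b f = (\<Sum>m\<in>B. Cst (coef f m) * b m)"
    using f fin by (intro lin_superset) (auto simp: on_def)
  have "Cst (coef f m0) * b m0 + (\<Sum>m\<in>?B. Cst (coef f m) * b m) = 0"
    using f(2) fin m0B unfolding f_lin by (simp add: sum.remove)
  then have "Cst (- coef f m0) * b m0 = (\<Sum>m\<in>?B. Cst (coef f m) * b m)"
    by (simp add: Cst_uminus minus_unique)
  also have "\<dots> \<in> pol.span (b ` ?B)"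
    by (intro pol.span_sum pol.span_scale pol.span_base) auto
  finally have "Cst (- inverse (coef f m0)) * (Cst (- coef f m0) * b m0) \<in> pol.span (b ` ?B)"
    by (rule pol.span_scale)
  also have "Cst (- inverse (coef f m0)) * (Cst (- coef f m0) * b m0) = b m0"
    using m0 by (simp add: mult.assoc[symmetric] Cst_mult[symmetric])
  finally have b0: "b m0 \<in> pol.span (b ` ?B)" .
  have b: "b m \<in> pol.span (b ` ?B)" if "m \<in> B" for m
    using that b0 pol.span_base[of "b m" "b ` ?B"] by (cases "m = m0") blast+
  have v: "mon m \<in> pol.span (b ` ?B)" if m: "m \<in> B" for m
  proof -
    obtain g where g: "g \<in> on B" "lin b g = mon m" using surj[OF m] by auto
    have "lin b g \<in> pol.span (b ` ?B)" unfolding lin_def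
      using g(1) by (intro pol.span_sum pol.span_scale[OF b]) (auto simp: on_def)
    then show ?thesis using g by simp
  qed
  have card: "card (b ` ?B) < card B"
    using card_image_le[of ?B b] card_Diff1_less[OF fin m0B] fin by simp
  obtain c i where c: "(\<Sum>i\<in>B. Cst (c i) * (mon i :: 'a pol)) = 0" "i \<in> B" "c i \<noteq> 0"
    by (rule pol.exists_linear_relation[OF fin _ card v]) (use fin in simp, assumption, rule that)
  have "coef (\<Sum>i\<in>B. Cst (c i) * (mon i :: 'a pol)) i = c i"
  proof -
    have "coef (\<Sum>i\<in>B. Cst (c i) * (mon i :: 'a pol)) i = (\<Sum>k\<in>B. if k = i then c k else 0)"
      unfolding lookup_sum by (intro sum.cong) (simp_all add: coef_mon)
    then show ?thesis using c(2) fin by (simp add: sum.delta)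
  qed
  then have "c i = 0" by (simp only: c(1) lookup_zero)
  then show False using c(3) by simp
qed

section \<open>Systems whose products with box monomials form a basis\<close>

definition allm :: "nat set \<Rightarrow> nat multiset set" where "allm V = {m. set_mset m \<subseteq> V}"
definition mons :: "nat set \<Rightarrow> nat \<Rightarrow> nat multiset set" where
  "mons V n = {m. set_mset m \<subseteq> V \<and> size m \<le> n}"

lemma mons_subset_allm: "mons V n \<subseteq> allm V" by (auto simp: mons_def allm_def)
lemma mons_mono: "m \<le> n \<Longrightarrow> mons V m \<subseteq> mons V n" by (auto simp: mons_def)
lemma mons_add: "a \<in> mons V m \<Longrightarrow> b \<in> mons V n \<Longrightarrow> a + b \<in> mons V (m + n)" by (auto simp: mons_def)
lemma allm_add: "a \<in> allm V \<Longrightarrow> b \<in> allm V \<Longrightarrow> a + b \<in> allm V" by (auto simp: allm_def)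

lemma on_mons_mult: "f \<in> on (mons V m) \<Longrightarrow> g \<in> on (mons V n) \<Longrightarrow> f * g \<in> on (mons V (m + n))"
  by (rule on_mult) (auto intro: mons_add)
lemma on_allm_mult: "f \<in> on (allm V) \<Longrightarrow> g \<in> on (allm V) \<Longrightarrow> f * g \<in> on (allm V)"
  by (rule on_mult) (auto intro: allm_add)
lemma on_mons_allm: "f \<in> on (mons V n) \<Longrightarrow> f \<in> on (allm V)"
  using on_mono mons_subset_allm by blast
lemma one_on_mons [simp]: "1 \<in> on (mons V n)" using on_mon[of "{#}" "mons V n"] by (simp add: mons_def)
lemma one_on_allm [simp]: "1 \<in> on (allm V)" using on_mon[of "{#}" "allm V"] by (simp add: allm_def)
lemma Cst_on_mons [simp]: "Cst c \<in> on (mons V n)" using on_Cst_mult[OF one_on_mons, of c V n] by simp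
lemma Cst_on_allm [simp]: "Cst c \<in> on (allm V)" using on_Cst_mult[OF one_on_allm, of c V] by simp
lemma on_allm_power: "f \<in> on (allm V) \<Longrightarrow> f ^ k \<in> on (allm V)"
  by (induction k) (auto intro: on_allm_mult)

lemma on_allm_degree:
  assumes "f \<in> on (allm V)" obtains n where "f \<in> on (mons V n)"
proof
  show "f \<in> on (mons V (\<Sum>m\<in>supp f. size m))"
    using assms member_le_sum[of _ "supp f" size] by (force simp: on_def mons_def allm_def)
qed

lemma size_eq_sum_count: "finite V \<Longrightarrow> set_mset m \<subseteq> V \<Longrightarrow> size m = (\<Sum>v\<in>V. count m v)"
  unfolding size_multiset_overloaded_eq
  by (rule sum.mono_neutral_left) (auto simp: not_in_iff)

lemma inj_on_count: "inj_on (\<lambda>m. restrict (count m) V) (allm V)"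
proof (rule inj_onI)
  fix x y assume xy: "x \<in> allm V" "y \<in> allm V" "restrict (count x) V = restrict (count y) V"
  show "x = y"
  proof (rule multiset_eqI)
    fix v show "count x v = count y v"
    proof (cases "v \<in> V")
      case True
      then show ?thesis using fun_cong[OF xy(3), of v] by simp
    next
      case False
      then have "v \<notin># x" "v \<notin># y" using xy(1,2) by (auto simp: allm_def)
      then show ?thesis by (simp add: not_in_iff)
    qed
  qed
qed

lemma finite_mons: "finite V \<Longrightarrow> finite (mons V n)"
  and card_mons: "finite V \<Longrightarrow> card (mons V n) \<le> (n + 1) ^ card V"
proof -
  assume V: "finite V"
  have inj: "inj_on (\<lambda>m. restrict (count m) V) (mons V n)"
    by (rule inj_on_subset[OF inj_on_count mons_subset_allm])
  have sub: "(\<lambda>m. restrict (count m) V) ` mons V n \<subseteq> V \<rightarrow>\<^sub>E {..n}"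
    using order_trans[OF count_le_size] by (fastforce simp: mons_def)
  have fin: "finite (V \<rightarrow>\<^sub>E {..n})" using V by (intro finite_PiE) auto
  show "finite (mons V n)" using inj sub fin by (meson finite_imageD finite_subset)
  have "card (mons V n) \<le> card (V \<rightarrow>\<^sub>E {..n})" using card_inj_on_le[OF inj sub fin] .
  also have "\<dots> = (n + 1) ^ card V" using V by (simp add: card_PiE)
  finally show "card (mons V n) \<le> (n + 1) ^ card V" .
qed

lemma coef_mon_mult: "coef (mon r * f) (r + m) = coef f m"
proof -
  have e: "mon r * f = (\<Sum>k\<in>supp f. Cst (coef f k) * mon (r + k))"
    using mult_eq_lin[of f "mon r"] by (simp add: lin_def mon_add mult.commute)
  have "coef (mon r * f) (r + m) = (\<Sum>k\<in>supp f. if k = m then coef f k else 0)"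
    unfolding e lookup_sum by (intro sum.cong) (simp_all add: coef_mon)
  then show ?thesis by (simp add: sum.delta in_keys_iff)
qed

definition quot_mset :: "nat \<Rightarrow> nat multiset \<Rightarrow> nat multiset" where
  "quot_mset d m = (\<Sum>v\<in>set_mset m. replicate_mset (count m v div d) v)"
definition rem_mset :: "nat \<Rightarrow> nat multiset \<Rightarrow> nat multiset" where
  "rem_mset d m = m - repeat_mset d (quot_mset d m)"

lemma count_quot_mset [simp]: "count (quot_mset d m) v = count m v div d"
proof -
  have "count (quot_mset d m) v = (\<Sum>w\<in>set_mset m. if w = v then count m w div d else 0)"
    unfolding quot_mset_def count_sum by (intro sum.cong) auto
  then show ?thesis by (simp add: sum.delta not_in_iff)
qed

lemma count_rem_mset [simp]: "count (rem_mset d m) v = count m v mod d"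
  by (simp add: rem_mset_def minus_div_mult_eq_mod[symmetric] mult.commute)

lemma rem_quot: "rem_mset d m + repeat_mset d (quot_mset d m) = m"
  by (rule multiset_eqI) simp

lemma size_rem_quot: "size (rem_mset d m) + d * size (quot_mset d m) = size m"
  using arg_cong[OF rem_quot[of d m], of size] by simp

lemma set_rem: "set_mset (rem_mset d m) \<subseteq> set_mset m"
  unfolding rem_mset_def by (meson in_diffD subsetI)

lemma set_quot: "set_mset (quot_mset d m) \<subseteq> set_mset m"
proof
  fix v assume "v \<in># quot_mset d m"
  then have "count m v div d \<noteq> 0" using count_quot_mset[of d m v] by (metis not_in_iff)
  then show "v \<in># m" by (metis div_0 not_in_iff)
qed

locale pol_system =
  fixes V :: "nat set" and d :: nat and G :: "nat \<Rightarrow> 'f::field pol"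
  assumes V: "finite V" and d: "d \<ge> 1" and G: "\<And>v. v \<in> V \<Longrightarrow> G v \<in> on (mons V d)"
begin

definition Gprod :: "nat multiset \<Rightarrow> 'f pol" where "Gprod m = prod_mset (image_mset G m)"
definition E :: "nat multiset \<Rightarrow> 'f pol" where "E m = mon (rem_mset d m) * Gprod (quot_mset d m)"
definition \<Theta> :: "'f pol \<Rightarrow> 'f pol" where "\<Theta> = lin E"

lemma G_allm: "v \<in> V \<Longrightarrow> G v \<in> on (allm V)"
  using G on_mons_allm by blast

lemma E_add: "E (m + replicate_mset d v) = G v * E m"
proof -
  have "rem_mset d (m + replicate_mset d v) = rem_mset d m"
    by (rule multiset_eqI) simp
  moreover have "quot_mset d (m + replicate_mset d v) = add_mset v (quot_mset d m)"
    using d by (intro multiset_eqI) auto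
  ultimately show ?thesis by (simp add: E_def Gprod_def mult.left_commute)
qed

lemma E_box: "(\<And>v. count m v < d) \<Longrightarrow> E m = mon m"
proof -
  assume b: "\<And>v. count m v < d"
  have "quot_mset d m = {#}" using b by (intro multiset_eqI) simp
  moreover have "rem_mset d m = m" using b by (intro multiset_eqI) simp
  ultimately show ?thesis by (simp add: E_def Gprod_def)
qed

lemma \<Theta>_add: "\<Theta> (f + g) = \<Theta> f + \<Theta> g" and \<Theta>_diff: "\<Theta> (f - g) = \<Theta> f - \<Theta> g"
  and \<Theta>_sum: "\<Theta> (\<Sum>i\<in>A. h i) = (\<Sum>i\<in>A. \<Theta> (h i))" and \<Theta>_Cst: "\<Theta> (Cst c * f) = Cst c * \<Theta> f"
  and \<Theta>_mon [simp]: "\<Theta> (mon m) = E m" and \<Theta>_0 [simp]: "\<Theta> 0 = 0"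
  by (simp_all add: \<Theta>_def lin_add lin_diff lin_sum lin_Cst_mult)

text \<open>\<open>\<Theta>\<close> turns the multiplication by the \<open>d\<close>-th power of a variable into the multiplication by
  the polynomial of the system that belongs to this variable.\<close>

lemma \<Theta>_power_var: "\<Theta> (mon (replicate_mset d v) * f) = G v * \<Theta> f"
proof -
  have "mon (replicate_mset d v) * f = lin (\<lambda>m. mon (m + replicate_mset d v)) f"
    using mult_eq_lin[of f "mon (replicate_mset d v)"] by (simp add: mon_add mult.commute)
  then have "\<Theta> (mon (replicate_mset d v) * f) = lin (\<lambda>m. E m * G v) f"
    by (simp add: \<Theta>_def lin_lin E_add mult.commute)
  also have "\<dots> = \<Theta> f * G v" by (simp add: lin_mult_right \<Theta>_def)
  finally show ?thesis by (simp only: mult.commute)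
qed

lemma Gprod_on: "set_mset m \<subseteq> V \<Longrightarrow> Gprod m \<in> on (mons V (d * size m))"
proof (induction m)
  case (add v m)
  have "Gprod (add_mset v m) = G v * Gprod m" by (simp add: Gprod_def)
  then show ?case using on_mons_mult[OF G add.IH] add.prems by auto
qed (simp add: Gprod_def)

lemma E_on: "m \<in> mons V n \<Longrightarrow> E m \<in> on (mons V n)"
proof -
  assume m: "m \<in> mons V n"
  have "rem_mset d m \<in> mons V (size (rem_mset d m))" using m set_rem by (fastforce simp: mons_def)
  then have "(mon (rem_mset d m) :: 'f pol) \<in> on (mons V (size (rem_mset d m)))" by simp
  then have "E m \<in> on (mons V (size (rem_mset d m) + d * size (quot_mset d m)))"
    unfolding E_def using m set_quot by (intro on_mons_mult Gprod_on) (fastforce simp: mons_def)+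
  then show ?thesis unfolding size_rem_quot
    by (rule on_mono) (use m in \<open>auto simp: mons_def\<close>)
qed

lemma \<Theta>_on: "f \<in> on (mons V n) \<Longrightarrow> \<Theta> f \<in> on (mons V n)"
  unfolding \<Theta>_def by (erule lin_on) (rule E_on)

definition range\<Theta> :: "nat \<Rightarrow> 'f pol set" where "range\<Theta> n = \<Theta> ` on (mons V n)"

lemma range\<Theta>_sum: "(\<And>i. i \<in> A \<Longrightarrow> h i \<in> range\<Theta> n) \<Longrightarrow> (\<Sum>i\<in>A. Cst (c i) * h i) \<in> range\<Theta> n"
proof -
  assume "\<And>i. i \<in> A \<Longrightarrow> h i \<in> range\<Theta> n"
  then have "\<forall>i. \<exists>f. i \<in> A \<longrightarrow> f \<in> on (mons V n) \<and> h i = \<Theta> f" by (auto simp: range\<Theta>_def)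
  then obtain f where f: "\<And>i. i \<in> A \<Longrightarrow> f i \<in> on (mons V n) \<and> h i = \<Theta> (f i)" by metis
  have "(\<Sum>i\<in>A. Cst (c i) * h i) = \<Theta> (\<Sum>i\<in>A. Cst (c i) * f i)"
    unfolding \<Theta>_sum \<Theta>_Cst using f by (intro sum.cong) auto
  moreover have "(\<Sum>i\<in>A. Cst (c i) * f i) \<in> on (mons V n)"
    using f by (intro on_sum on_Cst_mult) auto
  ultimately show ?thesis by (auto simp: range\<Theta>_def)
qed

lemma range\<Theta>_mono: "g \<in> range\<Theta> m \<Longrightarrow> m \<le> n \<Longrightarrow> g \<in> range\<Theta> n"
  unfolding range\<Theta>_def using on_mono[OF _ mons_mono] by blast

lemma range\<Theta>_G: "g \<in> range\<Theta> n \<Longrightarrow> v \<in> V \<Longrightarrow> G v * g \<in> range\<Theta> (d + n)"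
proof -
  assume "g \<in> range\<Theta> n" and v: "v \<in> V"
  then obtain f where f: "f \<in> on (mons V n)" "g = \<Theta> f" by (auto simp: range\<Theta>_def)
  have "replicate_mset d v \<in> mons V d" using v by (auto simp: mons_def)
  then have "(mon (replicate_mset d v) :: 'f pol) \<in> on (mons V d)" by simp
  then have "mon (replicate_mset d v) * f \<in> on (mons V (d + n))"
    using f(1) by (rule on_mons_mult)
  moreover have "G v * g = \<Theta> (mon (replicate_mset d v) * f)" using \<Theta>_power_var f(2) by simp
  ultimately show ?thesis by (auto simp: range\<Theta>_def)
qed

lemma range\<Theta>_Gprod: "g \<in> range\<Theta> n \<Longrightarrow> set_mset m \<subseteq> V \<Longrightarrow> Gprod m * g \<in> range\<Theta> (d * size m + n)"
proof (induction m)
  case (add v m)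
  have e: "Gprod (add_mset v m) * g = G v * (Gprod m * g)" by (simp add: Gprod_def mult.assoc)
  have "G v * (Gprod m * g) \<in> range\<Theta> (d + (d * size m + n))"
    using add by (intro range\<Theta>_G add.IH) auto
  then show ?case unfolding e by (simp add: add.assoc)
qed (simp add: Gprod_def)

lemma mon_in_range\<Theta>_add_var:
  assumes m: "m \<in> mons V n" and j: "j \<in> V"
    and low: "\<And>k m. k \<le> card V * (d - 1) + 1 \<Longrightarrow> m \<in> mons V k \<Longrightarrow> mon m \<in> range\<Theta> k"
  shows "Var j * E m \<in> range\<Theta> (Suc n)"
proof -
  let ?r = "rem_mset d m" and ?q = "quot_mset d m"
  have sets: "set_mset ?r \<subseteq> V" "set_mset ?q \<subseteq> V"
    using m set_rem[of d m] set_quot[of d m] by (auto simp: mons_def)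
  have "size ?r = (\<Sum>v\<in>V. count ?r v)" using size_eq_sum_count[OF V sets(1)] .
  also have "\<dots> \<le> (\<Sum>v\<in>V. d - 1)"
  proof (intro sum_mono)
    fix v
    have "count m v mod d < d" using d by simp
    then show "count ?r v \<le> d - 1" unfolding count_rem_mset by linarith
  qed
  finally have "Suc (size ?r) \<le> card V * (d - 1) + 1" by simp
  moreover have "add_mset j ?r \<in> mons V (Suc (size ?r))" using sets j by (auto simp: mons_def)
  ultimately have "mon (add_mset j ?r) \<in> range\<Theta> (Suc (size ?r))" by (rule low)
  then have "Gprod ?q * mon (add_mset j ?r) \<in> range\<Theta> (d * size ?q + Suc (size ?r))"
    using sets by (intro range\<Theta>_Gprod)
  moreover have "d * size ?q + Suc (size ?r) \<le> Suc n"
    using size_rem_quot[of d m] m by (simp add: mons_def)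
  moreover have "Gprod ?q * mon (add_mset j ?r) = Var j * E m"
  proof -
    have e: "mon (add_mset j ?r) = (Var j * mon ?r :: 'f pol)" using mon_add[of "{#j#}" ?r] by simp
    show ?thesis unfolding e E_def by (simp only: ac_simps)
  qed
  ultimately show ?thesis using range\<Theta>_mono by metis
qed

text \<open>The spanning property needs to be checked in low degrees only: the largest box monomial has
  degree \<open>card V * (d - 1)\<close>, so that degree one more suffices to multiply a box monomial by a
  variable.\<close>

lemma range\<Theta>_all:
  assumes low: "\<And>k m. k \<le> card V * (d - 1) + 1 \<Longrightarrow> m \<in> mons V k \<Longrightarrow> mon m \<in> range\<Theta> k"
  shows "m \<in> mons V n \<Longrightarrow> mon m \<in> range\<Theta> n"
proof (induction n arbitrary: m)
  case 0
  then show ?case using low[of 0] by simp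
next
  case (Suc n)
  show ?case
  proof (cases "m \<in> mons V n")
    case True
    then show ?thesis using Suc.IH range\<Theta>_mono by (metis le_SucI le_refl)
  next
    case False
    then have "m \<noteq> {#}" by (auto simp: mons_def)
    then obtain j m' where m': "m = add_mset j m'" by (meson multiset_cases)
    have jm: "j \<in> V" "m' \<in> mons V n" using Suc.prems m' by (auto simp: mons_def)
    obtain f where f: "f \<in> on (mons V n)" "mon m' = \<Theta> f"
      using Suc.IH[OF jm(2)] by (auto simp: range\<Theta>_def)
    have "mon m = Var j * mon m'" using m' mon_add[of "{#j#}" m'] by simp
    also have "\<dots> = (\<Sum>k\<in>supp f. Cst (coef f k) * (Var j * E k))"
      by (simp add: f(2) \<Theta>_def lin_def sum_distrib_left mult.left_commute)
    also have "\<dots> \<in> range\<Theta> (Suc n)"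
      using f(1) jm(1) low by (intro range\<Theta>_sum mon_in_range\<Theta>_add_var) (auto simp: on_def)
    finally show ?thesis .
  qed
qed

end

locale box_basis = pol_system +
  assumes surj: "\<And>n m. m \<in> mons V n \<Longrightarrow> mon m \<in> range\<Theta> n"
begin

lemma \<Theta>_surj_mons:
  assumes "g \<in> on (mons V n)" obtains f where "f \<in> on (mons V n)" "g = \<Theta> f"
proof -
  have "(\<Sum>m\<in>supp g. Cst (coef g m) * mon m) \<in> range\<Theta> n"
    using assms surj by (intro range\<Theta>_sum) (auto simp: on_def)
  then show ?thesis using that pol_expand[of g] by (auto simp: range\<Theta>_def)
qed

lemma \<Theta>_surj:
  assumes "g \<in> on (allm V)" obtains f where "f \<in> on (allm V)" "g = \<Theta> f"
  using assms on_allm_degree \<Theta>_surj_mons on_mons_allm by metis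

lemma \<Theta>_eq_0: assumes "f \<in> on (allm V)" "\<Theta> f = 0" shows "f = 0"
proof -
  obtain n where n: "f \<in> on (mons V n)" using on_allm_degree[OF assms(1)] .
  show ?thesis
  proof (rule lin_inj_if_surj[OF finite_mons[OF V] _ n])
    show "lin E f = 0" using assms(2) by (simp add: \<Theta>_def)
    show "\<exists>f\<in>on (mons V n). lin E f = mon m" if "m \<in> mons V n" for m
      using surj[OF that] by (auto simp: range\<Theta>_def \<Theta>_def)
  qed
qed

lemma \<Theta>_inj: "f \<in> on (allm V) \<Longrightarrow> g \<in> on (allm V) \<Longrightarrow> \<Theta> f = \<Theta> g \<Longrightarrow> f = g"
  using \<Theta>_eq_0[of "f - g"] by (simp add: on_diff \<Theta>_diff)

lemma \<Theta>_allm: "f \<in> on (allm V) \<Longrightarrow> \<Theta> f \<in> on (allm V)"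
  using on_allm_degree \<Theta>_on on_mons_allm by metis

definition I :: "nat set \<Rightarrow> 'a pol set" where
  "I U = {\<Sum>v\<in>U. G v * h v | h. \<forall>v\<in>U. h v \<in> on (allm V)}"
definition M :: "nat set \<Rightarrow> 'a pol set" where
  "M U = on {m \<in> allm V. \<exists>v\<in>U. d \<le> count m v}"

lemma I_subset: "U \<subseteq> V \<Longrightarrow> f \<in> I U \<Longrightarrow> f \<in> on (allm V)"
  using G_allm by (auto simp: I_def intro!: on_sum on_allm_mult)

lemma I_add: "f \<in> I U \<Longrightarrow> g \<in> I U \<Longrightarrow> f + g \<in> I U"
proof -
  assume "f \<in> I U" "g \<in> I U"
  then obtain h h' where "f = (\<Sum>v\<in>U. G v * h v)" "\<forall>v\<in>U. h v \<in> on (allm V)"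
    "g = (\<Sum>v\<in>U. G v * h' v)" "\<forall>v\<in>U. h' v \<in> on (allm V)" by (auto simp: I_def)
  then show ?thesis unfolding I_def
    by (auto intro!: exI[of _ "\<lambda>v. h v + h' v"] on_add simp: distrib_left sum.distrib)
qed

lemma I_mult: "f \<in> I U \<Longrightarrow> g \<in> on (allm V) \<Longrightarrow> g * f \<in> I U"
proof -
  assume "f \<in> I U" and g: "g \<in> on (allm V)"
  then obtain h where h: "f = (\<Sum>v\<in>U. G v * h v)" "\<forall>v\<in>U. h v \<in> on (allm V)" by (auto simp: I_def)
  then have "g * f = (\<Sum>v\<in>U. G v * (g * h v))" by (simp add: sum_distrib_left mult.left_commute)
  then show ?thesis unfolding I_def using h g by (auto intro!: exI[of _ "\<lambda>v. g * h v"] on_allm_mult)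
qed

lemma I_0 [simp]: "0 \<in> I U" unfolding I_def by (auto intro!: exI[of _ "\<lambda>v. 0"])
lemma I_uminus: "f \<in> I U \<Longrightarrow> - f \<in> I U"
  using I_mult[OF _ Cst_on_allm[of "-1"], of f U] by (simp add: Cst_uminus)
lemma I_diff: "f \<in> I U \<Longrightarrow> g \<in> I U \<Longrightarrow> f - g \<in> I U"
  using I_add[OF _ I_uminus, of f U g] by simp
lemma I_sum: "(\<And>i. i \<in> A \<Longrightarrow> f i \<in> I U) \<Longrightarrow> (\<Sum>i\<in>A. f i) \<in> I U"
  by (induction A rule: infinite_finite_induct) (auto intro: I_add)

lemma I_G: "v \<in> U \<Longrightarrow> U \<subseteq> V \<Longrightarrow> G v \<in> I U"
proof -
  assume v: "v \<in> U" "U \<subseteq> V"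
  then have "finite U" using V finite_subset by blast
  have "(\<Sum>u\<in>U. G u * (if u = v then 1 else 0)) = (\<Sum>u\<in>U. if u = v then G u else 0)"
    by (intro sum.cong) auto
  also have "\<dots> = G v" using \<open>finite U\<close> v by (simp add: sum.delta)
  finally have "G v = (\<Sum>u\<in>U. G u * (if u = v then 1 else 0))" by simp
  then show ?thesis unfolding I_def by (auto intro!: exI[of _ "\<lambda>u. if u = v then 1 else 0"])
qed

text \<open>The ideals of the system correspond to monomial ideals.\<close>

lemma I_eq_image: assumes U: "U \<subseteq> V" shows "I U = \<Theta> ` M U"
proof
  show "I U \<subseteq> \<Theta> ` M U"
  proof
    fix f assume "f \<in> I U"
    then obtain h where h: "f = (\<Sum>v\<in>U. G v * h v)" "\<forall>v\<in>U. h v \<in> on (allm V)" by (auto simp: I_def)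
    have "\<forall>v. \<exists>k. v \<in> U \<longrightarrow> k \<in> on (allm V) \<and> h v = \<Theta> k" using h(2) \<Theta>_surj by metis
    then obtain k where k: "\<And>v. v \<in> U \<Longrightarrow> k v \<in> on (allm V) \<and> h v = \<Theta> (k v)" by metis
    have "f = \<Theta> (\<Sum>v\<in>U. mon (replicate_mset d v) * k v)"
      unfolding h(1) \<Theta>_sum by (intro sum.cong) (simp_all add: \<Theta>_power_var k)
    moreover have "(\<Sum>v\<in>U. mon (replicate_mset d v) * k v) \<in> M U" unfolding M_def
    proof (rule on_sum)
      fix v assume v: "v \<in> U"
      have "(mon (replicate_mset d v) :: 'a pol) \<in> on {replicate_mset d v}" by simp
      then show "mon (replicate_mset d v) * k v \<in> on {m \<in> allm V. \<exists>v\<in>U. d \<le> count m v}"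
        using k[OF v] v U by (elim on_mult) (auto simp: allm_def intro!: bexI[of _ v])
    qed
    ultimately show "f \<in> \<Theta> ` M U" by blast
  qed
  show "\<Theta> ` M U \<subseteq> I U"
  proof
    fix f assume "f \<in> \<Theta> ` M U"
    then obtain k where k: "k \<in> M U" "f = \<Theta> k" by auto
    have "E m \<in> I U" if m: "m \<in> supp k" for m
    proof -
      obtain v where v: "v \<in> U" "d \<le> count m v" and mV: "m \<in> allm V" using k(1) m by (auto simp: M_def on_def)
      let ?m = "m - replicate_mset d v"
      have "?m + replicate_mset d v = m"
        using v(2) by (intro subset_mset.diff_add) (simp add: count_le_replicate_mset_subset_eq)
      then have "E m = E ?m * G v" using E_add[of ?m v] by (simp add: mult.commute)
      moreover have "E ?m \<in> on (allm V)"
      proof -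
        have "?m \<in> allm V" using mV by (auto simp: allm_def dest: in_diffD)
        then show ?thesis using \<Theta>_allm[of "mon ?m"] by simp
      qed
      ultimately show ?thesis using I_mult[OF I_G[OF v(1) U]] by simp
    qed
    then show "f \<in> I U" unfolding k(2) \<Theta>_def lin_def by (intro I_sum I_mult) auto
  qed
qed

lemma I_regular:
  assumes U: "U \<subseteq> V" and v: "v \<in> V - U" and f: "f \<in> on (allm V)" and Gf: "G v * f \<in> I U"
  shows "f \<in> I U"
proof -
  obtain k where k: "k \<in> on (allm V)" "f = \<Theta> k" using \<Theta>_surj[OF f] .
  obtain l where l: "l \<in> M U" "G v * f = \<Theta> l" using Gf I_eq_image[OF U] by auto
  have "(mon (replicate_mset d v) :: 'a pol) \<in> on (allm V)" using v by (auto simp: allm_def)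
  then have "mon (replicate_mset d v) * k \<in> on (allm V)" using k(1) by (rule on_allm_mult)
  moreover have "l \<in> on (allm V)" using l(1) unfolding M_def by (rule on_mono) auto
  moreover have "\<Theta> (mon (replicate_mset d v) * k) = \<Theta> l"
    by (simp only: \<Theta>_power_var k(2)[symmetric] l(2))
  ultimately have eq: "mon (replicate_mset d v) * k = l" by (rule \<Theta>_inj)
  have "k \<in> M U" unfolding M_def on_iff
  proof (intro allI impI)
    fix m assume m: "coef k m \<noteq> 0"
    then have "coef l (replicate_mset d v + m) \<noteq> 0" unfolding eq[symmetric] coef_mon_mult .
    then obtain u where "u \<in> U" "d \<le> count (replicate_mset d v + m) u"
      using l(1) by (auto simp: M_def on_iff)
    then have "u \<in> U \<and> d \<le> count m u" using v by (auto split: if_splits)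
    then show "m \<in> {m \<in> allm V. \<exists>v\<in>U. d \<le> count m v}" using k(1) m by (auto simp: on_iff)
  qed
  then show ?thesis using k(2) I_eq_image[OF U] by auto
qed

lemma one_notin_I: assumes "U \<subseteq> V" shows "1 \<notin> I U"
proof
  assume "1 \<in> I U"
  then obtain k where k: "k \<in> M U" "1 = \<Theta> k" using I_eq_image[OF assms] by auto
  have "\<Theta> (mon {#}) = mon {#}" unfolding \<Theta>_mon by (rule E_box) (use d in simp)
  then have eq: "\<Theta> k = \<Theta> (mon {#})" using k(2) by (simp only: mon_empty)
  have "k \<in> on (allm V)" using k(1) unfolding M_def by (rule on_mono) auto
  then have "k = mon {#}" by (rule \<Theta>_inj[OF _ _ eq]) (simp only: on_mon, simp add: allm_def)
  then have "{#} \<in> {m \<in> allm V. \<exists>v\<in>U. d \<le> count m v}"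
    using k(1) unfolding M_def by (simp only: on_mon)
  then show False using d by simp
qed

lemma G_nonzero: assumes "v \<in> V" shows "G v \<noteq> 0"
proof
  assume "G v = 0"
  then have "G v * 1 \<in> I {}" by simp
  then show False using I_regular[of "{}" v 1] one_notin_I[of "{}"] assms by simp
qed

lemma I_regular_power:
  assumes "U \<subseteq> V" "v \<in> V - U" "f \<in> on (allm V)" "G v ^ k * f \<in> I U"
  shows "f \<in> I U"
  using assms(4)
proof (induction k)
  case (Suc k)
  have "G v ^ k * f \<in> on (allm V)" using assms G_allm by (intro on_allm_mult on_allm_power) auto
  then have "G v ^ k * f \<in> I U" using I_regular[OF assms(1,2)] Suc.prems by (simp add: mult.assoc)
  then show ?case by (rule Suc.IH)
qed simp

lemma diff_power_in_I:
  assumes "U \<subseteq> V" "a - b \<in> I U" "a \<in> on (allm V)" "b \<in> on (allm V)"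
  shows "a ^ k - b ^ k \<in> I U"
proof (induction k)
  case (Suc k)
  have "a ^ Suc k - b ^ Suc k = a ^ k * (a - b) + b * (a ^ k - b ^ k)" by (simp add: algebra_simps)
  then show ?case using Suc assms by (auto intro!: I_add I_mult on_allm_power)
qed simp

text \<open>Radicality descends along the sequence: modulo the smaller ideal, a nilpotent element is a
  multiple of the last polynomial, with a nilpotent quotient of smaller degree.\<close>

lemma radical_descent:
  assumes U: "U \<subseteq> V" and v: "v \<in> V - U"
    and rad: "\<And>f k. f \<in> on (allm V) \<Longrightarrow> f ^ k \<in> I (insert v U) \<Longrightarrow> f \<in> I (insert v U)"
  shows "f \<in> on (mons V n) \<Longrightarrow> f ^ k \<in> I U \<Longrightarrow> f \<in> I U"
proof (induction n arbitrary: f k rule: less_induct)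
  case (less n)
  have vU: "insert v U \<subseteq> V" using U v by auto
  have f: "f \<in> on (allm V)" using less.prems(1) on_mons_allm by blast
  have "M U \<subseteq> M (insert v U)" by (auto simp: M_def on_iff)
  then have "I U \<subseteq> I (insert v U)" unfolding I_eq_image[OF U] I_eq_image[OF vU] by (rule image_mono)
  then have "f \<in> I (insert v U)" using rad[OF f] less.prems(2) by blast
  then obtain l where l: "l \<in> M (insert v U)" "f = \<Theta> l" using I_eq_image[OF vU] by auto
  obtain l' where l': "l' \<in> on (mons V n)" "f = \<Theta> l'" using \<Theta>_surj_mons[OF less.prems(1)] .
  have "l \<in> on (allm V)" using l(1) unfolding M_def by (rule on_mono) auto
  then have "l = l'" using on_mons_allm[OF l'(1)] by (rule \<Theta>_inj) (simp only: l(2)[symmetric] l'(2)[symmetric])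
  then have ln: "l \<in> on (mons V n)" using l' by simp
  define S where "S = {m \<in> supp l. \<not> (\<exists>u\<in>U. d \<le> count m u)}"
  have finS: "finite S" unfolding S_def by simp
  have S: "d \<le> count m v \<and> m - replicate_mset d v + replicate_mset d v = m
      \<and> m - replicate_mset d v \<in> mons V (n - d) \<and> d \<le> n" if "m \<in> S" for m
  proof -
    have dm: "d \<le> count m v" using that l(1) by (auto simp: S_def M_def on_def)
    have mn: "m \<in> mons V n" using that ln by (auto simp: S_def on_def)
    have sub: "replicate_mset d v \<subseteq># m" using dm by (simp add: count_le_replicate_mset_subset_eq)
    have "size (m - replicate_mset d v) = size m - d" using sub by (simp add: size_Diff_submset)
    moreover have "d \<le> size m" using dm count_le_size[of m v] by linarith
    ultimately show ?thesis using dm sub mn by (auto simp: mons_def dest: in_diffD)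
  qed
  define h where "h = (\<Sum>m\<in>S. Cst (coef l m) * mon (m - replicate_mset d v))"
  have h_on: "h \<in> on (mons V (n - d))" unfolding h_def using S by (intro on_sum on_Cst_mult) auto
  have split: "mon (replicate_mset d v) * h = (\<Sum>m\<in>S. Cst (coef l m) * mon m)"
  proof -
    have "mon (replicate_mset d v) * h
        = (\<Sum>m\<in>S. Cst (coef l m) * mon (m - replicate_mset d v + replicate_mset d v))"
      unfolding h_def sum_distrib_left by (intro sum.cong) (simp_all add: mon_add mult.left_commute mult.commute)
    then show ?thesis using S by simp
  qed
  have "(\<Sum>m\<in>supp l. Cst (coef l m) * mon m)
      = (\<Sum>m\<in>supp l - S. Cst (coef l m) * mon m) + (\<Sum>m\<in>S. Cst (coef l m) * mon m)"
    by (rule sum.subset_diff) (auto simp: S_def)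
  with pol_expand[of l]
  have "l = (\<Sum>m\<in>supp l - S. Cst (coef l m) * mon m) + (\<Sum>m\<in>S. Cst (coef l m) * mon m)"
    by (rule trans)
  then have "l - mon (replicate_mset d v) * h = (\<Sum>m\<in>supp l - S. Cst (coef l m) * mon m)"
    unfolding split diff_eq_eq .
  also have "\<dots> \<in> M U" unfolding M_def
  proof (intro on_sum on_Cst_mult)
    fix m assume m: "m \<in> supp l - S"
    then have "m \<in> mons V n" using ln by (auto simp: on_def)
    then show "mon m \<in> on {m \<in> allm V. \<exists>v\<in>U. d \<le> count m v}"
      unfolding on_mon using m mons_subset_allm by (auto simp: S_def)
  qed
  finally have lM: "l - mon (replicate_mset d v) * h \<in> M U" .
  have "f - G v * \<Theta> h = \<Theta> (l - mon (replicate_mset d v) * h)"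
    by (simp add: \<Theta>_diff \<Theta>_power_var l(2))
  then have fI: "f - G v * \<Theta> h \<in> I U" using lM I_eq_image[OF U] by auto
  have "\<Theta> h \<in> I U"
  proof (cases "S = {}")
    case True
    then show ?thesis by (simp add: h_def)
  next
    case False
    then have "n - d < n" using S d by fastforce
    have \<Theta>h: "\<Theta> h \<in> on (mons V (n - d))" using \<Theta>_on[OF h_on] .
    have \<Theta>h': "\<Theta> h \<in> on (allm V)" using \<Theta>h on_mons_allm by blast
    have "G v * \<Theta> h \<in> on (allm V)" using \<Theta>h' G_allm v by (intro on_allm_mult) auto
    then have "f ^ k - (G v * \<Theta> h) ^ k \<in> I U" using diff_power_in_I[OF U fI f] by blast
    then have "(G v * \<Theta> h) ^ k \<in> I U" using I_diff[OF less.prems(2), of "f ^ k - (G v * \<Theta> h) ^ k"] by simp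
    then have "G v ^ k * \<Theta> h ^ k \<in> I U" by (simp add: power_mult_distrib)
    then have "\<Theta> h ^ k \<in> I U" using I_regular_power[OF U v on_allm_power[OF \<Theta>h']] by blast
    then show ?thesis using less.IH[OF \<open>n - d < n\<close> \<Theta>h] by blast
  qed
  then have "G v * \<Theta> h \<in> I U" using I_mult G_allm v by blast
  then have "f - G v * \<Theta> h + G v * \<Theta> h \<in> I U" by (rule I_add[OF fI])
  then show ?case by simp
qed

end

section \<open>Almost all systems have a box basis\<close>

lemma finite_card_box_basis_exceptions:
  fixes A :: "nat \<Rightarrow> 'f::field pol"
  assumes V: "finite V" and d: "d \<ge> 1" and A: "\<And>v. v \<in> V \<Longrightarrow> A v \<in> on (mons V d)"
    and T: "finite T"
    and bad: "\<And>t. t \<in> T \<Longrightarrow> \<not> box_basis V d (\<lambda>v. A v + Cst t * mon (replicate_mset d v))"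
  shows "card T \<le> (card V * (d - 1) + 2) ^ card V"
proof -
  define N where "N = card V * (d - 1) + 1"
  define w where "w m = (SOME v. v \<in> V \<and> d \<le> count m v)" for m
  define \<psi> where "\<psi> m = (if \<exists>v\<in>V. d \<le> count m v then mon (m - replicate_mset d (w m)) * A (w m) else 0)" for m
  have w: "w m \<in> V \<and> d \<le> count m (w m)" if "\<exists>v\<in>V. d \<le> count m v" for m
    unfolding w_def by (rule someI_ex) (use that in blast)
  have rm: "m - replicate_mset d (w m) + replicate_mset d (w m) = m \<and>
      m - replicate_mset d (w m) \<in> mons V (n - d) \<and> d \<le> n"
    if "\<exists>v\<in>V. d \<le> count m v" "m \<in> mons V n" for m n
  proof -
    have sub: "replicate_mset d (w m) \<subseteq># m" using w[OF that(1)] by (simp add: count_le_replicate_mset_subset_eq)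
    have "size (m - replicate_mset d (w m)) = size m - d" using sub by (simp add: size_Diff_submset)
    moreover have "d \<le> size m" using w[OF that(1)] count_le_size[of m "w m"] by linarith
    ultimately show ?thesis using sub that(2) by (auto simp: mons_def dest: in_diffD)
  qed
  have \<psi>_on: "\<psi> m \<in> on (mons V n)" if m: "m \<in> mons V n" for m n
  proof (cases "\<exists>v\<in>V. d \<le> count m v")
    case True
    have "(mon (m - replicate_mset d (w m)) :: 'f pol) \<in> on (mons V (n - d))" using rm[OF True m] by simp
    then have "mon (m - replicate_mset d (w m)) * A (w m) \<in> on (mons V (n - d + d))"
      using A w[OF True] by (intro on_mons_mult) auto
    then show ?thesis using True rm[OF True m] by (simp add: \<psi>_def)
  qed (simp add: \<psi>_def)
  have "\<exists>f. f \<noteq> 0 \<and> lin \<psi> f = Cst (- t) * f \<and> f \<in> pol.span (mon ` mons V N)" if t: "t \<in> T" for t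
  proof (rule ccontr)
    assume noev: "\<not> ?thesis"
    define G where "G v = A v + Cst t * mon (replicate_mset d v)" for v
    define \<phi> where "\<phi> m = Cst t * mon m + \<psi> m" for m
    have G: "G v \<in> on (mons V d)" if "v \<in> V" for v
      unfolding G_def using A[OF that] that by (intro on_add on_Cst_mult) (auto simp: mons_def)
    interpret pol_system V d G using V d G by unfold_locales
    have lin\<phi>: "lin \<phi> f = Cst t * f + lin \<psi> f" for f
      unfolding \<phi>_def lin_fun_add lin_fun_Cst lin_id ..
    have inj: "f = 0" if f: "f \<in> on (mons V n)" "n \<le> N" "lin \<phi> f = 0" for f n
    proof -
      have "lin \<psi> f = - (Cst t * f)" using f(3) unfolding lin\<phi> by (simp only: add_eq_0_iff)
      then have "lin \<psi> f = Cst (- t) * f" by (simp add: Cst_uminus)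
      moreover have "f \<in> pol.span (mon ` mons V N)"
        using on_in_span[OF on_mono[OF f(1) mons_mono[OF f(2)]]] .
      ultimately show ?thesis using noev by blast
    qed
    have low: "mon m \<in> range\<Theta> n" if "n \<le> N" "m \<in> mons V n" for n m
      using that
    proof (induction n arbitrary: m rule: less_induct)
      case (less n)
      have pres: "\<phi> m \<in> on (mons V n)" if "m \<in> mons V n" for m
        unfolding \<phi>_def using that \<psi>_on by (intro on_add on_Cst_mult) auto
      have g: "(mon m :: 'f pol) \<in> on (mons V n)" using less.prems by simp
      obtain f where f: "f \<in> on (mons V n)" "lin \<phi> f = mon m"
        by (rule lin_surj_if_inj[OF finite_mons[OF V] pres inj[OF _ less.prems(1)] g])
          (assumption | erule (1) that)+
      have "\<phi> k \<in> range\<Theta> n" if k: "k \<in> mons V n" for k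
      proof (cases "\<exists>v\<in>V. d \<le> count k v")
        case False
        then have "count k v < d" for v
          using k d not_in_iff[of v k] by (cases "v \<in> V") (auto simp: mons_def subset_iff not_le)
        then have "\<phi> k = Cst t * E k" using False by (simp add: \<phi>_def \<psi>_def E_box)
        also have "\<dots> = \<Theta> (Cst t * mon k)" by (simp add: \<Theta>_Cst)
        also have "\<dots> \<in> range\<Theta> n" unfolding range\<Theta>_def using k by (intro imageI on_Cst_mult) auto
        finally show ?thesis .
      next
        case True
        let ?k = "k - replicate_mset d (w k)"
        have k': "?k + replicate_mset d (w k) = k" "?k \<in> mons V (n - d)" "d \<le> n"
          using rm[OF True k] by auto
        have "mon (?k + replicate_mset d (w k)) = mon ?k * (mon (replicate_mset d (w k)) :: 'f pol)"
          by (rule mon_add)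
        then have "mon k = mon (replicate_mset d (w k)) * (mon ?k :: 'f pol)"
          unfolding k'(1) by (simp only: mult.commute)
        moreover have "\<psi> k = mon ?k * A (w k)" using True by (simp add: \<psi>_def)
        ultimately have "\<phi> k = Cst t * (mon (replicate_mset d (w k)) * mon ?k) + mon ?k * A (w k)"
          by (simp only: \<phi>_def)
        then have "\<phi> k = G (w k) * mon ?k"
          unfolding G_def distrib_right by (simp only: ac_simps)
        moreover have "mon ?k \<in> range\<Theta> (n - d)" using less.IH[of "n - d" ?k] k' d less.prems(1) by simp
        then have "G (w k) * mon ?k \<in> range\<Theta> (d + (n - d))" using w[OF True] by (intro range\<Theta>_G) auto
        ultimately show ?thesis using k' by simp
      qed
      then have "(\<Sum>k\<in>supp f. Cst (coef f k) * \<phi> k) \<in> range\<Theta> n"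
        using f(1) by (intro range\<Theta>_sum) (auto simp: on_def)
      then show ?case using f(2) by (simp only: lin_def)
    qed
    have "mon m \<in> range\<Theta> n" if "m \<in> mons V n" for m n
      using range\<Theta>_all[OF low[unfolded N_def] that] .
    then have "box_basis V d G" by unfold_locales
    then show False using bad[OF t] by (simp add: G_def[abs_def])
  qed
  then obtain f where f: "\<And>t. t \<in> T \<Longrightarrow> f t \<noteq> 0 \<and> lin \<psi> (f t) = Cst (- t) * f t \<and> f t \<in> pol.span (mon ` mons V N)"
    by metis
  have "card (uminus ` T) \<le> card (mon ` mons V N :: 'f pol set)"
  proof (rule pol.card_eigenvalues_le[where \<Psi> = "lin \<psi>" and f = "\<lambda>t. f (- t)"])
    show "finite (uminus ` T)" using T by simp
    show "finite (mon ` mons V N)" using finite_mons[OF V] by simp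
    show "f (- t) \<noteq> 0 \<and> lin \<psi> (f (- t)) = Cst t * f (- t) \<and> f (- t) \<in> pol.span (mon ` mons V N)"
      if "t \<in> uminus ` T" for t
      using that f by auto
  qed (simp_all add: lin_add lin_Cst_mult)
  also have "\<dots> \<le> card (mons V N)" by (rule card_image_le[OF finite_mons[OF V]])
  also have "\<dots> \<le> (N + 1) ^ card V" by (rule card_mons[OF V])
  finally show ?thesis by (simp add: N_def card_image inj_on_def)
qed

section \<open>Evaluation and derivatives\<close>

definition mev :: "(nat \<Rightarrow> 'f::field) \<Rightarrow> nat multiset \<Rightarrow> 'f" where "mev x m = prod_mset (image_mset x m)"
definition ev :: "(nat \<Rightarrow> 'f) \<Rightarrow> 'f::field pol \<Rightarrow> 'f" where "ev x f = (\<Sum>m\<in>supp f. coef f m * mev x m)"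

lemma mev_add: "mev x (a + b) = mev x a * mev x b" by (simp add: mev_def)
lemma mev_empty [simp]: "mev x {#} = 1" by (simp add: mev_def)
lemma mev_add_mset [simp]: "mev x (add_mset a m) = x a * mev x m" by (simp add: mev_def)

lemma Cst_sum: "Cst (\<Sum>i\<in>A. f i) = (\<Sum>i\<in>A. Cst (f i))"
  by (induction A rule: infinite_finite_induct) (auto simp: Cst_add)

lemma Cst_inj: "Cst a = Cst b \<Longrightarrow> a = b"
  using Cst_diff[of a b] by simp

lemma Cst_ev: "Cst (ev x f) = lin (\<lambda>m. Cst (mev x m)) f"
  by (simp add: ev_def lin_def Cst_sum Cst_mult)

lemma ev_add: "ev x (f + g) = ev x f + ev x g"
  by (rule Cst_inj) (simp only: Cst_ev Cst_add lin_add)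
lemma ev_diff: "ev x (f - g) = ev x f - ev x g"
  by (rule Cst_inj) (simp only: Cst_ev Cst_diff lin_diff)
lemma ev_uminus: "ev x (- f) = - ev x f"
  by (rule Cst_inj) (simp only: Cst_ev Cst_uminus lin_uminus)
lemma ev_0 [simp]: "ev x 0 = 0" by (simp add: ev_def)
lemma ev_mon [simp]: "ev x (mon m) = mev x m"
  by (rule Cst_inj) (simp only: Cst_ev lin_mon)
lemma ev_1 [simp]: "ev x 1 = 1" using ev_mon[of x "{#}"] by simp

lemma ev_mult: "ev x (f * g) = ev x f * ev x g"
proof (rule Cst_inj)
  let ?c = "\<lambda>m. Cst (mev x m)"
  have *: "lin ?c (mon m * g) = ?c m * lin ?c g" for m
  proof -
    have "mon m * g = lin (\<lambda>k. mon (k + m)) g"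
      using mult_eq_lin[of g "mon m"] by (simp only: mon_add mult.commute)
    then have "lin ?c (mon m * g) = lin (\<lambda>k. ?c k * ?c m) g" by (simp only: lin_lin lin_mon mev_add Cst_mult)
    then show ?thesis by (simp only: lin_mult_right[symmetric] mult.commute)
  qed
  have "Cst (ev x (f * g)) = lin ?c (lin (\<lambda>m. mon m * g) f)" by (simp only: Cst_ev mult_eq_lin[of f g])
  also have "\<dots> = lin (\<lambda>m. ?c m * lin ?c g) f" by (simp only: lin_lin *)
  also have "\<dots> = lin ?c f * lin ?c g" by (simp only: lin_mult_right)
  finally show "Cst (ev x (f * g)) = Cst (ev x f * ev x g)" by (simp only: Cst_ev Cst_mult)
qed

lemma ev_Cst [simp]: "ev x (Cst c) = c"
proof -
  have "ev x (Cst c) = coef (Cst c) {#} * mev x {#}"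
    unfolding ev_def Cst_def by (simp add: keys_single)
  then show ?thesis by (simp add: Cst_def)
qed

lemma ev_sum: "ev x (\<Sum>i\<in>A. f i) = (\<Sum>i\<in>A. ev x (f i))"
  by (induction A rule: infinite_finite_induct) (auto simp: ev_add)
lemma ev_prod: "ev x (\<Prod>i\<in>A. f i) = (\<Prod>i\<in>A. ev x (f i))"
  by (induction A rule: infinite_finite_induct) (auto simp: ev_mult)
lemma ev_power: "ev x (f ^ k) = ev x f ^ k"
  by (induction k) (auto simp: ev_mult)
lemma ev_lin: "ev x (lin b f) = (\<Sum>m\<in>supp f. coef f m * ev x (b m))"
  by (simp add: lin_def ev_sum ev_mult)

interpretation ev_hom: comm_ring_hom "ev x" for x :: "nat \<Rightarrow> 'f::field"
  by unfold_locales (simp_all add: ev_add ev_mult)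

definition pdiff :: "nat \<Rightarrow> 'f::field pol \<Rightarrow> 'f pol" where
  "pdiff w = lin (\<lambda>m. Cst (of_nat (count m w)) * mon (m - {#w#}))"

lemma pdiff_on: "f \<in> on (mons V n) \<Longrightarrow> pdiff w f \<in> on (mons V n)"
  unfolding pdiff_def
proof (erule lin_on, rule on_Cst_mult)
  fix m assume m: "m \<in> mons V n"
  have "size (m - {#w#}) \<le> size m" by (rule size_mset_mono) simp
  then show "mon (m - {#w#}) \<in> on (mons V n)"
    unfolding on_mon using m by (auto simp: mons_def dest: in_diffD)
qed

lemma ring_telescope: "a * (p - c) + p * (y - a) = y * p - a * (c::'r::comm_ring_1)"
  by (simp add: algebra_simps)

text \<open>The Taylor expansion at a point, to the first order.\<close>

lemma hadamard_mon:
  fixes x :: "nat \<Rightarrow> 'f::field"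
  assumes V: "finite V" and m: "m \<in> allm V"
  shows "\<exists>H. (\<forall>w\<in>V. H w \<in> on (allm V) \<and> ev x (H w) = ev x (pdiff w (mon m))) \<and>
    mon m = Cst (mev x m) + (\<Sum>w\<in>V. H w * (Var w - Cst (x w)))"
  using m
proof (induction m)
  case empty
  show ?case by (intro exI[of _ "\<lambda>w. 0"]) (simp add: pdiff_def del: mon_empty, simp)
next
  case (add u m)
  then have u: "u \<in> V" and mV: "m \<in> allm V" by (auto simp: allm_def)
  obtain H where H: "\<And>w. w \<in> V \<Longrightarrow> H w \<in> on (allm V) \<and> ev x (H w) = ev x (pdiff w (mon m))"
    "mon m = Cst (mev x m) + (\<Sum>w\<in>V. H w * (Var w - Cst (x w)))"
    using add.IH[OF mV] by blast
  let ?e = "\<lambda>w. if w = u then mon m else 0"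
  let ?H = "\<lambda>w. Cst (x u) * H w + ?e w"
  have "?H w \<in> on (allm V)" if "w \<in> V" for w
    using H(1)[OF that] mV by (intro on_add on_Cst_mult) auto
  moreover have "ev x (?H w) = ev x (pdiff w (mon (add_mset u m)))" if w: "w \<in> V" for w
  proof -
    have e1: "ev x (H w) = of_nat (count m w) * mev x (m - {#w#})"
      using H(1)[OF w] by (simp add: pdiff_def ev_mult)
    have e2: "ev x (pdiff w (mon (add_mset u m))) = of_nat (count (add_mset u m) w) * mev x (add_mset u m - {#w#})"
      by (simp add: pdiff_def ev_mult)
    have e3: "ev x (?H w) = x u * (of_nat (count m w) * mev x (m - {#w#})) + (if w = u then mev x m else 0)"
      by (simp add: ev_add ev_mult e1)
    have e4: "x w * mev x (m - {#w#}) = mev x m" if "w \<in># m"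
      using mev_add_mset[of x w "m - {#w#}"] that by simp
    show ?thesis
    proof (cases "w \<in># m")
      case True
      show ?thesis
      proof (cases "w = u")
        case True
        then have "x u * (of_nat (count m w) * mev x (m - {#w#})) = of_nat (count m w) * mev x m"
          using e4[OF \<open>w \<in># m\<close>] mult.left_commute[of "x u" "of_nat (count m w)" "mev x (m - {#w#})"] by simp
        then show ?thesis unfolding e2 e3 using True by (simp add: distrib_right add.commute)
      next
        case False
        then have "add_mset u m - {#w#} = add_mset u (m - {#w#})" by simp
        then show ?thesis unfolding e2 e3 using False by (simp add: mult.left_commute)
      qed
    next
      case False
      then have "count m w = 0" by (simp add: not_in_iff)
      then show ?thesis unfolding e2 e3 by (cases "w = u") auto
    qed
  qed
  moreover have "mon (add_mset u m) = Cst (mev x (add_mset u m)) + (\<Sum>w\<in>V. ?H w * (Var w - Cst (x w)))"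
  proof -
    have s1: "(\<Sum>w\<in>V. ?e w * (Var w - Cst (x w))) = mon m * (Var u - Cst (x u))"
    proof -
      have "(\<Sum>w\<in>V. ?e w * (Var w - Cst (x w))) = (\<Sum>w\<in>V. if w = u then mon m * (Var u - Cst (x u)) else 0)"
        by (intro sum.cong) auto
      then show ?thesis using V u by (simp add: sum.delta)
    qed
    have s2: "(\<Sum>w\<in>V. Cst (x u) * H w * (Var w - Cst (x w))) = Cst (x u) * (mon m - Cst (mev x m))"
    proof -
      have "mon m - Cst (mev x m) = (\<Sum>w\<in>V. H w * (Var w - Cst (x w)))"
        by (subst diff_eq_eq, subst add.commute) (rule H(2))
      then show ?thesis by (simp only: sum_distrib_left mult.assoc)
    qed
    have "(\<Sum>w\<in>V. ?H w * (Var w - Cst (x w))) = Cst (x u) * (mon m - Cst (mev x m)) + mon m * (Var u - Cst (x u))"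
      unfolding distrib_right sum.distrib s1 s2 ..
    also have "\<dots> = Var u * mon m - Cst (x u) * Cst (mev x m)"
      by (rule ring_telescope)
    also have "\<dots> = mon (add_mset u m) - Cst (mev x (add_mset u m))"
      unfolding add_mset_add_single[of u m] union_commute[of m] mon_add mev_add Cst_mult
      by (simp only: mev_def image_mset_single prod_mset_singleton)
    finally have s: "(\<Sum>w\<in>V. ?H w * (Var w - Cst (x w))) = mon (add_mset u m) - Cst (mev x (add_mset u m))" .
    show ?thesis unfolding s by (simp only: add_diff_eq add_diff_cancel_left')
  qed
  ultimately show ?case by (intro exI[of _ ?H]) blast
qed

lemma hadamard:
  fixes x :: "nat \<Rightarrow> 'f::field"
  assumes V: "finite V" and f: "f \<in> on (allm V)"
  shows "\<exists>H. (\<forall>w\<in>V. H w \<in> on (allm V)) \<and> (\<forall>w\<in>V. ev x (H w) = ev x (pdiff w f)) \<and>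
    f = Cst (ev x f) + (\<Sum>w\<in>V. H w * (Var w - Cst (x w)))"
proof -
  let ?P = "\<lambda>m H. (\<forall>w\<in>V. H w \<in> on (allm V) \<and> ev x (H w) = ev x (pdiff w (mon m))) \<and>
    mon m = Cst (mev x m) + (\<Sum>w\<in>V. H w * (Var w - Cst (x w)))"
  have "\<exists>H. ?P m H" if "m \<in> supp f" for m
    by (rule hadamard_mon[OF V]) (use that f in \<open>auto simp: on_def\<close>)
  then have "\<forall>m\<in>supp f. \<exists>H. ?P m H" by (rule ballI)
  from bchoice[OF this] obtain H where H: "\<forall>m\<in>supp f. ?P m (H m)" ..
  have H1: "H m w \<in> on (allm V)" and H2: "ev x (H m w) = ev x (pdiff w (mon m))"
    if "m \<in> supp f" "w \<in> V" for m w
    using conjunct1[OF bspec[OF H that(1)]] that(2) by blast+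
  let ?H = "\<lambda>w. \<Sum>m\<in>supp f. Cst (coef f m) * H m w"
  show ?thesis
  proof (intro exI[of _ ?H] conjI ballI)
    fix w assume w: "w \<in> V"
    show "?H w \<in> on (allm V)" using H1 w by (intro on_sum on_Cst_mult)
  next
    fix w assume w: "w \<in> V"
    have "ev x (?H w) = (\<Sum>m\<in>supp f. coef f m * ev x (pdiff w (mon m)))"
      unfolding ev_sum ev_mult ev_Cst using H2 w by (intro sum.cong refl) simp
    also have "\<dots> = ev x (pdiff w f)"
      unfolding pdiff_def lin_mon by (simp only: ev_lin)
    finally show "ev x (?H w) = ev x (pdiff w f)" .
  next
    have "f = (\<Sum>m\<in>supp f. Cst (coef f m) * mon m)" by (rule pol_expand)
    also have "\<dots> = (\<Sum>m\<in>supp f. Cst (coef f m) * (Cst (mev x m) + (\<Sum>w\<in>V. H m w * (Var w - Cst (x w)))))"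
    proof (rule sum.cong[OF refl])
      fix m assume "m \<in> supp f"
      then have "mon m = Cst (mev x m) + (\<Sum>w\<in>V. H m w * (Var w - Cst (x w)))"
        by (rule conjunct2[OF bspec[OF H]])
      then show "Cst (coef f m) * mon m = Cst (coef f m) * (Cst (mev x m) + (\<Sum>w\<in>V. H m w * (Var w - Cst (x w))))"
        by (rule arg_cong)
    qed
    also have "\<dots> = (\<Sum>m\<in>supp f. Cst (coef f m) * Cst (mev x m))
        + (\<Sum>m\<in>supp f. \<Sum>w\<in>V. Cst (coef f m) * H m w * (Var w - Cst (x w)))"
      unfolding distrib_left sum.distrib sum_distrib_left mult.assoc ..
    finally have 1: "f = (\<Sum>m\<in>supp f. Cst (coef f m) * Cst (mev x m))
        + (\<Sum>m\<in>supp f. \<Sum>w\<in>V. Cst (coef f m) * H m w * (Var w - Cst (x w)))" .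
    have 2: "(\<Sum>m\<in>supp f. Cst (coef f m) * Cst (mev x m)) = Cst (ev x f)"
      by (simp only: ev_def Cst_sum Cst_mult)
    have "(\<Sum>m\<in>supp f. \<Sum>w\<in>V. Cst (coef f m) * H m w * (Var w - Cst (x w)))
        = (\<Sum>w\<in>V. \<Sum>m\<in>supp f. Cst (coef f m) * H m w * (Var w - Cst (x w)))"
      by (rule sum.swap)
    also have "\<dots> = (\<Sum>w\<in>V. ?H w * (Var w - Cst (x w)))"
      unfolding sum_distrib_right ..
    finally have 3: "(\<Sum>m\<in>supp f. \<Sum>w\<in>V. Cst (coef f m) * H m w * (Var w - Cst (x w)))
        = (\<Sum>w\<in>V. ?H w * (Var w - Cst (x w)))" .
    show "f = Cst (ev x f) + (\<Sum>w\<in>V. ?H w * (Var w - Cst (x w)))"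
      by (rule trans[OF 1 arg_cong2[where f = "(+)", OF 2 3]])
  qed
qed

section \<open>Radicality from the Jacobian determinant\<close>

definition algebraically_closed_type :: "'f::field itself \<Rightarrow> bool" where
  "algebraically_closed_type _ \<longleftrightarrow> (\<forall>p :: 'f poly. Polynomial.degree p > 0 \<longrightarrow> (\<exists>z. poly p z = 0))"

text \<open>A univariate polynomial at the variable \<open>w\<close>.\<close>

definition upol :: "nat \<Rightarrow> 'f::field poly \<Rightarrow> 'f pol" where "upol w p = poly (map_poly Cst p) (Var w)"

lemma upol_add: "upol w (p + q) = upol w p + upol w q"
proof -
  have "map_poly Cst (p + q) = map_poly Cst p + map_poly Cst q"
    by (rule poly_eqI) (simp add: coeff_map_poly Cst_add)
  then show ?thesis by (simp add: upol_def)
qed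

lemma upol_smult: "upol w (Polynomial.smult c p) = Cst c * upol w p"
proof -
  have "map_poly Cst (Polynomial.smult c p) = Polynomial.smult (Cst c) (map_poly Cst p)"
    by (rule poly_eqI) (simp add: coeff_map_poly Cst_mult)
  then show ?thesis by (simp add: upol_def)
qed

lemma upol_0 [simp]: "upol w 0 = 0" by (simp add: upol_def)

lemma upol_sum: "upol w (\<Sum>i\<in>A. f i) = (\<Sum>i\<in>A. upol w (f i))"
  by (induction A rule: infinite_finite_induct) (auto simp: upol_add)

lemma upol_pCons: "upol w (pCons a p) = Cst a + Var w * upol w p"
proof -
  have "map_poly Cst (pCons a p) = pCons (Cst a) (map_poly Cst p)"
    by (rule poly_eqI) (simp add: coeff_map_poly coeff_pCons split: nat.split)
  then show ?thesis by (simp add: upol_def)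
qed

lemma upol_linear_mult: "upol w ([:- c, 1:] * p) = (Var w - Cst c) * upol w p"
proof -
  have e: "[:- c, 1:] * p = Polynomial.smult (- c) p + pCons 0 p" by simp
  show ?thesis unfolding e upol_add upol_smult upol_pCons Cst_uminus Cst_0 add_0_left
    by (simp add: left_diff_distrib)
qed

lemma upol_monom: "upol w (Polynomial.monom c k) = Cst c * Var w ^ k"
  by (simp add: upol_def map_poly_monom poly_monom)

lemma upol_on: "w \<in> V \<Longrightarrow> upol w p \<in> on (allm V)"
proof (induction p)
  case (pCons a p)
  then have "Var w * upol w p \<in> on (allm V)" by (intro on_allm_mult) (auto simp: allm_def)
  then show ?case unfolding upol_pCons by (intro on_add) auto
qed simp

lemma det_closed:
  fixes M :: "'f::field pol mat"
  assumes M: "M \<in> carrier_mat n n" and "\<And>i j. i < n \<Longrightarrow> j < n \<Longrightarrow> M $$ (i, j) \<in> on (allm V)"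
  shows "det M \<in> on (allm V)"
  unfolding det_def'[OF M]
proof (rule on_sum)
  fix p assume p: "p \<in> {p. p permutes {0..<n}}"
  have "(\<Prod>i\<in>A. M $$ (i, p i)) \<in> on (allm V)" if "A \<subseteq> {0..<n}" for A
    using that
  proof (induction A rule: infinite_finite_induct)
    case (insert a A)
    have "p a < n" using p insert.prems permutes_in_image[of p "{0..<n}" a] by auto
    then have "M $$ (a, p a) * (\<Prod>i\<in>A. M $$ (i, p i)) \<in> on (allm V)"
      using insert assms(2)[of a "p a"] by (intro on_allm_mult) auto
    then show ?case using insert.hyps by simp
  qed auto
  from on_allm_mult[OF _ this[OF order_refl]]
  show "signof p * (\<Prod>i = 0..<n. M $$ (i, p i)) \<in> on (allm V)"
    using on_uminus[OF one_on_allm[of V, where ?'a = 'f]] by (simp add: sign_def)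
qed

lemma det_degree:
  fixes M :: "'f::field pol mat"
  assumes M: "M \<in> carrier_mat n n" and "\<And>i j. i < n \<Longrightarrow> j < n \<Longrightarrow> M $$ (i, j) \<in> on (mons V d)"
  shows "det M \<in> on (mons V (n * d))"
  unfolding det_def'[OF M]
proof (rule on_sum)
  fix p assume p: "p \<in> {p. p permutes {0..<n}}"
  have *: "(\<Prod>i\<in>A. M $$ (i, p i)) \<in> on (mons V (card A * d))" if "A \<subseteq> {0..<n}" "finite A" for A
    using that(2,1)
  proof (induction A rule: finite_induct)
    case (insert a A)
    have "p a < n" using p insert.prems permutes_in_image[of p "{0..<n}" a] by auto
    then have "M $$ (a, p a) * (\<Prod>i\<in>A. M $$ (i, p i)) \<in> on (mons V (d + card A * d))"
      using insert assms(2)[of a "p a"] by (intro on_mons_mult) auto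
    then show ?case using insert.hyps by simp
  qed auto
  have "(\<Prod>i\<in>{0..<n}. M $$ (i, p i)) \<in> on (mons V (n * d))" using *[of "{0..<n}"] by simp
  from this on_uminus[OF this]
  show "signof p * (\<Prod>i = 0..<n. M $$ (i, p i)) \<in> on (mons V (n * d))"
    by (simp add: sign_def)
qed

context box_basis
begin

definition jacobian :: "(nat \<Rightarrow> nat) \<Rightarrow> 'a pol" where
  "jacobian e = det (mat (card V) (card V) (\<lambda>(i, j). pdiff (e j) (G (e i))))"

text \<open>Near a common zero with nonvanishing Jacobian determinant the ideal contains all
  \<open>Var w - x w\<close>, by Cramer's rule for the Taylor expansions of the system.\<close>

lemma locally_maximal:
  assumes e: "bij_betw e {0..<card V} V" and zero: "\<And>v. v \<in> V \<Longrightarrow> ev x (G v) = 0"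
    and J: "ev x (jacobian e) \<noteq> 0"
  obtains g where "g \<in> on (allm V)" "ev x g \<noteq> 0" "\<And>w. w \<in> V \<Longrightarrow> g * (Var w - Cst (x w)) \<in> I V"
proof -
  let ?n = "card V"
  have eV: "e i \<in> V" if "i < ?n" for i using e that by (auto simp: bij_betw_def)
  have "\<exists>H. (\<forall>w\<in>V. H w \<in> on (allm V) \<and> ev x (H w) = ev x (pdiff w (G v))) \<and>
      G v = (\<Sum>w\<in>V. H w * (Var w - Cst (x w)))" if v: "v \<in> V" for v
  proof -
    obtain H where H: "\<forall>w\<in>V. H w \<in> on (allm V)" "\<forall>w\<in>V. ev x (H w) = ev x (pdiff w (G v))"
      "G v = Cst (ev x (G v)) + (\<Sum>w\<in>V. H w * (Var w - Cst (x w)))"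
      using hadamard[OF V G_allm[OF v], of x] by (elim exE conjE) (rule that)
    have "G v = (\<Sum>w\<in>V. H w * (Var w - Cst (x w)))" using H(3) unfolding zero[OF v] Cst_0 add_0_left .
    then show ?thesis using H(1,2) by (intro exI[of _ H] conjI ballI) simp_all
  qed
  then have "\<forall>v\<in>V. \<exists>H. (\<forall>w\<in>V. H w \<in> on (allm V) \<and> ev x (H w) = ev x (pdiff w (G v))) \<and>
      G v = (\<Sum>w\<in>V. H w * (Var w - Cst (x w)))" by (rule ballI)
  from bchoice[OF this] obtain H where H: "\<forall>v\<in>V. (\<forall>w\<in>V. H v w \<in> on (allm V) \<and> ev x (H v w) = ev x (pdiff w (G v))) \<and>
      G v = (\<Sum>w\<in>V. H v w * (Var w - Cst (x w)))" ..
  have H1: "H v w \<in> on (allm V)" "ev x (H v w) = ev x (pdiff w (G v))" if "v \<in> V" "w \<in> V" for v w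
    using conjunct1[OF bspec[OF H that(1)]] that(2) by blast+
  have H2: "G v = (\<Sum>w\<in>V. H v w * (Var w - Cst (x w)))" if "v \<in> V" for v
    by (rule conjunct2[OF bspec[OF H that]])
  define A where "A = mat ?n ?n (\<lambda>(i, j). H (e i) (e j))"
  have A: "A \<in> carrier_mat ?n ?n" by (simp add: A_def)
  have A_on: "A $$ (i, j) \<in> on (allm V)" if "i < ?n" "j < ?n" for i j
    using that H1 eV by (simp add: A_def)
  have det_on: "det A \<in> on (allm V)" by (rule det_closed[OF A A_on])
  have "ev x (det A) = det (map_mat (ev x) A)" by (rule ev_hom.hom_det[symmetric])
  also have "map_mat (ev x) A = map_mat (ev x) (mat ?n ?n (\<lambda>(i, j). pdiff (e j) (G (e i))))"
    using H1 eV by (intro eq_matI) (auto simp: A_def)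
  also have "det \<dots> = ev x (jacobian e)" unfolding jacobian_def by (rule ev_hom.hom_det)
  finally have ne: "ev x (det A) \<noteq> 0" using J by simp
  have "det A * (Var (e j) - Cst (x (e j))) \<in> I V" if j: "j < ?n" for j
  proof -
    let ?y = "\<lambda>j. Var (e j) - Cst (x (e j)) :: 'a pol"
    let ?B = "adj_mat A"
    have B: "?B \<in> carrier_mat ?n ?n" by (rule adj_mat(1)[OF A])
    have Ge: "G (e i) = (\<Sum>k<?n. A $$ (i, k) * ?y k)" if i: "i < ?n" for i
    proof -
      have "G (e i) = (\<Sum>k\<in>{0..<?n}. H (e i) (e k) * ?y k)"
        unfolding H2[OF eV[OF i]] by (rule sum.reindex_bij_betw[OF e, symmetric])
      also have "\<dots> = (\<Sum>k<?n. A $$ (i, k) * ?y k)"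
        by (intro sum.cong) (use i in \<open>auto simp: A_def\<close>)
      finally show ?thesis .
    qed
    have BA: "(\<Sum>i<?n. ?B $$ (j, i) * A $$ (i, k)) = (if j = k then det A else 0)" if k: "k < ?n" for k
    proof -
      have "(\<Sum>i<?n. ?B $$ (j, i) * A $$ (i, k)) = (?B * A) $$ (j, k)"
        using A B j k by (auto simp: scalar_prod_def atLeast0LessThan intro!: sum.cong)
      also have "\<dots> = (if j = k then det A else 0)" using j k by (simp add: adj_mat(3)[OF A])
      finally show ?thesis .
    qed
    have "(\<Sum>i<?n. ?B $$ (j, i) * G (e i)) = (\<Sum>i<?n. \<Sum>k<?n. ?B $$ (j, i) * A $$ (i, k) * ?y k)"
    proof (intro sum.cong refl)
      fix i assume "i \<in> {..<?n}"
      then have "?B $$ (j, i) * G (e i) = ?B $$ (j, i) * (\<Sum>k<?n. A $$ (i, k) * ?y k)" using Ge[of i] by simp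
      then show "?B $$ (j, i) * G (e i) = (\<Sum>k<?n. ?B $$ (j, i) * A $$ (i, k) * ?y k)"
        by (simp only: sum_distrib_left mult.assoc)
    qed
    also have "\<dots> = (\<Sum>k<?n. \<Sum>i<?n. ?B $$ (j, i) * A $$ (i, k) * ?y k)" by (rule sum.swap)
    also have "\<dots> = (\<Sum>k<?n. (\<Sum>i<?n. ?B $$ (j, i) * A $$ (i, k)) * ?y k)"
      by (simp only: sum_distrib_right)
    also have "\<dots> = (\<Sum>k<?n. if k = j then det A * ?y j else 0)"
      by (intro sum.cong refl) (use BA in auto)
    also have "\<dots> = det A * ?y j" using j by (simp add: sum.delta)
    finally have eq: "(\<Sum>i<?n. ?B $$ (j, i) * G (e i)) = det A * ?y j" .
    have "?B $$ (j, i) \<in> on (allm V)" if i: "i < ?n" for i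
    proof -
      have "mat_delete A i j \<in> carrier_mat (?n - 1) (?n - 1)" by (rule mat_delete_carrier[OF A])
      moreover have "mat_delete A i j $$ (a, b) \<in> on (allm V)" if "a < ?n - 1" "b < ?n - 1" for a b
        using that A A_on by (auto simp: mat_delete_def)
      ultimately have D: "det (mat_delete A i j) \<in> on (allm V)" by (rule det_closed)
      have "(- 1 :: 'a pol) ^ (i + j) \<in> on (allm V)" by (intro on_allm_power on_uminus) simp
      then show ?thesis using D i j A by (auto simp: adj_mat_def cofactor_def intro: on_allm_mult)
    qed
    then have "(\<Sum>i<?n. ?B $$ (j, i) * G (e i)) \<in> I V"
      using eV by (intro I_sum I_mult I_G) auto
    then show ?thesis unfolding eq .
  qed
  then have max: "det A * (Var w - Cst (x w)) \<in> I V" if "w \<in> V" for w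
  proof -
    have "w \<in> e ` {0..<?n}" using e that by (simp add: bij_betw_def)
    then obtain j where "j < ?n" "w = e j" by auto
    then show ?thesis using \<open>\<And>j. j < ?n \<Longrightarrow> det A * (Var (e j) - Cst (x (e j))) \<in> I V\<close> by blast
  qed
  show thesis by (rule that[OF det_on ne max])
qed

definition is_ideal :: "'a pol set \<Rightarrow> bool" where
  "is_ideal A \<longleftrightarrow> A \<subseteq> on (allm V) \<and> 0 \<in> A \<and> (\<forall>f\<in>A. \<forall>g\<in>A. f + g \<in> A) \<and> (\<forall>f\<in>A. \<forall>g\<in>on (allm V). g * f \<in> A)"

lemma is_ideal_sub: "is_ideal A \<Longrightarrow> f \<in> A \<Longrightarrow> f \<in> on (allm V)"
  and is_ideal_0: "is_ideal A \<Longrightarrow> 0 \<in> A"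
  and is_ideal_add: "is_ideal A \<Longrightarrow> f \<in> A \<Longrightarrow> g \<in> A \<Longrightarrow> f + g \<in> A"
  and is_ideal_mult: "is_ideal A \<Longrightarrow> f \<in> A \<Longrightarrow> g \<in> on (allm V) \<Longrightarrow> g * f \<in> A"
  by (simp_all add: is_ideal_def subset_iff)

text \<open>Modulo the system all polynomials are combinations of finitely many box monomials, so the
  powers of each variable are linearly dependent.\<close>

lemma algebraic_variable:
  assumes w: "w \<in> V" obtains p where "p \<noteq> 0" "upol w p \<in> I V"
proof -
  define B where "B = {m \<in> allm V. \<forall>v\<in>V. count m v < d}"
  have "B \<subseteq> mons V (card V * d)"
  proof
    fix m assume m: "m \<in> B"
    then have "size m = (\<Sum>v\<in>V. count m v)" by (intro size_eq_sum_count[OF V]) (auto simp: B_def allm_def)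
    also have "\<dots> \<le> (\<Sum>v\<in>V. d)" using m by (intro sum_mono) (auto simp: B_def)
    finally show "m \<in> mons V (card V * d)" using m by (simp add: B_def mons_def allm_def)
  qed
  then have finB: "finite B" using finite_mons[OF V] finite_subset by blast
  have var_on: "Var w ^ k \<in> on (allm V)" for k
    using w by (intro on_allm_power) (auto simp: allm_def)
  have "\<exists>f. f \<in> on (allm V) \<and> Var w ^ k = \<Theta> f" for k
    using \<Theta>_surj[OF var_on[of k]] by blast
  then have "\<forall>k. \<exists>f. f \<in> on (allm V) \<and> Var w ^ k = \<Theta> f" by (rule allI)
  from choice[OF this] obtain f where f: "\<forall>k. f k \<in> on (allm V) \<and> Var w ^ k = \<Theta> (f k)" ..
  define b where "b k = (\<Sum>m\<in>supp (f k) \<inter> B. Cst (coef (f k) m) * mon m)" for k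
  have b_span: "b k \<in> pol.span (mon ` B)" for k
    unfolding b_def by (intro pol.span_sum pol.span_scale pol.span_base) auto
  have fb: "f k - b k \<in> M V" for k
  proof -
    have "(\<Sum>m\<in>supp (f k). Cst (coef (f k) m) * mon m)
        = (\<Sum>m\<in>supp (f k) - B. Cst (coef (f k) m) * mon m) + b k"
      unfolding b_def using sum.subset_diff[of "supp (f k) \<inter> B" "supp (f k)" "\<lambda>m. Cst (coef (f k) m) * mon m"]
      by (simp add: Diff_Int)
    with pol_expand[of "f k"] have "f k = (\<Sum>m\<in>supp (f k) - B. Cst (coef (f k) m) * mon m) + b k"
      by (rule trans)
    then have "f k - b k = (\<Sum>m\<in>supp (f k) - B. Cst (coef (f k) m) * mon m)" unfolding diff_eq_eq .
    also have "\<dots> \<in> M V" unfolding M_def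
    proof (intro on_sum on_Cst_mult)
      fix m assume m: "m \<in> supp (f k) - B"
      have "supp (f k) \<subseteq> allm V" using f unfolding on_def by blast
      then have "m \<in> allm V" using m by blast
      then show "mon m \<in> on {m \<in> allm V. \<exists>v\<in>V. d \<le> count m v}"
        unfolding on_mon using m by (auto simp: B_def not_less)
    qed
    finally show ?thesis .
  qed
  have card: "card (mon ` B :: 'a pol set) < card {..card B}"
    using card_image_le[OF finB, of "mon :: _ \<Rightarrow> 'a pol"] by simp
  obtain c i where c: "(\<Sum>k\<in>{..card B}. Cst (c k) * b k) = 0" "i \<in> {..card B}" "c i \<noteq> 0"
    by (rule pol.exists_linear_relation[OF _ _ card b_span]) (use finB in simp, use finB in simp, rule that)
  define p where "p = (\<Sum>k\<in>{..card B}. Polynomial.monom (c k) k)"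
  have "Polynomial.coeff p i = c i"
    using c(2) by (simp add: p_def coeff_sum sum.delta)
  then have p0: "p \<noteq> 0" using c(3) by auto
  have "(\<Sum>k\<in>{..card B}. Cst (c k) * f k) = (\<Sum>k\<in>{..card B}. Cst (c k) * (f k - b k))"
    unfolding right_diff_distrib sum_subtractf c(1) diff_0_right ..
  also have "\<dots> \<in> M V" unfolding M_def
    by (intro on_sum on_Cst_mult) (use fb in \<open>simp add: M_def\<close>)
  finally have "\<Theta> (\<Sum>k\<in>{..card B}. Cst (c k) * f k) \<in> I V" using I_eq_image[of V] by blast
  also have "\<Theta> (\<Sum>k\<in>{..card B}. Cst (c k) * f k) = upol w p"
    unfolding \<Theta>_sum \<Theta>_Cst p_def upol_sum upol_monom using f by (intro sum.cong refl) simp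
  finally show thesis using that p0 by blast
qed

text \<open>The weak Nullstellensatz for ideals that contain the system.\<close>

lemma ideal_add_linear:
  assumes "is_ideal A" "w \<in> V"
  shows "is_ideal {a + b * (Var w - Cst c) | a b. a \<in> A \<and> b \<in> on (allm V)}" (is "is_ideal ?A")
    and "A \<subseteq> {a + b * (Var w - Cst c) | a b. a \<in> A \<and> b \<in> on (allm V)}"
    and "Var w - Cst c \<in> {a + b * (Var w - Cst c) | a b. a \<in> A \<and> b \<in> on (allm V)}"
proof -
  let ?l = "Var w - Cst c :: 'a pol"
  have l: "?l \<in> on (allm V)"
    using assms(2) by (intro on_diff Cst_on_allm) (simp add: allm_def)
  note A = is_ideal_sub[OF assms(1)] is_ideal_0[OF assms(1)] is_ideal_add[OF assms(1)] is_ideal_mult[OF assms(1)]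
  have memI: "f \<in> ?A" if "f = a + b * ?l" "a \<in> A" "b \<in> on (allm V)" for f a b
    unfolding mem_Collect_eq by (intro exI conjI) (rule that)+
  have memD: "\<exists>a b. f = a + b * ?l \<and> a \<in> A \<and> b \<in> on (allm V)" if "f \<in> ?A" for f
    using that by (rule CollectD)
  show sub: "A \<subseteq> ?A"
  proof
    fix f assume "f \<in> A"
    then show "f \<in> ?A" by (intro memI[of f f 0]) simp_all
  qed
  show "?l \<in> ?A" by (rule memI[of _ 0 1]) (simp_all add: A(2))
  have "f + g \<in> ?A" if fg: "f \<in> ?A" "g \<in> ?A" for f g
  proof -
    obtain a b where ab: "f = a + b * ?l" "a \<in> A" "b \<in> on (allm V)"
      using memD[OF fg(1)] by (elim exE conjE) (rule that)
    obtain a' b' where ab': "g = a' + b' * ?l" "a' \<in> A" "b' \<in> on (allm V)"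
      using memD[OF fg(2)] by (elim exE conjE) (rule that)
    have "f + g = (a + a') + (b + b') * ?l" unfolding ab(1) ab'(1) distrib_right by (simp only: ac_simps)
    then show ?thesis by (rule memI) (rule A(3)[OF ab(2) ab'(2)], rule on_add[OF ab(3) ab'(3)])
  qed
  moreover have "g * f \<in> ?A" if f: "f \<in> ?A" and g: "g \<in> on (allm V)" for f g
  proof -
    obtain a b where ab: "f = a + b * ?l" "a \<in> A" "b \<in> on (allm V)"
      using memD[OF f] by (elim exE conjE) (rule that)
    have "g * f = g * a + (g * b) * ?l" unfolding ab(1) distrib_left by (simp only: ac_simps)
    then show ?thesis by (rule memI) (rule A(4)[OF ab(2) g], rule on_allm_mult[OF g ab(3)])
  qed
  moreover have "?A \<subseteq> on (allm V)"
  proof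
    fix f assume f: "f \<in> ?A"
    obtain a b where ab: "f = a + b * ?l" "a \<in> A" "b \<in> on (allm V)"
      using memD[OF f] by (elim exE conjE) (rule that)
    show "f \<in> on (allm V)" unfolding ab(1) by (rule on_add[OF A(1)[OF ab(2)] on_allm_mult[OF ab(3) l]])
  qed
  moreover have "0 \<in> ?A" by (rule subsetD[OF sub A(2)])
  ultimately show "is_ideal ?A" unfolding is_ideal_def by simp
qed

lemma proper_ideal_add_linear:
  assumes closed: "algebraically_closed_type TYPE('a)"
    and A: "is_ideal A" "1 \<notin> A" and w: "w \<in> V"
  shows "p \<noteq> 0 \<Longrightarrow> upol w p \<in> A \<Longrightarrow>
    \<exists>c. 1 \<notin> {a + b * (Var w - Cst c) | a b. a \<in> A \<and> b \<in> on (allm V)}"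
proof (induction "Polynomial.degree p" arbitrary: p rule: less_induct)
  case less
  note mult = is_ideal_mult[OF A(1)] and add = is_ideal_add[OF A(1)]
  show ?case
  proof (cases "Polynomial.degree p = 0")
    case True
    then obtain a where a: "p = [:a:]" by (rule degree_eq_zeroE)
    then have "a \<noteq> 0" using less.prems(1) by auto
    have "Cst a \<in> A" using less.prems(2) unfolding a upol_pCons upol_0 mult_zero_right add_0_right .
    then have "Cst (inverse a) * Cst a \<in> A" by (rule mult) simp
    then have "1 \<in> A" using \<open>a \<noteq> 0\<close> unfolding Cst_mult[symmetric] by simp
    then show ?thesis using A(2) by blast
  next
    case False
    then obtain c where "poly p c = 0" using closed unfolding algebraically_closed_type_def by blast
    then obtain q where q: "p = [:- c, 1:] * q" by (auto simp: poly_eq_0_iff_dvd elim: dvdE)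
    have q0: "q \<noteq> 0" using less.prems(1) q by auto
    have deg: "Polynomial.degree q < Polynomial.degree p"
      using q0 unfolding q by (subst degree_mult_eq) auto
    show ?thesis
    proof (rule ccontr)
      assume no: "\<nexists>c. 1 \<notin> {a + b * (Var w - Cst c) | a b. a \<in> A \<and> b \<in> on (allm V)}"
      then obtain a b where ab: "1 = a + b * (Var w - Cst c)" "a \<in> A" "b \<in> on (allm V)" by blast
      have "upol w q = upol w q * 1" by simp
      also have "\<dots> = upol w q * a + b * ((Var w - Cst c) * upol w q)"
        unfolding ab(1) distrib_left by (simp only: ac_simps)
      also have "(Var w - Cst c) * upol w q = upol w p" unfolding q upol_linear_mult ..
      finally have "upol w q \<in> A" using add mult[OF ab(2) upol_on[OF w]] mult[OF less.prems(2) ab(3)] by metis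
      then show False using less.hyps[OF deg q0] no by blast
    qed
  qed
qed

lemma proper_ideal_with_point:
  assumes closed: "algebraically_closed_type TYPE('a)"
    and A: "is_ideal A" "1 \<notin> A" "I V \<subseteq> A"
  shows "finite W \<Longrightarrow> W \<subseteq> V \<Longrightarrow> \<exists>x B. is_ideal B \<and> 1 \<notin> B \<and> A \<subseteq> B \<and> (\<forall>w\<in>W. Var w - Cst (x w) \<in> B)"
proof (induction W rule: finite_induct)
  case empty
  then show ?case using A by blast
next
  case (insert w W)
  then obtain x B where B: "is_ideal B" "1 \<notin> B" "A \<subseteq> B" "\<forall>w\<in>W. Var w - Cst (x w) \<in> B" by blast
  have w: "w \<in> V" using insert.prems by blast
  obtain p where p: "p \<noteq> 0" "upol w p \<in> I V" using algebraic_variable[OF w] .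
  have pB: "upol w p \<in> B" using p(2) A(3) B(3) by blast
  obtain c where c: "1 \<notin> {a + b * (Var w - Cst c) | a b. a \<in> B \<and> b \<in> on (allm V)}"
    using proper_ideal_add_linear[OF closed B(1,2) w p(1) pB] ..
  note B' = ideal_add_linear[OF B(1) w, of c]
  have "Var u - Cst ((x(w := c)) u) \<in> {a + b * (Var w - Cst c) | a b. a \<in> B \<and> b \<in> on (allm V)}"
    if "u \<in> insert w W" for u
  proof (cases "u = w")
    case True
    show ?thesis unfolding True fun_upd_same by (rule B'(3))
  next
    case False
    then have "Var u - Cst (x u) \<in> B" using that B(4) by blast
    then have "Var u - Cst (x u) \<in> {a + b * (Var w - Cst c) | a b. a \<in> B \<and> b \<in> on (allm V)}"
      by (rule subsetD[OF B'(2)])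
    then show ?thesis using False by (simp only: fun_upd_other not_False_eq_True)
  qed
  then show ?case using B' c B(3) by (intro exI[of _ "x(w := c)"] exI conjI ballI) blast+
qed

lemma nullstellensatz:
  assumes closed: "algebraically_closed_type TYPE('a)"
    and A: "is_ideal A" "1 \<notin> A" "I V \<subseteq> A"
  obtains x where "\<And>f. f \<in> A \<Longrightarrow> ev x f = 0"
proof -
  obtain x B where B: "is_ideal B" "1 \<notin> B" "A \<subseteq> B" "\<forall>w\<in>V. Var w - Cst (x w) \<in> B"
    using proper_ideal_with_point[OF closed A V order_refl] by blast
  note mult = is_ideal_mult[OF B(1)] and add = is_ideal_add[OF B(1)]
  have sum: "(\<Sum>w\<in>W. h w) \<in> B" if "\<And>w. w \<in> W \<Longrightarrow> h w \<in> B" for h and W :: "nat set"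
    using that
  proof (induction W rule: infinite_finite_induct)
    case (insert w W)
    then show ?case using add by simp
  qed (simp_all add: is_ideal_0[OF B(1)])
  have "ev x f = 0" if f: "f \<in> A" for f
  proof (rule ccontr)
    assume ne: "ev x f \<noteq> 0"
    have fV: "f \<in> on (allm V)" by (rule is_ideal_sub[OF A(1) f])
    obtain H where H: "\<forall>w\<in>V. H w \<in> on (allm V)" "\<forall>w\<in>V. ev x (H w) = ev x (pdiff w f)"
      "f = Cst (ev x f) + (\<Sum>w\<in>V. H w * (Var w - Cst (x w)))"
      using hadamard[OF V fV, of x] by (elim exE conjE) (rule that)
    have "(\<Sum>w\<in>V. H w * (Var w - Cst (x w))) \<in> B"
      by (intro sum mult) (rule bspec[OF B(4)], assumption, rule bspec[OF H(1)])
    then have "Cst (- 1) * (\<Sum>w\<in>V. H w * (Var w - Cst (x w))) \<in> B" by (rule mult) simp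
    then have "f + Cst (- 1) * (\<Sum>w\<in>V. H w * (Var w - Cst (x w))) \<in> B"
      using f B(3) by (intro add) auto
    also have "f + Cst (- 1) * (\<Sum>w\<in>V. H w * (Var w - Cst (x w))) = f - (\<Sum>w\<in>V. H w * (Var w - Cst (x w)))"
      by (simp add: Cst_uminus)
    also have "\<dots> = Cst (ev x f)" unfolding diff_eq_eq by (rule H(3))
    finally have "Cst (inverse (ev x f)) * Cst (ev x f) \<in> B" by (rule mult) simp
    then show False using ne B(2) unfolding Cst_mult[symmetric] by simp
  qed
  then show thesis using that by blast
qed

lemma ev_I: "(\<And>v. v \<in> V \<Longrightarrow> ev x (G v) = 0) \<Longrightarrow> f \<in> I V \<Longrightarrow> ev x f = 0"
  by (auto simp: I_def ev_sum ev_mult)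

lemma radical_if_jacobian:
  assumes closed: "algebraically_closed_type TYPE('a)" and e: "bij_betw e {0..<card V} V"
    and J: "\<And>x. (\<And>v. v \<in> V \<Longrightarrow> ev x (G v) = 0) \<Longrightarrow> ev x (jacobian e) \<noteq> 0"
    and f: "f \<in> on (allm V)" and fk: "f ^ k \<in> I V"
  shows "f \<in> I V"
proof -
  define A where "A = {g \<in> on (allm V). g * f \<in> I V}"
  have A: "is_ideal A" unfolding is_ideal_def
  proof (intro conjI ballI)
    show "A \<subseteq> on (allm V)" "0 \<in> A" by (auto simp: A_def)
    show "g + h \<in> A" if "g \<in> A" "h \<in> A" for g h
      using that by (auto simp: A_def distrib_right intro: on_add I_add)
    show "h * g \<in> A" if "g \<in> A" "h \<in> on (allm V)" for g h
      using that I_mult[of "g * f" V h] by (auto simp: A_def mult.assoc intro: on_allm_mult)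
  qed
  have IA: "I V \<subseteq> A"
  proof
    fix g assume "g \<in> I V"
    then show "g \<in> A" using I_mult[OF _ f, of g V] I_subset[of V g] by (simp add: A_def mult.commute)
  qed
  have "1 \<in> A"
  proof (rule ccontr)
    assume "1 \<notin> A"
    then obtain x where x: "\<And>g. g \<in> A \<Longrightarrow> ev x g = 0" using nullstellensatz[OF closed A _ IA] by blast
    have zero: "ev x (G v) = 0" if "v \<in> V" for v using x IA I_G[OF that order_refl] by blast
    obtain g where g: "g \<in> on (allm V)" "ev x g \<noteq> 0" "\<And>w. w \<in> V \<Longrightarrow> g * (Var w - Cst (x w)) \<in> I V"
      using locally_maximal[OF e zero J[OF zero]] by blast
    have "ev x f ^ k = 0" using ev_I[OF zero fk] by (simp only: ev_power)
    then have fx: "ev x f = 0" by simp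
    obtain H where H: "\<forall>w\<in>V. H w \<in> on (allm V)" "\<forall>w\<in>V. ev x (H w) = ev x (pdiff w f)"
      "f = Cst (ev x f) + (\<Sum>w\<in>V. H w * (Var w - Cst (x w)))"
      using hadamard[OF V f, of x] by (elim exE conjE) (rule that)
    have "f = (\<Sum>w\<in>V. H w * (Var w - Cst (x w)))" using H(3) unfolding fx Cst_0 add_0_left .
    then have "g * f = g * (\<Sum>w\<in>V. H w * (Var w - Cst (x w)))" by (rule arg_cong)
    also have "\<dots> = (\<Sum>w\<in>V. H w * (g * (Var w - Cst (x w))))"
      unfolding sum_distrib_left by (intro sum.cong refl) (rule mult.left_commute)
    also have "\<dots> \<in> I V" by (rule I_sum, rule I_mult) (rule g(3), assumption, rule bspec[OF H(1)])
    finally have "g \<in> A" using g(1) by (simp add: A_def)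
    then show False using x g(2) by blast
  qed
  then show ?thesis by (simp add: A_def)
qed

end

section \<open>Counting lemmas\<close>

text \<open>If every orbit of a family of permutations meets a set rarely, then the set is small.\<close>

lemma orbit_count:
  fixes sh :: "'t \<Rightarrow> 'x \<Rightarrow> 'x"
  assumes S: "finite S" and T: "finite T" and inj: "\<And>t. t \<in> T \<Longrightarrow> inj_on (sh t) S"
    and into: "\<And>t x. t \<in> T \<Longrightarrow> x \<in> S \<Longrightarrow> sh t x \<in> S"
    and B: "B \<subseteq> S" and D: "\<And>x. x \<in> S \<Longrightarrow> card {t \<in> T. sh t x \<in> B} \<le> D"
  shows "card B * card T \<le> D * card S"
proof -
  have fibre: "card {x \<in> S. sh t x \<in> B} = card B" if t: "t \<in> T" for t
  proof -
    have "sh t ` S = S" using endo_inj_surj[OF S _ inj[OF t]] into[OF t] by blast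
    then have "sh t ` {x \<in> S. sh t x \<in> B} = B" using B by auto
    moreover have "inj_on (sh t) {x \<in> S. sh t x \<in> B}" using inj[OF t] by (rule inj_on_subset) auto
    ultimately show ?thesis using card_image by metis
  qed
  have "card B * card T = (\<Sum>t\<in>T. card {x \<in> S. sh t x \<in> B})" using fibre by simp
  also have "\<dots> = (\<Sum>t\<in>T. \<Sum>x\<in>S. if sh t x \<in> B then 1 else 0)"
    using S by (simp add: sum.If_cases Int_def)
  also have "\<dots> = (\<Sum>x\<in>S. \<Sum>t\<in>T. if sh t x \<in> B then 1 else 0)" by (rule sum.swap)
  also have "\<dots> = (\<Sum>x\<in>S. card {t \<in> T. sh t x \<in> B})"
    using T by (simp add: sum.If_cases Int_def)
  also have "\<dots> \<le> (\<Sum>x\<in>S. D)" by (intro sum_mono D)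
  finally show ?thesis by (simp add: mult.commute)
qed

lemma card_singular_shifts:
  fixes A :: "'f::field mat"
  assumes A: "A \<in> carrier_mat n n" and T: "finite T"
    and sing: "\<And>t. t \<in> T \<Longrightarrow> det (A + t \<cdot>\<^sub>m 1\<^sub>m n) = 0"
  shows "card T \<le> n"
proof -
  let ?p = "char_poly A"
  have p: "Polynomial.degree ?p = n" "monic ?p" using degree_monic_char_poly[OF A] by auto
  then have p0: "?p \<noteq> 0" by auto
  have "uminus ` T \<subseteq> {z. poly ?p z = 0}"
  proof
    fix z assume "z \<in> uminus ` T"
    then obtain t where t: "t \<in> T" "z = - t" by auto
    have "char_matrix A z = A + t \<cdot>\<^sub>m 1\<^sub>m n" using A t(2) by (auto simp: char_matrix_def)
    then have "eigenvalue A z" using eigenvalue_det[OF A] sing[OF t(1)] by simp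
    then show "z \<in> {z. poly ?p z = 0}" using eigenvalue_root_char_poly[OF A] by simp
  qed
  then have "card (uminus ` T) \<le> card {z. poly ?p z = 0}"
    using poly_roots_finite[OF p0] by (intro card_mono)
  also have "\<dots> \<le> n" using card_poly_roots_bound[OF p0] p(1) by simp
  finally show ?thesis by (simp add: card_image inj_on_def)
qed

definition boxm :: "nat set \<Rightarrow> nat \<Rightarrow> nat multiset set" where
  "boxm V M = {m \<in> allm V. \<forall>v. count m v < M}"

lemma mev_cong: "(\<And>v. v \<in># m \<Longrightarrow> x v = y v) \<Longrightarrow> mev x m = mev y m"
  unfolding mev_def by (intro arg_cong[of _ _ prod_mset] image_mset_cong)

lemma mev_replicate: "mev x (replicate_mset k v) = x v ^ k"
  by (induction k) simp_all

lemma ev_cong: "f \<in> on (allm V) \<Longrightarrow> (\<And>v. v \<in> V \<Longrightarrow> x v = y v) \<Longrightarrow> ev x f = ev y f"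
  unfolding ev_def
proof (intro sum.cong refl)
  fix m assume f: "f \<in> on (allm V)" and xy: "\<And>v. v \<in> V \<Longrightarrow> x v = y v" and m: "m \<in> supp f"
  have "set_mset m \<subseteq> V" using f m by (auto simp: on_def allm_def)
  then have "mev x m = mev y m" using xy by (intro mev_cong) auto
  then show "coef f m * mev x m = coef f m * mev y m" by simp
qed

text \<open>The Schwartz--Zippel lemma.\<close>

lemma card_zeros_le:
  assumes V: "finite V" and K: "finite K"
  shows "P \<noteq> 0 \<Longrightarrow> P \<in> on (boxm V (Suc M)) \<Longrightarrow>
    card {y \<in> V \<rightarrow>\<^sub>E K. ev y P = 0} \<le> card V * M * card K ^ (card V - 1)"
  using V
proof (induction V arbitrary: P rule: finite_induct)
  case empty
  have "supp P \<subseteq> {{#}}" using empty.prems(2) by (auto simp: on_def boxm_def allm_def)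
  then have P: "ev y P = coef P {#}" for y
    using empty.prems(1) by (auto simp: ev_def subset_singleton_iff)
  have "supp P \<noteq> {}" using empty.prems(1) by simp
  then have "coef P {#} \<noteq> 0" using \<open>supp P \<subseteq> {{#}}\<close> by (auto simp: in_keys_iff subset_singleton_iff)
  then show ?case using P by simp
next
  case (insert v V)
  let ?r = "\<lambda>m. filter_mset (\<lambda>u. u \<noteq> v) m"
  define cf where "cf j = lin (\<lambda>m. if count m v = j then mon (?r m) else 0) P" for j
  have split: "m = replicate_mset (count m v) v + ?r m" for m
    using multiset_partition[of m "\<lambda>u. u = v"] by (simp add: filter_eq_replicate_mset)
  have supp_P: "m \<in> allm (insert v V) \<and> (\<forall>u. count m u < Suc M)" if "m \<in> supp P" for m
    using insert.prems(2) that by (auto simp: on_def boxm_def)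
  have cf_on: "cf j \<in> on (boxm V (Suc M))" for j
    unfolding cf_def
  proof (rule lin_on[OF insert.prems(2)])
    fix m assume m: "m \<in> boxm (insert v V) (Suc M)"
    then have "?r m \<in> boxm V (Suc M)" by (auto simp: boxm_def allm_def)
    then show "(if count m v = j then mon (?r m) else 0) \<in> on (boxm V (Suc M))" by simp
  qed
  have ev_P: "ev y P = (\<Sum>j\<le>M. ev y (cf j) * y v ^ j)" for y
  proof -
    have summand: "coef P m * mev y m = (\<Sum>j\<le>M. coef P m * ev y (if count m v = j then mon (?r m) else 0) * y v ^ j)"
      if m: "m \<in> supp P" for m
    proof -
      have "mev y m = y v ^ count m v * mev y (?r m)"
        using arg_cong[OF split[of m], of "mev y"] unfolding mev_add mev_replicate by simp
      moreover have "(\<Sum>j\<le>M. coef P m * ev y (if count m v = j then mon (?r m) else 0) * y v ^ j)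
          = (\<Sum>j\<le>M. if j = count m v then coef P m * mev y (?r m) * y v ^ count m v else 0)"
        by (intro sum.cong refl) simp
      moreover have "count m v \<le> M" using conjunct2[OF supp_P[OF m]] less_Suc_eq_le by blast
      ultimately show ?thesis by (simp add: sum.delta mult.assoc mult.commute)
    qed
    have "ev y P = (\<Sum>m\<in>supp P. \<Sum>j\<le>M. coef P m * ev y (if count m v = j then mon (?r m) else 0) * y v ^ j)"
      unfolding ev_def[of y P] by (intro sum.cong refl summand)
    also have "\<dots> = (\<Sum>j\<le>M. \<Sum>m\<in>supp P. coef P m * ev y (if count m v = j then mon (?r m) else 0) * y v ^ j)"
      by (rule sum.swap)
    also have "\<dots> = (\<Sum>j\<le>M. ev y (cf j) * y v ^ j)"
      unfolding cf_def ev_lin sum_distrib_right ..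
    finally show ?thesis .
  qed
  have "supp P \<noteq> {}" using insert.prems(1) by simp
  then obtain m0 where m0: "m0 \<in> supp P" by blast
  let ?j = "count m0 v"
  have jM: "?j \<le> M" using conjunct2[OF supp_P[OF m0]] less_Suc_eq_le by blast
  have "coef (cf ?j) (?r m0) = (\<Sum>m\<in>supp P. if m = m0 then coef P m else 0)"
    unfolding cf_def lin_def lookup_sum coef_Cst_mult
  proof (intro sum.cong refl)
    fix m
    have "count m v = ?j \<and> ?r m = ?r m0 \<longleftrightarrow> m = m0" using split[of m] split[of m0] by auto
    then show "coef P m * coef (if count m v = ?j then mon (?r m) else 0) (?r m0) = (if m = m0 then coef P m else 0)"
      by (auto simp: coef_mon)
  qed
  also have "\<dots> \<noteq> 0" using m0 by (simp add: sum.delta in_keys_iff)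
  finally have cf0: "cf ?j \<noteq> 0" by auto
  let ?Z = "{g \<in> V \<rightarrow>\<^sub>E K. ev g (cf ?j) = 0}"
  have IH: "card ?Z \<le> card V * M * card K ^ (card V - 1)" by (rule insert.IH[OF cf0 cf_on])
  have cf_upd: "ev (g(v := z)) (cf j) = ev g (cf j)" for g z j
  proof (rule ev_cong)
    show "cf j \<in> on (allm V)" using cf_on by (rule on_mono) (auto simp: boxm_def)
    show "(g(v := z)) u = g u" if "u \<in> V" for u using that insert.hyps by auto
  qed
  have bound: "card {z \<in> K. ev (g(v := z)) P = 0} \<le> (if g \<in> ?Z then card K else M)" if g: "g \<in> V \<rightarrow>\<^sub>E K" for g
  proof (cases "g \<in> ?Z")
    case True
    then show ?thesis using K by (simp add: card_mono)
  next
    case False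
    define p where "p = (\<Sum>j\<le>M. Polynomial.monom (ev g (cf j)) j)"
    have "Polynomial.coeff p ?j = ev g (cf ?j)" using jM by (simp add: p_def coeff_sum sum.delta)
    then have p0: "p \<noteq> 0" using False g by auto
    have "Polynomial.degree p \<le> M" unfolding p_def
      by (rule degree_sum_le) (auto intro: order_trans[OF degree_monom_le])
    then have "card {z. poly p z = 0} \<le> M" using card_poly_roots_bound[OF p0] by simp
    moreover have "card {z \<in> K. ev (g(v := z)) P = 0} \<le> card {z. poly p z = 0}"
    proof (rule card_mono[OF poly_roots_finite[OF p0]], rule subsetI)
      fix z assume "z \<in> {z \<in> K. ev (g(v := z)) P = 0}"
      then have "(\<Sum>j\<le>M. ev g (cf j) * z ^ j) = 0" unfolding ev_P cf_upd by simp
      then show "z \<in> {z. poly p z = 0}" by (simp add: p_def poly_sum poly_monom)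
    qed
    ultimately have "card {z \<in> K. ev (g(v := z)) P = 0} \<le> M" by linarith
    then show ?thesis by (simp only: if_not_P[OF False])
  qed
  have fin: "finite (V \<rightarrow>\<^sub>E K)" using insert.hyps K by (intro finite_PiE) auto
  have "{y \<in> insert v V \<rightarrow>\<^sub>E K. ev y P = 0}
      \<subseteq> (\<lambda>(g, z). g(v := z)) ` (SIGMA g:V \<rightarrow>\<^sub>E K. {z \<in> K. ev (g(v := z)) P = 0})"
  proof
    fix y assume y: "y \<in> {y \<in> insert v V \<rightarrow>\<^sub>E K. ev y P = 0}"
    then obtain z g where zg: "y = g(v := z)" "z \<in> K" "g \<in> V \<rightarrow>\<^sub>E K"
      unfolding PiE_insert_eq by auto
    then have "(g, z) \<in> (SIGMA g:V \<rightarrow>\<^sub>E K. {z \<in> K. ev (g(v := z)) P = 0})" using y by simp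
    then show "y \<in> (\<lambda>(g, z). g(v := z)) ` (SIGMA g:V \<rightarrow>\<^sub>E K. {z \<in> K. ev (g(v := z)) P = 0})"
      unfolding zg(1) by (rule rev_image_eqI) simp
  qed
  then have "card {y \<in> insert v V \<rightarrow>\<^sub>E K. ev y P = 0}
      \<le> card (SIGMA g:V \<rightarrow>\<^sub>E K. {z \<in> K. ev (g(v := z)) P = 0})"
    using fin K by (intro surj_card_le) auto
  also have "\<dots> = (\<Sum>g\<in>V \<rightarrow>\<^sub>E K. card {z \<in> K. ev (g(v := z)) P = 0})"
    using fin K by (intro card_SigmaI) auto
  also have "\<dots> \<le> (\<Sum>g\<in>V \<rightarrow>\<^sub>E K. (if g \<in> ?Z then card K else 0) + M)"
    by (intro sum_mono order_trans[OF bound]) auto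
  also have "\<dots> = card ?Z * card K + M * card (V \<rightarrow>\<^sub>E K)"
  proof -
    have "(\<Sum>g\<in>V \<rightarrow>\<^sub>E K. if g \<in> ?Z then card K else 0) = (\<Sum>g\<in>?Z. card K)"
      using fin by (intro sum.mono_neutral_cong_right) auto
    then show ?thesis by (simp add: sum.distrib mult.commute)
  qed
  also have "\<dots> \<le> (card V * M * card K ^ (card V - 1)) * card K + M * card K ^ card V"
    using IH insert.hyps by (simp add: card_PiE)
  also have "\<dots> = card (insert v V) * M * card K ^ (card (insert v V) - 1)"
  proof (cases "card V")
    case (Suc k)
    then show ?thesis using insert.hyps by (simp add: algebra_simps)
  qed (use insert.hyps in simp)
  finally show ?case .
qed

lemma card_boxm:
  assumes V: "finite V" and M: "M > 0"
  shows "M ^ card V \<le> card (boxm V M)" and "boxm V M \<subseteq> mons V (card V * (M - 1))"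
proof -
  show sub: "boxm V M \<subseteq> mons V (card V * (M - 1))"
  proof
    fix m assume m: "m \<in> boxm V M"
    then have V': "set_mset m \<subseteq> V" by (simp add: boxm_def allm_def)
    have "size m = (\<Sum>v\<in>V. count m v)" by (rule size_eq_sum_count[OF V V'])
    also have "\<dots> \<le> (\<Sum>v\<in>V. M - 1)"
    proof (rule sum_mono)
      fix v have "count m v < M" using m by (simp add: boxm_def)
      then show "count m v \<le> M - 1" by simp
    qed
    finally show "m \<in> mons V (card V * (M - 1))" using V' by (simp add: mons_def)
  qed
  let ?f = "\<lambda>g. \<Sum>v\<in>V. replicate_mset (g v) v"
  have count_f: "count (?f g) u = (if u \<in> V then g u else 0)" for g u
    using V by (simp add: count_sum sum.delta)
  show "M ^ card V \<le> card (boxm V M)"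
  proof -
    have "inj_on ?f (V \<rightarrow>\<^sub>E {..<M})"
    proof (rule inj_onI)
      fix g h assume gh: "g \<in> V \<rightarrow>\<^sub>E {..<M}" "h \<in> V \<rightarrow>\<^sub>E {..<M}" "?f g = ?f h"
      show "g = h"
      proof (rule PiE_ext[OF gh(1,2)])
        fix u assume "u \<in> V"
        then show "g u = h u" using arg_cong[OF gh(3), of "\<lambda>m. count m u"] count_f by simp
      qed
    qed
    moreover have "?f ` (V \<rightarrow>\<^sub>E {..<M}) \<subseteq> boxm V M"
    proof
      fix m assume "m \<in> ?f ` (V \<rightarrow>\<^sub>E {..<M})"
      then obtain g where g: "g \<in> V \<rightarrow>\<^sub>E {..<M}" "m = ?f g" by blast
      have c: "count m u = (if u \<in> V then g u else 0)" for u using count_f g(2) by simp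
      have "set_mset m \<subseteq> V"
      proof
        fix u assume "u \<in># m"
        then have "count m u \<noteq> 0" by simp
        then show "u \<in> V" unfolding c[of u] by (simp split: if_splits)
      qed
      moreover have "count m u < M" for u using c[of u] g(1) M by (auto dest: PiE_mem)
      ultimately show "m \<in> boxm V M" by (simp add: boxm_def allm_def)
    qed
    ultimately have "card (V \<rightarrow>\<^sub>E {..<M}) \<le> card (boxm V M)"
      using finite_subset[OF sub finite_mons[OF V]] by (intro card_inj_on_le)
    then show ?thesis using V by (simp add: card_PiE)
  qed
qed

lemma card_mons_step:
  assumes V: "finite V" "v \<in> V"
  shows "card (mons V (k + \<delta>)) \<le> card (mons V k) + \<delta> * (k + \<delta> + 1) ^ (card V - 1)"
proof -
  let ?D = "mons V (k + \<delta>) - mons V k"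
  let ?f = "\<lambda>m. (restrict (count m) (V - {v}), size m - Suc k)"
  let ?T = "((V - {v}) \<rightarrow>\<^sub>E {..k + \<delta>}) \<times> {..<\<delta>}"
  have size_v: "size m = count m v + (\<Sum>u\<in>V - {v}. count m u)" if "m \<in> mons V (k + \<delta>)" for m
    using size_eq_sum_count[OF V(1), of m] that V sum.remove[OF V, of "count m"] by (simp add: mons_def)
  have "inj_on ?f ?D"
  proof (rule inj_onI)
    fix m n assume mn: "m \<in> ?D" "n \<in> ?D" "?f m = ?f n"
    have res: "restrict (count m) (V - {v}) = restrict (count n) (V - {v})" using mn(3) by simp
    have c: "count m u = count n u" if "u \<in> V - {v}" for u
      using that fun_cong[OF res, of u] by simp
    have "size m = size n" using mn by (auto simp: mons_def)
    then have "count m v = count n v" using size_v[of m] size_v[of n] mn c by simp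
    then have "restrict (count m) V = restrict (count n) V" using c by (auto simp: fun_eq_iff)
    moreover have "m \<in> allm V" "n \<in> allm V" using mn mons_subset_allm by blast+
    ultimately show "m = n" by (rule inj_onD[OF inj_on_count])
  qed
  moreover have "?f ` ?D \<subseteq> ?T"
  proof
    fix y assume "y \<in> ?f ` ?D"
    then obtain m where m: "m \<in> ?D" "y = ?f m" by blast
    then have s: "k < size m" "size m \<le> k + \<delta>" by (auto simp: mons_def)
    have "count m u \<le> k + \<delta>" for u using count_le_size[of m u] s by linarith
    then show "y \<in> ?T" using s unfolding m(2) by auto
  qed
  moreover have "finite ?T" using V by (intro finite_cartesian_product finite_PiE) auto
  ultimately have "card ?D \<le> card ?T" by (rule card_inj_on_le)
  also have "\<dots> = \<delta> * (k + \<delta> + 1) ^ (card V - 1)"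
    using V by (simp add: card_cartesian_product card_PiE mult.commute)
  finally have D: "card ?D \<le> \<delta> * (k + \<delta> + 1) ^ (card V - 1)" .
  have "mons V (k + \<delta>) = mons V k \<union> ?D" using mons_mono[of k "k + \<delta>" V] by auto
  then have "card (mons V (k + \<delta>)) \<le> card (mons V k) + card ?D" using card_Un_le by metis
  then show ?thesis using D by simp
qed

text \<open>The polynomials in the \<open>G v\<close> of bounded degree are too many to be independent modulo \<open>J\<close>:
  the quotient by \<open>J\<close> grows more slowly than the number of monomials.\<close>

lemma exists_multiple_in_subalgebra:
  fixes G :: "nat \<Rightarrow> 'f::field pol"
  assumes V: "finite V" "v \<in> V" and d: "d \<ge> 1" and G: "\<And>v. v \<in> V \<Longrightarrow> G v \<in> on (mons V d)"
    and J: "J \<noteq> 0" "J \<in> on (mons V (card V * d))"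
  obtains P Q where "P \<noteq> 0" "P \<in> on (boxm V (Suc ((d * card V) ^ card V)))"
    "lin (\<lambda>m. prod_mset (image_mset G m)) P = J * Q"
proof -
  define s where "s = card V"
  have s: "s \<ge> 1" using V card_gt_0_iff[of V] by (auto simp: s_def)
  define M where "M = Suc ((d * s) ^ s)"
  define k where "k = d * (s * (M - 1)) - s * d"
  let ?n = "k + s * d"
  let ?g = "\<lambda>m. prod_mset (image_mset G m)"
  have M1: "M - 1 \<ge> 1" using s d by (simp add: M_def)
  have M0: "M > 0" by (simp add: M_def)
  have n: "?n = d * (s * (M - 1))"
  proof -
    have "s * d * 1 \<le> s * d * (M - 1)" using M1 by (rule mult_le_mono2)
    then show ?thesis by (simp add: k_def ac_simps)
  qed
  have g_on: "?g m \<in> on (mons V (d * size m))" if "set_mset m \<subseteq> V" for m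
  proof -
    interpret pol_system V d G using V(1) d G by unfold_locales
    show ?thesis using Gprod_on[OF that] unfolding Gprod_def .
  qed
  let ?A = "Inl ` boxm V M \<union> Inr ` mons V k :: (nat multiset + nat multiset) set"
  let ?v = "\<lambda>i. case i of Inl m \<Rightarrow> ?g m | Inr m \<Rightarrow> J * mon m"
  have fbox: "finite (boxm V M)" using finite_subset[OF card_boxm(2)[OF V(1) M0] finite_mons[OF V(1)]] .
  have fmons: "finite (mons V k)" by (rule finite_mons[OF V(1)])
  have v_span: "?v i \<in> pol.span (mon ` mons V ?n)" if i: "i \<in> ?A" for i
  proof (cases i)
    case (Inl m)
    then have m: "m \<in> boxm V M" using i by auto
    have mV: "m \<in> mons V (s * (M - 1))" using m card_boxm(2)[OF V(1) M0] by (auto simp: s_def)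
    then have "?g m \<in> on (mons V (d * size m))" by (intro g_on) (simp add: mons_def)
    then have "?g m \<in> on (mons V ?n)"
      by (rule on_mono) (rule mons_mono, use mV in \<open>simp add: n mons_def\<close>)
    then show ?thesis using Inl by (simp add: on_in_span)
  next
    case (Inr m)
    then have m: "m \<in> mons V k" using i by auto
    then have "(mon m :: 'f pol) \<in> on (mons V k)" by simp
    then have "J * mon m \<in> on (mons V (s * d + k))"
      using J(2) by (intro on_mons_mult) (simp_all add: s_def)
    then show ?thesis using Inr by (simp add: on_in_span add.commute)
  qed
  have big: "s * d * (?n + 1) ^ (s - 1) < M ^ s"
  proof -
    have "?n + 1 \<le> d * s * M"
    proof -
      have "d * s * M = d * s * (M - 1) + d * s" using M1 by (cases M) (simp_all add: algebra_simps)
      moreover have "d * s \<ge> 1" using d s by simp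
      ultimately show ?thesis unfolding n by (simp add: mult.assoc)
    qed
    then have "s * d * (?n + 1) ^ (s - 1) \<le> s * d * (d * s * M) ^ (s - 1)"
      by (intro mult_le_mono2 power_mono) simp_all
    also have "\<dots> = (d * s) * (d * s) ^ (s - 1) * M ^ (s - 1)"
      unfolding power_mult_distrib[of "d * s" M] mult.commute[of s d] by (rule mult.assoc[symmetric])
    also have "\<dots> = (d * s) ^ s * M ^ (s - 1)" using s power_minus_mult[of s "d * s"] by (simp add: mult.commute)
    also have "\<dots> < M * M ^ (s - 1)" by (intro mult_strict_right_mono) (simp_all add: M_def)
    also have "\<dots> = M ^ s" using s by (cases s) simp_all
    finally show ?thesis .
  qed
  have "card (mons V ?n) \<le> card (mons V k) + s * d * (?n + 1) ^ (s - 1)"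
    using card_mons_step[OF V, of k "s * d"] by (simp add: s_def)
  also have "\<dots> < card (mons V k) + M ^ s" using big by simp
  also have "\<dots> \<le> card (mons V k) + card (boxm V M)" using card_boxm(1)[OF V(1) M0] by (simp add: s_def)
  also have "\<dots> = card ?A"
    using fbox fmons by (subst card_Un_disjoint) (auto simp: card_image)
  finally have "card (mons V ?n) < card ?A" .
  then have card: "card (mon ` mons V ?n :: 'f pol set) < card ?A"
    using card_image_le[OF finite_mons[OF V(1)], of "mon :: _ \<Rightarrow> 'f pol" ?n] by linarith
  have finA: "finite ?A" using fbox fmons by simp
  have finB: "finite (mon ` mons V ?n :: 'f pol set)" using finite_mons[OF V(1)] by simp
  obtain c i where c: "(\<Sum>i\<in>?A. Cst (c i) * ?v i) = 0" "i \<in> ?A" "c i \<noteq> 0"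
    by (rule pol.exists_linear_relation[OF finA finB card v_span]) (assumption, rule that)
  define P where "P = (\<Sum>m\<in>boxm V M. Cst (c (Inl m)) * mon m)"
  define R where "R = (\<Sum>m\<in>mons V k. Cst (c (Inr m)) * mon m)"
  have lP: "lin ?g P = (\<Sum>m\<in>boxm V M. Cst (c (Inl m)) * ?g m)"
    by (simp add: P_def lin_sum lin_Cst_mult)
  have JR: "J * R = (\<Sum>m\<in>mons V k. Cst (c (Inr m)) * (J * mon m))"
    unfolding R_def sum_distrib_left by (intro sum.cong refl) (rule mult.left_commute)
  have "(\<Sum>i\<in>?A. Cst (c i) * ?v i) = (\<Sum>i\<in>Inl ` boxm V M. Cst (c i) * ?v i) + (\<Sum>i\<in>Inr ` mons V k. Cst (c i) * ?v i)"
    using fbox fmons by (intro sum.union_disjoint) auto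
  also have "\<dots> = lin ?g P + J * R" unfolding lP JR
    by (intro arg_cong2[where f = "(+)"]) (simp_all add: sum.reindex)
  finally have rel: "lin ?g P + J * R = 0" using c(1) by simp
  have coefP: "coef P m = c (Inl m)" if "m \<in> boxm V M" for m
  proof -
    have "coef P m = (\<Sum>k\<in>boxm V M. if k = m then c (Inl k) else 0)"
      unfolding P_def lookup_sum by (intro sum.cong refl) (simp add: coef_mon)
    then show ?thesis using that fbox by (simp add: sum.delta)
  qed
  have coefR: "coef R m = c (Inr m)" if "m \<in> mons V k" for m
  proof -
    have "coef R m = (\<Sum>n\<in>mons V k. if n = m then c (Inr n) else 0)"
      unfolding R_def lookup_sum by (intro sum.cong refl) (simp add: coef_mon)
    then show ?thesis using that fmons by (simp add: sum.delta)
  qed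
  have "P \<noteq> 0"
  proof
    assume P0: "P = 0"
    then have "J * R = 0" using rel by simp
    then have "R = 0" using J(1) by simp
    then have "c (Inr m) = 0" if "m \<in> mons V k" for m using coefR[OF that] by simp
    moreover have "c (Inl m) = 0" if "m \<in> boxm V M" for m using coefP[OF that] P0 by simp
    ultimately show False using c(2,3) by auto
  qed
  moreover have "P \<in> on (boxm V (Suc ((d * card V) ^ card V)))"
    unfolding P_def M_def s_def by (intro on_sum on_Cst_mult) simp
  moreover have "lin ?g P = J * (- R)" using rel by (simp add: eq_neg_iff_add_eq_0)
  ultimately show thesis by (rule that)
qed

section \<open>Polynomials over a finite subfield\<close>

locale finite_subfield_set =
  fixes K :: "'f::field set"
  assumes finite_K: "finite K" and zero_K: "0 \<in> K" and one_K: "1 \<in> K"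
    and add_K: "\<And>a b. a \<in> K \<Longrightarrow> b \<in> K \<Longrightarrow> a + b \<in> K"
    and uminus_K: "\<And>a. a \<in> K \<Longrightarrow> - a \<in> K"
    and mult_K: "\<And>a b. a \<in> K \<Longrightarrow> b \<in> K \<Longrightarrow> a * b \<in> K"
    and inverse_K: "\<And>a. a \<in> K \<Longrightarrow> inverse a \<in> K"
begin

lemma diff_K: "a \<in> K \<Longrightarrow> b \<in> K \<Longrightarrow> a - b \<in> K"
  using add_K[OF _ uminus_K, of a b] by simp
lemma sum_K: "(\<And>i. i \<in> A \<Longrightarrow> h i \<in> K) \<Longrightarrow> (\<Sum>i\<in>A. h i) \<in> K"
  by (induction A rule: infinite_finite_induct) (auto intro: add_K zero_K)
lemma power_K: "a \<in> K \<Longrightarrow> a ^ k \<in> K"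
  by (induction k) (auto intro: mult_K one_K)
lemma mev_K: "(\<And>i. i \<in># m \<Longrightarrow> x i \<in> K) \<Longrightarrow> mev x m \<in> K"
  by (induction m) (auto intro: mult_K one_K)

definition pols :: "nat multiset set \<Rightarrow> 'f pol set" where
  "pols B = {f \<in> on B. \<forall>m. coef f m \<in> K}"

lemma pols_on: "f \<in> pols B \<Longrightarrow> f \<in> on B" and pols_coef: "f \<in> pols B \<Longrightarrow> coef f m \<in> K"
  by (simp_all add: pols_def)
lemma pols_0: "0 \<in> pols B" by (simp add: pols_def zero_K)
lemma pols_add: "f \<in> pols B \<Longrightarrow> g \<in> pols B \<Longrightarrow> f + g \<in> pols B"
  by (simp add: pols_def on_add lookup_add add_K)
lemma pols_diff: "f \<in> pols B \<Longrightarrow> g \<in> pols B \<Longrightarrow> f - g \<in> pols B"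
  by (simp add: pols_def on_diff lookup_minus diff_K)
lemma pols_Cst_mult: "f \<in> pols B \<Longrightarrow> c \<in> K \<Longrightarrow> Cst c * f \<in> pols B"
  by (simp add: pols_def on_Cst_mult mult_K)
lemma pols_mon: "m \<in> B \<Longrightarrow> mon m \<in> pols B"
  by (simp add: pols_def coef_mon zero_K one_K)
lemma pols_Cst: "{#} \<in> B \<Longrightarrow> c \<in> K \<Longrightarrow> Cst c \<in> pols B"
  using pols_Cst_mult[OF pols_mon, of "{#}" B c] by simp
lemma pols_sum: "(\<And>i. i \<in> A \<Longrightarrow> h i \<in> pols B) \<Longrightarrow> (\<Sum>i\<in>A. h i) \<in> pols B"
  by (induction A rule: infinite_finite_induct) (auto intro: pols_add pols_0)
lemma pols_mono: "f \<in> pols A \<Longrightarrow> A \<subseteq> B \<Longrightarrow> f \<in> pols B"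
  unfolding pols_def using on_mono by blast

lemma pols_lin: "f \<in> pols A \<Longrightarrow> (\<And>m. m \<in> A \<Longrightarrow> b m \<in> pols B) \<Longrightarrow> lin b f \<in> pols B"
  unfolding lin_def
proof (rule pols_sum)
  fix m assume f: "f \<in> pols A" and b: "\<And>m. m \<in> A \<Longrightarrow> b m \<in> pols B" and m: "m \<in> supp f"
  have "m \<in> A" using pols_on[OF f] m by (auto simp: on_def)
  then show "Cst (coef f m) * b m \<in> pols B" by (rule pols_Cst_mult[OF b pols_coef[OF f]])
qed

lemma pols_mult:
  assumes f: "f \<in> pols A" and g: "g \<in> pols B" and C: "\<And>a b. a \<in> A \<Longrightarrow> b \<in> B \<Longrightarrow> a + b \<in> C"
  shows "f * g \<in> pols C"
  unfolding mult_eq_lin[of f g]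
proof (rule pols_lin[OF f])
  fix a assume a: "a \<in> A"
  have e: "mon a * g = lin (\<lambda>b. mon (b + a)) g"
    using mult_eq_lin[of g "mon a"] by (simp only: mon_add mult.commute)
  show "mon a * g \<in> pols C" unfolding e
    by (rule pols_lin[OF g], rule pols_mon) (use C[OF a] in \<open>simp add: add.commute\<close>)
qed

lemma pols_mons_mult: "f \<in> pols (mons V m) \<Longrightarrow> g \<in> pols (mons V n) \<Longrightarrow> f * g \<in> pols (mons V (m + n))"
  by (rule pols_mult) (auto intro: mons_add)

lemma ev_K: "f \<in> pols (mons V n) \<Longrightarrow> (\<And>i. i \<in> V \<Longrightarrow> x i \<in> K) \<Longrightarrow> ev x f \<in> K"
  unfolding ev_def
proof (intro sum_K mult_K)
  fix m assume f: "f \<in> pols (mons V n)" and x: "\<And>i. i \<in> V \<Longrightarrow> x i \<in> K" and m: "m \<in> supp f"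
  show "coef f m \<in> K" by (rule pols_coef[OF f])
  have "m \<in> mons V n" using pols_on[OF f] m by (auto simp: on_def)
  then show "mev x m \<in> K" by (intro mev_K x) (auto simp: mons_def)
qed

lemma finite_pols: assumes "finite B" shows "finite (pols B)"
proof (rule finite_imageD)
  show "finite ((\<lambda>f. restrict (coef f) B) ` pols B)"
  proof (rule finite_subset)
    show "(\<lambda>f. restrict (coef f) B) ` pols B \<subseteq> B \<rightarrow>\<^sub>E K" using pols_coef by auto
    show "finite (B \<rightarrow>\<^sub>E K)" using assms finite_K by (intro finite_PiE) auto
  qed
  show "inj_on (\<lambda>f. restrict (coef f) B) (pols B)"
  proof (rule inj_onI)
    fix f g assume fg: "f \<in> pols B" "g \<in> pols B" "restrict (coef f) B = restrict (coef g) B"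
    show "f = g"
    proof (rule poly_mapping_eqI)
      fix m show "coef f m = coef g m"
      proof (cases "m \<in> B")
        case True
        then show ?thesis using fun_cong[OF fg(3), of m] by simp
      next
        case False
        then have "coef f m = 0" "coef g m = 0" using pols_on[OF fg(1)] pols_on[OF fg(2)] unfolding on_iff by blast+
        then show ?thesis by simp
      qed
    qed
  qed
qed

definition Sys :: "nat set \<Rightarrow> nat \<Rightarrow> (nat \<Rightarrow> 'f pol) set" where
  "Sys V d = V \<rightarrow>\<^sub>E pols (mons V d)"

lemma finite_Sys: "finite V \<Longrightarrow> finite (Sys V d)"
  unfolding Sys_def by (intro finite_PiE finite_pols finite_mons)

end

section \<open>Systems without a reduced regular sequence are rare\<close>

lemma box_basis_cong:
  assumes G: "box_basis V d G" and eq: "\<And>v. v \<in> V \<Longrightarrow> G v = G' v"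
  shows "box_basis V d G'"
proof -
  interpret G: box_basis V d G by (rule G)
  interpret G': pol_system V d G' using G.V G.d G.G eq by unfold_locales simp_all
  have E: "G.E m = G'.E m" if m: "m \<in> mons V n" for m n
  proof -
    have "set_mset (quot_mset d m) \<subseteq> V" using m set_quot[of d m] by (auto simp: mons_def)
    then have "image_mset G (quot_mset d m) = image_mset G' (quot_mset d m)"
      using eq by (intro image_mset_cong) auto
    then show ?thesis by (simp only: G.E_def G'.E_def G.Gprod_def G'.Gprod_def)
  qed
  have "G.\<Theta> f = G'.\<Theta> f" if f: "f \<in> on (mons V n)" for f n
    unfolding G.\<Theta>_def G'.\<Theta>_def using f E by (rule lin_cong)
  then have "G.range\<Theta> n = G'.range\<Theta> n" for n
    unfolding G.range\<Theta>_def G'.range\<Theta>_def by (intro image_cong refl)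
  then have "mon m \<in> G'.range\<Theta> n" if "m \<in> mons V n" for m n using G.surj[OF that] by simp
  then show ?thesis by unfold_locales
qed

definition jac :: "nat set \<Rightarrow> (nat \<Rightarrow> nat) \<Rightarrow> (nat \<Rightarrow> 'f::field pol) \<Rightarrow> 'f pol" where
  "jac V e G = det (mat (card V) (card V) (\<lambda>(i, j). pdiff (e j) (G (e i))))"

definition good_system :: "nat set \<Rightarrow> nat \<Rightarrow> (nat \<Rightarrow> nat) \<Rightarrow> (nat \<Rightarrow> 'f::field pol) \<Rightarrow> bool" where
  "good_system V d e G \<longleftrightarrow> box_basis V d G \<and>
     (\<forall>x. (\<forall>v\<in>V. ev x (G v) = 0) \<longrightarrow> ev x (jac V e G) \<noteq> 0)"

lemma pdiff_add: "pdiff w (f + g) = pdiff w f + pdiff w g"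
  and pdiff_diff: "pdiff w (f - g) = pdiff w f - pdiff w g"
  and pdiff_Cst_mult: "pdiff w (Cst c * f) = Cst c * pdiff w f"
  by (simp_all add: pdiff_def lin_add lin_diff lin_Cst_mult)

lemma pdiff_Cst [simp]: "pdiff w (Cst c) = 0"
proof -
  have "pdiff w (mon {#} :: 'a pol) = 0" unfolding pdiff_def lin_mon by simp
  then show ?thesis using pdiff_Cst_mult[of w c "mon {#}"] by simp
qed

context finite_subfield_set
begin

context
  fixes V :: "nat set" and d :: nat and e :: "nat \<Rightarrow> nat"
  assumes V: "finite V" and d: "d \<ge> 1" and e: "bij_betw e {0..<card V} V"
begin

lemma eV: "i < card V \<Longrightarrow> e i \<in> V"
  using e by (auto simp: bij_betw_def)

definition shift :: "(nat \<Rightarrow> 'f pol) \<Rightarrow> (nat \<Rightarrow> 'f pol) \<Rightarrow> (nat \<Rightarrow> 'f pol)" where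
  "shift \<delta> F = (\<lambda>v\<in>V. F v + \<delta> v)"

lemma shift_inj: "inj_on (shift \<delta>) (Sys V d)"
proof (rule inj_onI)
  fix F G assume FG: "F \<in> Sys V d" "G \<in> Sys V d" "shift \<delta> F = shift \<delta> G"
  show "F = G"
  proof (rule PiE_ext[OF FG(1,2)[unfolded Sys_def]])
    fix v assume "v \<in> V"
    then show "F v = G v" using fun_cong[OF FG(3), of v] by (simp add: shift_def)
  qed
qed

lemma shift_Sys: "(\<And>v. v \<in> V \<Longrightarrow> \<delta> v \<in> pols (mons V d)) \<Longrightarrow> F \<in> Sys V d \<Longrightarrow> shift \<delta> F \<in> Sys V d"
  unfolding Sys_def shift_def by (auto intro!: pols_add)

lemma card_no_box_basis:
  "card {F \<in> Sys V d. \<not> box_basis V d F} * card K \<le> (card V * (d - 1) + 2) ^ card V * card (Sys V d)"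
proof (rule orbit_count[where sh = "\<lambda>t. shift (\<lambda>v. Cst t * mon (replicate_mset d v))"])
  show "finite (Sys V d)" by (rule finite_Sys[OF V])
  show "finite K" by (rule finite_K)
  show "inj_on (shift (\<lambda>v. Cst t * mon (replicate_mset d v))) (Sys V d)" for t by (rule shift_inj)
  show "shift (\<lambda>v. Cst t * mon (replicate_mset d v)) F \<in> Sys V d" if "t \<in> K" "F \<in> Sys V d" for t F
    using that by (intro shift_Sys pols_Cst_mult pols_mon) (auto simp: mons_def)
  show "{F \<in> Sys V d. \<not> box_basis V d F} \<subseteq> Sys V d" by blast
  fix F assume F: "F \<in> Sys V d"
  let ?T = "{t \<in> K. shift (\<lambda>v. Cst t * mon (replicate_mset d v)) F \<in> {F \<in> Sys V d. \<not> box_basis V d F}}"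
  show "card ?T \<le> (card V * (d - 1) + 2) ^ card V"
  proof (rule finite_card_box_basis_exceptions[OF V d, where A = F])
    show "F v \<in> on (mons V d)" if "v \<in> V" for v
      using F that unfolding Sys_def by (intro pols_on) (rule PiE_mem)
    show "finite ?T" using finite_K by simp
    show "\<not> box_basis V d (\<lambda>v. F v + Cst t * mon (replicate_mset d v))" if t: "t \<in> ?T" for t
    proof
      assume "box_basis V d (\<lambda>v. F v + Cst t * mon (replicate_mset d v))"
      then have "box_basis V d (shift (\<lambda>v. Cst t * mon (replicate_mset d v)) F)"
        by (rule box_basis_cong) (simp add: shift_def)
      then show False using t by blast
    qed
  qed
qed

lemma card_jac_zero_at_origin:
  "card {F \<in> Sys V d. ev (\<lambda>_. 0) (jac V e F) = 0} * card K \<le> card V * card (Sys V d)"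
proof (rule orbit_count[where sh = "\<lambda>t. shift (\<lambda>v. Cst t * Var v)"])
  show "finite (Sys V d)" by (rule finite_Sys[OF V])
  show "finite K" by (rule finite_K)
  show "inj_on (shift (\<lambda>v. Cst t * Var v)) (Sys V d)" for t by (rule shift_inj)
  show "shift (\<lambda>v. Cst t * Var v) F \<in> Sys V d" if "t \<in> K" "F \<in> Sys V d" for t F
    using that d by (intro shift_Sys pols_Cst_mult pols_mon) (auto simp: mons_def)
  show "{F \<in> Sys V d. ev (\<lambda>_. 0) (jac V e F) = 0} \<subseteq> Sys V d" by blast
  fix F assume F: "F \<in> Sys V d"
  let ?n = "card V"
  let ?T = "{t \<in> K. shift (\<lambda>v. Cst t * Var v) F \<in> {F \<in> Sys V d. ev (\<lambda>_. 0) (jac V e F) = 0}}"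
  define A where "A = mat ?n ?n (\<lambda>(i, j). ev (\<lambda>_. 0) (pdiff (e j) (F (e i))))"
  have d_var: "ev (\<lambda>_. 0) (pdiff w (Var u)) = (if w = u then 1 else (0::'f))" for w u
    unfolding pdiff_def lin_mon by (simp add: ev_mult)
  have "ev (\<lambda>_. 0) (jac V e (shift (\<lambda>v. Cst t * Var v) F)) = det (A + t \<cdot>\<^sub>m 1\<^sub>m ?n)" for t
  proof -
    let ?B = "mat ?n ?n (\<lambda>(i, j). pdiff (e j) (shift (\<lambda>v. Cst t * Var v) F (e i)))"
    have "ev (\<lambda>_. 0) (jac V e (shift (\<lambda>v. Cst t * Var v) F)) = det (map_mat (ev (\<lambda>_. 0)) ?B)"
      unfolding jac_def by (rule ev_hom.hom_det[symmetric])
    also have "map_mat (ev (\<lambda>_. 0)) ?B = A + t \<cdot>\<^sub>m 1\<^sub>m ?n"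
    proof (rule eq_matI)
      fix i j assume "i < dim_row (A + t \<cdot>\<^sub>m 1\<^sub>m ?n)" "j < dim_col (A + t \<cdot>\<^sub>m 1\<^sub>m ?n)"
      then have ij: "i < ?n" "j < ?n" by auto
      have "e j = e i \<longleftrightarrow> i = j"
        using e ij unfolding bij_betw_def inj_on_def by auto
      then show "map_mat (ev (\<lambda>_. 0)) ?B $$ (i, j) = (A + t \<cdot>\<^sub>m 1\<^sub>m ?n) $$ (i, j)"
        using ij eV[OF ij(1)]
        by (simp add: A_def shift_def pdiff_add pdiff_Cst_mult ev_add ev_mult d_var)
    qed (simp_all add: A_def)
    finally show ?thesis .
  qed
  then show "card ?T \<le> card V"
    using finite_K by (intro card_singular_shifts[of A]) (auto simp: A_def)
qed

lemma mult_cancel_common: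
  fixes a b c p q r :: nat
  assumes "a * p \<le> (b * r) * c" "p = q * r" "r > 0"
  shows "a * q \<le> b * c"
proof -
  have "(a * q) * r \<le> (b * c) * r" using assms(1) unfolding assms(2) by (simp only: ac_simps)
  then show ?thesis using assms(3) by simp
qed

text \<open>The Jacobian determinant does not see the constant terms.  A shift by constants is bad only
  if it satisfies an algebraic relation.\<close>

lemma card_singular_zero:
  assumes V0: "V \<noteq> {}"
  shows "card {F \<in> Sys V d. jac V e F \<noteq> 0 \<and> (\<exists>x. (\<forall>v\<in>V. ev x (F v) = 0) \<and> ev x (jac V e F) = 0)} * card K
    \<le> card V * (d * card V) ^ card V * card (Sys V d)" (is "card ?B * _ \<le> _")
proof -
  let ?n = "card V" and ?q = "card K"
  have n: "?n \<ge> 1" using V V0 by (simp add: Suc_leI card_gt_0_iff)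
  have q: "?q \<ge> 1" using finite_K zero_K card_gt_0_iff[of K] by auto
  let ?sh = "\<lambda>y. shift (\<lambda>v. Cst (- y v))"
  have "card ?B * card (V \<rightarrow>\<^sub>E K) \<le> (?n * (d * ?n) ^ ?n * ?q ^ (?n - 1)) * card (Sys V d)"
  proof (rule orbit_count[where sh = ?sh])
    show "finite (Sys V d)" by (rule finite_Sys[OF V])
    show "finite (V \<rightarrow>\<^sub>E K)" using V finite_K by (intro finite_PiE) auto
    show "inj_on (?sh y) (Sys V d)" for y by (rule shift_inj)
    show "?sh y F \<in> Sys V d" if "y \<in> V \<rightarrow>\<^sub>E K" "F \<in> Sys V d" for y F
    proof (intro shift_Sys that(2) pols_Cst uminus_K)
      show "{#} \<in> mons V d" by (simp add: mons_def)
      show "y v \<in> K" if "v \<in> V" for v using \<open>y \<in> V \<rightarrow>\<^sub>E K\<close> that by (rule PiE_mem)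
    qed
    show "?B \<subseteq> Sys V d" by blast
    fix F assume F: "F \<in> Sys V d"
    have F_on: "F v \<in> on (mons V d)" if "v \<in> V" for v
      using F that unfolding Sys_def by (intro pols_on) (rule PiE_mem)
    have jac_sh: "jac V e (?sh y F) = jac V e F" for y
    proof -
      have "mat ?n ?n (\<lambda>(i, j). pdiff (e j) (?sh y F (e i))) = mat ?n ?n (\<lambda>(i, j). pdiff (e j) (F (e i)))"
        using eV by (intro eq_matI) (auto simp: shift_def pdiff_add)
      then show ?thesis by (simp only: jac_def)
    qed
    show "card {y \<in> V \<rightarrow>\<^sub>E K. ?sh y F \<in> ?B} \<le> ?n * (d * ?n) ^ ?n * ?q ^ (?n - 1)"
    proof (cases "jac V e F = 0")
      case True
      then have "{y \<in> V \<rightarrow>\<^sub>E K. ?sh y F \<in> ?B} = {}" using jac_sh by auto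
      then show ?thesis by (simp only: card.empty zero_le)
    next
      case False
      obtain v where v: "v \<in> V" using V0 by blast
      have J_on: "jac V e F \<in> on (mons V (?n * d))" unfolding jac_def
        by (rule det_degree[OF mat_carrier]) (use eV F_on in \<open>simp add: pdiff_on\<close>)
      obtain P Q where PQ: "P \<noteq> 0" "P \<in> on (boxm V (Suc ((d * ?n) ^ ?n)))"
        "lin (\<lambda>m. prod_mset (image_mset F m)) P = jac V e F * Q"
        by (rule exists_multiple_in_subalgebra[OF V v d F_on False J_on]) (assumption, rule that)
      have zero: "ev y P = 0" if y: "y \<in> V \<rightarrow>\<^sub>E K" "?sh y F \<in> ?B" for y
      proof -
        have "\<exists>x. (\<forall>v\<in>V. ev x (?sh y F v) = 0) \<and> ev x (jac V e (?sh y F)) = 0"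
          using CollectD[OF y(2)] by (elim conjE)
        then obtain x where x: "\<forall>v\<in>V. ev x (?sh y F v) = 0" "ev x (jac V e F) = 0"
          unfolding jac_sh by (elim exE conjE) (rule that)
        have xy: "ev x (F v) = y v" if "v \<in> V" for v
          using bspec[OF x(1) that] that by (simp add: shift_def ev_add)
        have "ev x (lin (\<lambda>m. prod_mset (image_mset F m)) P) = (\<Sum>m\<in>supp P. coef P m * mev y m)"
          unfolding ev_lin
        proof (intro sum.cong refl)
          fix m assume "m \<in> supp P"
          then have m: "set_mset m \<subseteq> V" using PQ(2) by (auto simp: on_def boxm_def allm_def)
          have "ev x (prod_mset (image_mset F m)) = mev (\<lambda>v. ev x (F v)) m"
            by (induction m) (simp_all add: mev_def ev_mult)
          also have "\<dots> = mev y m" using m xy by (intro mev_cong) auto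
          finally show "coef P m * ev x (prod_mset (image_mset F m)) = coef P m * mev y m" by simp
        qed
        then have "ev y P = ev x (jac V e F * Q)" unfolding PQ(3) by (simp only: ev_def)
        then show ?thesis by (simp add: ev_mult x(2))
      qed
      have "card {y \<in> V \<rightarrow>\<^sub>E K. ?sh y F \<in> ?B} \<le> card {y \<in> V \<rightarrow>\<^sub>E K. ev y P = 0}"
        using zero V finite_K by (intro card_mono finite_subset[OF _ finite_PiE[OF V, of "\<lambda>_. K"]]) auto
      also have "\<dots> \<le> ?n * (d * ?n) ^ ?n * ?q ^ (?n - 1)"
        by (rule card_zeros_le[OF V finite_K PQ(1,2)])
      finally show ?thesis .
    qed
  qed
  moreover have "card (V \<rightarrow>\<^sub>E K) = ?q * ?q ^ (?n - 1)"
    using V n power_minus_mult[of ?n ?q] by (simp add: card_PiE mult.commute)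
  moreover have "?q ^ (?n - 1) > 0" using q by simp
  ultimately show ?thesis by (rule mult_cancel_common)
qed

lemma card_not_good_system:
  assumes s: "1 \<le> card V" "card V < d"
  shows "card {F \<in> Sys V d. \<not> good_system V d e F} * card K \<le> 2 * (d + 1) ^ (2 * card V + 1) * card (Sys V d)"
proof -
  let ?s = "card V"
  let ?B1 = "{F \<in> Sys V d. \<not> box_basis V d F}"
  let ?B2 = "{F \<in> Sys V d. ev (\<lambda>_. 0) (jac V e F) = 0}"
  let ?B3 = "{F \<in> Sys V d. jac V e F \<noteq> 0 \<and> (\<exists>x. (\<forall>v\<in>V. ev x (F v) = 0) \<and> ev x (jac V e F) = 0)}"
  have fin: "finite (Sys V d)" by (rule finite_Sys[OF V])
  have "{F \<in> Sys V d. \<not> good_system V d e F} \<subseteq> ?B1 \<union> ?B2 \<union> ?B3"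
    unfolding good_system_def by auto
  then have "card {F \<in> Sys V d. \<not> good_system V d e F} \<le> card (?B1 \<union> ?B2 \<union> ?B3)"
    using fin by (intro card_mono) auto
  also have "\<dots> \<le> card ?B1 + card ?B2 + card ?B3"
    using card_Un_le[of "?B1 \<union> ?B2" ?B3] card_Un_le[of ?B1 ?B2] by linarith
  finally have "card {F \<in> Sys V d. \<not> good_system V d e F} * card K
      \<le> (card ?B1 + card ?B2 + card ?B3) * card K" by (rule mult_le_mono1)
  also have "\<dots> \<le> ((?s * (d - 1) + 2) ^ ?s + ?s + ?s * (d * ?s) ^ ?s) * card (Sys V d)"
    unfolding distrib_right
    by (intro add_mono card_no_box_basis card_jac_zero_at_origin card_singular_zero) (use s(1) in auto)
  also have "\<dots> \<le> 2 * (d + 1) ^ (2 * ?s + 1) * card (Sys V d)"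
  proof (rule mult_le_mono1)
    have "?s * (d - 1) + 2 \<le> (d - 1) * (d - 1) + 2" using s by (intro add_right_mono mult_le_mono1) simp
    also have "\<dots> \<le> d * d"
    proof -
      have "2 \<le> d" using s by simp
      then obtain k where "d = k + 2" using le_Suc_ex[of 2 d] by (auto simp: add.commute)
      then show ?thesis by simp
    qed
    finally have a: "(?s * (d - 1) + 2) ^ ?s \<le> (d * d) ^ ?s" by (rule power_mono) simp
    have b: "(d * ?s) ^ ?s \<le> (d * d) ^ ?s" using s by (intro power_mono) auto
    have dd: "(d * d) ^ ?s \<le> (d + 1) ^ (2 * ?s)"
      unfolding power_mult by (intro power_mono) (simp_all add: power2_eq_square)
    have "(?s * (d - 1) + 2) ^ ?s + ?s + ?s * (d * ?s) ^ ?s \<le> (d * d) ^ ?s + d + d * (d * d) ^ ?s"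
      using a b s by (intro add_mono mult_mono) auto
    also have "\<dots> = (d + 1) * (d * d) ^ ?s + d" by simp
    also have "\<dots> \<le> (d + 1) * (d + 1) ^ (2 * ?s) + (d + 1) * (d + 1) ^ (2 * ?s)"
    proof (intro add_mono mult_le_mono2 dd)
      have "(d + 1) * 1 \<le> (d + 1) * (d + 1) ^ (2 * ?s)" by (rule mult_le_mono2) simp
      then show "d \<le> (d + 1) * (d + 1) ^ (2 * ?s)" by simp
    qed
    also have "\<dots> = 2 * (d + 1) ^ (2 * ?s + 1)" by simp
    finally show "(?s * (d - 1) + 2) ^ ?s + ?s + ?s * (d * ?s) ^ ?s \<le> 2 * (d + 1) ^ (2 * ?s + 1)" .
  qed
  finally show ?thesis .
qed

end

end

lemma (in box_basis) radical_subset: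
  assumes closed: "algebraically_closed_type TYPE('a)" and e: "bij_betw e {0..<card V} V"
    and J: "\<And>x. (\<And>v. v \<in> V \<Longrightarrow> ev x (G v) = 0) \<Longrightarrow> ev x (jac V e G) \<noteq> 0"
  shows "finite W \<Longrightarrow> W \<subseteq> V \<Longrightarrow> f \<in> on (allm V) \<Longrightarrow> f ^ k \<in> I (V - W) \<Longrightarrow> f \<in> I (V - W)"
proof (induction W arbitrary: f k rule: finite_induct)
  case empty
  have "ev x (jacobian e) \<noteq> 0" if "\<And>v. v \<in> V \<Longrightarrow> ev x (G v) = 0" for x
    unfolding jacobian_def jac_def[symmetric] by (rule J) (rule that)
  from radical_if_jacobian[OF closed e this] show ?case using empty by simp
next
  case (insert w W)
  have ins: "insert w (V - insert w W) = V - W" using insert.hyps insert.prems by blast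
  obtain n where n: "f \<in> on (mons V n)" using on_allm_degree[OF insert.prems(2)] .
  show ?case
  proof (rule radical_descent[OF _ _ _ n insert.prems(3)])
    show "V - insert w W \<subseteq> V" "w \<in> V - (V - insert w W)" using insert.prems by auto
    show "f \<in> I (insert w (V - insert w W))" if "f \<in> on (allm V)" "f ^ k \<in> I (insert w (V - insert w W))" for f k
      using insert.IH[of f k] that insert.prems(1) unfolding ins by simp
  qed
qed

section \<open>Interpolation on vertical strips\<close>

text \<open>The number of elements of a fibre of a surjection that is constant exactly on the cosets of
  a subgroup.\<close>

lemma card_fibre:
  fixes S N :: "'g::ab_group_add set"
  assumes S: "finite S" "\<And>f g. f \<in> S \<Longrightarrow> g \<in> S \<Longrightarrow> f + g \<in> S" "\<And>f g. f \<in> S \<Longrightarrow> g \<in> S \<Longrightarrow> f - g \<in> S"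
    and N: "N \<subseteq> S" and eq: "\<And>f g. f \<in> S \<Longrightarrow> g \<in> S \<Longrightarrow> \<phi> f = \<phi> g \<longleftrightarrow> f - g \<in> N"
    and surj: "\<phi> ` S = Y"
  shows "\<And>y. y \<in> Y \<Longrightarrow> card {f \<in> S. \<phi> f = y} = card N" and "card S = card Y * card N"
proof -
  show fib: "card {f \<in> S. \<phi> f = y} = card N" if "y \<in> Y" for y
  proof -
    have "y \<in> \<phi> ` S" using that surj by simp
    then obtain f0 where f0: "f0 \<in> S" "\<phi> f0 = y" by auto
    have "bij_betw (\<lambda>f. f - f0) {f \<in> S. \<phi> f = y} N"
    proof (rule bij_betwI[where g = "\<lambda>f. f + f0"])
      show "(\<lambda>f. f - f0) \<in> {f \<in> S. \<phi> f = y} \<rightarrow> N" using eq f0 by auto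
      show "(\<lambda>f. f + f0) \<in> N \<rightarrow> {f \<in> S. \<phi> f = y}"
      proof
        fix n assume n: "n \<in> N"
        then have "n + f0 \<in> S" using N S(2) f0 by blast
        moreover from this have "\<phi> (n + f0) = \<phi> f0" using eq[of "n + f0" f0] f0 n by simp
        ultimately show "n + f0 \<in> {f \<in> S. \<phi> f = y}" using f0 by simp
      qed
    qed simp_all
    then show ?thesis by (rule bij_betw_same_card)
  qed
  have "card S = (\<Sum>y\<in>Y. card {f \<in> S. \<phi> f = y})"
    using sum.image_gen[OF S(1), of "\<lambda>_. 1::nat" \<phi>] surj by simp
  then show "card S = card Y * card N" using fib by simp
qed

context finite_subfield_set
begin

definition separated :: "nat set \<Rightarrow> (nat \<Rightarrow> 'f) list \<Rightarrow> bool" where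
  "separated A as \<longleftrightarrow> distinct as \<and>
    (\<forall>a\<in>set as. \<exists>l\<in>pols (mons A 1). ev a l = 1 \<and> (\<forall>b\<in>set as - {a}. ev b l = 0))"

lemma exists_point_separator:
  assumes "v \<in> W" "x v \<noteq> y v" "x v \<in> K" "y v \<in> K"
  shows "\<exists>l\<in>pols (mons W 1). ev x l = 1 \<and> ev y l = 0"
proof (intro bexI conjI)
  let ?l = "Cst (inverse (x v - y v)) * (Var v - Cst (y v))"
  show "ev x ?l = 1" "ev y ?l = 0" using assms(2) by (simp_all add: ev_mult ev_diff)
  show "?l \<in> pols (mons W 1)"
    using assms by (intro pols_Cst_mult pols_diff pols_mon pols_Cst inverse_K diff_K) (auto simp: mons_def)
qed

lemma pols_prod:
  assumes "finite T" "\<And>y. y \<in> T \<Longrightarrow> l y \<in> pols (mons W 1)"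
  shows "(\<Prod>y\<in>T. l y) \<in> pols (mons W (card T))"
  using assms
proof (induction T rule: finite_induct)
  case empty
  have "Cst 1 \<in> pols (mons W 0)" by (rule pols_Cst) (simp_all add: mons_def one_K)
  then show ?case by simp
next
  case (insert y T)
  have "l y * (\<Prod>y\<in>T. l y) \<in> pols (mons W (1 + card T))"
    using insert by (intro pols_mons_mult) auto
  then show ?case using insert.hyps by simp
qed

lemma pols_mons_mono: "f \<in> pols (mons W m) \<Longrightarrow> m \<le> n \<Longrightarrow> f \<in> pols (mons W n)"
  by (erule pols_mono) (erule mons_mono)

lemma pols_vars_mono: "f \<in> pols (mons A n) \<Longrightarrow> A \<subseteq> W \<Longrightarrow> f \<in> pols (mons W n)"
  by (rule pols_mono) (auto simp: mons_def)

text \<open>A point in a strip is separated from the other strips by an affine form and from at most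
  \<open>d - 1\<close> points of its own strip by linear forms, in total degree \<open>d\<close>.  In one of the strips a
  further point is affordable, because the other strips can be corrected afterwards.\<close>

lemma exists_interpolant:
  assumes as: "separated A as" and T: "finite T" "T \<subseteq> W \<rightarrow>\<^sub>E K" "A \<subseteq> W" and d: "d \<ge> 1"
    and strips: "\<And>x. x \<in> T \<Longrightarrow> restrict x A \<in> set as"
    and few: "\<And>a. a \<in> set as \<Longrightarrow> card {x \<in> T. restrict x A = a} \<le> (if a = a0 then d + 1 else d)"
    and x: "x \<in> T"
  shows "\<exists>f\<in>pols (mons W d). ev x f = 1 \<and> (\<forall>y\<in>T - {x}. ev y f = 0)"
proof -
  let ?S = "\<lambda>x. {y \<in> T. restrict y A = restrict x A} - {x}"
  have xK: "x v \<in> K" if "x \<in> T" "v \<in> W" for x v using T(2) that by auto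
  have "\<exists>l\<in>pols (mons W 1). ev x l = 1 \<and> ev y l = 0" if xy: "x \<in> T" "y \<in> T" "x \<noteq> y" for x y
  proof -
    have "x \<in> W \<rightarrow>\<^sub>E K" "y \<in> W \<rightarrow>\<^sub>E K" using xy T(2) by auto
    then obtain v where v: "v \<in> W" "x v \<noteq> y v" using PiE_ext[of x W "\<lambda>_. K" y] xy(3) by blast
    then show ?thesis
      using exists_point_separator[where v = v and W = W and x = x and y = y] xK[OF xy(1)] xK[OF xy(2)] by simp
  qed
  then have ex_l: "\<exists>l. l \<in> pols (mons W 1) \<and> ev x l = 1 \<and> ev y l = 0" if "x \<in> T" "y \<in> T" "x \<noteq> y" for x y
    using that unfolding Bex_def by blast
  define l where "l x y = (SOME l. l \<in> pols (mons W 1) \<and> ev x l = 1 \<and> ev y l = 0)" for x y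
  have l: "l x y \<in> pols (mons W 1) \<and> ev x (l x y) = 1 \<and> ev y (l x y) = 0" if "x \<in> T" "y \<in> T" "x \<noteq> y" for x y
    unfolding l_def by (rule someI_ex[OF ex_l[OF that]])
  define g where "g x = (\<Prod>y\<in>?S x. l x y)" for x
  have g: "g x \<in> pols (mons W (card (?S x)))" "ev x (g x) = 1" "\<And>y. y \<in> ?S x \<Longrightarrow> ev y (g x) = 0" if "x \<in> T" for x
  proof -
    show "g x \<in> pols (mons W (card (?S x)))" unfolding g_def
      using l[OF that] T(1) by (intro pols_prod) auto
    show "ev x (g x) = 1" unfolding g_def ev_prod using l[OF that] by (intro prod.neutral) auto
    show "ev y (g x) = 0" if y: "y \<in> ?S x" for y
    proof -
      have "ev y (l x y) = 0" using l[OF \<open>x \<in> T\<close>, of y] y by auto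
      then show ?thesis unfolding g_def ev_prod using y T(1) by (intro prod_zero) auto
    qed
  qed
  have ex_L: "\<exists>l. l \<in> pols (mons A 1) \<and> ev a l = 1 \<and> (\<forall>b\<in>set as - {a}. ev b l = 0)" if "a \<in> set as" for a
    using as that unfolding separated_def Bex_def by blast
  define L where "L a = (SOME l. l \<in> pols (mons A 1) \<and> ev a l = 1 \<and> (\<forall>b\<in>set as - {a}. ev b l = 0))" for a
  have L: "L a \<in> pols (mons A 1) \<and> ev a (L a) = 1 \<and> (\<forall>b\<in>set as - {a}. ev b (L a) = 0)" if "a \<in> set as" for a
    unfolding L_def by (rule someI_ex[OF ex_L[OF that]])
  have ev_L: "ev x (L a) = (if restrict x A = a then 1 else 0)" if "a \<in> set as" "x \<in> T" for a x
  proof -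
    have "L a \<in> on (allm A)" using L[OF that(1)] pols_on on_mons_allm by blast
    then have "ev x (L a) = ev (restrict x A) (L a)" by (rule ev_cong) simp
    then show ?thesis using L[OF that(1)] strips[OF that(2)] by auto
  qed
  have card_S: "card (?S x) + 1 = card {y \<in> T. restrict y A = restrict x A}" if "x \<in> T" for x
    using that T(1) by (subst card_Suc_Diff1[symmetric, of _ x]) auto
  define f where "f x = L (restrict x A) * g x" for x
  have f: "f x \<in> pols (mons W d)" "ev x (f x) = 1" "\<forall>y\<in>T - {x}. ev y (f x) = 0"
    if x: "x \<in> T" "restrict x A \<noteq> a0" for x
  proof -
    have le: "1 + card (?S x) \<le> d" using card_S[OF x(1)] few[OF strips[OF x(1)]] x(2) by simp
    have "L (restrict x A) \<in> pols (mons W 1)" by (rule pols_vars_mono[OF conjunct1[OF L[OF strips[OF x(1)]]] T(3)])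
    from pols_mons_mult[OF this g(1)[OF x(1)]] have "f x \<in> pols (mons W (1 + card (?S x)))" unfolding f_def .
    then show "f x \<in> pols (mons W d)" using le by (rule pols_mons_mono)
    show "ev x (f x) = 1" unfolding f_def ev_mult using ev_L[OF strips[OF x(1)] x(1)] g(2)[OF x(1)] by simp
    show "\<forall>y\<in>T - {x}. ev y (f x) = 0"
    proof
      fix y assume y: "y \<in> T - {x}"
      show "ev y (f x) = 0"
      proof (cases "restrict y A = restrict x A")
        case True
        then show ?thesis using g(3)[OF x(1), of y] y by (simp add: f_def ev_mult)
      next
        case False
        then show ?thesis using ev_L[OF strips[OF x(1)], of y] y by (simp add: f_def ev_mult)
      qed
    qed
  qed
  show ?thesis
  proof (cases "restrict x A = a0")
    case False
    then show ?thesis using f[OF x] by blast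
  next
    case True
    define Z where "Z = {z \<in> T. restrict z A \<noteq> a0}"
    have finZ: "finite Z" using T(1) by (simp add: Z_def)
    have Z: "z \<in> T" "restrict z A \<noteq> a0" if "z \<in> Z" for z using that by (simp_all add: Z_def)
    define h where "h = g x - (\<Sum>z\<in>Z. Cst (ev z (g x)) * f z)"
    have "card (?S x) \<le> d" using card_S[OF x] few[OF strips[OF x]] True by simp
    then have gd: "g x \<in> pols (mons W d)" by (rule pols_mons_mono[OF g(1)[OF x]])
    have h_mem: "h \<in> pols (mons W d)" unfolding h_def
    proof (intro pols_diff gd pols_sum pols_Cst_mult)
      fix z assume z: "z \<in> Z"
      show "f z \<in> pols (mons W d)" by (rule f(1)[OF Z[OF z]])
      show "ev z (g x) \<in> K" by (rule ev_K[OF gd]) (rule xK[OF Z(1)[OF z]])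
    qed
    have ev_h: "ev y h = ev y (g x) - (\<Sum>z\<in>Z. ev z (g x) * ev y (f z))" for y
      unfolding h_def ev_diff ev_sum ev_mult ev_Cst ..
    have ev_other: "ev y h = ev y (g x)" if "y \<in> T" "y \<notin> Z" for y
    proof -
      have "(\<Sum>z\<in>Z. ev z (g x) * ev y (f z)) = 0"
      proof (rule sum.neutral, rule ballI)
        fix z assume z: "z \<in> Z"
        then have "y \<in> T - {z}" using that by auto
        then have "ev y (f z) = 0" using f(3)[OF Z[OF z]] by blast
        then show "ev z (g x) * ev y (f z) = 0" by simp
      qed
      then show ?thesis unfolding ev_h by simp
    qed
    have ev_Z: "ev y h = 0" if y: "y \<in> Z" for y
    proof -
      have "(\<Sum>z\<in>Z. ev z (g x) * ev y (f z)) = (\<Sum>z\<in>Z. if z = y then ev y (g x) else 0)"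
      proof (intro sum.cong refl)
        fix z assume z: "z \<in> Z"
        show "ev z (g x) * ev y (f z) = (if z = y then ev y (g x) else 0)"
        proof (cases "z = y")
          case True
          then show ?thesis using f(2)[OF Z[OF y]] by simp
        next
          case False
          then have "y \<in> T - {z}" using Z(1)[OF y] by auto
          then have "ev y (f z) = 0" using f(3)[OF Z[OF z]] by blast
          then show ?thesis using False by simp
        qed
      qed
      then show ?thesis unfolding ev_h using finZ y by (simp add: sum.delta)
    qed
    have "x \<notin> Z" using True by (simp add: Z_def)
    then have "ev x h = 1" using ev_other[OF x] g(2)[OF x] by simp
    moreover have "\<forall>y\<in>T - {x}. ev y h = 0"
    proof
      fix y assume y: "y \<in> T - {x}"
      show "ev y h = 0"
      proof (cases "y \<in> Z")
        case True
        then show ?thesis by (rule ev_Z)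
      next
        case False
        then have "ev y (g x) = 0" using y \<open>restrict x A = a0\<close> g(3)[OF x, of y] by (simp add: Z_def)
        then show ?thesis using ev_other[of y] y False by simp
      qed
    qed
    ultimately show ?thesis using h_mem by (intro bexI[of _ h] conjI)
  qed
qed

lemma card_vanishing:
  assumes W: "finite W" and T: "finite T" "T \<subseteq> W \<rightarrow>\<^sub>E K"
    and interp: "\<And>x. x \<in> T \<Longrightarrow> \<exists>f\<in>pols (mons W d). ev x f = 1 \<and> (\<forall>y\<in>T - {x}. ev y f = 0)"
  shows "card (pols (mons W d)) = card K ^ card T * card {f \<in> pols (mons W d). \<forall>x\<in>T. ev x f = 0}"
proof -
  let ?S = "pols (mons W d)" and ?N = "{f \<in> pols (mons W d). \<forall>x\<in>T. ev x f = 0}"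
  let ?\<phi> = "\<lambda>f. \<lambda>x\<in>T. ev x f"
  have xK: "x v \<in> K" if "x \<in> T" "v \<in> W" for x v using T(2) that by auto
  define h where "h x = (SOME f. f \<in> ?S \<and> ev x f = 1 \<and> (\<forall>y\<in>T - {x}. ev y f = 0))" for x
  have h: "h x \<in> ?S \<and> ev x (h x) = 1 \<and> (\<forall>y\<in>T - {x}. ev y (h x) = 0)" if "x \<in> T" for x
    unfolding h_def by (rule someI_ex[OF interp[OF that, unfolded Bex_def]])
  have "card ?S = card (T \<rightarrow>\<^sub>E K) * card ?N"
  proof (rule card_fibre(2)[where \<phi> = ?\<phi>])
    show "finite ?S" by (rule finite_pols[OF finite_mons[OF W]])
    show "f + g \<in> ?S" if "f \<in> ?S" "g \<in> ?S" for f g by (rule pols_add[OF that])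
    show "f - g \<in> ?S" if "f \<in> ?S" "g \<in> ?S" for f g by (rule pols_diff[OF that])
    show "?N \<subseteq> ?S" by blast
    show "?\<phi> f = ?\<phi> g \<longleftrightarrow> f - g \<in> ?N" if fg: "f \<in> ?S" "g \<in> ?S" for f g
    proof -
      have "?\<phi> f = ?\<phi> g \<longleftrightarrow> (\<forall>x\<in>T. ev x f = ev x g)" by (auto simp: restrict_def fun_eq_iff)
      also have "\<dots> \<longleftrightarrow> f - g \<in> ?N" using pols_diff[OF fg] by (simp add: ev_diff)
      finally show ?thesis .
    qed
    show "?\<phi> ` ?S = T \<rightarrow>\<^sub>E K"
    proof
      show "?\<phi> ` ?S \<subseteq> T \<rightarrow>\<^sub>E K" using ev_K xK by (auto simp: PiE_def Pi_def)
      show "T \<rightarrow>\<^sub>E K \<subseteq> ?\<phi> ` ?S"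
      proof
        fix y assume y: "y \<in> T \<rightarrow>\<^sub>E K"
        let ?f = "\<Sum>z\<in>T. Cst (y z) * h z"
        have m1: "?f \<in> ?S" using h y by (intro pols_sum pols_Cst_mult) (auto dest: PiE_mem)
        have m2: "?\<phi> ?f = y"
        proof
          fix x
          show "?\<phi> ?f x = y x"
          proof (cases "x \<in> T")
            case True
            have "ev x ?f = (\<Sum>z\<in>T. if z = x then y x else 0)"
              unfolding ev_sum ev_mult ev_Cst
            proof (intro sum.cong refl)
              fix z assume z: "z \<in> T"
              show "y z * ev x (h z) = (if z = x then y x else 0)"
                using h[OF z] True by (cases "z = x") auto
            qed
            then show ?thesis using True T(1) by (simp add: sum.delta)
          next
            case False
            then show ?thesis using y by (simp add: PiE_def extensional_def)
          qed
        qed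
        show "y \<in> ?\<phi> ` ?S" by (rule rev_image_eqI[where f = ?\<phi>, OF m1 m2[symmetric]])
      qed
    qed
  qed
  then show ?thesis using T(1) by (simp add: card_PiE)
qed

section \<open>Strips in general position\<close>

definition strip_lists :: "nat \<Rightarrow> (nat \<Rightarrow> 'f) list set" where
  "strip_lists n = {as. length as = n + 1 \<and> set as \<subseteq> {1..n} \<rightarrow>\<^sub>E K}"

definition diff_mat :: "nat \<Rightarrow> (nat \<Rightarrow> 'f) list \<Rightarrow> 'f mat" where
  "diff_mat n as = mat n n (\<lambda>(i, j). (as ! Suc i) (Suc j) - (as ! 0) (Suc j))"

lemma separated_if_det:
  assumes as: "as \<in> strip_lists n" and det: "det (diff_mat n as) \<noteq> 0"
  shows "separated {1..n} as"
proof -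
  have len: "length as = n + 1" using as by (simp add: strip_lists_def)
  have asK: "(as ! i) j \<in> K" if "i \<le> n" "j \<in> {1..n}" for i j
  proof -
    have "as ! i \<in> set as" using len that(1) by simp
    then have "as ! i \<in> {1..n} \<rightarrow>\<^sub>E K" using as unfolding strip_lists_def by blast
    then show ?thesis using that(2) by (rule PiE_mem)
  qed
  let ?M = "diff_mat n as"
  have M: "?M \<in> carrier_mat n n" by (simp add: diff_mat_def)
  define \<phi> where "\<phi> c = (\<lambda>i\<in>{..<n}. \<Sum>j<n. ?M $$ (i, j) * c j)" for c :: "nat \<Rightarrow> 'f"
  have MK: "?M $$ (i, j) \<in> K" if "i < n" "j < n" for i j
    using that asK by (simp add: diff_mat_def diff_K)
  have "inj_on \<phi> ({..<n} \<rightarrow>\<^sub>E K)"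
  proof (rule inj_onI, rule ccontr)
    fix c c' assume c: "c \<in> {..<n} \<rightarrow>\<^sub>E K" "c' \<in> {..<n} \<rightarrow>\<^sub>E K" "\<phi> c = \<phi> c'" "c \<noteq> c'"
    then obtain j where j: "j < n" "c j \<noteq> c' j" using PiE_ext[OF c(1,2)] by blast
    let ?w = "vec n (\<lambda>j. c j - c' j)"
    have "?M *\<^sub>v ?w = 0\<^sub>v n"
    proof (rule eq_vecI)
      fix i assume "i < dim_vec (0\<^sub>v n :: 'f vec)"
      then have i: "i < n" by simp
      have "(?M *\<^sub>v ?w) $ i = (\<Sum>j<n. ?M $$ (i, j) * (c j - c' j))"
        using i M by (auto simp: scalar_prod_def atLeast0LessThan intro!: sum.cong)
      also have "\<dots> = \<phi> c i - \<phi> c' i" using i by (simp add: \<phi>_def right_diff_distrib sum_subtractf)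
      finally show "(?M *\<^sub>v ?w) $ i = 0\<^sub>v n $ i" using i c(3) by simp
    qed (use M in simp)
    moreover have "?w \<noteq> 0\<^sub>v n"
    proof
      assume "?w = 0\<^sub>v n"
      then have "?w $ j = 0" using j(1) by simp
      then show False using j by simp
    qed
    moreover have "?w \<in> carrier_vec n" by simp
    ultimately have "det ?M = 0" using det_0_iff_vec_prod_zero_field[OF M] by blast
    then show False using det by simp
  qed
  moreover have "\<phi> ` ({..<n} \<rightarrow>\<^sub>E K) \<subseteq> {..<n} \<rightarrow>\<^sub>E K"
  proof
    fix y assume "y \<in> \<phi> ` ({..<n} \<rightarrow>\<^sub>E K)"
    then obtain c where c: "c \<in> {..<n} \<rightarrow>\<^sub>E K" "y = \<phi> c" by blast
    have "(\<Sum>j<n. ?M $$ (i, j) * c j) \<in> K" if "i < n" for i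
      using that MK c(1) by (intro sum_K mult_K) (auto dest: PiE_mem)
    then show "y \<in> {..<n} \<rightarrow>\<^sub>E K" unfolding c(2) \<phi>_def by auto
  qed
  moreover have "finite ({..<n} \<rightarrow>\<^sub>E K)" using finite_K by (intro finite_PiE) auto
  ultimately have onto: "\<phi> ` ({..<n} \<rightarrow>\<^sub>E K) = {..<n} \<rightarrow>\<^sub>E K" by (intro endo_inj_surj)
  have "\<exists>l\<in>pols (mons {1..n} 1). \<forall>k\<le>n. ev (as ! k) l = (if k = Suc i then 1 else 0)" if i: "i < n" for i
  proof -
    have "(\<lambda>k\<in>{..<n}. if k = i then 1 else 0) \<in> {..<n} \<rightarrow>\<^sub>E K" using zero_K one_K by auto
    then have "(\<lambda>k\<in>{..<n}. if k = i then 1 else 0) \<in> \<phi> ` ({..<n} \<rightarrow>\<^sub>E K)" unfolding onto .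
    then obtain c where c: "\<phi> c = (\<lambda>k\<in>{..<n}. if k = i then 1 else 0)" "c \<in> {..<n} \<rightarrow>\<^sub>E K"
      by (elim imageE) (rule that, rule sym)
    have cK: "c j \<in> K" if "j < n" for j using c(2) that by (auto dest: PiE_mem)
    let ?l = "(\<Sum>j<n. Cst (c j) * (Var (Suc j) - Cst ((as ! 0) (Suc j))))"
    have "?l \<in> pols (mons {1..n} 1)"
      using cK asK[of 0] by (intro pols_sum pols_Cst_mult pols_diff pols_mon pols_Cst) (auto simp: mons_def)
    moreover have "ev (as ! k) ?l = (if k = Suc i then 1 else 0)" if k: "k \<le> n" for k
    proof -
      have e: "ev (as ! k) ?l = (\<Sum>j<n. c j * ((as ! k) (Suc j) - (as ! 0) (Suc j)))"
        by (simp add: ev_sum ev_mult ev_diff)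
      show ?thesis
      proof (cases k)
        case 0
        then show ?thesis unfolding e by simp
      next
        case (Suc k')
        then have k': "k' < n" using k by simp
        have "(\<Sum>j<n. c j * ((as ! k) (Suc j) - (as ! 0) (Suc j))) = \<phi> c k'"
          using k' by (simp add: \<phi>_def diff_mat_def Suc mult.commute)
        then show ?thesis unfolding e c(1) using k' Suc by simp
      qed
    qed
    ultimately show ?thesis by blast
  qed
  then have ex_l: "\<exists>l. l \<in> pols (mons {1..n} 1) \<and> (\<forall>k\<le>n. ev (as ! k) l = (if k = Suc i then 1 else 0))" if "i < n" for i
    using that unfolding Bex_def by blast
  define l where "l i = (SOME l. l \<in> pols (mons {1..n} 1) \<and> (\<forall>k\<le>n. ev (as ! k) l = (if k = Suc i then 1 else 0)))" for i
  have l: "l i \<in> pols (mons {1..n} 1) \<and> (\<forall>k\<le>n. ev (as ! k) (l i) = (if k = Suc i then 1 else 0))" if "i < n" for i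
    unfolding l_def by (rule someI_ex[OF ex_l[OF that]])
  define L where "L k = (case k of 0 \<Rightarrow> Cst 1 - (\<Sum>i<n. l i) | Suc i \<Rightarrow> l i)" for k
  have L: "L i \<in> pols (mons {1..n} 1)" "ev (as ! k) (L i) = (if k = i then 1 else 0)" if "i \<le> n" "k \<le> n" for i k
  proof -
    show "L i \<in> pols (mons {1..n} 1)"
      using l that(1) one_K by (cases i) (auto simp: L_def mons_def simp del: Cst_1 intro!: pols_diff pols_Cst pols_sum)
    show "ev (as ! k) (L i) = (if k = i then 1 else 0)"
    proof (cases i)
      case 0
      have "(\<Sum>j<n. ev (as ! k) (l j)) = (\<Sum>j<n. if Suc j = k then 1 else 0)"
        using l that(2) by (intro sum.cong) auto
      also have "\<dots> = (if k = 0 then 0 else 1)"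
        using that(2) by (cases k) (simp_all add: sum.delta)
      finally show ?thesis using 0 by (simp add: L_def ev_diff ev_sum del: Cst_1)
    next
      case (Suc j)
      then show ?thesis using l[of j] that by (auto simp: L_def)
    qed
  qed
  have dist: "as ! i \<noteq> as ! k" if "i \<le> n" "k \<le> n" "i \<noteq> k" for i k
  proof
    assume "as ! i = as ! k"
    then have "ev (as ! i) (L k) = ev (as ! k) (L k)" by simp
    then show False using L(2)[of k i] L(2)[of k k] that by simp
  qed
  show ?thesis unfolding separated_def
  proof (intro conjI ballI)
    show "distinct as" unfolding distinct_conv_nth len using dist by auto
    fix a assume "a \<in> set as"
    then obtain i where i: "i \<le> n" "a = as ! i" unfolding in_set_conv_nth len by (auto simp: less_Suc_eq_le)
    have "ev b (L i) = 0" if b: "b \<in> set as - {a}" for b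
    proof -
      obtain k where "k \<le> n" "b = as ! k" using b unfolding Diff_iff in_set_conv_nth len by (auto simp: less_Suc_eq_le)
      then show ?thesis using L(2)[OF i(1), of k] b i by auto
    qed
    then show "\<exists>l\<in>pols (mons {1..n} 1). ev a l = 1 \<and> (\<forall>b\<in>set as - {a}. ev b l = 0)"
      using L[OF i(1,1)] i by (intro bexI[of _ "L i"]) auto
  qed
qed

lemma card_not_separated:
  "card {as \<in> strip_lists n. \<not> separated {1..n} as} * card K \<le> n * card (strip_lists n)"
proof -
  have fin: "finite (strip_lists n)"
  proof -
    have "finite ({1..n} \<rightarrow>\<^sub>E K)" using finite_K by (intro finite_PiE) auto
    from finite_lists_length_eq[OF this, of "n + 1"] show ?thesis by (simp add: strip_lists_def conj_commute)
  qed
  define sh where "sh t as = map (\<lambda>i. if i = 0 then as ! 0 else (as ! i)(i := (as ! i) i + t)) [0..<n+1]"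
    for t and as :: "(nat \<Rightarrow> 'f) list"
  have nth_sh: "sh t as ! i = (if i = 0 then as ! 0 else (as ! i)(i := (as ! i) i + t))" if "i \<le> n" for t as i
    unfolding sh_def using that nth_map[of i "[0..<n+1]"] by (simp del: upt_Suc)
  have len_sh: "length (sh t as) = n + 1" for t as by (simp add: sh_def)
  show ?thesis
  proof (rule orbit_count[OF fin finite_K, where sh = sh])
    show "inj_on (sh t) (strip_lists n)" for t
    proof (rule inj_onI)
      fix as bs assume ab: "as \<in> strip_lists n" "bs \<in> strip_lists n" "sh t as = sh t bs"
      show "as = bs"
      proof (rule nth_equalityI)
        show len: "length as = length bs" using ab by (simp add: strip_lists_def)
        fix i assume "i < length as"
        then have i: "i \<le> n" using ab by (simp add: strip_lists_def)
        have "sh t as ! i = sh t bs ! i" using ab(3) by simp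
        then have eq: "(if i = 0 then as ! 0 else (as ! i)(i := (as ! i) i + t)) = (if i = 0 then bs ! 0 else (bs ! i)(i := (bs ! i) i + t))"
          unfolding nth_sh[OF i] .
        show "as ! i = bs ! i"
        proof (cases "i = 0")
          case False
          show ?thesis
          proof
            fix j show "(as ! i) j = (bs ! i) j"
              using fun_cong[OF eq, of j] False by (cases "j = i") auto
          qed
        qed (use eq in simp)
      qed
    qed
    show "sh t as \<in> strip_lists n" if t: "t \<in> K" and as: "as \<in> strip_lists n" for t as
    proof -
      have shK: "sh t as ! i \<in> {1..n} \<rightarrow>\<^sub>E K" if i: "i \<le> n" for i
      proof -
        have a: "as ! j \<in> {1..n} \<rightarrow>\<^sub>E K" if "j \<le> n" for j
        proof -
          have "as ! j \<in> set as" using as that by (simp add: strip_lists_def)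
          then show ?thesis using as unfolding strip_lists_def by blast
        qed
        show ?thesis
        proof (cases "i = 0")
          case True
          then show ?thesis using nth_sh[OF i] a[of 0] by simp
        next
          case False
          have "(as ! i) i + t \<in> K" using PiE_mem[OF a[OF i], of i] False i t by (intro add_K) auto
          then have "(as ! i)(i := (as ! i) i + t) \<in> {1..n} \<rightarrow>\<^sub>E K"
            using a[OF i] False i by (auto simp: PiE_def extensional_def Pi_def)
          then show ?thesis using nth_sh[OF i] False by simp
        qed
      qed
      have "set (sh t as) \<subseteq> {1..n} \<rightarrow>\<^sub>E K"
      proof
        fix b assume "b \<in> set (sh t as)"
        then obtain i where "i < n + 1" "b = sh t as ! i" unfolding in_set_conv_nth len_sh by auto
        then show "b \<in> {1..n} \<rightarrow>\<^sub>E K" using shK[of i] by simp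
      qed
      then show ?thesis using len_sh by (simp add: strip_lists_def)
    qed
    fix as assume as: "as \<in> strip_lists n"
    let ?T = "{t \<in> K. sh t as \<in> {as \<in> strip_lists n. \<not> separated {1..n} as}}"
    show "card ?T \<le> n"
    proof (rule card_singular_shifts[of "diff_mat n as"])
      show "diff_mat n as \<in> carrier_mat n n" by (simp add: diff_mat_def)
      show "finite ?T" using finite_K by simp
      fix t assume t: "t \<in> ?T"
      have "diff_mat n (sh t as) = diff_mat n as + t \<cdot>\<^sub>m 1\<^sub>m n"
        by (rule eq_matI) (auto simp: diff_mat_def nth_sh)
      moreover have "sh t as \<in> strip_lists n" "\<not> separated {1..n} (sh t as)" using t by blast+
      then have "det (diff_mat n (sh t as)) = 0" using separated_if_det by blast
      ultimately show "det (diff_mat n as + t \<cdot>\<^sub>m 1\<^sub>m n) = 0" by simp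
    qed
  qed blast
qed

end

section \<open>Specialization\<close>

definition spec :: "nat set \<Rightarrow> (nat \<Rightarrow> 'f::field) \<Rightarrow> 'f pol \<Rightarrow> 'f pol" where
  "spec A a = lin (\<lambda>m. Cst (mev a (filter_mset (\<lambda>i. i \<in> A) m)) * mon (filter_mset (\<lambda>i. i \<notin> A) m))"

lemma spec_add: "spec A a (f + g) = spec A a f + spec A a g"
  and spec_diff: "spec A a (f - g) = spec A a f - spec A a g"
  by (simp_all add: spec_def lin_add lin_diff)

lemma ev_spec: "ev x (spec A a f) = ev (\<lambda>i. if i \<in> A then a i else x i) f"
  unfolding spec_def ev_lin ev_def[of "\<lambda>i. if i \<in> A then a i else x i"]
proof (intro sum.cong refl)
  fix m
  let ?y = "\<lambda>i. if i \<in> A then a i else x i"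
  have "mev ?y m = mev ?y (filter_mset (\<lambda>i. i \<in> A) m) * mev ?y (filter_mset (\<lambda>i. i \<notin> A) m)"
    using arg_cong[OF multiset_partition[of m "\<lambda>i. i \<in> A"], of "mev ?y"] unfolding mev_add .
  also have "mev ?y (filter_mset (\<lambda>i. i \<in> A) m) = mev a (filter_mset (\<lambda>i. i \<in> A) m)"
    by (rule mev_cong) simp
  also have "mev ?y (filter_mset (\<lambda>i. i \<notin> A) m) = mev x (filter_mset (\<lambda>i. i \<notin> A) m)"
    by (rule mev_cong) simp
  finally show "coef f m * ev x (Cst (mev a (filter_mset (\<lambda>i. i \<in> A) m)) * mon (filter_mset (\<lambda>i. i \<notin> A) m)) = coef f m * mev ?y m"
    by (simp add: ev_mult)
qed

context finite_subfield_set
begin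

lemma spec_pols:
  assumes "\<And>i. i \<in> A \<Longrightarrow> a i \<in> K" "f \<in> pols (mons (A \<union> V) d)" "A \<inter> V = {}"
  shows "spec A a f \<in> pols (mons V d)"
  unfolding spec_def
proof (rule pols_lin[OF assms(2)], rule pols_Cst_mult[OF pols_mon])
  fix m assume m: "m \<in> mons (A \<union> V) d"
  show "filter_mset (\<lambda>i. i \<notin> A) m \<in> mons V d"
    using m by (auto simp: mons_def intro: order_trans[OF size_filter_mset_lesseq])
  show "mev a (filter_mset (\<lambda>i. i \<in> A) m) \<in> K" using assms(1) by (intro mev_K) auto
qed

lemma spec_id:
  assumes f: "f \<in> pols (mons V d)" and disj: "A \<inter> V = {}"
  shows "spec A a f = f"
proof -
  have "spec A a f = lin mon f" unfolding spec_def
  proof (rule lin_cong[OF pols_on[OF f]])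
    fix m assume "m \<in> mons V d"
    then have cnt: "count m i = 0" if "i \<in> A" for i using disj that by (auto simp: mons_def count_eq_zero_iff)
    then have f1: "filter_mset (\<lambda>i. i \<in> A) m = {#}" and f2: "filter_mset (\<lambda>i. i \<notin> A) m = m"
      by (intro multiset_eqI; simp add: cnt)+
    show "Cst (mev a (filter_mset (\<lambda>i. i \<in> A) m)) * mon (filter_mset (\<lambda>i. i \<notin> A) m) = mon m"
      unfolding f1 f2 mev_empty Cst_1 mult_1_left ..
  qed
  then show ?thesis by (simp only: lin_id)
qed

text \<open>Specialization maps the uniform distribution to the uniform distribution.\<close>

lemma card_spec_fibre:
  assumes fin: "finite A" "finite V" and a: "\<And>i. i \<in> A \<Longrightarrow> a i \<in> K" and disj: "A \<inter> V = {}"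
    and g: "g \<in> pols (mons V d)"
  shows "card {f \<in> pols (mons (A \<union> V) d). spec A a f = g} * card (pols (mons V d)) = card (pols (mons (A \<union> V) d))"
proof -
  let ?S = "pols (mons (A \<union> V) d)" and ?N = "{f \<in> pols (mons (A \<union> V) d). spec A a f = 0}"
  have S: "finite ?S" by (rule finite_pols[OF finite_mons]) (use fin in simp)
  have eq: "spec A a f = spec A a g \<longleftrightarrow> f - g \<in> ?N" if "f \<in> ?S" "g \<in> ?S" for f g
    using pols_diff[OF that] by (simp add: spec_diff)
  have surj: "spec A a ` ?S = pols (mons V d)"
  proof
    show "spec A a ` ?S \<subseteq> pols (mons V d)"
      by (rule image_subsetI, rule spec_pols[OF _ _ disj]) (use a in auto)
    show "pols (mons V d) \<subseteq> spec A a ` ?S"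
    proof
      fix h assume h: "h \<in> pols (mons V d)"
      have "h \<in> ?S" by (rule pols_vars_mono[OF h]) simp
      then show "h \<in> spec A a ` ?S"  by (rule rev_image_eqI) (rule spec_id[OF h disj, symmetric])
    qed
  qed
  have N: "?N \<subseteq> ?S" by blast
  have "card {f \<in> ?S. spec A a f = g} = card ?N"
    by (rule card_fibre(1)[where S = ?S and Y = "pols (mons V d)"])
      (rule S, erule (1) pols_add, erule (1) pols_diff, rule N, erule (1) eq, rule surj, rule g)
  moreover have "card ?S = card (pols (mons V d)) * card ?N"
    by (rule card_fibre(2)[where \<phi> = "spec A a"])
      (rule S, erule (1) pols_add, erule (1) pols_diff, rule N, erule (1) eq, rule surj)
  ultimately show ?thesis by simp
qed

end

section \<open>Fields given as records\<close>

lemma coef_mon_mult_if: "coef (mon r * f) m = (if r \<subseteq># m then coef f (m - r) else 0)"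
proof (cases "r \<subseteq># m")
  case True
  then have "m = r + (m - r)" by simp
  then show ?thesis using True coef_mon_mult[of r f "m - r"] by simp
next
  case False
  have "m \<notin> supp (mon r * f)"
  proof
    assume "m \<in> supp (mon r * f)"
    then obtain a b where "a \<in> supp (mon r :: 'a pol)" "m = a + b" using keys_mult[of "mon r" f] by blast
    then show False using False by (auto simp: mon_def split: if_splits)
  qed
  then show ?thesis using False by (simp add: in_keys_iff)
qed

lemma coef_mult: "coef (f * g :: 'f::field pol) m = (\<Sum>n\<in>{n. n \<subseteq># m}. coef f n * coef g (m - n))"
proof -
  have fin: "finite {n. n \<subseteq># m}"
    by (rule finite_subset[OF _ finite_mons[of "set_mset m" "size m"]])
      (auto simp: mons_def dest: set_mset_mono size_mset_mono)
  have "coef (f * g) m = (\<Sum>n\<in>supp f. coef f n * (if n \<subseteq># m then coef g (m - n) else 0))"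
    by (subst mult_eq_lin) (simp only: lin_def lookup_sum coef_Cst_mult coef_mon_mult_if)
  also have "\<dots> = (\<Sum>n\<in>supp f \<union> {n. n \<subseteq># m}. coef f n * (if n \<subseteq># m then coef g (m - n) else 0))"
    by (rule sum.mono_neutral_left) (use fin in \<open>auto simp: in_keys_iff\<close>)
  also have "\<dots> = (\<Sum>n\<in>{n. n \<subseteq># m}. coef f n * (if n \<subseteq># m then coef g (m - n) else 0))"
    by (rule sum.mono_neutral_right) (use fin in auto)
  also have "\<dots> = (\<Sum>n\<in>{n. n \<subseteq># m}. coef f n * coef g (m - n))" by (rule sum.cong) auto
  finally show ?thesis .
qed

lemma coef_spec:
  "coef (spec A a f) m =
     (if set_mset m \<inter> A = {} then \<Sum>n\<in>{n. set_mset n \<subseteq> A \<and> coef f (m + n) \<noteq> 0}. coef f (m + n) * mev a n else 0)"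
proof -
  let ?in = "filter_mset (\<lambda>i. i \<in> A)" and ?out = "filter_mset (\<lambda>i. i \<notin> A)"
  have "coef (spec A a f) m = (\<Sum>p\<in>supp f. if ?out p = m then coef f p * mev a (?in p) else 0)"
    unfolding spec_def lin_def lookup_sum coef_Cst_mult coef_mon by (rule sum.cong) auto
  also have "\<dots> = (\<Sum>p\<in>{p \<in> supp f. ?out p = m}. coef f p * mev a (?in p))"
    by (rule sum.inter_filter[symmetric]) simp
  finally have eq: "coef (spec A a f) m = (\<Sum>p\<in>{p \<in> supp f. ?out p = m}. coef f p * mev a (?in p))" .
  show ?thesis
  proof (cases "set_mset m \<inter> A = {}")
    case False
    then have e: "{p \<in> supp f. ?out p = m} = {}" by auto
    show ?thesis unfolding eq e using False by simp
  next
    case True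
    have m: "?out m = m" "?in m = {#}" using True by (auto simp: multiset_eq_iff simp flip: not_in_iff)
    have n: "?out n = {#}" "?in n = n" if "set_mset n \<subseteq> A" for n
      using that by (auto simp: multiset_eq_iff simp flip: not_in_iff)
    have split: "?out p + ?in p = p" for p by (subst add.commute) (rule multiset_partition[symmetric])
    have "(\<Sum>p\<in>{p \<in> supp f. ?out p = m}. coef f p * mev a (?in p)) =
        (\<Sum>n\<in>{n. set_mset n \<subseteq> A \<and> coef f (m + n) \<noteq> 0}. coef f (m + n) * mev a n)"
    proof (rule sum.reindex_bij_witness[where i = "\<lambda>n. m + n" and j = ?in])
      fix p assume p: "p \<in> {p \<in> supp f. ?out p = m}"
      have "?out p = m" using p by simp
      then show mp: "m + ?in p = p" using split[of p] by (simp only:)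
      show "?in p \<in> {n. set_mset n \<subseteq> A \<and> coef f (m + n) \<noteq> 0}" using p mp by (auto simp: in_keys_iff)
      show "coef f (m + ?in p) * mev a (?in p) = coef f p * mev a (?in p)" using mp by simp
    next
      fix n assume n': "n \<in> {n. set_mset n \<subseteq> A \<and> coef f (m + n) \<noteq> 0}"
      then show "?in (m + n) = n" using m n by simp
      have "set_mset n \<subseteq> A" using n' by simp
      then show "m + n \<in> {p \<in> supp f. ?out p = m}" using n' m(1) by (auto simp: in_keys_iff)
    qed
    then show ?thesis using True unfolding eq by simp
  qed
qed

locale field_rep =
  fixes L :: "'a ring" and rep :: "'f::field \<Rightarrow> 'a"
  assumes L: "field L" and bij: "bij_betw rep UNIV (carrier L)"
    and rep_add: "rep (x + y) = rep x \<oplus>\<^bsub>L\<^esub> rep y" and rep_mult: "rep (x * y) = rep x \<otimes>\<^bsub>L\<^esub> rep y"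
begin

sublocale L: field L by (rule L)

lemma carrier_rep: "carrier L = range rep" using bij by (simp add: bij_betw_def)
lemma rep_closed [simp]: "rep x \<in> carrier L" by (simp add: carrier_rep)
lemma rep_eq [simp]: "rep x = rep y \<longleftrightarrow> x = y" using bij by (auto simp: bij_betw_def inj_on_def)

lemma rep_0: "rep 0 = \<zero>\<^bsub>L\<^esub>"
proof -
  obtain u where u: "\<zero>\<^bsub>L\<^esub> = rep u" using L.zero_closed unfolding carrier_rep by (rule rangeE)
  have "rep 0 = rep 0 \<oplus>\<^bsub>L\<^esub> rep u" using L.r_zero[OF rep_closed] by (simp add: u)
  also have "\<dots> = rep u" by (simp flip: rep_add)
  finally show ?thesis using u by simp
qed

lemma rep_1: "rep 1 = \<one>\<^bsub>L\<^esub>"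
proof -
  obtain u where u: "\<one>\<^bsub>L\<^esub> = rep u" using L.one_closed unfolding carrier_rep by (rule rangeE)
  have "rep 1 = rep 1 \<otimes>\<^bsub>L\<^esub> rep u" using L.r_one[OF rep_closed] by (simp add: u)
  also have "\<dots> = rep u" by (simp flip: rep_mult)
  finally show ?thesis using u by simp
qed

lemma rep_eq_0 [simp]: "rep x = \<zero>\<^bsub>L\<^esub> \<longleftrightarrow> x = 0" by (simp flip: rep_0)

lemma rep_sum: "finite A \<Longrightarrow> rep (\<Sum>i\<in>A. f i) = (\<Oplus>\<^bsub>L\<^esub>i\<in>A. rep (f i))"
  by (induction A rule: finite_induct) (simp_all add: rep_0 rep_add L.finsum_insert Pi_def)

lemma rep_power: "rep (x ^ n) = rep x [^]\<^bsub>L\<^esub> n"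
  by (induction n) (simp_all add: rep_1 rep_mult L.m_comm)

lemma rep_prod: "finite A \<Longrightarrow> rep (\<Prod>i\<in>A. f i) = (\<Otimes>\<^bsub>L\<^esub>i\<in>A. rep (f i))"
  by (induction A rule: finite_induct) (simp_all add: rep_1 rep_mult L.finprod_insert Pi_def)

text \<open>A root in \<open>L\<close> of the list of coefficients is a root of the polynomial.\<close>

lemma eval_rep: "L.eval (map rep ys) (rep z) = rep (poly (Poly (rev ys)) z)"
proof (induction ys)
  case (Cons y ys)
  have "poly (Poly (us @ [y])) z = z ^ length us * y + poly (Poly us) z" for us
    by (induction us) (simp_all add: algebra_simps)
  then show ?case using Cons by (simp add: rep_add rep_mult rep_power mult.commute L.m_comm)
qed (simp add: rep_0)

lemma algebraically_closed_type_rep: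
  assumes "algebraically_closed L" shows "algebraically_closed_type TYPE('f)"
  unfolding algebraically_closed_type_def
proof (intro allI impI)
  fix p :: "'f poly" assume deg: "Polynomial.degree p > 0"
  let ?P = "map rep (rev (coeffs p))"
  have p: "coeffs p \<noteq> []" using deg by auto
  have "hd ?P = rep (Polynomial.lead_coeff p)"
    using p by (simp add: hd_map hd_rev last_coeffs_eq_coeff_degree)
  then have P: "?P \<in> carrier (poly_ring L)"
    using p deg by (auto simp: polynomial_def simp flip: univ_poly_carrier)
  have "size (L.roots ?P) = length ?P - 1"
    using algebraically_closed.roots_over_carrier[OF assms P] by (simp add: L.splitted_def)
  then have "L.roots ?P \<noteq> {#}" using deg p by (auto simp: length_coeffs)
  then obtain x where "x \<in># L.roots ?P" by auto
  then have "L.is_root ?P x" using L.roots_mem_iff_is_root[OF P] by simp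
  then have x: "x \<in> carrier L" "L.eval ?P x = \<zero>\<^bsub>L\<^esub>" unfolding L.is_root_def by auto
  then obtain z where "x = rep z" unfolding carrier_rep by auto
  then show "\<exists>z. poly p z = 0" using x(2) eval_rep[of "rev (coeffs p)" z] by auto
qed

definition toR :: "'f pol \<Rightarrow> nat multiset \<Rightarrow> 'a" where "toR f = (\<lambda>m. rep (coef f m))"

lemma toR_eq [simp]: "toR f = toR g \<longleftrightarrow> f = g"
  by (auto simp: toR_def fun_eq_iff intro: poly_mapping_eqI)
lemma toR_mem [simp]: "toR f \<in> toR ` S \<longleftrightarrow> f \<in> S" by auto

lemma toR_const: "ring.indexed_const L (rep c) = toR (Cst c)"
  by (auto simp: fun_eq_iff L.indexed_const_def toR_def Cst_def lookup_single when_def rep_0)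
lemma toR_add: "ring.indexed_padd L (toR f) (toR g) = toR (f + g)"
  by (simp add: fun_eq_iff L.indexed_padd_def toR_def lookup_add rep_add)
lemma toR_pmult: "ring.indexed_pmult L (toR f) i = toR (Var i * f)"
  by (simp add: fun_eq_iff L.indexed_pmult_def toR_def coef_mon_mult_if rep_0)

lemma indexed_pset_rep:
  assumes K: "0 \<in> K" "\<And>a b. a \<in> K \<Longrightarrow> b \<in> K \<Longrightarrow> a + b \<in> K"
  shows "ring.indexed_pset L I (rep ` K) = toR ` {f \<in> on (allm I). \<forall>m. coef f m \<in> K}"
proof
  let ?S = "{f \<in> on (allm I). \<forall>m. coef f m \<in> K}"
  show "ring.indexed_pset L I (rep ` K) \<subseteq> toR ` ?S"
  proof
    fix P assume "P \<in> ring.indexed_pset L I (rep ` K)"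
    then show "P \<in> toR ` ?S"
    proof (induction rule: L.indexed_pset.induct)
      case (indexed_const k)
      then obtain c where c: "c \<in> K" "k = rep c" by blast
      have "coef (Cst c) m \<in> K" for m using c K by (simp add: Cst_def lookup_single when_def)
      then show ?case by (simp add: c toR_const)
    next
      case (indexed_padd P Q)
      then obtain f g where "P = toR f" "Q = toR g" "f \<in> ?S" "g \<in> ?S" by blast
      then show ?case using K by (simp add: toR_add on_add lookup_add)
    next
      case (indexed_pmult P i)
      then obtain f where f: "P = toR f" "f \<in> ?S" by blast
      have "Var i * f \<in> on (allm I)"
        by (rule on_allm_mult) (use f indexed_pmult in \<open>auto simp: allm_def\<close>)
      then show ?case using f K by (simp add: toR_pmult coef_mon_mult_if)
    qed
  qed
  show "toR ` ?S \<subseteq> ring.indexed_pset L I (rep ` K)"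
  proof (rule image_subsetI)
    fix f assume f: "f \<in> ?S"
    have mono: "toR (Cst c * mon m) \<in> ring.indexed_pset L I (rep ` K)" if "c \<in> K" "set_mset m \<subseteq> I" for c m
      using that(2)
    proof (induction m)
      case empty
      show ?case using L.indexed_pset.indexed_const[of "rep c" "rep ` K" I] that(1) by (simp add: toR_const)
    next
      case (add x m)
      have "mon (add_mset x m) = Var x * (mon m :: 'f pol)" using mon_add[of "{#x#}" m] by simp
      then have eq: "Cst c * mon (add_mset x m) = Var x * (Cst c * mon m)" by (simp only: mult.left_commute)
      show ?case unfolding eq toR_pmult[symmetric]
        by (rule L.indexed_pset.indexed_pmult) (use add in simp_all)
    qed
    have "toR (\<Sum>m\<in>S. Cst (coef f m) * mon m) \<in> ring.indexed_pset L I (rep ` K)"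
      if "finite S" "S \<subseteq> allm I" for S
      using that
    proof (induction S rule: finite_induct)
      case empty
      show ?case using mono[of 0 "{#}"] K by simp
    next
      case (insert m S)
      then show ?case
        using L.indexed_pset.indexed_padd[OF mono[of "coef f m" m], of "toR (\<Sum>m\<in>S. Cst (coef f m) * mon m)"] f
        by (simp add: toR_add allm_def)
    qed
    from this[of "supp f"] show "toR f \<in> ring.indexed_pset L I (rep ` K)"
      using f by (simp add: on_def flip: pol_expand)
  qed
qed

lemma monomial_eval_rep:
  assumes "\<And>i. i \<in># m \<Longrightarrow> z i = rep (x i)"
  shows "monomial_eval L z m = rep (mev x m)"
proof -
  have "rep (mev x m) = (\<Otimes>\<^bsub>L\<^esub>i\<in>set_mset m. rep (x i) [^]\<^bsub>L\<^esub> count m i)"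
    by (simp add: mev_def image_prod_mset_multiplicity rep_prod rep_power)
  also have "\<dots> = monomial_eval L z m"
    unfolding monomial_eval_def by (rule L.finprod_cong') (use assms in auto)
  finally show ?thesis by simp
qed

lemma mpoly_eval_rep:
  assumes f: "f \<in> on (allm I)" and z: "\<And>i. i \<in> I \<Longrightarrow> z i = rep (x i)"
  shows "mpoly_eval L z (toR f) = rep (ev x f)"
proof -
  have "rep (ev x f) = (\<Oplus>\<^bsub>L\<^esub>m\<in>supp f. rep (coef f m * mev x m))" by (simp add: ev_def rep_sum)
  also have "\<dots> = mpoly_eval L z (toR f)" unfolding mpoly_eval_def
  proof (rule L.finsum_cong')
    show "supp f = {m. toR f m \<noteq> \<zero>\<^bsub>L\<^esub>}" by (auto simp: toR_def in_keys_iff)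
    fix m assume "m \<in> {m. toR f m \<noteq> \<zero>\<^bsub>L\<^esub>}"
    then have "coef f m \<noteq> 0" by (auto simp: toR_def)
    then have "set_mset m \<subseteq> I" using f unfolding on_iff allm_def by blast
    then have "monomial_eval L z m = rep (mev x m)" by (intro monomial_eval_rep z) auto
    then show "rep (coef f m * mev x m) = toR f m \<otimes>\<^bsub>L\<^esub> monomial_eval L z m" by (simp add: rep_mult toR_def)
  next
    show "(\<lambda>m. toR f m \<otimes>\<^bsub>L\<^esub> monomial_eval L z m) \<in> {m. toR f m \<noteq> \<zero>\<^bsub>L\<^esub>} \<rightarrow> carrier L"
    proof
      fix m assume "m \<in> {m. toR f m \<noteq> \<zero>\<^bsub>L\<^esub>}"
      then have "coef f m \<noteq> 0" by (auto simp: toR_def)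
      then have "set_mset m \<subseteq> I" using f unfolding on_iff allm_def by blast
      then have "monomial_eval L z m = rep (mev x m)" by (intro monomial_eval_rep z) auto
      then show "toR f m \<otimes>\<^bsub>L\<^esub> monomial_eval L z m \<in> carrier L" by (simp add: toR_def)
    qed
  qed
  finally show ?thesis by simp
qed

lemma mpoly_specialize_rep:
  assumes a: "\<And>i. i \<in> A \<Longrightarrow> a i = rep (b i)"
  shows "mpoly_specialize L A a (toR f) = toR (spec A b f)"
proof
  fix m
  let ?N = "{n. set_mset n \<subseteq> A \<and> coef f (m + n) \<noteq> 0}"
  have fin: "finite ?N"
    by (rule inj_on_finite[where f = "\<lambda>n. m + n" and B = "supp f"]) (auto simp: inj_on_def in_keys_iff)
  show "mpoly_specialize L A a (toR f) m = toR (spec A b f) m"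
  proof (cases "set_mset m \<inter> A = {}")
    case True
    have mev: "monomial_eval L a n = rep (mev b n)" if "n \<in> ?N" for n
      by (rule monomial_eval_rep) (use that a in auto)
    have "toR (spec A b f) m = (\<Oplus>\<^bsub>L\<^esub>n\<in>?N. rep (coef f (m + n) * mev b n))"
      using True fin by (simp add: toR_def coef_spec rep_sum)
    also have "\<dots> = (\<Oplus>\<^bsub>L\<^esub>n\<in>{n. set_mset n \<subseteq> A \<and> toR f (m + n) \<noteq> \<zero>\<^bsub>L\<^esub>}. toR f (m + n) \<otimes>\<^bsub>L\<^esub> monomial_eval L a n)"
      by (rule L.finsum_cong') (use mev in \<open>auto simp: toR_def rep_mult\<close>)
    finally show ?thesis using True by (simp add: mpoly_specialize_def)
  qed (simp add: mpoly_specialize_def toR_def coef_spec rep_0)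
qed

lemma mpoly_carrier: "carrier (mpoly_ring L I) = toR ` on (allm I)"
  using indexed_pset_rep[of UNIV I] by (simp add: mpoly_ring_def carrier_rep)
lemma mpoly_mult: "toR f \<otimes>\<^bsub>mpoly_ring L I\<^esub> toR g = toR (f * g)"
proof
  fix m :: "nat multiset"
  have fin: "finite {n. n \<subseteq># m}"
    by (rule finite_subset[OF _ finite_mons[of "set_mset m" "size m"]])
      (auto simp: mons_def dest: set_mset_mono size_mset_mono)
  show "(toR f \<otimes>\<^bsub>mpoly_ring L I\<^esub> toR g) m = toR (f * g) m"
    by (simp add: mpoly_ring_def toR_def coef_mult rep_sum[OF fin] rep_mult)
qed
lemma mpoly_add: "toR f \<oplus>\<^bsub>mpoly_ring L I\<^esub> toR g = toR (f + g)"
  by (simp add: mpoly_ring_def toR_add)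
lemma mpoly_one: "\<one>\<^bsub>mpoly_ring L I\<^esub> = toR 1"
  using toR_const[of 1] by (simp add: mpoly_ring_def rep_1)
lemma mpoly_zero: "\<zero>\<^bsub>mpoly_ring L I\<^esub> = toR 0"
  using toR_const[of 0] by (simp add: mpoly_ring_def rep_0)

lemmas mpoly = mpoly_mult mpoly_add mpoly_one mpoly_zero

lemma mpolyE: assumes "P \<in> carrier (mpoly_ring L I)" obtains f where "P = toR f" "f \<in> on (allm I)"
  using assms unfolding mpoly_carrier by blast
lemma mpolyI: "f \<in> on (allm I) \<Longrightarrow> toR f \<in> carrier (mpoly_ring L I)"
  unfolding mpoly_carrier by (rule imageI)

lemma cring_mpoly:
  fixes I :: "nat set"
  shows "cring (mpoly_ring L I)"
proof (rule cringI)
  show "abelian_group (mpoly_ring L I)"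
  proof (rule abelian_groupI)
    fix P Q assume PQ: "P \<in> carrier (mpoly_ring L I)" "Q \<in> carrier (mpoly_ring L I)"
    obtain f where f: "P = toR f" "f \<in> on (allm I)" using PQ(1) by (rule mpolyE)
    obtain g where g: "Q = toR g" "g \<in> on (allm I)" using PQ(2) by (rule mpolyE)
    show "P \<oplus>\<^bsub>mpoly_ring L I\<^esub> Q \<in> carrier (mpoly_ring L I)" by (simp add: f g mpoly mpolyI on_add)
    show "P \<oplus>\<^bsub>mpoly_ring L I\<^esub> Q = Q \<oplus>\<^bsub>mpoly_ring L I\<^esub> P" by (simp add: f g mpoly add.commute[of f g])
    fix T assume "T \<in> carrier (mpoly_ring L I)"
    then obtain h where h: "T = toR h" "h \<in> on (allm I)" by (rule mpolyE)
    show "P \<oplus>\<^bsub>mpoly_ring L I\<^esub> Q \<oplus>\<^bsub>mpoly_ring L I\<^esub> T = P \<oplus>\<^bsub>mpoly_ring L I\<^esub> (Q \<oplus>\<^bsub>mpoly_ring L I\<^esub> T)"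
      by (simp add: f g h mpoly add.assoc)
  next
    fix P assume "P \<in> carrier (mpoly_ring L I)"
    then obtain f where f: "P = toR f" "f \<in> on (allm I)" by (rule mpolyE)
    show "\<zero>\<^bsub>mpoly_ring L I\<^esub> \<oplus>\<^bsub>mpoly_ring L I\<^esub> P = P" by (simp add: f mpoly)
    show "\<exists>Q\<in>carrier (mpoly_ring L I). Q \<oplus>\<^bsub>mpoly_ring L I\<^esub> P = \<zero>\<^bsub>mpoly_ring L I\<^esub>"
      by (rule bexI[OF _ mpolyI[OF on_uminus[OF f(2)]]]) (simp add: f mpoly)
  qed (simp add: mpoly mpolyI)
  show "Group.comm_monoid (mpoly_ring L I)"
  proof (rule comm_monoidI)
    fix P Q assume PQ: "P \<in> carrier (mpoly_ring L I)" "Q \<in> carrier (mpoly_ring L I)"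
    obtain f where f: "P = toR f" "f \<in> on (allm I)" using PQ(1) by (rule mpolyE)
    obtain g where g: "Q = toR g" "g \<in> on (allm I)" using PQ(2) by (rule mpolyE)
    show "P \<otimes>\<^bsub>mpoly_ring L I\<^esub> Q \<in> carrier (mpoly_ring L I)" by (simp add: f g mpoly mpolyI on_allm_mult)
    show "P \<otimes>\<^bsub>mpoly_ring L I\<^esub> Q = Q \<otimes>\<^bsub>mpoly_ring L I\<^esub> P" by (simp add: f g mpoly mult.commute[of f g])
    fix T assume "T \<in> carrier (mpoly_ring L I)"
    then obtain h where h: "T = toR h" "h \<in> on (allm I)" by (rule mpolyE)
    show "P \<otimes>\<^bsub>mpoly_ring L I\<^esub> Q \<otimes>\<^bsub>mpoly_ring L I\<^esub> T = P \<otimes>\<^bsub>mpoly_ring L I\<^esub> (Q \<otimes>\<^bsub>mpoly_ring L I\<^esub> T)"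
      by (simp add: f g h mpoly mult.assoc)
  next
    fix P assume "P \<in> carrier (mpoly_ring L I)"
    then obtain f where f: "P = toR f" "f \<in> on (allm I)" by (rule mpolyE)
    show "\<one>\<^bsub>mpoly_ring L I\<^esub> \<otimes>\<^bsub>mpoly_ring L I\<^esub> P = P" by (simp add: f mpoly)
  qed (simp add: mpoly mpolyI)
  fix P Q T assume PQT: "P \<in> carrier (mpoly_ring L I)" "Q \<in> carrier (mpoly_ring L I)" "T \<in> carrier (mpoly_ring L I)"
  obtain f where f: "P = toR f" "f \<in> on (allm I)" using PQT(1) by (rule mpolyE)
  obtain g where g: "Q = toR g" "g \<in> on (allm I)" using PQT(2) by (rule mpolyE)
  obtain h where h: "T = toR h" "h \<in> on (allm I)" using PQT(3) by (rule mpolyE)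
  show "(P \<oplus>\<^bsub>mpoly_ring L I\<^esub> Q) \<otimes>\<^bsub>mpoly_ring L I\<^esub> T =
      P \<otimes>\<^bsub>mpoly_ring L I\<^esub> T \<oplus>\<^bsub>mpoly_ring L I\<^esub> Q \<otimes>\<^bsub>mpoly_ring L I\<^esub> T"
    by (simp only: f g h mpoly distrib_right)
qed

lemma mpoly_power:
  "toR f [^]\<^bsub>mpoly_ring L I\<^esub> (n::nat) = toR (f ^ n)"
proof (induction n)
  case 0
  show ?case by (simp add: nat_pow_def mpoly)
next
  case (Suc n)
  have "toR f [^]\<^bsub>mpoly_ring L I\<^esub> Suc n = toR f [^]\<^bsub>mpoly_ring L I\<^esub> n \<otimes>\<^bsub>mpoly_ring L I\<^esub> toR f"
    by (simp add: nat_pow_def)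
  then show ?case unfolding Suc by (simp only: mpoly power_Suc2)
qed

end

context field_rep
begin

text \<open>Regularity, radicality and properness of the ideals generated by initial segments are
  statements about polynomials, which the representation of the coefficients does not change.\<close>

lemma cond_H_if_good:
  assumes alg: "algebraically_closed_type TYPE('f)" and s: "1 \<le> s" "s \<le> r"
    and good: "good_system {r-s+1..r} d e G" and e: "bij_betw e {0..<s} {r-s+1..r}"
    and Gr: "\<And>i. i \<in> {1..s} \<Longrightarrow> Gr i = toR (G (r - s + i))"
  shows "cond_H L r s Gr"
proof -
  define k where "k = r - s"
  define V where "V = {r-s+1..r}"
  have r: "r = k + s" using s by (simp add: k_def)
  have cardV: "card V = s" and finV: "finite V" using s by (auto simp: V_def)
  interpret B: box_basis V d G using good unfolding good_system_def V_def by (rule conjunct1)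
  define R where "R = mpoly_ring L V"
  interpret R: cring R unfolding R_def by (rule cring_mpoly)
  define U where "U i = {k+1..k+i}" for i
  have U: "U i \<subseteq> V" if "i \<le> s" for i using that by (auto simp: U_def V_def r)
  have Gr': "Gr i = toR (G (k + i))" "k + i \<in> V" if "i \<in> {1..s}" for i
  proof -
    show "Gr i = toR (G (k + i))" using Gr[OF that] by (simp only: k_def)
    have "1 \<le> i" "i \<le> s" using that by auto
    then show "k + i \<in> V" by (simp add: V_def r)
  qed
  have subI: "f \<in> B.I W \<Longrightarrow> W \<subseteq> V \<Longrightarrow> f \<in> on (allm V)" for f W by (rule B.I_subset)
  have idl: "ideal (toR ` B.I W) R" if W: "W \<subseteq> V" for W
  proof (rule idealI)
    show "ring R" by (rule R.ring_axioms)
    show "subgroup (toR ` B.I W) (add_monoid R)"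
    proof (rule group.subgroupI[OF R.a_group])
      show "toR ` B.I W \<subseteq> carrier (add_monoid R)"
        using B.I_subset[OF W] by (auto simp: R_def mpoly_carrier)
      show "toR ` B.I W \<noteq> {}" using B.I_0 by blast
    next
      fix P assume "P \<in> toR ` B.I W"
      then obtain f where f: "P = toR f" "f \<in> B.I W" by blast
      have m: "toR f \<in> carrier R" "toR (- f) \<in> carrier R"
        using B.I_subset[OF W f(2)] by (auto simp: R_def intro!: mpolyI on_uminus)
      have "a_inv R P = toR (- f)" unfolding f(1)
        by (rule R.minus_equality[OF _ m]) (simp add: R_def mpoly)
      then show "m_inv (add_monoid R) P \<in> toR ` B.I W"
        unfolding a_inv_def using B.I_uminus[OF f(2)] by simp
    next
      fix P Q assume "P \<in> toR ` B.I W" "Q \<in> toR ` B.I W"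
      then obtain f g where "P = toR f" "f \<in> B.I W" "Q = toR g" "g \<in> B.I W" by blast
      then show "P \<otimes>\<^bsub>add_monoid R\<^esub> Q \<in> toR ` B.I W" by (simp add: R_def mpoly B.I_add)
    qed
    fix P Q assume "P \<in> toR ` B.I W" "Q \<in> carrier R"
    then obtain f g where fg: "P = toR f" "f \<in> B.I W" "Q = toR g" "g \<in> on (allm V)"
      unfolding R_def mpoly_carrier by blast
    have "g * f \<in> B.I W" by (rule B.I_mult[OF fg(2,4)])
    then show "Q \<otimes>\<^bsub>R\<^esub> P \<in> toR ` B.I W" "P \<otimes>\<^bsub>R\<^esub> Q \<in> toR ` B.I W"
      by (simp_all add: fg(1,3) R_def mpoly mult.commute[of f g])
  qed
  have Idl: "Idl\<^bsub>R\<^esub> (Gr ` {1..i}) = toR ` B.I (U i)" if i: "i \<le> s" for i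
  proof
    have Gr_im: "Gr j = toR (G (k + j))" "k + j \<in> U i" "k + j \<in> V" if "j \<in> {1..i}" for j
      using that i Gr'[of j] by (auto simp: U_def)
    have GrR: "Gr ` {1..i} \<subseteq> carrier R"
      using Gr_im B.G_allm by (auto simp: R_def intro!: mpolyI)
    show "Idl\<^bsub>R\<^esub> (Gr ` {1..i}) \<subseteq> toR ` B.I (U i)"
    proof (rule R.genideal_minimal[OF idl[OF U[OF i]]])
      show "Gr ` {1..i} \<subseteq> toR ` B.I (U i)"
      proof (rule image_subsetI)
        fix j assume j: "j \<in> {1..i}"
        show "Gr j \<in> toR ` B.I (U i)"
          using B.I_G[OF Gr_im(2)[OF j] U[OF i]] Gr_im(1)[OF j] by simp
      qed
    qed
    interpret J: ideal "Idl\<^bsub>R\<^esub> (Gr ` {1..i})" R by (rule R.genideal_ideal[OF GrR])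
    have gen: "toR (G v) \<in> Idl\<^bsub>R\<^esub> (Gr ` {1..i})" if "v \<in> U i" for v
    proof -
      have "v - k \<in> {1..i}" "v = k + (v - k)" using that by (auto simp: U_def)
      then have "toR (G v) = Gr (v - k)" using Gr_im(1)[of "v - k"] by simp
      then show ?thesis using R.genideal_self[OF GrR] \<open>v - k \<in> {1..i}\<close> by auto
    qed
    show "toR ` B.I (U i) \<subseteq> Idl\<^bsub>R\<^esub> (Gr ` {1..i})"
    proof (rule image_subsetI)
      fix f assume "f \<in> B.I (U i)"
      then obtain h where h: "f = (\<Sum>v\<in>U i. G v * h v)" "\<forall>v\<in>U i. h v \<in> on (allm V)"
        unfolding B.I_def by blast
      have "toR (\<Sum>v\<in>W. G v * h v) \<in> Idl\<^bsub>R\<^esub> (Gr ` {1..i})" if "finite W" "W \<subseteq> U i" for W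
        using that
      proof (induction W rule: finite_induct)
        case empty
        have "toR 0 = \<zero>\<^bsub>R\<^esub>" by (simp add: R_def mpoly)
        then show ?case using J.zero_closed by simp
      next
        case (insert v W)
        have "toR (G v) \<otimes>\<^bsub>R\<^esub> toR (h v) \<in> Idl\<^bsub>R\<^esub> (Gr ` {1..i})"
          by (rule J.I_r_closed[OF gen]) (use insert h(2) in \<open>auto simp: R_def intro!: mpolyI\<close>)
        moreover have "toR (\<Sum>v\<in>W. G v * h v) \<in> Idl\<^bsub>R\<^esub> (Gr ` {1..i})" using insert by simp
        ultimately have "toR (G v) \<otimes>\<^bsub>R\<^esub> toR (h v) \<oplus>\<^bsub>R\<^esub> toR (\<Sum>v\<in>W. G v * h v) \<in> Idl\<^bsub>R\<^esub> (Gr ` {1..i})"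
          by (rule J.a_closed)
        then show ?case using insert.hyps by (simp add: R_def mpoly)
      qed
      from this[of "U i"] show "toR f \<in> Idl\<^bsub>R\<^esub> (Gr ` {1..i})" unfolding h(1) by (simp add: U_def)
    qed
  qed
  have coset: "toR ` B.I W +>\<^bsub>R\<^esub> P = toR ` B.I W \<longleftrightarrow> P \<in> toR ` B.I W" if "W \<subseteq> V" "P \<in> carrier R" for W P
  proof -
    have sub: "subgroup (toR ` B.I W) (add_monoid R)"
      using idl[OF that(1)] by (rule additive_subgroup.a_subgroup[OF ideal.axioms(1)])
    show ?thesis using R.a_coset_join1[OF _ that(2) sub] R.a_coset_join2[OF that(2) sub] by blast
  qed
  have GrR: "Gr i \<in> carrier R" if "i \<in> {1..s}" for i
    using Gr'[OF that] B.G_allm by (simp add: R_def mpolyI)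
  have 1: "Idl\<^bsub>R\<^esub> (Gr ` {1..s}) \<noteq> carrier R"
  proof
    assume "Idl\<^bsub>R\<^esub> (Gr ` {1..s}) = carrier R"
    then have "toR 1 \<in> toR ` B.I (U s)" using R.one_closed unfolding Idl[OF order_refl] by (simp add: R_def mpoly)
    then show False using B.one_notin_I[OF U[OF order_refl]] by simp
  qed
  have 2: "Gr 1 \<noteq> \<zero>\<^bsub>R\<^esub>"
    using Gr'[of 1] s B.G_nonzero[of "k + 1"] by (simp add: R_def mpoly)
  have 3: "toR ` B.I (U (i - 1)) +>\<^bsub>R\<^esub> Gr i \<noteq> \<zero>\<^bsub>R Quot toR ` B.I (U (i - 1))\<^esub> \<and>
      \<not> Defs.zero_divisor (R Quot toR ` B.I (U (i - 1))) (toR ` B.I (U (i - 1)) +>\<^bsub>R\<^esub> Gr i)" if i: "i \<in> {2..s}" for i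
  proof -
    have i1: "i \<in> {1..s}" using i by auto
    have W: "U (i - 1) \<subseteq> V" using i by (intro U) auto
    have v: "k + i \<in> V - U (i - 1)" using Gr'(2)[OF i1] i by (auto simp: U_def)
    let ?J = "toR ` B.I (U (i - 1))"
    interpret J: ideal ?J R by (rule idl[OF W])
    have reg: "f \<in> B.I (U (i - 1))" if "f \<in> on (allm V)" "G (k + i) * f \<in> B.I (U (i - 1))" for f
      by (rule B.I_regular[OF W v that])
    have "Gr i \<notin> ?J"
      using reg[OF one_on_allm] B.one_notin_I[OF W] Gr'(1)[OF i1] by auto
    moreover have "\<not> Defs.zero_divisor (R Quot ?J) (?J +>\<^bsub>R\<^esub> Gr i)"
    proof
      assume "Defs.zero_divisor (R Quot ?J) (?J +>\<^bsub>R\<^esub> Gr i)"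
      then obtain Y where Y: "Y \<in> a_rcosets\<^bsub>R\<^esub> ?J" "Y \<noteq> ?J" "[mod ?J:] (?J +>\<^bsub>R\<^esub> Gr i) \<Otimes>\<^bsub>R\<^esub> Y = ?J"
        unfolding Defs.zero_divisor_def by (auto simp: FactRing_def)
      then obtain P where P: "P \<in> carrier R" "Y = ?J +>\<^bsub>R\<^esub> P" unfolding A_RCOSETS_def' by blast
      have "?J +>\<^bsub>R\<^esub> (Gr i \<otimes>\<^bsub>R\<^esub> P) = ?J"
        using Y(3) J.rcoset_mult_add[OF GrR[OF i1] P(1)] P(2) by simp
      then have *: "Gr i \<otimes>\<^bsub>R\<^esub> P \<in> ?J" using coset[OF W] GrR[OF i1] P(1) by simp
      obtain f where f: "P = toR f" "f \<in> on (allm V)" using P(1) unfolding R_def by (rule mpolyE)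
      have "G (k + i) * f \<in> B.I (U (i - 1))" using * by (simp add: Gr'(1)[OF i1] f R_def mpoly)
      from reg[OF f(2) this] have "P \<in> ?J" using f by simp
      then show False using Y(2) P coset[OF W P(1)] by simp
    qed
    ultimately show ?thesis using coset[OF W GrR[OF i1]] by (simp add: FactRing_def)
  qed
  have 4: "radical_ideal R (toR ` B.I (U i))" if i: "i \<in> {1..s}" for i
    unfolding radical_ideal_def
  proof (intro conjI ballI allI impI)
    have W: "U i \<subseteq> V" using i by (intro U) auto
    show "ideal (toR ` B.I (U i)) R" by (rule idl[OF W])
    fix P n assume P: "P \<in> carrier R" and n: "P [^]\<^bsub>R\<^esub> (n::nat) \<in> toR ` B.I (U i)"
    obtain f where f: "P = toR f" "f \<in> on (allm V)" using P unfolding R_def by (rule mpolyE)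
    have fn: "f ^ n \<in> B.I (U i)" using n by (simp add: f(1) R_def mpoly_power)
    have Ui: "U i = V - {k+i+1..r}" using i by (auto simp: U_def V_def r)
    have e': "bij_betw e {0..<card V} V" using e unfolding cardV unfolding V_def .
    have J: "ev x (jac V e G) \<noteq> 0" if "\<And>v. v \<in> V \<Longrightarrow> ev x (G v) = 0" for x
      using good that unfolding good_system_def V_def[symmetric] by blast
    have "f \<in> B.I (V - {k+i+1..r})"
      by (rule B.radical_subset[OF alg e' J, of "{k+i+1..r}" f n])
        (assumption, simp, simp add: V_def r subset_iff, rule f(2), use fn Ui in simp)
    then show "P \<in> toR ` B.I (U i)" using f Ui by simp
  qed
  show ?thesis
    unfolding cond_H_def V_def[symmetric] R_def[symmetric] reduced_regular_sequence_def Let_def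
  proof (intro conjI ballI)
    fix i assume "i \<in> {1..s}"
    then show "Gr i \<in> carrier R" by (rule GrR)
  next
    fix i assume i: "i \<in> {2..s}"
    then have e: "Idl\<^bsub>R\<^esub> (Gr ` {1..i - 1}) = toR ` B.I (U (i - 1))" by (intro Idl) auto
    show "Idl\<^bsub>R\<^esub> (Gr ` {1..i - 1}) +>\<^bsub>R\<^esub> Gr i \<noteq> \<zero>\<^bsub>R Quot Idl\<^bsub>R\<^esub> (Gr ` {1..i - 1})\<^esub>"
      and "\<not> Defs.zero_divisor (R Quot Idl\<^bsub>R\<^esub> (Gr ` {1..i - 1})) (Idl\<^bsub>R\<^esub> (Gr ` {1..i - 1}) +>\<^bsub>R\<^esub> Gr i)"
      using 3[OF i] unfolding e by auto
  next
    fix i assume i: "i \<in> {1..s}"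
    then have e: "Idl\<^bsub>R\<^esub> (Gr ` {1..i}) = toR ` B.I (U i)" by (intro Idl) auto
    show "radical_ideal R (Idl\<^bsub>R\<^esub> (Gr ` {1..i}))" unfolding e by (rule 4[OF i])
  qed (fact 1 2)+
qed

end

definition strip_statistics :: "'a ring \<Rightarrow> 'a set \<Rightarrow> nat \<Rightarrow> nat \<Rightarrow> nat \<Rightarrow> bool" where
  "strip_statistics L K r s d \<longleftrightarrow>
     (let S = systems L K {1..r} s d; B = {r-s+1..r} \<rightarrow>\<^sub>E K;
          lists = {as. length as = r - s + 1 \<and> set as \<subseteq> strips K r s}
      in finite S \<and> S \<noteq> {} \<and>
         (\<forall>F\<in>S. \<forall>a\<in>strips K r s. specialize L r s F a \<in> systems L K {r-s+1..r} s d) \<and>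
         (\<forall>a\<in>strips K r s. card {F \<in> S. \<not> cond_H L r s (specialize L r s F a)} * card K
            \<le> 2 * (d + 1) ^ (2 * s + 1) * card S) \<and>
         (\<exists>Gen \<subseteq> lists. card (lists - Gen) * card K \<le> (r - s) * card lists \<and>
            (\<forall>as\<in>Gen. distinct as \<and>
               (\<forall>T a0. T \<subseteq> set as \<times> B \<longrightarrow>
                  (\<forall>a\<in>set as. card {x. (a, x) \<in> T} \<le> (if a = a0 then d + 1 else d)) \<longrightarrow>
                  card {F \<in> S. \<forall>(a, x)\<in>T. x \<in> rational_zeros L K r s (specialize L r s F a)} * card B ^ card T
                    = card S))))"


section \<open>Strips over a represented field\<close>

lemma bij_betw_PiE_comp:
  assumes inj: "inj_on g P"
  shows "bij_betw (\<lambda>f. \<lambda>i\<in>A. g (f i)) (A \<rightarrow>\<^sub>E P) (A \<rightarrow>\<^sub>E g ` P)"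
proof (rule bij_betw_imageI)
  show "inj_on (\<lambda>f. \<lambda>i\<in>A. g (f i)) (A \<rightarrow>\<^sub>E P)"
  proof (rule inj_onI)
    fix f f' assume f: "f \<in> A \<rightarrow>\<^sub>E P" "f' \<in> A \<rightarrow>\<^sub>E P" and eq: "(\<lambda>i\<in>A. g (f i)) = (\<lambda>i\<in>A. g (f' i))"
    show "f = f'"
    proof (rule PiE_ext[OF f])
      fix i assume i: "i \<in> A"
      then have "g (f i) = g (f' i)" using fun_cong[OF eq, of i] by simp
      then show "f i = f' i" by (rule inj_onD[OF inj]) (rule PiE_mem[OF f(1) i], rule PiE_mem[OF f(2) i])
    qed
  qed
  show "(\<lambda>f. \<lambda>i\<in>A. g (f i)) ` (A \<rightarrow>\<^sub>E P) = A \<rightarrow>\<^sub>E g ` P"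
  proof
    show "(\<lambda>f. \<lambda>i\<in>A. g (f i)) ` (A \<rightarrow>\<^sub>E P) \<subseteq> A \<rightarrow>\<^sub>E g ` P"
      by (intro image_subsetI restrict_PiE_iff[THEN iffD2] ballI imageI) (rule PiE_mem)
    show "A \<rightarrow>\<^sub>E g ` P \<subseteq> (\<lambda>f. \<lambda>i\<in>A. g (f i)) ` (A \<rightarrow>\<^sub>E P)"
    proof
      fix u assume u: "u \<in> A \<rightarrow>\<^sub>E g ` P"
      define f where "f = (\<lambda>i\<in>A. inv_into P g (u i))"
      have ui: "u i \<in> g ` P" if "i \<in> A" for i by (rule PiE_mem[OF u that])
      have "f \<in> A \<rightarrow>\<^sub>E P" unfolding f_def
        by (rule restrict_PiE_iff[THEN iffD2], rule ballI, rule inv_into_into, rule ui)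
      moreover have "u = (\<lambda>i\<in>A. g (f i))"
      proof
        fix i show "u i = (\<lambda>i\<in>A. g (f i)) i"
        proof (cases "i \<in> A")
          case True
          then show ?thesis using f_inv_into_f[OF ui[OF True]] by (simp add: f_def)
        next
          case False
          then show ?thesis using PiE_arb[OF u False] by simp
        qed
      qed
      ultimately show "u \<in> (\<lambda>f. \<lambda>i\<in>A. g (f i)) ` (A \<rightarrow>\<^sub>E P)" by blast
    qed
  qed
qed

lemma card_preimage_uniform:
  assumes S: "finite S" and Y: "finite Y" "D \<subseteq> Y"
    and fib: "\<And>y. y \<in> Y \<Longrightarrow> card {x \<in> S. \<phi> x = y} * card Y = card S"
  shows "card {x \<in> S. \<phi> x \<in> D} * card Y = card D * card S"
proof -
  have "card {x \<in> S. \<phi> x \<in> D} = card (\<Union>y\<in>D. {x \<in> S. \<phi> x = y})" by (rule arg_cong[of _ _ card]) auto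
  also have "\<dots> = (\<Sum>y\<in>D. card {x \<in> S. \<phi> x = y})"
    by (rule card_UN_disjoint) (use S Y finite_subset in auto)
  finally have "card {x \<in> S. \<phi> x \<in> D} * card Y = (\<Sum>y\<in>D. card {x \<in> S. \<phi> x = y} * card Y)"
    by (simp add: sum_distrib_right)
  also have "\<dots> = (\<Sum>y\<in>D. card S)" by (rule sum.cong) (use fib Y in auto)
  finally show ?thesis by simp
qed

lemma Collect_conjD1: "x \<in> {x. P x \<and> Q x} \<Longrightarrow> P x"
  and Collect_conjD2: "x \<in> {x. P x \<and> Q x} \<Longrightarrow> Q x"
  by simp_all

lemma Collect_image_mem: "{y \<in> g ` D. Q y} = g ` {x \<in> D. Q (g x)}"
  by blast

locale finite_subfield_rep = field_rep L rep + finite_subfield_set K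
  for L :: "'a ring" and rep :: "'f::field \<Rightarrow> 'a" and K :: "'f set"
begin

lemma polys_le_rep: "polys_le L (rep ` K) I d = toR ` pols (mons I d)"
proof -
  have p: "ring.indexed_pset L I (rep ` K) = toR ` {f \<in> on (allm I). \<forall>m. coef f m \<in> K}"
    by (rule indexed_pset_rep) (rule zero_K, rule add_K)
  have sz: "(\<forall>m. toR f m \<noteq> \<zero>\<^bsub>L\<^esub> \<longrightarrow> size m \<le> d) \<longleftrightarrow> (\<forall>m. coef f m \<noteq> 0 \<longrightarrow> size m \<le> d)" for f
    by (simp add: toR_def)
  have "polys_le L (rep ` K) I d =
      toR ` {f \<in> {f \<in> on (allm I). \<forall>m. coef f m \<in> K}. \<forall>m. coef f m \<noteq> 0 \<longrightarrow> size m \<le> d}"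
    unfolding polys_le_def p Collect_image_mem sz ..
  also have "{f \<in> {f \<in> on (allm I). \<forall>m. coef f m \<in> K}. \<forall>m. coef f m \<noteq> 0 \<longrightarrow> size m \<le> d} = pols (mons I d)"
    unfolding pols_def on_iff mons_def allm_def by blast
  finally show ?thesis .
qed

context
  fixes r s d :: nat
  assumes s: "1 \<le> s" "s < r" "s < d"
begin

abbreviation "A \<equiv> {1..r-s}"
abbreviation "V \<equiv> {r-s+1..r}"
abbreviation "W \<equiv> {1..r}"
abbreviation "FS \<equiv> {1..s} \<rightarrow>\<^sub>E pols (mons W d)"
abbreviation "conv f \<equiv> (\<lambda>i\<in>{1..s}. toR (f i))"
abbreviation "irep \<equiv> inv_into UNIV rep"
abbreviation "Sy \<equiv> systems L (rep ` K) W s d"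

lemma AV: "A \<union> V = W" "A \<inter> V = {}" "card V = s" using s by auto

lemma bij_systems: "bij_betw (\<lambda>f. conv f) ({1..s} \<rightarrow>\<^sub>E pols (mons I d)) (systems L (rep ` K) I s d)"
  unfolding systems_def polys_le_rep by (rule bij_betw_PiE_comp) (simp add: inj_on_def)

lemma finite_pols_mons: "finite I \<Longrightarrow> finite (pols (mons I d))" by (rule finite_pols[OF finite_mons])
lemma finite_FS: "finite FS" by (rule finite_PiE) (simp_all add: finite_pols_mons)

lemma image_conv: "(\<lambda>f. conv f) ` FS = Sy" by (rule bij_betw_imp_surj_on[OF bij_systems])

lemma card_systems_Collect: "card {F \<in> Sy. Q F} = card {f \<in> FS. Q (conv f)}"
proof -
  have eq: "{F \<in> Sy. Q F} = (\<lambda>f. conv f) ` {f \<in> FS. Q (conv f)}"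
    unfolding image_conv[symmetric] by (rule Collect_image_mem)
  have inj: "inj_on (\<lambda>f. conv f) {f \<in> FS. Q (conv f)}"
    by (rule inj_on_subset[OF bij_betw_imp_inj_on[OF bij_systems[of W]] Collect_subset])
  show ?thesis unfolding eq by (rule card_image[OF inj])
qed

lemma card_systems: "card Sy = card FS" using bij_betw_same_card[OF bij_systems[of W]] by simp

lemma irep: "x \<in> rep ` K \<Longrightarrow> rep (irep x) = x" "x \<in> rep ` K \<Longrightarrow> irep x \<in> K" "irep (rep z) = z"
proof -
  show *: "irep (rep z) = z" for z by (rule inv_f_f) (simp add: inj_on_def)
  show "x \<in> rep ` K \<Longrightarrow> rep (irep x) = x" "x \<in> rep ` K \<Longrightarrow> irep x \<in> K" using * by auto
qed

lemma strip_coord: "a \<in> strips (rep ` K) r s \<Longrightarrow> i \<in> A \<Longrightarrow> a i \<in> rep ` K"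
  unfolding strips_def by (rule PiE_mem)

lemma specialize_rep:
  assumes a: "a \<in> strips (rep ` K) r s"
  shows "specialize L r s (conv f) a = (\<lambda>i\<in>{1..s}. toR (spec A (\<lambda>i. irep (a i)) (f i)))"
proof
  fix i
  have "mpoly_specialize L A a (toR (f i)) = toR (spec A (\<lambda>i. irep (a i)) (f i))"
    by (rule mpoly_specialize_rep) (use irep(1) strip_coord[OF a] in simp)
  then show "specialize L r s (conv f) a i = (\<lambda>i\<in>{1..s}. toR (spec A (\<lambda>i. irep (a i)) (f i))) i"
    by (simp add: specialize_def)
qed

lemma spec_small:
  assumes a: "a \<in> strips (rep ` K) r s" and p: "p \<in> pols (mons W d)"
  shows "spec A (\<lambda>i. irep (a i)) p \<in> pols (mons V d)"
  by (rule spec_pols[OF _ _ AV(2)]) (use irep(2) strip_coord[OF a] p AV(1) in simp_all)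

lemma specialize_systems:
  assumes "F \<in> Sy" and a: "a \<in> strips (rep ` K) r s"
  shows "specialize L r s F a \<in> systems L (rep ` K) V s d"
proof -
  obtain f where f: "F = conv f" "f \<in> FS" using assms(1) unfolding image_conv[symmetric] by (rule imageE)
  show ?thesis unfolding f(1) specialize_rep[OF a] systems_def polys_le_rep
  proof (rule restrict_PiE_iff[THEN iffD2], rule ballI)
    fix i assume "i \<in> {1..s}"
    then have "f i \<in> pols (mons W d)" using f(2) by (rule PiE_mem[rotated])
    then show "toR (spec A (\<lambda>i. irep (a i)) (f i)) \<in> toR ` pols (mons V d)" using spec_small[OF a] by simp
  qed
qed

text \<open>Specialization to a strip transports the uniform distribution on systems in all variables to
  the uniform distribution on systems in the remaining ones, for which the exceptions have been
  counted.\<close>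

lemma card_not_cond_H:
  assumes alg: "algebraically_closed_type TYPE('f)" and a: "a \<in> strips (rep ` K) r s"
  shows "card {F \<in> Sy. \<not> cond_H L r s (specialize L r s F a)} * card K \<le> 2 * (d + 1) ^ (2 * s + 1) * card Sy"
proof -
  define b where "b = (\<lambda>i. irep (a i))"
  define e where "e j = r - s + 1 + j" for j
  define \<phi> where "\<phi> f = (\<lambda>v\<in>V. spec A b (f (v - (r - s))))" for f
  have e: "bij_betw e {0..<card V} V" unfolding AV(3)
    by (rule bij_betwI[where g = "\<lambda>v. v - (r - s + 1)"]) (use s in \<open>auto simp: e_def\<close>)
  have bK: "b i \<in> K" if "i \<in> A" for i using irep(2) strip_coord[OF a that] by (simp add: b_def)
  let ?D = "{G \<in> Sys V d. \<not> good_system V d e G}"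
  have finY: "finite (Sys V d)" by (rule finite_Sys) simp
  have fib: "card {f \<in> FS. \<phi> f = g} * card (Sys V d) = card FS" if g: "g \<in> Sys V d" for g
  proof -
    let ?T = "\<lambda>i. {p \<in> pols (mons W d). spec A b p = g (r - s + i)}"
    have gi: "g (r - s + i) \<in> pols (mons V d)" if "i \<in> {1..s}" for i
      using g that s unfolding Sys_def by (intro PiE_mem[of g V]) auto
    have "{f \<in> FS. \<phi> f = g} = PiE {1..s} ?T"
    proof (rule equalityI; rule subsetI)
      fix f assume f: "f \<in> {f \<in> FS. \<phi> f = g}"
      have fFS: "f \<in> FS" and \<phi>f: "\<phi> f = g" using f by (rule Collect_conjD1, rule Collect_conjD2)
      show "f \<in> PiE {1..s} ?T"
      proof (rule PiE_I)
        fix i assume i: "i \<in> {1..s}"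
        then have v: "r - s + i \<in> V" using s by auto
        have "g (r - s + i) = \<phi> f (r - s + i)" by (simp only: \<phi>f)
        also have "\<dots> = spec A b (f (r - s + i - (r - s)))" unfolding \<phi>_def by (rule restrict_apply'[OF v])
        also have "r - s + i - (r - s) = i" by (rule diff_add_inverse)
        finally have "spec A b (f i) = g (r - s + i)" by (rule sym)
        then show "f i \<in> ?T i" by (intro CollectI conjI PiE_mem[OF fFS i])
      qed (rule PiE_arb[OF fFS])
    next
      fix f assume f: "f \<in> PiE {1..s} ?T"
      have "PiE {1..s} ?T \<subseteq> FS" by (rule PiE_mono) (rule Collect_subset)
      then have fFS: "f \<in> FS" using f by (rule subsetD)
      have "\<phi> f = g"
      proof
        fix v
        show "\<phi> f v = g v"
        proof (cases "v \<in> V")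
          case True
          then have i: "v - (r - s) \<in> {1..s}" and v: "r - s + (v - (r - s)) = v" using s by auto
          have "\<phi> f v = spec A b (f (v - (r - s)))" unfolding \<phi>_def by (rule restrict_apply'[OF True])
          also have "\<dots> = g (r - s + (v - (r - s)))" using PiE_mem[OF f i] by (rule Collect_conjD2)
          finally show ?thesis unfolding v .
        next
          case False
          have "g v = undefined" by (rule PiE_arb[OF g[unfolded Sys_def] False])
          then show ?thesis using False by (simp only: \<phi>_def restrict_apply if_False)
        qed
      qed
      then show "f \<in> {f \<in> FS. \<phi> f = g}" by (intro CollectI conjI fFS)
    qed
    then have c1: "card {f \<in> FS. \<phi> f = g} = (\<Prod>i\<in>{1..s}. card (?T i))" by (simp add: card_PiE)
    have c2: "card (Sys V d) = card (pols (mons V d)) ^ s"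
      unfolding Sys_def using card_funcsetE[of V "pols (mons V d)"] AV(3) by simp
    have c3: "card (?T i) * card (pols (mons V d)) = card (pols (mons W d))" if "i \<in> {1..s}" for i
      using card_spec_fibre[OF _ _ bK AV(2) gi[OF that]] unfolding AV(1) by simp
    have "card {f \<in> FS. \<phi> f = g} * card (Sys V d) = (\<Prod>i\<in>{1..s}. card (?T i) * card (pols (mons V d)))"
      by (simp only: c1 c2 prod.distrib prod_constant card_atLeastAtMost diff_Suc_1)
    also have "\<dots> = (\<Prod>i\<in>{1..s}. card (pols (mons W d)))"
      by (rule prod.cong[OF refl]) (rule c3)
    also have "\<dots> = card FS" by (simp add: card_funcsetE)
    finally show ?thesis .
  qed
  have sub: "{f \<in> FS. \<not> cond_H L r s (specialize L r s (conv f) a)} \<subseteq> {f \<in> FS. \<phi> f \<in> ?D}"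
  proof (rule subsetI)
    fix f assume fH: "f \<in> {f \<in> FS. \<not> cond_H L r s (specialize L r s (conv f) a)}"
    have f: "f \<in> FS" and H: "\<not> cond_H L r s (specialize L r s (conv f) a)"
      using fH by (rule Collect_conjD1, rule Collect_conjD2)
    have SysV: "\<phi> f \<in> Sys V d" unfolding Sys_def \<phi>_def
    proof (rule restrict_PiE_iff[THEN iffD2], rule ballI)
      fix v assume "v \<in> V"
      then have "v - (r - s) \<in> {1..s}" using s by auto
      then have "f (v - (r - s)) \<in> pols (mons W d)" by (rule PiE_mem[OF f])
      then show "spec A b (f (v - (r - s))) \<in> pols (mons V d)" unfolding b_def by (rule spec_small[OF a])
    qed
    have bad: "\<not> good_system V d e (\<phi> f)"
    proof (rule contrapos_nn[OF H], rule cond_H_if_good[OF alg])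
      assume "good_system V d e (\<phi> f)"
      then show "good_system V d e (\<phi> f)" .
      show "1 \<le> s" "s \<le> r" using s by auto
      show "bij_betw e {0..<s} V" using e unfolding AV(3) .
      fix i assume i: "i \<in> {1..s}"
      then have "r - s + i \<in> V" "r - s + i - (r - s) = i" using s by auto
      then show "specialize L r s (conv f) a i = toR (\<phi> f (r - s + i))"
        unfolding specialize_rep[OF a] \<phi>_def b_def by (simp only: restrict_apply'[OF i] restrict_apply')
    qed
    show "f \<in> {f \<in> FS. \<phi> f \<in> ?D}" by (intro CollectI conjI f SysV bad)
  qed
  let ?m = "card {F \<in> Sy. \<not> cond_H L r s (specialize L r s F a)}"
  have "?m \<le> card {f \<in> FS. \<phi> f \<in> ?D}"
    unfolding card_systems_Collect by (rule card_mono[OF _ sub]) (use finite_FS in simp)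
  then have "?m * card K * card (Sys V d) \<le> card {f \<in> FS. \<phi> f \<in> ?D} * card (Sys V d) * card K"
    by (simp add: mult.commute mult.left_commute)
  also have "card {f \<in> FS. \<phi> f \<in> ?D} * card (Sys V d) = card ?D * card FS"
    by (rule card_preimage_uniform[OF finite_FS finY _ fib]) auto
  also have "card ?D * card FS * card K = (card ?D * card K) * card FS" by simp
  also have "\<dots> \<le> (2 * (d + 1) ^ (2 * card V + 1) * card (Sys V d)) * card FS"
    by (rule mult_right_mono[OF card_not_good_system]) (use e s AV(3) in auto)
  also have "\<dots> = (2 * (d + 1) ^ (2 * s + 1) * card Sy) * card (Sys V d)" unfolding AV(3) card_systems by simp
  finally have "?m * card K * card (Sys V d) \<le> (2 * (d + 1) ^ (2 * s + 1) * card Sy) * card (Sys V d)" .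
  moreover have "card (Sys V d) > 0"
  proof -
    have "(\<lambda>v\<in>V. 0) \<in> Sys V d" unfolding Sys_def by (rule restrict_PiE_iff[THEN iffD2]) (simp add: pols_0)
    then show ?thesis using finY by (auto simp: card_gt_0_iff)
  qed
  ultimately show ?thesis by simp
qed

definition pt :: "(nat \<Rightarrow> 'a) \<times> (nat \<Rightarrow> 'a) \<Rightarrow> nat \<Rightarrow> 'f" where
  "pt z = (\<lambda>i\<in>W. irep (if i \<in> A then fst z i else snd z i))"
definition ia :: "(nat \<Rightarrow> 'a) \<Rightarrow> nat \<Rightarrow> 'f" where "ia a = (\<lambda>i\<in>A. irep (a i))"

lemma ia_strips: "a \<in> strips (rep ` K) r s \<Longrightarrow> ia a \<in> A \<rightarrow>\<^sub>E K"
  unfolding ia_def by (rule restrict_PiE_iff[THEN iffD2]) (intro ballI irep(2) strip_coord)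

lemma ia_inj: "inj_on ia (strips (rep ` K) r s)"
proof (rule inj_onI)
  fix a b assume ab: "a \<in> strips (rep ` K) r s" "b \<in> strips (rep ` K) r s" "ia a = ia b"
  show "a = b"
  proof (rule PiE_ext[OF ab(1,2)[unfolded strips_def]])
    fix i assume i: "i \<in> A"
    then have "irep (a i) = irep (b i)" using fun_cong[OF ab(3), of i] by (simp add: ia_def)
    then have "rep (irep (a i)) = rep (irep (b i))" by (rule arg_cong)
    then show "a i = b i" unfolding irep(1)[OF strip_coord[OF ab(1) i]] irep(1)[OF strip_coord[OF ab(2) i]] .
  qed
qed

lemma pt_props:
  assumes a: "a \<in> strips (rep ` K) r s" and x: "x \<in> V \<rightarrow>\<^sub>E rep ` K"
  shows "pt (a, x) \<in> W \<rightarrow>\<^sub>E K" "restrict (pt (a, x)) A = ia a"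
proof -
  have "(if i \<in> A then a i else x i) \<in> rep ` K" if "i \<in> W" for i
    using strip_coord[OF a, of i] PiE_mem[OF x, of i] that s by auto
  then show "pt (a, x) \<in> W \<rightarrow>\<^sub>E K" unfolding pt_def fst_conv snd_conv
    by (intro restrict_PiE_iff[THEN iffD2] ballI irep(2))
  show "restrict (pt (a, x)) A = ia a" by (auto simp: pt_def ia_def fun_eq_iff)
qed

lemma pt_inj: "inj_on pt (strips (rep ` K) r s \<times> (V \<rightarrow>\<^sub>E rep ` K))"
proof (rule inj_onI, clarify)
  fix a x b y assume a: "a \<in> strips (rep ` K) r s" and x: "x \<in> V \<rightarrow>\<^sub>E rep ` K"
    and b: "b \<in> strips (rep ` K) r s" and y: "y \<in> V \<rightarrow>\<^sub>E rep ` K" and eq: "pt (a, x) = pt (b, y)"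
  have "ia a = ia b" using pt_props(2)[OF a x] pt_props(2)[OF b y] eq by simp
  then have "a = b" by (rule inj_onD[OF ia_inj]) (fact a b)+
  moreover have "x = y"
  proof (rule PiE_ext[OF x y])
    fix i assume i: "i \<in> V"
    then have "i \<in> W" "i \<notin> A" using AV by auto
    then have "irep (x i) = irep (y i)" using fun_cong[OF eq, of i] by (simp add: pt_def)
    then have "rep (irep (x i)) = rep (irep (y i))" by (rule arg_cong)
    then show "x i = y i" unfolding irep(1)[OF PiE_mem[OF x i]] irep(1)[OF PiE_mem[OF y i]] .
  qed
  ultimately show "a = b \<and> x = y" by simp
qed

lemma rational_zeros_rep:
  assumes f: "f \<in> FS" and a: "a \<in> strips (rep ` K) r s" and x: "x \<in> V \<rightarrow>\<^sub>E rep ` K"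
  shows "x \<in> rational_zeros L (rep ` K) r s (specialize L r s (conv f) a) \<longleftrightarrow> (\<forall>i\<in>{1..s}. ev (pt (a, x)) (f i) = 0)"
proof -
  have "mpoly_eval L x (specialize L r s (conv f) a i) = rep (ev (pt (a, x)) (f i))" if i: "i \<in> {1..s}" for i
  proof -
    let ?p = "spec A (\<lambda>i. irep (a i)) (f i)"
    have fi: "f i \<in> pols (mons W d)" by (rule PiE_mem[OF f i])
    have "?p \<in> on (allm V)" by (rule on_mons_allm[OF pols_on[OF spec_small[OF a fi]]])
    then have "mpoly_eval L x (toR ?p) = rep (ev (\<lambda>i. irep (x i)) ?p)"
      by (rule mpoly_eval_rep) (use irep(1) PiE_mem[OF x] in simp)
    also have "ev (\<lambda>i. irep (x i)) ?p = ev (pt (a, x)) (f i)"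
      unfolding ev_spec by (rule ev_cong[OF on_mons_allm[OF pols_on[OF fi]]]) (auto simp: pt_def)
    finally show ?thesis using i unfolding specialize_rep[OF a] by simp
  qed
  then show ?thesis using x by (auto simp: rational_zeros_def)
qed

definition general_lists :: "(nat \<Rightarrow> 'a) list set" where
  "general_lists = {as. length as = r - s + 1 \<and> set as \<subseteq> strips (rep ` K) r s \<and> separated A (map ia as)}"

lemma card_general:
  "card ({as. length as = r - s + 1 \<and> set as \<subseteq> strips (rep ` K) r s} - general_lists) * card (rep ` K)
     \<le> (r - s) * card {as. length as = r - s + 1 \<and> set as \<subseteq> strips (rep ` K) r s}"
proof -
  let ?Ls = "{as. length as = r - s + 1 \<and> set as \<subseteq> strips (rep ` K) r s}"
  have cK: "card (rep ` K) = card K" by (rule card_image) (simp add: inj_on_def)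
  have finA: "finite (A \<rightarrow>\<^sub>E K)" using finite_K by (simp add: finite_PiE)
  have cs: "card (strips (rep ` K) r s) = card (A \<rightarrow>\<^sub>E K)" unfolding strips_def by (simp add: card_funcsetE cK)
  have fins: "finite (strips (rep ` K) r s)" unfolding strips_def using finite_K by (simp add: finite_PiE)
  have "card ?Ls = card (strip_lists (r - s))"
    using card_lists_length_eq[OF finA, of "r - s + 1"] card_lists_length_eq[OF fins, of "r - s + 1"] cs
    by (simp add: strip_lists_def conj_commute)
  then have len: "(r - s) * card (strip_lists (r - s)) = (r - s) * card ?Ls" by simp
  have "card (?Ls - general_lists) \<le> card {bs \<in> strip_lists (r - s). \<not> separated A bs}"
  proof (rule card_inj_on_le[where f = "map ia"])
    show "inj_on (map ia) (?Ls - general_lists)"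
      by (rule inj_on_mapI, rule inj_on_subset[OF ia_inj]) blast
    show "map ia ` (?Ls - general_lists) \<subseteq> {bs \<in> strip_lists (r - s). \<not> separated A bs}"
    proof (rule image_subsetI)
      fix xs assume xs: "xs \<in> ?Ls - general_lists"
      have sub: "set xs \<subseteq> strips (rep ` K) r s" and len: "length (map ia xs) = r - s + 1"
        and sep: "\<not> separated A (map ia xs)"
        using xs by (simp_all add: general_lists_def)
      have "set (map ia xs) \<subseteq> A \<rightarrow>\<^sub>E K"
        unfolding set_map by (rule image_subsetI, rule ia_strips, rule subsetD[OF sub])
      then show "map ia xs \<in> {bs \<in> strip_lists (r - s). \<not> separated A bs}"
        unfolding strip_lists_def by (intro CollectI conjI len sep)
    qed
    show "finite {bs \<in> strip_lists (r - s). \<not> separated A bs}"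
      using finite_lists_length_eq[OF finA, of "r - s + 1"]
      by (simp add: strip_lists_def conj_commute)
  qed
  then have "card (?Ls - general_lists) * card K \<le> card {bs \<in> strip_lists (r - s). \<not> separated A bs} * card K"
    by (rule mult_le_mono1)
  also have "\<dots> \<le> (r - s) * card (strip_lists (r - s))" by (rule card_not_separated)
  finally show ?thesis unfolding cK len .
qed

text \<open>Few points in strips in general position impose independent conditions.\<close>

lemma card_systems_vanishing:
  assumes as: "as \<in> general_lists" and T: "T \<subseteq> set as \<times> (V \<rightarrow>\<^sub>E rep ` K)"
    and few: "\<And>a. a \<in> set as \<Longrightarrow> card {x. (a, x) \<in> T} \<le> (if a = a0 then d + 1 else d)"
  shows "card {F \<in> Sy. \<forall>(a, x)\<in>T. x \<in> rational_zeros L (rep ` K) r s (specialize L r s F a)}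
     * card (V \<rightarrow>\<^sub>E rep ` K) ^ card T = card Sy"
proof -
  have sub: "set as \<subseteq> strips (rep ` K) r s" and sep: "separated A (map ia as)"
    using as by (auto simp: general_lists_def)
  have Tsub: "T \<subseteq> strips (rep ` K) r s \<times> (V \<rightarrow>\<^sub>E rep ` K)" using T sub by blast
  have finT: "finite T" by (rule finite_subset[OF T]) (use finite_K in \<open>simp add: finite_PiE\<close>)
  let ?T = "pt ` T"
  have cT: "card ?T = card T" by (rule card_image[OF inj_on_subset[OF pt_inj Tsub]])
  have TW: "?T \<subseteq> W \<rightarrow>\<^sub>E K" using Tsub pt_props(1) by fastforce
  let ?N = "{p \<in> pols (mons W d). \<forall>t\<in>?T. ev t p = 0}"
  have pts: "\<exists>a x. t = pt (a, x) \<and> (a, x) \<in> T \<and> a \<in> set as \<and> restrict t A = ia a" if "t \<in> ?T" for t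
  proof -
    obtain z where z: "t = pt z" "z \<in> T" using \<open>t \<in> ?T\<close> by (rule imageE)
    obtain a x where "z = (a, x)" by (rule prod.exhaust)
    with z have ax: "t = pt (a, x)" "(a, x) \<in> T" by (simp_all only:)
    have "a \<in> strips (rep ` K) r s" "x \<in> V \<rightarrow>\<^sub>E rep ` K" "a \<in> set as"
      using subsetD[OF Tsub ax(2)] subsetD[OF T ax(2)] by (simp_all only: mem_Sigma_iff)
    then show ?thesis using pt_props(2)[of a x] by (intro exI[of _ a] exI[of _ x] conjI ax) (simp_all only: ax)
  qed
  have "card (pols (mons W d)) = card K ^ card ?T * card ?N"
  proof (rule card_vanishing[OF _ _ TW])
    fix t assume t: "t \<in> ?T"
    show "\<exists>f\<in>pols (mons W d). ev t f = 1 \<and> (\<forall>y\<in>?T - {t}. ev y f = 0)"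
    proof (rule exists_interpolant[OF sep _ TW _ _ _ _ t, where ?a0.0 = "ia a0"])
      show "finite ?T" using finT by simp
      show "A \<subseteq> W" "d \<ge> 1" using s by auto
      show "restrict t A \<in> set (map ia as)" if tT: "t \<in> ?T" for t
        using pts[OF tT] unfolding set_map by (elim exE conjE) (rule image_eqI)
      fix a' assume "a' \<in> set (map ia as)"
      then obtain a where a: "a' = ia a" "a \<in> set as" unfolding set_map by (rule imageE)
      have "{x. (a, x) \<in> T} \<subseteq> snd ` T"
      proof
        fix x assume "x \<in> {x. (a, x) \<in> T}"
        then have "(a, x) \<in> T" by (rule CollectD)
        then show "x \<in> snd ` T" by (rule rev_image_eqI) (rule snd_conv[symmetric])
      qed
      then have fin: "finite {x. (a, x) \<in> T}" using finite_imageI[OF finT] by (rule finite_subset)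
      have "{t \<in> ?T. restrict t A = a'} \<subseteq> (\<lambda>x. pt (a, x)) ` {x. (a, x) \<in> T}"
      proof
        fix t assume t: "t \<in> {t \<in> ?T. restrict t A = a'}"
        have tT: "t \<in> ?T" and ta: "restrict t A = a'"
          using t by (rule Collect_conjD1, rule Collect_conjD2)
        obtain b x where bx: "t = pt (b, x)" "(b, x) \<in> T" "b \<in> set as" "restrict t A = ia b"
          using pts[OF tT] by (elim exE conjE) (rule that)
        have "ia b = ia a" using ta unfolding bx(4) a(1) .
        then have "b = a" by (rule inj_onD[OF ia_inj]) (rule subsetD[OF sub bx(3)], rule subsetD[OF sub a(2)])
        with bx have "t = pt (a, x)" "(a, x) \<in> T" by (simp_all only:)
        then show "t \<in> (\<lambda>x. pt (a, x)) ` {x. (a, x) \<in> T}" by (intro image_eqI CollectI)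
      qed
      then have "card {t \<in> ?T. restrict t A = a'} \<le> card {x. (a, x) \<in> T}"
        by (rule surj_card_le[OF fin])
      also have "\<dots> \<le> (if a = a0 then d + 1 else d)" by (rule few[OF a(2)])
      also have "\<dots> \<le> (if a' = ia a0 then d + 1 else d)" using a(1) by auto
      finally show "card {t \<in> ?T. restrict t A = a'} \<le> (if a' = ia a0 then d + 1 else d)" .
    qed
  qed (rule finite_atLeastAtMost, rule finite_imageI[OF finT])
  then have cP: "card (pols (mons W d)) = card K ^ card T * card ?N" unfolding cT .
  have iff: "(\<forall>(a, x)\<in>T. x \<in> rational_zeros L (rep ` K) r s (specialize L r s (conv f) a)) \<longleftrightarrow>
      (\<forall>i\<in>{1..s}. \<forall>t\<in>?T. ev t (f i) = 0)" if f: "f \<in> FS" for f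
  proof -
    have "(\<forall>(a, x)\<in>T. x \<in> rational_zeros L (rep ` K) r s (specialize L r s (conv f) a)) \<longleftrightarrow>
        (\<forall>(a, x)\<in>T. \<forall>i\<in>{1..s}. ev (pt (a, x)) (f i) = 0)"
    proof (rule ball_cong[OF refl], clarify)
      fix a x assume "(a, x) \<in> T"
      then show "x \<in> rational_zeros L (rep ` K) r s (specialize L r s (conv f) a) \<longleftrightarrow> (\<forall>i\<in>{1..s}. ev (pt (a, x)) (f i) = 0)"
        using Tsub by (intro rational_zeros_rep f) auto
    qed
    also have "\<dots> \<longleftrightarrow> (\<forall>i\<in>{1..s}. \<forall>t\<in>?T. ev t (f i) = 0)" by auto
    finally show ?thesis .
  qed
  have "card {F \<in> Sy. \<forall>(a, x)\<in>T. x \<in> rational_zeros L (rep ` K) r s (specialize L r s F a)} =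
      card {f \<in> FS. \<forall>i\<in>{1..s}. \<forall>t\<in>?T. ev t (f i) = 0}"
    unfolding card_systems_Collect
    by (rule arg_cong[of _ _ card], rule Collect_cong, rule conj_cong[OF refl], rule iff)
  also have "{f \<in> FS. \<forall>i\<in>{1..s}. \<forall>t\<in>?T. ev t (f i) = 0} = {1..s} \<rightarrow>\<^sub>E ?N"
    by (rule Set.set_eqI, unfold mem_Collect_eq PiE_iff, blast)
  also have "card ({1..s} \<rightarrow>\<^sub>E ?N) = card ?N ^ s" by (simp add: card_funcsetE)
  finally have c: "card {F \<in> Sy. \<forall>(a, x)\<in>T. x \<in> rational_zeros L (rep ` K) r s (specialize L r s F a)} = card ?N ^ s" .
  have "card (V \<rightarrow>\<^sub>E rep ` K) = card K ^ s"
  proof -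
    have "card (rep ` K) = card K" by (rule card_image) (simp add: inj_on_def)
    then show ?thesis using card_funcsetE[of V "rep ` K"] AV(3) by simp
  qed
  moreover have "card Sy = (card K ^ card T * card ?N) ^ s"
  proof -
    have "card FS = card (pols (mons W d)) ^ s" by (simp add: card_funcsetE)
    then show ?thesis unfolding card_systems cP .
  qed
  ultimately show ?thesis unfolding c
    by (simp only: power_mult_distrib power_mult[symmetric] mult.commute[of s] mult.commute[of "card ?N ^ s"])
qed

lemma strip_statistics_rep:
  assumes alg: "algebraically_closed_type TYPE('f)"
  shows "strip_statistics L (rep ` K) r s d"
proof -
  have finS: "finite Sy" using bij_betw_finite[OF bij_systems[of W]] finite_FS by simp
  have "(\<lambda>i\<in>{1..s}. 0) \<in> FS" by (rule restrict_PiE_iff[THEN iffD2]) (simp add: pols_0)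
  then have "(\<lambda>f. conv f) (\<lambda>i\<in>{1..s}. 0) \<in> Sy" unfolding image_conv[symmetric] by (rule imageI)
  then have neS: "Sy \<noteq> {}" by (intro notI) (simp only: empty_iff)
  have cK: "card (rep ` K) = card K" by (rule card_image) (simp add: inj_on_def)
  have gen: "distinct as" if "as \<in> general_lists" for as
    using that by (auto simp: general_lists_def separated_def distinct_map)
  have gl: "general_lists \<subseteq> {as. length as = r - s + 1 \<and> set as \<subseteq> strips (rep ` K) r s}"
    by (auto simp: general_lists_def)
  show ?thesis
    unfolding strip_statistics_def Let_def
  proof (intro conjI)
    show "\<exists>Gen\<subseteq>{as. length as = r - s + 1 \<and> set as \<subseteq> strips (rep ` K) r s}.
      card ({as. length as = r - s + 1 \<and> set as \<subseteq> strips (rep ` K) r s} - Gen) * card (rep ` K)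
        \<le> (r - s) * card {as. length as = r - s + 1 \<and> set as \<subseteq> strips (rep ` K) r s} \<and>
      (\<forall>as\<in>Gen. distinct as \<and> (\<forall>T a0. T \<subseteq> set as \<times> (V \<rightarrow>\<^sub>E rep ` K) \<longrightarrow>
         (\<forall>a\<in>set as. card {x. (a, x) \<in> T} \<le> (if a = a0 then d + 1 else d)) \<longrightarrow>
         card {F \<in> Sy. \<forall>(a, x)\<in>T. x \<in> rational_zeros L (rep ` K) r s (specialize L r s F a)} *
           card (V \<rightarrow>\<^sub>E rep ` K) ^ card T = card Sy))"
    proof (rule exI[of _ general_lists], intro conjI ballI allI impI gl card_general)
      fix as assume as: "as \<in> general_lists"
      then show "distinct as" by (rule gen)
      fix T a0 assume Tsub: "T \<subseteq> set as \<times> (V \<rightarrow>\<^sub>E rep ` K)"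
        and few: "\<forall>a\<in>set as. card {x. (a, x) \<in> T} \<le> (if a = a0 then d + 1 else d)"
      show "card {F \<in> Sy. \<forall>(a, x)\<in>T. x \<in> rational_zeros L (rep ` K) r s (specialize L r s F a)} *
           card (V \<rightarrow>\<^sub>E rep ` K) ^ card T = card Sy"
        by (rule card_systems_vanishing[OF as Tsub]) (rule bspec[OF few])
    qed
    show "finite Sy" "Sy \<noteq> {}" by (fact finS neS)+
    show "\<forall>F\<in>Sy. \<forall>a\<in>strips (rep ` K) r s. specialize L r s F a \<in> systems L (rep ` K) V s d"
      by (intro ballI specialize_systems)
    show "\<forall>a\<in>strips (rep ` K) r s. card {F \<in> Sy. \<not> cond_H L r s (specialize L r s F a)} * card (rep ` K)
        \<le> 2 * (d + 1) ^ (2 * s + 1) * card Sy"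
      unfolding cK by (intro ballI card_not_cond_H alg)
  qed
qed

end

end

section \<open>Every algebraically closed record is represented by a type\<close>

definition tame :: "'a ring \<Rightarrow> bool" where
  "tame L \<longleftrightarrow> (\<forall>K r s d. subfield K L \<and> finite K \<and> 1 \<le> s \<and> s < r \<and> s < d \<longrightarrow> strip_statistics L K r s d)"

lemma (in field_rep) tame_rep:
  assumes alg: "algebraically_closed L"
  shows "tame L"
  unfolding tame_def
proof (intro allI impI, elim conjE)
  fix K and r s d :: nat
  assume K: "subfield K L" "finite K" and s: "1 \<le> s" "s < r" "s < d"
  define K' where "K' = rep -` K"
  have sub: "subring K L" using K(1) by (rule subfieldE(1))
  have eqK: "rep ` K' = K" using subringE(1)[OF sub] by (auto simp: K'_def carrier_rep)
  interpret finite_subfield_rep L rep K'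
  proof
    show "finite K'" unfolding K'_def by (rule finite_vimageI[OF K(2)]) (simp add: inj_on_def)
    show "0 \<in> K'" "1 \<in> K'" using subringE(2,3)[OF sub] by (simp_all add: K'_def rep_0 rep_1)
    fix a b assume a: "a \<in> K'"
    have um: "rep (- a) = \<ominus>\<^bsub>L\<^esub> rep a"
      by (rule L.minus_equality[symmetric]) (simp_all flip: rep_add rep_0)
    show "- a \<in> K'" using a subringE(5)[OF sub] by (simp add: K'_def um)
    show "inverse a \<in> K'"
    proof (cases "a = 0")
      case False
      then have "rep a \<in> K - {\<zero>\<^bsub>L\<^esub>}" using a by (simp add: K'_def)
      note i = L.subfield_m_inv[OF K(1) this]
      obtain w where w: "inv\<^bsub>L\<^esub> rep a = rep w" using i(1) eqK by blast
      have "rep (a * w) = rep 1" using i(2) by (simp add: w rep_mult rep_1)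
      then have "inverse a = w" by (intro inverse_unique) simp
      then show ?thesis using i(1) w by (simp add: K'_def)
    qed (use \<open>0 \<in> K'\<close> in simp)
    assume b: "b \<in> K'"
    show "a + b \<in> K'" "a * b \<in> K'" using a b subringE(6,7)[OF sub] by (simp_all add: K'_def rep_add rep_mult)
  qed
  show "strip_statistics L K r s d"
    using strip_statistics_rep[OF s algebraically_closed_type_rep[OF alg]] unfolding eqK .
qed

definition closed_field :: "('a + rat) ring" where
  "closed_field = (if \<exists>L :: 'a ring. algebraically_closed L \<and> \<not> tame L
     then image_ring Inl (SOME L :: 'a ring. algebraically_closed L \<and> \<not> tame L)
     else image_ring Inr (ring_of_type_algebra :: rat ring))"

lemma field_closed_field: "field (closed_field :: ('a + rat) ring)"
proof (cases "\<exists>L :: 'a ring. algebraically_closed L \<and> \<not> tame L")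
  case True
  define L where "L = (SOME L :: 'a ring. algebraically_closed L \<and> \<not> tame L)"
  have "algebraically_closed L" using someI_ex[OF True] by (simp add: L_def)
  then have "field L" by (rule algebraically_closed.axioms(1))
  then have "field (image_ring Inl L :: ('a + rat) ring)"
    by (rule field.inj_imp_image_ring_is_field) simp
  then show ?thesis using True by (simp add: closed_field_def L_def)
next
  case False
  have "field (image_ring Inr (ring_of_type_algebra :: rat ring) :: ('a + rat) ring)"
    by (rule field.inj_imp_image_ring_is_field[OF field_from_type_algebra]) simp
  then show ?thesis unfolding closed_field_def if_not_P[OF False] .
qed

typedef (overloaded) 'a closed_elem = "carrier (closed_field :: ('a + rat) ring)"
proof -
  interpret CF: field "closed_field :: ('a + rat) ring" by (rule field_closed_field)
  show ?thesis using CF.zero_closed by blast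
qed

lemma Rep_carrier [simp]: "Rep_closed_elem x \<in> carrier closed_field" by (rule Rep_closed_elem)

instantiation closed_elem :: (type) field
begin

definition "0 = Abs_closed_elem \<zero>\<^bsub>closed_field\<^esub>"
definition "1 = Abs_closed_elem \<one>\<^bsub>closed_field\<^esub>"
definition "x + y = Abs_closed_elem (Rep_closed_elem x \<oplus>\<^bsub>closed_field\<^esub> Rep_closed_elem y)"
definition "x * y = Abs_closed_elem (Rep_closed_elem x \<otimes>\<^bsub>closed_field\<^esub> Rep_closed_elem y)"
definition "- x = Abs_closed_elem (\<ominus>\<^bsub>closed_field\<^esub> Rep_closed_elem x)"
definition "x - y = x + - (y :: 'a closed_elem)"
definition "inverse x = (if x = 0 then 0 else Abs_closed_elem (inv\<^bsub>closed_field\<^esub> Rep_closed_elem x))"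
definition "x div y = x * inverse (y :: 'a closed_elem)"

lemma Rep_closed_elem_simps:
  fixes x y :: "'a closed_elem"
  shows "Rep_closed_elem 0 = \<zero>\<^bsub>closed_field\<^esub>" "Rep_closed_elem 1 = \<one>\<^bsub>closed_field\<^esub>"
  "Rep_closed_elem (x + y) = Rep_closed_elem x \<oplus>\<^bsub>closed_field\<^esub> Rep_closed_elem y"
  "Rep_closed_elem (x * y) = Rep_closed_elem x \<otimes>\<^bsub>closed_field\<^esub> Rep_closed_elem y"
  "Rep_closed_elem (- x) = \<ominus>\<^bsub>closed_field\<^esub> Rep_closed_elem x"
proof -
  interpret CF: field "closed_field :: ('a + rat) ring" by (rule field_closed_field)
  show "Rep_closed_elem 0 = \<zero>\<^bsub>closed_field\<^esub>" "Rep_closed_elem 1 = \<one>\<^bsub>closed_field\<^esub>"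
    "Rep_closed_elem (x + y) = Rep_closed_elem x \<oplus>\<^bsub>closed_field\<^esub> Rep_closed_elem y"
    "Rep_closed_elem (x * y) = Rep_closed_elem x \<otimes>\<^bsub>closed_field\<^esub> Rep_closed_elem y"
    "Rep_closed_elem (- x) = \<ominus>\<^bsub>closed_field\<^esub> Rep_closed_elem x"
    unfolding zero_closed_elem_def one_closed_elem_def plus_closed_elem_def times_closed_elem_def uminus_closed_elem_def
    by (simp_all add: Abs_closed_elem_inverse)
qed

instance
proof
  interpret CF: field "closed_field :: ('a + rat) ring" by (rule field_closed_field)
  fix x y z :: "'a closed_elem"
  note R = Rep_closed_elem_inject[symmetric] Rep_closed_elem_simps
  show "x * y * z = x * (y * z)" unfolding R by (rule CF.m_assoc) simp_all
  show "x * y = y * x" unfolding R by (rule CF.m_comm) simp_all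
  show "1 * x = x" unfolding R by (rule CF.l_one) simp
  show "x + y + z = x + (y + z)" unfolding R by (rule CF.a_assoc) simp_all
  show "x + y = y + x" unfolding R by (rule CF.a_comm) simp_all
  show "0 + x = x" unfolding R by (rule CF.l_zero) simp
  show "- x + x = 0" unfolding R by (rule CF.l_neg) simp
  show "x - y = x + - y" by (rule minus_closed_elem_def)
  show "(x + y) * z = x * z + y * z" unfolding R by (rule CF.l_distr) simp_all
  show "(0 :: 'a closed_elem) \<noteq> 1" unfolding R by simp
  show "inverse 0 = (0 :: 'a closed_elem)" by (simp add: inverse_closed_elem_def)
  show "x div y = x * inverse y" by (rule divide_closed_elem_def)
  assume x: "x \<noteq> 0"
  then have u: "Rep_closed_elem x \<in> Units closed_field" unfolding CF.field_Units R by simp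
  then have "Rep_closed_elem (inverse x) = inv\<^bsub>closed_field\<^esub> Rep_closed_elem x"
    using x by (simp add: inverse_closed_elem_def Abs_closed_elem_inverse)
  then show "inverse x * x = 1" unfolding R using u by simp
qed

end

text \<open>A type cannot be chosen within a proof, but one type can be built in advance from a record
  that violates the claim, if there is any; its elements then refute the violation.\<close>

lemma tame: 
  assumes "algebraically_closed (L :: 'a ring)"
  shows "tame L"
proof (rule ccontr)
  assume "\<not> tame L"
  with assms have ex: "\<exists>L :: 'a ring. algebraically_closed L \<and> \<not> tame L" by blast
  define L0 where "L0 = (SOME L :: 'a ring. algebraically_closed L \<and> \<not> tame L)"
  have L0: "algebraically_closed L0" "\<not> tame L0" using someI_ex[OF ex] by (simp_all add: L0_def)
  have cf: "closed_field = image_ring Inl L0" using ex by (simp add: closed_field_def L0_def)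
  interpret L0: field L0 by (rule algebraically_closed.axioms(1)[OF L0(1)])
  have iso: "Inl \<in> ring_iso L0 (closed_field :: ('a + rat) ring)"
    unfolding cf by (rule inj_imp_image_ring_iso) simp
  then have hom: "Inl \<in> Ring.ring_hom L0 (closed_field :: ('a + rat) ring)"
    and bij: "bij_betw Inl (carrier L0) (carrier (closed_field :: ('a + rat) ring))"
    unfolding ring_iso_def by auto
  define rep :: "'a closed_elem \<Rightarrow> 'a" where "rep x = (inv_into (carrier L0) Inl (Rep_closed_elem x))" for x
  have rep: "rep x \<in> carrier L0" "Inl (rep x) = Rep_closed_elem x" for x
    using bij_betw_inv_into[OF bij] bij_betw_inv_into_right[OF bij, of "Rep_closed_elem x"] Rep_carrier[of x]
    by (auto simp: rep_def bij_betw_def)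
  interpret field_rep L0 rep
  proof
    have "bij_betw Rep_closed_elem UNIV (carrier (closed_field :: ('a + rat) ring))"
      by (rule bij_betwI[where g = Abs_closed_elem]) (auto simp: Rep_closed_elem_inverse Abs_closed_elem_inverse)
    from bij_betw_trans[OF this bij_betw_inv_into[OF bij]]
    show "bij_betw rep UNIV (carrier L0)" by (simp add: rep_def[abs_def] comp_def)
    fix x y
    have "(Inl (rep (x + y)) :: 'a + rat) = Inl (rep x \<oplus>\<^bsub>L0\<^esub> rep y)"
      unfolding Ring.ring_hom_add[OF hom rep(1) rep(1)] rep(2) by (rule Rep_closed_elem_simps(3))
    then show "rep (x + y) = rep x \<oplus>\<^bsub>L0\<^esub> rep y" by simp
    have "(Inl (rep (x * y)) :: 'a + rat) = Inl (rep x \<otimes>\<^bsub>L0\<^esub> rep y)"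
      unfolding Ring.ring_hom_mult[OF hom rep(1) rep(1)] rep(2) by (rule Rep_closed_elem_simps(4))
    then show "rep (x * y) = rep x \<otimes>\<^bsub>L0\<^esub> rep y" by simp
  qed
  from tame_rep[OF L0(1)] L0(2) show False by simp
qed

section \<open>The numbers \<open>mu m\<close>\<close>

lemma one_minus_mu: "1 - mu m = (\<Sum>j\<le>m. (- 1) ^ j / fact j)"
proof (induction m)
  case (Suc m)
  have "mu (Suc m) = mu m + (- 1) ^ m / fact (Suc m)" by (simp add: mu_def)
  then show ?case using Suc by simp
qed (simp add: mu_def)

lemma mu_diff_Suc: "\<bar>(1 - mu (Suc m)) - (1 - mu m)\<bar> = 1 / fact (Suc m)"
  unfolding one_minus_mu by (simp add: abs_mult power_abs[symmetric])

lemma abs_mu_minus_half: "m \<ge> 2 \<Longrightarrow> \<bar>mu m - 1 / 2\<bar> \<le> 1 / 2 - 1 / fact m"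
proof (induction m rule: nat_induct_at_least)
  case base
  have "mu 2 = 1 / 2" by (simp add: mu_def numeral_2_eq_2)
  then show ?case by (simp add: numeral_2_eq_2)
next
  case (Suc m)
  have "2 * (1 / fact (Suc m)) \<le> (1 / fact m :: real)"
    using Suc.hyps by (simp add: divide_simps)
  then show ?case using Suc.IH mu_diff_Suc[of m] by linarith
qed

lemma mu_bounds: assumes "m \<ge> 2" shows "0 < mu m" "mu m < 1"
proof -
  have "(0::real) < 1 / fact m" by simp
  then show "0 < mu m" "mu m < 1" using abs_mu_minus_half[OF assms] by linarith+
qed

lemma sum_inverse_fact_le: "m \<ge> 1 \<Longrightarrow> (\<Sum>i\<le>m. 1 / fact i :: real) \<le> 3 - 1 / fact m"
proof (induction m rule: nat_induct_at_least)
  case (Suc m)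
  have "2 * (1 / fact (Suc m)) \<le> (1 / fact m :: real)"
    using Suc.hyps by (simp add: divide_simps)
  then show ?case using Suc.IH by simp
qed simp

section \<open>Bonferroni inequalities\<close>

definition bonferroni :: "nat \<Rightarrow> nat \<Rightarrow> real" where
  "bonferroni d N = (\<Sum>j\<le>d. (- 1) ^ j * real (N choose j))"

lemma bonferroni_Suc: "bonferroni d (Suc n) = (- 1) ^ d * real (n choose d)"
  by (induction d) (simp_all add: bonferroni_def algebra_simps)

lemma bonferroni_0: "bonferroni d 0 = 1"
  by (induction d) (simp_all add: bonferroni_def)

lemma bonferroni_error: "\<bar>of_bool (N = 0) - bonferroni d N\<bar> \<le> real (N choose (d + 1))"
  by (cases N) (simp_all add: bonferroni_0 bonferroni_Suc abs_mult power_abs[symmetric])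

lemma abs_bonferroni_le: "\<bar>bonferroni d N\<bar> \<le> 1 + real (N choose d)"
proof (cases N)
  case (Suc n)
  have "n choose d \<le> Suc n choose d" by (cases d) simp_all
  then show ?thesis using Suc by (simp add: bonferroni_Suc abs_mult power_abs[symmetric])
qed (simp add: bonferroni_0)

lemma abs_prod_diff_le:
  fixes x y U :: "'i \<Rightarrow> real"
  assumes "finite I" "\<And>i. i \<in> I \<Longrightarrow> \<bar>x i\<bar> \<le> U i" "\<And>i. i \<in> I \<Longrightarrow> \<bar>y i\<bar> \<le> U i"
  shows "\<bar>(\<Prod>i\<in>I. x i) - (\<Prod>i\<in>I. y i)\<bar> \<le> (\<Sum>i\<in>I. \<bar>x i - y i\<bar> * (\<Prod>j\<in>I - {i}. U j))"
  using assms
proof (induction I rule: finite_induct)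
  case (insert a I)
  let ?P = "\<Prod>i\<in>I. x i" and ?Q = "\<Prod>i\<in>I. y i"
  have P: "\<bar>?P\<bar> \<le> (\<Prod>i\<in>I. U i)" unfolding abs_prod using insert.prems by (intro prod_mono) auto
  have IH: "\<bar>?P - ?Q\<bar> \<le> (\<Sum>i\<in>I. \<bar>x i - y i\<bar> * (\<Prod>j\<in>I - {i}. U j))"
    using insert.IH insert.prems by auto
  have "\<bar>x a * ?P - y a * ?Q\<bar> = \<bar>(x a - y a) * ?P + y a * (?P - ?Q)\<bar>" by (simp add: algebra_simps)
  also have "\<dots> \<le> \<bar>x a - y a\<bar> * \<bar>?P\<bar> + \<bar>y a\<bar> * \<bar>?P - ?Q\<bar>"
    by (metis abs_mult abs_triangle_ineq)
  also have "\<dots> \<le> \<bar>x a - y a\<bar> * (\<Prod>i\<in>I. U i) + U a * (\<Sum>i\<in>I. \<bar>x i - y i\<bar> * (\<Prod>j\<in>I - {i}. U j))"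
    using P IH insert.prems by (intro add_mono mult_mono) (auto intro: order_trans[OF abs_ge_zero])
  also have "U a * (\<Sum>i\<in>I. \<bar>x i - y i\<bar> * (\<Prod>j\<in>I - {i}. U j))
      = (\<Sum>i\<in>I. \<bar>x i - y i\<bar> * (\<Prod>j\<in>insert a I - {i}. U j))"
    unfolding sum_distrib_left
  proof (intro sum.cong refl)
    fix i assume i: "i \<in> I"
    then have "insert a I - {i} = insert a (I - {i})" "a \<notin> I - {i}" using insert.hyps by auto
    then have "(\<Prod>j\<in>insert a I - {i}. U j) = U a * (\<Prod>j\<in>I - {i}. U j)" using insert.hyps by simp
    then show "U a * (\<bar>x i - y i\<bar> * (\<Prod>j\<in>I - {i}. U j)) = \<bar>x i - y i\<bar> * (\<Prod>j\<in>insert a I - {i}. U j)"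
      by simp
  qed
  finally show ?case using insert.hyps by simp
qed simp

lemma abs_power_diff_le:
  fixes a b :: real assumes "\<bar>a\<bar> \<le> 1" "\<bar>b\<bar> \<le> 1"
  shows "\<bar>a ^ k - b ^ k\<bar> \<le> real k * \<bar>a - b\<bar>"
  using abs_prod_diff_le[of "{..<k}" "\<lambda>_. a" "\<lambda>_. 1" "\<lambda>_. b"] assms by simp

lemma alternating_sum_bounds:
  fixes c :: "nat \<Rightarrow> real"
  assumes "\<And>j. 0 \<le> c j" "\<And>j. c (Suc j) \<le> c j"
  shows "0 \<le> (\<Sum>j\<le>d. (- 1) ^ j * c j) \<and> (\<Sum>j\<le>d. (- 1) ^ j * c j) \<le> c 0"
  using assms
proof (induction d arbitrary: c)
  case (Suc d)
  have "(\<Sum>j\<le>Suc d. (- 1) ^ j * c j) = c 0 - (\<Sum>j\<le>d. (- 1) ^ j * c (Suc j))"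
    by (simp only: sum.atMost_Suc_shift) (simp add: sum_negf)
  moreover have "0 \<le> (\<Sum>j\<le>d. (- 1) ^ j * c (Suc j)) \<and> (\<Sum>j\<le>d. (- 1) ^ j * c (Suc j)) \<le> c (Suc 0)"
    using Suc.IH[of "\<lambda>j. c (Suc j)"] Suc.prems by simp
  moreover have "c (Suc 0) \<le> c 0" by (rule Suc.prems(2))
  ultimately show ?case by linarith
qed simp

section \<open>Points that are zeros independently\<close>

lemma choose_ratio_step:
  assumes "Q > 0"
  shows "real (Q choose Suc j) * fact (Suc j) / real Q ^ Suc j
    = real (Q choose j) * fact j / real Q ^ j * (1 - real j / real Q)"
proof (cases "j \<le> Q")
  case True
  have "Suc j * (Q choose Suc j) = (Q - j) * (Q choose j)"
    by (simp only: binomial_absorption binomial_absorb_comp)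
  then have "real (Suc j) * real (Q choose Suc j) = (real Q - real j) * real (Q choose j)"
    using True by (metis of_nat_mult of_nat_diff)
  have "real (Q choose Suc j) * fact (Suc j) = (real (Suc j) * real (Q choose Suc j)) * fact j"
    unfolding fact_Suc of_nat_mult by (simp only: ac_simps)
  also have "\<dots> = (real Q - real j) * (real (Q choose j) * fact j)"
    unfolding \<open>real (Suc j) * real (Q choose Suc j) = (real Q - real j) * real (Q choose j)\<close> by (simp only: ac_simps)
  finally have "real (Q choose Suc j) * fact (Suc j) = (real Q - real j) * (real (Q choose j) * fact j)" .
  then show ?thesis using assms by (simp add: divide_simps)
qed (simp add: binomial_eq_0)

lemma choose_ratio:
  assumes "Q > 0"
  shows "real (Q choose j) / real Q ^ j \<le> 1 / fact j"
    and "1 / fact j - real (Q choose j) / real Q ^ j \<le> real (j * (j - 1)) / (2 * fact j) / real Q"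
proof -
  let ?r = "\<lambda>j. real (Q choose j) * fact j / real Q ^ j"
  have r: "0 \<le> ?r j \<and> ?r j \<le> 1 \<and> 1 - ?r j \<le> real (j * (j - 1)) / 2 / real Q" for j
  proof (induction j)
    case (Suc j)
    have step: "?r (Suc j) = ?r j - ?r j * (real j / real Q)"
      using choose_ratio_step[OF assms, of j] by (simp add: right_diff_distrib)
    have "?r j * (real j / real Q) \<le> 1 * (real j / real Q)" using Suc.IH by (intro mult_right_mono) auto
    moreover have "0 \<le> ?r j * (real j / real Q)" using Suc.IH by (intro mult_nonneg_nonneg) auto
    moreover have "real (Suc j * (Suc j - 1)) / 2 / real Q = real (j * (j - 1)) / 2 / real Q + real j / real Q"
      using assms by (cases j) (simp_all add: field_simps)
    moreover have "0 \<le> ?r (Suc j)" by simp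
    ultimately show ?case using Suc.IH step by linarith
  qed simp
  have e: "real (Q choose j) / real Q ^ j = ?r j * (1 / fact j)" by simp
  show "real (Q choose j) / real Q ^ j \<le> 1 / fact j"
    unfolding e using mult_right_mono[of "?r j" 1 "1 / fact j"] r[of j] by simp
  have "1 / fact j - real (Q choose j) / real Q ^ j = (1 - ?r j) * (1 / fact j)"
    by (simp add: diff_divide_distrib)
  also have "\<dots> \<le> real (j * (j - 1)) / 2 / real Q * (1 / fact j)"
    using r[of j] by (intro mult_right_mono) auto
  also have "\<dots> = real (j * (j - 1)) / (2 * fact j) / real Q" by (simp add: field_simps)
  finally show "1 / fact j - real (Q choose j) / real Q ^ j \<le> real (j * (j - 1)) / (2 * fact j) / real Q" .
qed

definition emptiness :: "nat \<Rightarrow> nat \<Rightarrow> real" where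
  "emptiness d Q = (\<Sum>j\<le>d. (- 1) ^ j * (real (Q choose j) / real Q ^ j))"

lemma emptiness_bounds: assumes "Q > 0" shows "0 \<le> emptiness d Q" "emptiness d Q \<le> 1"
proof -
  have "real (Q choose Suc j) / real Q ^ Suc j \<le> real (Q choose j) / real Q ^ j" for j
  proof -
    have "Q choose Suc j \<le> (Q choose j) * Q"
    proof -
      have "Q choose Suc j \<le> Suc j * (Q choose Suc j)" by simp
      also have "\<dots> = (Q - j) * (Q choose j)" by (simp only: binomial_absorption binomial_absorb_comp)
      also have "\<dots> \<le> (Q choose j) * Q" by (simp add: mult.commute)
      finally show ?thesis .
    qed
    then have "real (Q choose Suc j) \<le> real (Q choose j) * real Q" by (metis of_nat_le_iff of_nat_mult)
    then show ?thesis using assms by (simp add: divide_simps mult.commute mult.left_commute)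
  qed
  from alternating_sum_bounds[of "\<lambda>j. real (Q choose j) / real Q ^ j" d, OF _ this]
  show "0 \<le> emptiness d Q" "emptiness d Q \<le> 1" by (simp_all add: emptiness_def)
qed

lemma emptiness_mu: assumes Q: "Q > 0" and d: "d \<ge> 3" shows "\<bar>emptiness d Q - (1 - mu d)\<bar> \<le> 2 / real Q"
proof -
  have "\<bar>emptiness d Q - (1 - mu d)\<bar> = \<bar>\<Sum>j\<le>d. (- 1) ^ j * (real (Q choose j) / real Q ^ j - 1 / fact j)\<bar>"
    unfolding emptiness_def one_minus_mu by (simp add: sum_subtractf right_diff_distrib)
  also have "\<dots> \<le> (\<Sum>j\<le>d. \<bar>(- 1) ^ j * (real (Q choose j) / real Q ^ j - 1 / fact j)\<bar>)" by (rule sum_abs)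
  also have "\<dots> \<le> (\<Sum>j\<le>d. real (j * (j - 1)) / (2 * fact j) / real Q)"
  proof (rule sum_mono)
    fix j
    have "\<bar>(- 1) ^ j * (real (Q choose j) / real Q ^ j - 1 / fact j)\<bar> = \<bar>real (Q choose j) / real Q ^ j - 1 / fact j\<bar>"
      by (simp add: abs_mult power_abs[symmetric])
    then show "\<bar>(- 1) ^ j * (real (Q choose j) / real Q ^ j - 1 / fact j)\<bar> \<le> real (j * (j - 1)) / (2 * fact j) / real Q"
      using choose_ratio[OF Q, of j] by linarith
  qed
  also have "\<dots> = (\<Sum>j\<le>d. real (j * (j - 1)) / fact j) / 2 / real Q"
    by (simp add: sum_divide_distrib mult.commute mult.left_commute)
  also have "(\<Sum>j\<le>d. real (j * (j - 1)) / fact j) \<le> 3"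
  proof -
    have e: "(\<Sum>j\<le>Suc (Suc m). real (j * (j - 1)) / fact j) = (\<Sum>i\<le>m. 1 / fact i)" for m
    proof -
      have "real (Suc (Suc i) * (Suc (Suc i) - 1)) / fact (Suc (Suc i)) = 1 / fact i" for i
      proof -
        have 1: "fact (Suc (Suc i)) = real (Suc (Suc i) * Suc i) * (fact i :: real)"
          unfolding fact_Suc of_nat_mult by (simp only: mult.assoc)
        have 2: "Suc (Suc i) * (Suc (Suc i) - 1) = Suc (Suc i) * Suc i" by simp
        have 3: "real (Suc (Suc i) * Suc i) \<noteq> 0" unfolding of_nat_eq_0_iff by simp
        show ?thesis unfolding 1 2 by (rule nonzero_divide_mult_cancel_left[OF 3])
      qed
      then show ?thesis by (simp only: sum.atMost_Suc_shift) simp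
    qed
    have "d = Suc (Suc (d - 2))" using d by simp
    then have "(\<Sum>j\<le>d. real (j * (j - 1)) / fact j) = (\<Sum>i\<le>d - 2. 1 / fact i)" using e[of "d - 2"] by simp
    also have "\<dots> \<le> 3 - 1 / fact (d - 2)" using d by (intro sum_inverse_fact_le) simp
    also have "\<dots> \<le> 3" by simp
    finally show ?thesis .
  qed
  finally show ?thesis using Q by (simp add: divide_simps)
qed

lemma sum_subsets_by_card:
  fixes w :: "nat \<Rightarrow> real"
  assumes S: "finite S" and Z: "Z \<subseteq> S"
  shows "(\<Sum>T | T \<subseteq> S \<and> card T \<le> D. w (card T) * of_bool (T \<subseteq> Z)) = (\<Sum>j\<le>D. w j * real (card Z choose j))"
proof -
  let ?A = "{T. T \<subseteq> S \<and> card T \<le> D}"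
  have fin: "finite ?A" by (rule finite_subset[of _ "Pow S"]) (use S in auto)
  have "(\<Sum>T\<in>?A. w (card T) * of_bool (T \<subseteq> Z))
      = (\<Sum>j\<le>D. \<Sum>T | T \<in> ?A \<and> card T = j. w (card T) * of_bool (T \<subseteq> Z))"
    by (rule sum.group[symmetric]) (use fin in auto)
  also have "\<dots> = (\<Sum>j\<le>D. w j * real (card Z choose j))"
  proof (rule sum.cong[OF refl])
    fix j assume j: "j \<in> {..D}"
    have "(\<Sum>T | T \<in> ?A \<and> card T = j. w (card T) * of_bool (T \<subseteq> Z)) = (\<Sum>T | T \<subseteq> Z \<and> card T = j. w j)"
    proof (rule sum.mono_neutral_cong_right)
      show "finite {T. T \<in> ?A \<and> card T = j}" by (rule finite_subset[OF _ fin]) auto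
    qed (use j Z in auto)
    also have "\<dots> = w j * real (card Z choose j)"
      using n_subsets[OF finite_subset[OF Z S], of j] by simp
    finally show "(\<Sum>T | T \<in> ?A \<and> card T = j. w (card T) * of_bool (T \<subseteq> Z)) = w j * real (card Z choose j)" .
  qed
  finally show ?thesis .
qed

locale strip_model =
  fixes \<F> :: "'g set" and A :: "'b set" and P :: "'p set" and Z :: "'g \<Rightarrow> 'b \<Rightarrow> 'p set" and d :: nat
  assumes F: "finite \<F>" "\<F> \<noteq> {}" and A: "finite A" and P: "finite P" "P \<noteq> {}" and d: "d \<ge> 3"
    and Z: "\<And>f a. f \<in> \<F> \<Longrightarrow> a \<in> A \<Longrightarrow> Z f a \<subseteq> P"
    and indep: "\<And>T a0. T \<subseteq> A \<times> P \<Longrightarrow> (\<And>a. a \<in> A \<Longrightarrow> card {x. (a, x) \<in> T} \<le> (if a = a0 then d + 1 else d)) \<Longrightarrow>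
      card {f \<in> \<F>. \<forall>(a, x)\<in>T. x \<in> Z f a} * card P ^ card T = card \<F>"
begin

abbreviation Q :: nat where "Q \<equiv> card P"

lemma Q: "Q > 0" using P by (simp add: card_gt_0_iff)

lemma moments:
  assumes D: "\<And>a. a \<in> A \<Longrightarrow> D a \<le> (if a = a0 then d + 1 else d)"
  shows "(\<Sum>f\<in>\<F>. \<Prod>a\<in>A. \<Sum>j\<le>D a. w a j * real (card (Z f a) choose j))
    = real (card \<F>) * (\<Prod>a\<in>A. \<Sum>j\<le>D a. w a j * (real (Q choose j) / real Q ^ j))"
proof -
  let ?S = "\<lambda>a. {T. T \<subseteq> P \<and> card T \<le> D a}"
  have finS: "finite (?S a)" for a by (rule finite_subset[of _ "Pow P"]) (use P in auto)
  have "(\<Sum>f\<in>\<F>. \<Prod>a\<in>A. \<Sum>j\<le>D a. w a j * real (card (Z f a) choose j))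
      = (\<Sum>f\<in>\<F>. \<Prod>a\<in>A. \<Sum>T\<in>?S a. w a (card T) * of_bool (T \<subseteq> Z f a))"
    using Z by (intro sum.cong prod.cong refl sum_subsets_by_card[OF P(1), symmetric]) auto
  also have "\<dots> = (\<Sum>f\<in>\<F>. \<Sum>\<tau>\<in>PiE A ?S. \<Prod>a\<in>A. w a (card (\<tau> a)) * of_bool (\<tau> a \<subseteq> Z f a))"
    by (intro sum.cong refl prod_sum_PiE A finS)
  also have "\<dots> = (\<Sum>\<tau>\<in>PiE A ?S. \<Sum>f\<in>\<F>. \<Prod>a\<in>A. w a (card (\<tau> a)) * of_bool (\<tau> a \<subseteq> Z f a))"
    by (rule sum.swap)
  also have "\<dots> = (\<Sum>\<tau>\<in>PiE A ?S. real (card \<F>) * (\<Prod>a\<in>A. w a (card (\<tau> a)) / real Q ^ card (\<tau> a) * of_bool (\<tau> a \<subseteq> P)))"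
  proof (rule sum.cong[OF refl])
    fix \<tau> assume \<tau>: "\<tau> \<in> PiE A ?S"
    then have \<tau>P: "\<tau> a \<subseteq> P" "card (\<tau> a) \<le> D a" if "a \<in> A" for a using that by (auto dest: PiE_mem)
    let ?T = "Sigma A \<tau>"
    have fin: "finite (\<tau> a)" if "a \<in> A" for a using \<tau>P(1)[OF that] P(1) finite_subset by blast
    have T: "?T \<subseteq> A \<times> P" using \<tau>P by blast
    have few: "card {x. (a, x) \<in> ?T} \<le> (if a = a0 then d + 1 else d)" if a: "a \<in> A" for a
    proof -
      have "{x. (a, x) \<in> ?T} = \<tau> a" using a by auto
      then show ?thesis using \<tau>P(2)[OF a] D[OF a] by simp
    qed
    have prod: "(\<Prod>a\<in>A. of_bool (\<tau> a \<subseteq> Z f a)) = (of_bool (\<forall>(a, x)\<in>?T. x \<in> Z f a) :: real)" for f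
    proof (cases "\<forall>a\<in>A. \<tau> a \<subseteq> Z f a")
      case True
      then show ?thesis by (auto intro!: prod.neutral)
    next
      case False
      then have "(\<Prod>a\<in>A. of_bool (\<tau> a \<subseteq> Z f a) :: real) = 0" using A by (intro prod_zero) auto
      moreover have "\<not> (\<forall>(a, x)\<in>?T. x \<in> Z f a)" using False by auto
      ultimately show ?thesis by simp
    qed
    have "(\<Sum>f\<in>\<F>. \<Prod>a\<in>A. w a (card (\<tau> a)) * of_bool (\<tau> a \<subseteq> Z f a))
        = (\<Sum>f\<in>\<F>. (\<Prod>a\<in>A. w a (card (\<tau> a))) * of_bool (\<forall>(a, x)\<in>?T. x \<in> Z f a))"
      unfolding prod.distrib prod ..
    also have "\<dots> = (\<Prod>a\<in>A. w a (card (\<tau> a))) * real (card {f \<in> \<F>. \<forall>(a, x)\<in>?T. x \<in> Z f a})"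
      using F(1) by (simp add: sum_distrib_left[symmetric] Int_def)
    also have "real (card {f \<in> \<F>. \<forall>(a, x)\<in>?T. x \<in> Z f a}) = real (card \<F>) / real Q ^ card ?T"
      using arg_cong[OF indep[OF T few], of real] Q by (simp add: field_simps)
    also have "card ?T = (\<Sum>a\<in>A. card (\<tau> a))" using A fin by (intro card_SigmaI) auto
    also have "real Q ^ (\<Sum>a\<in>A. card (\<tau> a)) = (\<Prod>a\<in>A. real Q ^ card (\<tau> a))" by (rule power_sum)
    also have "(\<Prod>a\<in>A. w a (card (\<tau> a))) * (real (card \<F>) / (\<Prod>a\<in>A. real Q ^ card (\<tau> a)))
        = real (card \<F>) * (\<Prod>a\<in>A. w a (card (\<tau> a)) / real Q ^ card (\<tau> a))"
      by (simp add: prod_dividef)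
    also have "(\<Prod>a\<in>A. w a (card (\<tau> a)) / real Q ^ card (\<tau> a))
        = (\<Prod>a\<in>A. w a (card (\<tau> a)) / real Q ^ card (\<tau> a) * of_bool (\<tau> a \<subseteq> P))"
      using \<tau>P by (intro prod.cong refl) simp
    finally show "(\<Sum>f\<in>\<F>. \<Prod>a\<in>A. w a (card (\<tau> a)) * of_bool (\<tau> a \<subseteq> Z f a))
        = real (card \<F>) * (\<Prod>a\<in>A. w a (card (\<tau> a)) / real Q ^ card (\<tau> a) * of_bool (\<tau> a \<subseteq> P))" .
  qed
  also have "\<dots> = real (card \<F>) * (\<Prod>a\<in>A. \<Sum>T\<in>?S a. w a (card T) / real Q ^ card T * of_bool (T \<subseteq> P))"
    by (simp only: sum_distrib_left[symmetric] prod_sum_PiE[OF A finS])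
  also have "(\<Prod>a\<in>A. \<Sum>T\<in>?S a. w a (card T) / real Q ^ card T * of_bool (T \<subseteq> P))
      = (\<Prod>a\<in>A. \<Sum>j\<le>D a. w a j / real Q ^ j * real (Q choose j))"
    by (intro prod.cong refl sum_subsets_by_card[OF P(1)]) simp
  finally show ?thesis by simp
qed

lemma no_zero_probability:
  "\<bar>real (card {f \<in> \<F>. \<forall>a\<in>A. Z f a = {}}) / real (card \<F>) - emptiness d Q ^ card A\<bar>
    \<le> real (card A) * (1 / fact (d + 1) * (1 + 1 / fact d) ^ (card A - 1))"
proof -
  let ?N = "\<lambda>f a. card (Z f a)"
  let ?x = "\<lambda>f a. of_bool (?N f a = 0) :: real" and ?y = "\<lambda>f a. bonferroni d (?N f a)"
    and ?U = "\<lambda>f a. 1 + real (?N f a choose d)"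
  have cF: "real (card \<F>) > 0" using F by (simp add: card_gt_0_iff)
  have finZ: "finite (Z f a)" if "f \<in> \<F>" "a \<in> A" for f a using Z[OF that] P(1) finite_subset by blast
  have "(\<Sum>f\<in>\<F>. \<Prod>a\<in>A. ?x f a) = (\<Sum>f\<in>\<F>. of_bool (\<forall>a\<in>A. Z f a = {}))"
  proof (rule sum.cong[OF refl])
    fix f assume f: "f \<in> \<F>"
    show "(\<Prod>a\<in>A. ?x f a) = of_bool (\<forall>a\<in>A. Z f a = {})"
    proof (cases "\<forall>a\<in>A. Z f a = {}")
      case False
      then obtain a where "a \<in> A" "Z f a \<noteq> {}" by blast
      then have "a \<in> A \<and> ?x f a = 0" using finZ[OF f] by simp
      then have "(\<Prod>a\<in>A. ?x f a) = 0" using A by (intro prod_zero) blast+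
      then show ?thesis using False by simp
    qed simp
  qed
  also have "\<dots> = real (card {f \<in> \<F>. \<forall>a\<in>A. Z f a = {}})" using F(1) by (simp add: Int_def)
  finally have x: "(\<Sum>f\<in>\<F>. \<Prod>a\<in>A. ?x f a) = real (card {f \<in> \<F>. \<forall>a\<in>A. Z f a = {}})" .
  have y: "(\<Sum>f\<in>\<F>. \<Prod>a\<in>A. ?y f a) = real (card \<F>) * emptiness d Q ^ card A"
    using moments[of "\<lambda>_. d" undefined "\<lambda>_ j. (- 1) ^ j"] by (simp add: bonferroni_def emptiness_def)
  have "\<bar>(\<Sum>f\<in>\<F>. \<Prod>a\<in>A. ?x f a) - (\<Sum>f\<in>\<F>. \<Prod>a\<in>A. ?y f a)\<bar>
      \<le> (\<Sum>f\<in>\<F>. \<bar>(\<Prod>a\<in>A. ?x f a) - (\<Prod>a\<in>A. ?y f a)\<bar>)"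
    unfolding sum_subtractf[symmetric] by (rule sum_abs)
  also have "\<dots> \<le> (\<Sum>f\<in>\<F>. \<Sum>i\<in>A. real (?N f i choose (d + 1)) * (\<Prod>a\<in>A - {i}. ?U f a))"
  proof (rule sum_mono)
    fix f assume f: "f \<in> \<F>"
    have "\<bar>(\<Prod>a\<in>A. ?x f a) - (\<Prod>a\<in>A. ?y f a)\<bar> \<le> (\<Sum>i\<in>A. \<bar>?x f i - ?y f i\<bar> * (\<Prod>a\<in>A - {i}. ?U f a))"
      using A by (intro abs_prod_diff_le abs_bonferroni_le) auto
    also have "\<dots> \<le> (\<Sum>i\<in>A. real (?N f i choose (d + 1)) * (\<Prod>a\<in>A - {i}. ?U f a))"
      by (intro sum_mono mult_right_mono bonferroni_error prod_nonneg) auto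
    finally show "\<bar>(\<Prod>a\<in>A. ?x f a) - (\<Prod>a\<in>A. ?y f a)\<bar> \<le> (\<Sum>i\<in>A. real (?N f i choose (d + 1)) * (\<Prod>a\<in>A - {i}. ?U f a))" .
  qed
  also have "\<dots> = (\<Sum>i\<in>A. \<Sum>f\<in>\<F>. real (?N f i choose (d + 1)) * (\<Prod>a\<in>A - {i}. ?U f a))" by (rule sum.swap)
  also have "\<dots> \<le> (\<Sum>i\<in>A. real (card \<F>) * (1 / fact (d + 1) * (1 + 1 / fact d) ^ (card A - 1)))"
  proof (rule sum_mono)
    fix i assume i: "i \<in> A"
    let ?w = "\<lambda>a j. if a = i then of_bool (j = d + 1) else of_bool (j = 0) + of_bool (j = d) :: real"
    let ?D = "\<lambda>a. if a = i then d + 1 else d"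
    have wsum: "(\<Sum>j\<le>?D a. ?w a j * h j) = (if a = i then h (d + 1) else h 0 + h d)" for a and h :: "nat \<Rightarrow> real"
    proof (cases "a = i")
      case True
      have "(\<Sum>j\<le>d + 1. of_bool (j = d + 1) * h j) = h (d + 1)"
        by (simp add: of_bool_def if_distrib[of "\<lambda>c. c * _"] cong: if_cong)
      then show ?thesis using True by simp
    next
      case False
      have "(\<Sum>j\<le>d. of_bool (j = 0) * h j) = h 0" "(\<Sum>j\<le>d. of_bool (j = d) * h j) = h d"
        by (simp_all add: of_bool_def if_distrib[of "\<lambda>c. c * _"] sum.delta cong: if_cong)
      then show ?thesis using False by (simp add: distrib_right sum.distrib)
    qed
    have split: "(\<Prod>a\<in>A. if a = i then u else h a) = u * (\<Prod>a\<in>A - {i}. h a)" for u and h :: "'b \<Rightarrow> real"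
    proof -
      have "(\<Prod>a\<in>A. if a = i then u else h a) = u * (\<Prod>a\<in>A - {i}. if a = i then u else h a)"
        using prod.remove[OF A i, of "\<lambda>a. if a = i then u else h a"] by simp
      also have "(\<Prod>a\<in>A - {i}. if a = i then u else h a) = (\<Prod>a\<in>A - {i}. h a)" by (rule prod.cong) auto
      finally show ?thesis .
    qed
    have "(\<Sum>f\<in>\<F>. real (?N f i choose (d + 1)) * (\<Prod>a\<in>A - {i}. ?U f a))
        = (\<Sum>f\<in>\<F>. \<Prod>a\<in>A. \<Sum>j\<le>?D a. ?w a j * real (?N f a choose j))"
    proof (rule sum.cong[OF refl])
      fix f
      have "(\<Prod>a\<in>A. \<Sum>j\<le>?D a. ?w a j * real (?N f a choose j))
          = (\<Prod>a\<in>A. if a = i then real (?N f i choose (d + 1)) else ?U f a)"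
        unfolding wsum by (intro prod.cong refl) simp
      then show "real (?N f i choose (d + 1)) * (\<Prod>a\<in>A - {i}. ?U f a) = (\<Prod>a\<in>A. \<Sum>j\<le>?D a. ?w a j * real (?N f a choose j))"
        unfolding split by simp
    qed
    also have "\<dots> = real (card \<F>) * (\<Prod>a\<in>A. \<Sum>j\<le>?D a. ?w a j * (real (Q choose j) / real Q ^ j))"
      by (rule moments[of ?D i]) simp
    also have "(\<Prod>a\<in>A. \<Sum>j\<le>?D a. ?w a j * (real (Q choose j) / real Q ^ j))
        = (\<Prod>a\<in>A. if a = i then real (Q choose (d + 1)) / real Q ^ (d + 1) else 1 + real (Q choose d) / real Q ^ d)"
      unfolding wsum by (intro prod.cong refl) simp
    also have "\<dots> = real (Q choose (d + 1)) / real Q ^ (d + 1) * (1 + real (Q choose d) / real Q ^ d) ^ (card A - 1)"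
      unfolding split using A i by simp
    also have "\<dots> \<le> 1 / fact (d + 1) * (1 + 1 / fact d) ^ (card A - 1)"
      by (intro mult_mono power_mono add_left_mono choose_ratio(1)[OF Q]) auto
    finally show "(\<Sum>f\<in>\<F>. real (?N f i choose (d + 1)) * (\<Prod>a\<in>A - {i}. ?U f a))
        \<le> real (card \<F>) * (1 / fact (d + 1) * (1 + 1 / fact d) ^ (card A - 1))"
      using cF by (simp add: mult_left_mono)
  qed
  finally have "\<bar>real (card {f \<in> \<F>. \<forall>a\<in>A. Z f a = {}}) - real (card \<F>) * emptiness d Q ^ card A\<bar>
      \<le> real (card \<F>) * (real (card A) * (1 / fact (d + 1) * (1 + 1 / fact d) ^ (card A - 1)))"
    unfolding x y by (simp add: mult.left_commute)
  then have "\<bar>real (card {f \<in> \<F>. \<forall>a\<in>A. Z f a = {}}) - real (card \<F>) * emptiness d Q ^ card A\<bar> / real (card \<F>)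
      \<le> real (card A) * (1 / fact (d + 1) * (1 + 1 / fact d) ^ (card A - 1))"
    using cF by (simp add: pos_divide_le_eq mult.commute)
  moreover have "\<bar>real (card {f \<in> \<F>. \<forall>a\<in>A. Z f a = {}}) - real (card \<F>) * emptiness d Q ^ card A\<bar> / real (card \<F>)
      = \<bar>real (card {f \<in> \<F>. \<forall>a\<in>A. Z f a = {}}) / real (card \<F>) - emptiness d Q ^ card A\<bar>"
  proof -
    have "real (card {f \<in> \<F>. \<forall>a\<in>A. Z f a = {}}) / real (card \<F>) - emptiness d Q ^ card A
        = (real (card {f \<in> \<F>. \<forall>a\<in>A. Z f a = {}}) - real (card \<F>) * emptiness d Q ^ card A) / real (card \<F>)"
      using cF by (simp add: diff_divide_distrib)
    then show ?thesis using cF by (simp add: abs_divide)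
  qed
  ultimately show ?thesis by simp
qed

end

lemma growth_le_exp: "real k * ((7 / 6) ^ (k - 1) + 1) \<le> exp 1 ^ k"
proof -
  have e: "exp 1 \<ge> (5 / 2 :: real)" using exp_lower_Taylor_quadratic[of 1] by simp
  have "k \<ge> 1 \<Longrightarrow> real k * ((7 / 6) ^ (k - 1) + 1) \<le> exp 1 ^ k"
  proof (induction k rule: nat_induct_at_least)
    case base
    then show ?case using e by simp
  next
    case (Suc k)
    let ?p = "(7 / 6 :: real) ^ (k - 1)"
    have p: "(7 / 6 :: real) ^ k = 7 / 6 * ?p" using Suc.hyps by (cases k) simp_all
    have "real (Suc k) * ((7 / 6) ^ (Suc k - 1) + 1) \<le> (2 * real k) * (7 / 6 * (?p + 1))"
      using Suc.hyps by (intro mult_mono) (simp_all add: p)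
    also have "\<dots> = (7 / 3) * (real k * (?p + 1))" by simp
    also have "\<dots> \<le> exp 1 * exp 1 ^ k" using e Suc.IH by (intro mult_mono) auto
    finally show ?case by simp
  qed
  then show ?thesis by (cases "k = 0") auto
qed

text \<open>The probability that none of \<open>k\<close> strips in general position contains a rational zero.\<close>

lemma (in strip_model) no_zero_probability_mu:
  assumes m: "m = d \<or> m = d + 1"
  shows "\<bar>real (card {f \<in> \<F>. \<forall>a\<in>A. Z f a = {}}) / real (card \<F>) - (1 - mu m) ^ card A\<bar>
    \<le> exp 1 ^ card A / fact (d + 1) + 2 * real (card A) / real Q"
proof -
  let ?k = "card A"
  have "\<bar>(1 - mu m) - (1 - mu d)\<bar> \<le> 1 / fact (d + 1)"
    using m mu_diff_Suc[of d] by auto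
  then have diff: "\<bar>emptiness d Q - (1 - mu m)\<bar> \<le> 2 / real Q + 1 / fact (d + 1)"
    using emptiness_mu[OF Q d] by linarith
  have "m \<ge> 2" using m d by auto
  then have "\<bar>1 - mu m\<bar> \<le> 1" using mu_bounds[of m] by simp
  moreover have "\<bar>emptiness d Q\<bar> \<le> 1" using emptiness_bounds[OF Q, of d] by simp
  ultimately have "\<bar>emptiness d Q ^ ?k - (1 - mu m) ^ ?k\<bar> \<le> real ?k * \<bar>emptiness d Q - (1 - mu m)\<bar>"
    by (intro abs_power_diff_le)
  also have "\<dots> \<le> real ?k * (2 / real Q + 1 / fact (d + 1))" using diff by (intro mult_left_mono) auto
  finally have 1: "\<bar>emptiness d Q ^ ?k - (1 - mu m) ^ ?k\<bar> \<le> real ?k * (2 / real Q + 1 / fact (d + 1))" .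
  have "(fact 3 :: real) \<le> fact d" by (rule fact_mono[OF d])
  moreover have "(fact 3 :: real) = 6" by (simp add: numeral_3_eq_3)
  ultimately have six: "(6::real) \<le> fact d" by linarith
  have "1 / fact d \<le> (1 / 6 :: real)" by (rule frac_le) (use six in simp_all)
  then have "1 + 1 / fact d \<le> (7 / 6 :: real)" by linarith
  then have "real ?k * (1 / fact (d + 1) * (1 + 1 / fact d) ^ (?k - 1)) \<le> real ?k * (1 / fact (d + 1) * (7 / 6) ^ (?k - 1))"
    by (intro mult_left_mono power_mono) auto
  then have "\<bar>real (card {f \<in> \<F>. \<forall>a\<in>A. Z f a = {}}) / real (card \<F>) - (1 - mu m) ^ ?k\<bar>
      \<le> real ?k * (1 / fact (d + 1) * (7 / 6) ^ (?k - 1)) + real ?k * (2 / real Q + 1 / fact (d + 1))"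
    using no_zero_probability 1 by linarith
  also have "\<dots> = real ?k * ((7 / 6) ^ (?k - 1) + 1) / fact (d + 1) + 2 * real ?k / real Q"
  proof -
    have "k * (1 / f * p) + k * (2 / q + 1 / f) = k * (p + 1) / f + 2 * k / q" for k f p q :: real
      by (simp add: ring_distribs add_divide_distrib)
    then show ?thesis .
  qed
  also have "\<dots> \<le> exp 1 ^ ?k / fact (d + 1) + 2 * real ?k / real Q"
    using growth_le_exp[of ?k] by (intro add_right_mono divide_right_mono) auto
  finally show ?thesis .
qed

section \<open>The algorithm\<close>

lemma svs_fails: "fst (svs f as) = None \<longleftrightarrow> (\<forall>a\<in>set as. fst (f a) = None)"
  by (induction as) (auto split: prod.splits option.splits simp: Let_def)

lemma svs_cost:
  assumes "\<And>a. a \<in> set as \<Longrightarrow> snd (f a) \<le> t"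
  shows "snd (svs f as) \<le> t * (\<Sum>i<length as. if \<forall>a\<in>set (take i as). fst (f a) = None then 1 else 0)"
  using assms
proof (induction as)
  case (Cons b as)
  let ?g = "\<lambda>i. if \<forall>a\<in>set (take i as). fst (f a) = None then 1 else 0 :: nat"
  have IH: "snd (svs f as) \<le> t * (\<Sum>i<length as. ?g i)" and b: "snd (f b) \<le> t"
    using Cons by auto
  have split: "(\<Sum>i<length (b # as). if \<forall>a\<in>set (take i (b # as)). fst (f a) = None then 1 else 0 :: nat)
      = 1 + (\<Sum>i<length as. if fst (f b) = None then ?g i else 0)"
    by (simp only: list.size(4) add_Suc_right add_0_right sum.lessThan_Suc_shift take_Suc_Cons) (auto intro!: sum.cong)
  show ?case
  proof (cases "fst (f b)")
    case None
    then have "snd (svs f (b # as)) = snd (f b) + snd (svs f as)"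
      by (auto split: prod.splits option.splits simp: Let_def)
    then show ?thesis using IH b None unfolding split by (simp add: algebra_simps)
  next
    case (Some x)
    then have "snd (svs f (b # as)) = snd (f b)" by (auto split: prod.splits option.splits)
    then show ?thesis using b Some unfolding split by simp
  qed
qed simp

lemma average_le:
  fixes f :: "'x \<Rightarrow> real"
  assumes T: "finite T" "T \<noteq> {}" "G \<subseteq> T" and few: "real (card (T - G)) \<le> \<delta> * real (card T)"
    and G: "\<And>x. x \<in> G \<Longrightarrow> f x \<le> u" and all: "\<And>x. x \<in> T \<Longrightarrow> f x \<le> u + M" and M: "0 \<le> M"
  shows "(\<Sum>x\<in>T. f x) / real (card T) \<le> u + M * \<delta>"
proof -
  have "(\<Sum>x\<in>T. f x) \<le> (\<Sum>x\<in>T. u + (if x \<in> T - G then M else 0))"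
    by (rule sum_mono) (use G all in auto)
  also have "\<dots> = real (card T) * u + M * real (card (T - G))"
    using T by (simp add: sum.distrib sum.If_cases Int_absorb1 mult.commute set_diff_eq Int_def)
  also have "\<dots> \<le> real (card T) * u + M * (\<delta> * real (card T))"
    using few M by (intro add_left_mono mult_left_mono)
  finally have "(\<Sum>x\<in>T. f x) \<le> (u + M * \<delta>) * real (card T)" by (simp add: algebra_simps)
  moreover have "real (card T) > 0" using T by (simp add: card_gt_0_iff)
  ultimately show ?thesis by (simp add: divide_le_eq)
qed

locale svs_setting =
  fixes L :: "'a ring" and K :: "'a set" and r s d t :: nat
    and solver :: "('a, 'w) zero_solver" and spec_cost and \<Omega> :: "'w set" and c :: real
  assumes stats: "strip_statistics L K r s d" and s: "1 < s" "s < r" "s < d" and K: "finite K" "K \<noteq> {}"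
    and \<Omega>: "finite \<Omega>" "\<Omega> \<noteq> {}"
    and true_zeros: "outputs_true_zeros L K r s d solver \<Omega>"
    and reliable: "solver_reliable L K r s d t solver spec_cost \<Omega> c"
begin

abbreviation "S \<equiv> systems L K {1..r} s d"
abbreviation "B \<equiv> {r-s+1..r} \<rightarrow>\<^sub>E K"
abbreviation "q \<equiv> card K"
abbreviation "h \<equiv> r - s + 1"
abbreviation "tuples_rep \<equiv> {as. length as = h \<and> set as \<subseteq> strips K r s}"
abbreviation "tuples \<equiv> strip_tuples K r s h"
abbreviation "Z F a \<equiv> rational_zeros L K r s (specialize L r s F a)"
abbreviation "fails z a \<equiv> fst (strip_search L r s t solver spec_cost (fst z) (snd z) a) = None"

lemma S: "finite S" "S \<noteq> {}" using stats by (simp_all add: strip_statistics_def Let_def)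
lemma q: "q > 0" using K by (simp add: card_gt_0_iff)
lemma n: "real (card S) > 0" "real (card \<Omega>) > 0" using S \<Omega> by (simp_all add: card_gt_0_iff)
lemma finite_strips: "finite (strips K r s)" using K by (simp add: strips_def finite_PiE)
lemma finite_lists: "finite tuples_rep"
  using finite_lists_length_eq[OF finite_strips, of h] by (simp add: conj_commute)

lemma fails_if_no_zero:
  assumes "F \<in> S" "a \<in> strips K r s" "\<omega> \<in> \<Omega>" "Z F a = {}"
  shows "fails (F, \<omega>) a"
proof -
  have "specialize L r s F a \<in> systems L K {r-s+1..r} s d"
    using stats assms(1,2) by (simp add: strip_statistics_def Let_def)
  then have "fst (solver (specialize L r s F a) \<omega>) = None"
    using true_zeros assms(3,4) unfolding outputs_true_zeros_def
    by (cases "fst (solver (specialize L r s F a) \<omega>)") auto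
  then show ?thesis by (auto simp: strip_search_def Let_def split: prod.splits)
qed

lemma search_cost: "snd (strip_search L r s t solver spec_cost F \<omega> a) \<le> t"
  by (auto simp: strip_search_def Let_def split: prod.splits)

definition \<beta> :: real where "\<beta> = 2 * (real d + 1) ^ (2 * s + 1) + \<bar>c\<bar>"

lemma \<beta>: "\<beta> \<ge> 0" by (simp add: \<beta>_def)

text \<open>Zeros are overlooked for the exceptional systems, and by bad luck of the solver.\<close>

lemma card_overlooked:
  assumes a: "a \<in> strips K r s"
  shows "real (card {z \<in> S \<times> \<Omega>. Z (fst z) a \<noteq> {} \<and> fails z a}) \<le> \<beta> / real q * (real (card S) * real (card \<Omega>))"
proof -
  let ?bad = "{F \<in> S. \<not> cond_H L r s (specialize L r s F a)}"
  let ?W = "\<lambda>F. {\<omega> \<in> \<Omega>. Z F a \<noteq> {} \<and> fails (F, \<omega>) a}"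
  have "{z \<in> S \<times> \<Omega>. Z (fst z) a \<noteq> {} \<and> fails z a} = Sigma S ?W" by auto
  then have "real (card {z \<in> S \<times> \<Omega>. Z (fst z) a \<noteq> {} \<and> fails z a}) = (\<Sum>F\<in>S. real (card (?W F)))"
    using S \<Omega> by (simp add: card_SigmaI)
  also have "\<dots> \<le> (\<Sum>F\<in>S. (if F \<in> ?bad then real (card \<Omega>) else 0) + \<bar>c\<bar> / real q * real (card \<Omega>))"
  proof (rule sum_mono)
    fix F assume F: "F \<in> S"
    show "real (card (?W F)) \<le> (if F \<in> ?bad then real (card \<Omega>) else 0) + \<bar>c\<bar> / real q * real (card \<Omega>)"
    proof (cases "F \<in> ?bad \<or> Z F a = {}")
      case True
      have "card (?W F) \<le> card \<Omega>" by (rule card_mono[OF \<Omega>(1)]) auto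
      moreover have "Z F a = {} \<Longrightarrow> card (?W F) = 0" by simp
      moreover have "0 \<le> \<bar>c\<bar> / real q * real (card \<Omega>)" by simp
      ultimately show ?thesis using True by (smt (verit, best) of_nat_0 of_nat_0_le_iff of_nat_mono)
    next
      case False
      then have "real (card {\<omega>\<in>\<Omega>. fst (strip_search L r s t solver spec_cost F \<omega> a) = None}) / real (card \<Omega>) \<le> c / real q"
        using reliable F a unfolding solver_reliable_def by auto
      moreover have "?W F = {\<omega>\<in>\<Omega>. fst (strip_search L r s t solver spec_cost F \<omega> a) = None}" using False by auto
      ultimately have "real (card (?W F)) \<le> c / real q * real (card \<Omega>)" using n by (simp add: divide_le_eq)
      also have "\<dots> \<le> \<bar>c\<bar> / real q * real (card \<Omega>)" by (intro mult_right_mono divide_right_mono) auto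
      finally show ?thesis using False by simp
    qed
  qed
  also have "\<dots> = real (card ?bad) * real (card \<Omega>) + real (card S) * (\<bar>c\<bar> / real q * real (card \<Omega>))"
    using S by (simp add: sum.distrib sum.If_cases Int_def)
  also have "\<dots> \<le> (2 * (real d + 1) ^ (2 * s + 1) / real q * real (card S)) * real (card \<Omega>) + real (card S) * (\<bar>c\<bar> / real q * real (card \<Omega>))"
  proof (intro add_right_mono mult_right_mono)
    have "card ?bad * q \<le> 2 * (d + 1) ^ (2 * s + 1) * card S"
      using stats a by (simp add: strip_statistics_def Let_def)
    then have "real (card ?bad * q) \<le> real (2 * (d + 1) ^ (2 * s + 1) * card S)" by (rule of_nat_mono)
    then have "real (card ?bad) * real q \<le> 2 * (real d + 1) ^ (2 * s + 1) * real (card S)"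
      by (simp only: of_nat_mult of_nat_power of_nat_add of_nat_1 of_nat_numeral)
    then show "real (card ?bad) \<le> 2 * (real d + 1) ^ (2 * s + 1) / real q * real (card S)"
      using q by (simp add: field_simps)
  qed simp
  also have "\<dots> = \<beta> / real q * (real (card S) * real (card \<Omega>))"
    by (simp add: \<beta>_def add_divide_distrib algebra_simps)
  finally show ?thesis .
qed

definition p :: "nat \<Rightarrow> (nat \<Rightarrow> 'a) list \<Rightarrow> real" where
  "p i as = real (card {z \<in> S \<times> \<Omega>. \<forall>a\<in>set (take i as). fails z a}) / (real (card S) * real (card \<Omega>))"

lemma p_bounds: "0 \<le> p i as" "p i as \<le> 1"
proof -
  show "0 \<le> p i as" by (simp add: p_def)
  have "card {z \<in> S \<times> \<Omega>. \<forall>a\<in>set (take i as). fails z a} \<le> card (S \<times> \<Omega>)"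
    by (rule card_mono) (use S \<Omega> in auto)
  then have "real (card {z \<in> S \<times> \<Omega>. \<forall>a\<in>set (take i as). fails z a}) \<le> real (card S) * real (card \<Omega>)"
    unfolding card_cartesian_product by (simp flip: of_nat_mult)
  then show "p i as \<le> 1" using n by (simp add: p_def divide_le_eq)
qed

text \<open>Failing in given strips is almost the same event as the absence of zeros there.\<close>

lemma p_no_zero:
  assumes as: "set as \<subseteq> strips K r s"
  shows "\<bar>p i as - real (card {F \<in> S. \<forall>a\<in>set (take i as). Z F a = {}}) / real (card S)\<bar> \<le> real i * \<beta> / real q"
proof -
  let ?A = "set (take i as)"
  let ?N = "{F \<in> S. \<forall>a\<in>?A. Z F a = {}}" and ?P = "{z \<in> S \<times> \<Omega>. \<forall>a\<in>?A. fails z a}"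
  let ?O = "\<lambda>a. {z \<in> S \<times> \<Omega>. Z (fst z) a \<noteq> {} \<and> fails z a}"
  let ?n = "real (card S) * real (card \<Omega>)"
  have A: "?A \<subseteq> strips K r s" using as set_take_subset by fast
  have fin: "finite ?N" "finite ?P" "finite (\<Union>a\<in>?A. ?O a)" using S \<Omega> by auto
  have "?N \<times> \<Omega> \<subseteq> ?P" using fails_if_no_zero A by auto
  then have "card (?N \<times> \<Omega>) \<le> card ?P" by (rule card_mono[OF fin(2)])
  then have low: "real (card ?N) * real (card \<Omega>) \<le> real (card ?P)" unfolding card_cartesian_product by (simp flip: of_nat_mult)
  have "?P \<subseteq> ?N \<times> \<Omega> \<union> (\<Union>a\<in>?A. ?O a)" by auto
  then have "card ?P \<le> card (?N \<times> \<Omega> \<union> (\<Union>a\<in>?A. ?O a))" by (rule card_mono[rotated]) (use fin \<Omega> in auto)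
  also have "\<dots> \<le> card (?N \<times> \<Omega>) + card (\<Union>a\<in>?A. ?O a)" by (rule card_Un_le)
  also have "\<dots> \<le> card (?N \<times> \<Omega>) + (\<Sum>a\<in>?A. card (?O a))" by (intro add_left_mono card_UN_le) simp
  finally have "card ?P \<le> card ?N * card \<Omega> + (\<Sum>a\<in>?A. card (?O a))" unfolding card_cartesian_product .
  then have "real (card ?P) \<le> real (card ?N * card \<Omega> + (\<Sum>a\<in>?A. card (?O a)))" by (rule of_nat_mono)
  then have "real (card ?P) \<le> real (card ?N) * real (card \<Omega>) + (\<Sum>a\<in>?A. real (card (?O a)))" by simp
  also have "(\<Sum>a\<in>?A. real (card (?O a))) \<le> real (card ?A) * (\<beta> / real q * ?n)"
    by (rule sum_bounded_above) (use card_overlooked A in auto)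
  also have "\<dots> \<le> real i * (\<beta> / real q * ?n)"
  proof (rule mult_right_mono)
    have "card ?A \<le> i" using card_length[of "take i as"] by simp
    then show "real (card ?A) \<le> real i" by simp
    show "0 \<le> \<beta> / real q * ?n" using \<beta> by simp
  qed
  finally have up: "real (card ?P) \<le> real (card ?N) * real (card \<Omega>) + real i * (\<beta> / real q * ?n)" by simp
  have "p i as - real (card ?N) / real (card S) = (real (card ?P) - real (card ?N) * real (card \<Omega>)) / ?n"
    using n by (simp add: p_def field_simps)
  moreover have "\<bar>real (card ?P) - real (card ?N) * real (card \<Omega>)\<bar> \<le> real i * \<beta> / real q * ?n"
    using low up by simp
  ultimately show ?thesis using n by (simp add: abs_divide divide_le_eq)
qed

text \<open>The tuples_rep of strips in general position.\<close>

definition Gen :: "(nat \<Rightarrow> 'a) list set" where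
  "Gen = (SOME Gen. Gen \<subseteq> tuples_rep \<and> card (tuples_rep - Gen) * q \<le> (r - s) * card tuples_rep \<and>
            (\<forall>as\<in>Gen. distinct as \<and>
               (\<forall>T a0. T \<subseteq> set as \<times> B \<longrightarrow>
                  (\<forall>a\<in>set as. card {x. (a, x) \<in> T} \<le> (if a = a0 then d + 1 else d)) \<longrightarrow>
                  card {F \<in> S. \<forall>(a, x)\<in>T. x \<in> Z F a} * card B ^ card T = card S)))"

lemma Gen: "Gen \<subseteq> tuples_rep" "card (tuples_rep - Gen) * q \<le> (r - s) * card tuples_rep"
    "\<And>as. as \<in> Gen \<Longrightarrow> distinct as"
    "\<And>as T a0. as \<in> Gen \<Longrightarrow> T \<subseteq> set as \<times> B \<Longrightarrow>
       (\<And>a. a \<in> set as \<Longrightarrow> card {x. (a, x) \<in> T} \<le> (if a = a0 then d + 1 else d)) \<Longrightarrow>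
       card {F \<in> S. \<forall>(a, x)\<in>T. x \<in> Z F a} * card B ^ card T = card S"
proof -
  let ?Q = "\<lambda>Gen. Gen \<subseteq> tuples_rep \<and> card (tuples_rep - Gen) * q \<le> (r - s) * card tuples_rep \<and>
            (\<forall>as\<in>Gen. distinct as \<and>
               (\<forall>T a0. T \<subseteq> set as \<times> B \<longrightarrow>
                  (\<forall>a\<in>set as. card {x. (a, x) \<in> T} \<le> (if a = a0 then d + 1 else d)) \<longrightarrow>
                  card {F \<in> S. \<forall>(a, x)\<in>T. x \<in> Z F a} * card B ^ card T = card S))"
  have "\<exists>G. ?Q G" using stats unfolding strip_statistics_def Let_def by blast
  then have Q: "?Q Gen" unfolding Gen_def by (rule someI_ex)
  from Q show "Gen \<subseteq> tuples_rep" "card (tuples_rep - Gen) * q \<le> (r - s) * card tuples_rep" by (blast, blast)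
  from Q show "\<And>as. as \<in> Gen \<Longrightarrow> distinct as" by blast
  fix as T a0 assume as: "as \<in> Gen" and T: "T \<subseteq> set as \<times> B"
    and few: "\<And>a. a \<in> set as \<Longrightarrow> card {x. (a, x) \<in> T} \<le> (if a = a0 then d + 1 else d)"
  from Q as have "\<forall>T a0. T \<subseteq> set as \<times> B \<longrightarrow>
                  (\<forall>a\<in>set as. card {x. (a, x) \<in> T} \<le> (if a = a0 then d + 1 else d)) \<longrightarrow>
                  card {F \<in> S. \<forall>(a, x)\<in>T. x \<in> Z F a} * card B ^ card T = card S" by blast
  from this[rule_format, OF T few] show "card {F \<in> S. \<forall>(a, x)\<in>T. x \<in> Z F a} * card B ^ card T = card S" .
qed

lemma p_Gen:
  assumes as: "as \<in> Gen" and i: "i \<le> h" and m: "m = d \<or> m = d + 1"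
  shows "\<bar>p i as - (1 - mu m) ^ i\<bar> \<le> exp 1 ^ i / fact (d + 1) + real i * (\<beta> + 2) / real q"
proof -
  let ?A = "set (take i as)"
  have len: "length as = h" and sub: "set as \<subseteq> strips K r s" using Gen(1) as by auto
  have card: "card ?A = i" using Gen(3)[OF as] i len by (simp add: distinct_card)
  have B: "finite B" "B \<noteq> {}" using K by (auto simp: finite_PiE PiE_eq_empty_iff)
  interpret strip_model S ?A B Z d
  proof
    show "finite S" "S \<noteq> {}" by (fact S)+
    show "finite ?A" by simp
    show "finite B" "B \<noteq> {}" by (fact B)+
    show "3 \<le> d" using s by simp
    show "Z F a \<subseteq> B" for F a by (auto simp: rational_zeros_def)
    fix T a0 assume T: "T \<subseteq> ?A \<times> B" and few: "\<And>a. a \<in> ?A \<Longrightarrow> card {x. (a, x) \<in> T} \<le> (if a = a0 then d + 1 else d)"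
    show "card {F \<in> S. \<forall>(a, x)\<in>T. x \<in> Z F a} * card B ^ card T = card S"
    proof (rule Gen(4)[OF as])
      show "T \<subseteq> set as \<times> B" using T set_take_subset by fast
      show "card {x. (a, x) \<in> T} \<le> (if a = a0 then d + 1 else d)" for a
      proof (cases "a \<in> ?A")
        case False
        then have "{x. (a, x) \<in> T} = {}" using T by auto
        then show ?thesis by simp
      qed (rule few)
    qed
  qed
  have qB: "real q \<le> real (card B)"
  proof -
    have "card B = q ^ s" using s by (simp add: card_funcsetE)
    also have "\<dots> \<ge> q ^ 1" using q s by (intro power_increasing) auto
    finally show ?thesis by simp
  qed
  then have "2 * real i / real (card B) \<le> 2 * real i / real q" using q by (intro divide_left_mono) auto
  moreover have "real i * (\<beta> + 2) / real q = real i * \<beta> / real q + 2 * real i / real q"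
    by (simp add: add_divide_distrib algebra_simps)
  ultimately show ?thesis using no_zero_probability_mu[OF m] p_no_zero[OF sub, of i] unfolding card by linarith
qed

lemma tuples: "tuples = {as \<in> tuples_rep. distinct as}" by (auto simp: strip_tuples_def)
lemma finite_tuples: "finite tuples" unfolding tuples by (rule finite_subset[OF _ finite_lists]) auto
lemma Gen_tuples: "Gen \<subseteq> tuples" using Gen(1,3) unfolding tuples by blast

lemma failure_prob_eq:
  "failure_prob L K r s d h t solver spec_cost \<Omega> = (\<Sum>as\<in>tuples. p h as) / real (card tuples)"
proof -
  have "{(as, F, \<omega>) \<in> tuples \<times> S \<times> \<Omega>. fst (svs_run L r s t solver spec_cost as F \<omega>) = None} =
      Sigma tuples (\<lambda>as. {z \<in> S \<times> \<Omega>. \<forall>a\<in>set (take h as). fails z a})"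
    by (auto simp: svs_run_def svs_fails strip_tuples_def)
  then have "real (card {(as, F, \<omega>) \<in> tuples \<times> S \<times> \<Omega>. fst (svs_run L r s t solver spec_cost as F \<omega>) = None}) =
      (\<Sum>as\<in>tuples. real (card {z \<in> S \<times> \<Omega>. \<forall>a\<in>set (take h as). fails z a}))"
    using finite_tuples S \<Omega> by (simp add: card_SigmaI)
  also have "\<dots> = (\<Sum>as\<in>tuples. p h as) * (real (card S) * real (card \<Omega>))"
    unfolding sum_distrib_right by (rule sum.cong) (use n in \<open>auto simp: p_def\<close>)
  finally show ?thesis using n by (simp add: failure_prob_def)
qed

lemma average_cost_le:
  "average_cost L K r s d h t solver spec_cost \<Omega> \<le> real t * ((\<Sum>as\<in>tuples. \<Sum>i<h. p i as) / real (card tuples))"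
proof -
  let ?run = "\<lambda>as z. svs_run L r s t solver spec_cost as (fst z) (snd z)"
  have cost: "real (snd (?run as z)) \<le> (\<Sum>i<h. real t * (if \<forall>a\<in>set (take i as). fails z a then 1 else 0))"
    if "as \<in> tuples" for as z
  proof -
    have "snd (?run as z) \<le> t * (\<Sum>i<length as. if \<forall>a\<in>set (take i as). fails z a then 1 else 0)"
      unfolding svs_run_def by (rule svs_cost) (rule search_cost)
    then have "real (snd (?run as z)) \<le> real (t * (\<Sum>i<length as. if \<forall>a\<in>set (take i as). fails z a then 1 else 0))"
      by (rule of_nat_mono)
    also have "\<dots> = (\<Sum>i<h. real t * (if \<forall>a\<in>set (take i as). fails z a then 1 else 0))"
      using that by (simp add: strip_tuples_def sum_distrib_left if_distrib cong: if_cong)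
    finally show ?thesis .
  qed
  have "(\<Sum>(as, F, \<omega>)\<in>tuples \<times> S \<times> \<Omega>. real (snd (svs_run L r s t solver spec_cost as F \<omega>)))
      = (\<Sum>as\<in>tuples. \<Sum>z\<in>S \<times> \<Omega>. real (snd (?run as z)))"
    by (simp add: sum.cartesian_product case_prod_beta)
  also have "\<dots> \<le> (\<Sum>as\<in>tuples. \<Sum>z\<in>S \<times> \<Omega>. \<Sum>i<h. real t * (if \<forall>a\<in>set (take i as). fails z a then 1 else 0))"
    by (intro sum_mono cost)
  also have "\<dots> = (\<Sum>as\<in>tuples. \<Sum>i<h. \<Sum>z\<in>S \<times> \<Omega>. real t * (if \<forall>a\<in>set (take i as). fails z a then 1 else 0))"
    by (intro sum.cong refl sum.swap)
  also have "\<dots> = (\<Sum>as\<in>tuples. \<Sum>i<h. real t * (p i as * (real (card S) * real (card \<Omega>))))"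
  proof (intro sum.cong refl)
    fix as i
    have "(\<Sum>z\<in>S \<times> \<Omega>. (if \<forall>a\<in>set (take i as). fails z a then 1 else 0 :: real)) =
        real (card {z \<in> S \<times> \<Omega>. \<forall>a\<in>set (take i as). fails z a})"
      using S \<Omega> by (simp add: sum.If_cases Int_def)
    then show "(\<Sum>z\<in>S \<times> \<Omega>. real t * (if \<forall>a\<in>set (take i as). fails z a then 1 else 0)) =
        real t * (p i as * (real (card S) * real (card \<Omega>)))"
      unfolding sum_distrib_left[symmetric] using n by (simp add: p_def)
  qed
  also have "\<dots> = real t * (\<Sum>as\<in>tuples. \<Sum>i<h. p i as) * (real (card S) * real (card \<Omega>))"
    by (simp only: sum_distrib_left sum_distrib_right mult.assoc)
  finally have "(\<Sum>(as, F, \<omega>)\<in>tuples \<times> S \<times> \<Omega>. real (snd (svs_run L r s t solver spec_cost as F \<omega>)))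
      \<le> real t * (\<Sum>as\<in>tuples. \<Sum>i<h. p i as) * (real (card S) * real (card \<Omega>))" .
  then have "average_cost L K r s d h t solver spec_cost \<Omega> \<le>
      real t * (\<Sum>as\<in>tuples. \<Sum>i<h. p i as) * (real (card S) * real (card \<Omega>)) /
        (real (card tuples) * real (card S) * real (card \<Omega>))"
    unfolding average_cost_def by (intro divide_right_mono) auto
  also have "\<dots> = real t * ((\<Sum>as\<in>tuples. \<Sum>i<h. p i as) / real (card tuples))"
    using n by simp
  finally show ?thesis .
qed

lemma few_degenerate:
  assumes "2 * (r - s) \<le> q"
  shows "tuples \<noteq> {}" "real (card (tuples - Gen)) \<le> 2 * real (r - s) / real q * real (card tuples)"
proof -
  have "card tuples_rep = card (strips K r s) ^ h"
    using card_lists_length_eq[OF finite_strips, of h] by (simp add: conj_commute)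
  moreover have "card (strips K r s) > 0" using K q by (simp add: strips_def card_funcsetE)
  ultimately have pos: "card tuples_rep > 0" by simp
  have "real (card (tuples_rep - Gen) * q) \<le> real ((r - s) * card tuples_rep)" using Gen(2) by (rule of_nat_mono)
  then have gen: "real (card (tuples_rep - Gen)) * real q \<le> real (r - s) * real (card tuples_rep)" by simp
  have "real (card (tuples_rep - Gen)) = real (card tuples_rep) - real (card Gen)"
    unfolding card_Diff_subset[OF finite_subset[OF Gen(1) finite_lists] Gen(1)]
    by (rule of_nat_diff[OF card_mono[OF finite_lists Gen(1)]])
  moreover have "real (card Gen) \<le> real (card tuples)" using card_mono[OF finite_tuples Gen_tuples] by simp
  moreover have "2 * real (card (tuples_rep - Gen)) \<le> real (card tuples_rep)"
  proof -
    have "2 * real (card (tuples_rep - Gen)) * real q \<le> 2 * real (r - s) * real (card tuples_rep)" using gen by simp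
    also have "\<dots> \<le> real q * real (card tuples_rep)" using assms by (intro mult_right_mono) (simp_all flip: of_nat_mult)
    finally show ?thesis using q by (simp add: mult.commute)
  qed
  ultimately have half: "real (card tuples_rep) \<le> 2 * real (card tuples)" by linarith
  then show "tuples \<noteq> {}" using pos by auto
  have "card (tuples - Gen) \<le> card (tuples_rep - Gen)"
    by (rule card_mono) (use finite_lists tuples in auto)
  then have "real (card (tuples - Gen)) * real q \<le> real (card (tuples_rep - Gen)) * real q" by (intro mult_right_mono) auto
  also have "\<dots> \<le> real (r - s) * (2 * real (card tuples))"
    using gen mult_left_mono[OF half, of "real (r - s)"] by simp
  finally show "real (card (tuples - Gen)) \<le> 2 * real (r - s) / real q * real (card tuples)"
    using q by (simp add: field_simps)
qed

abbreviation "err \<equiv> (6 + \<bar>c\<bar>) * (real r * (real d + 1) ^ (2 * r) / real q)"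

lemma h_bounds: "real h \<le> real r" "real h * (real d + 1) ^ (2 * s + 1) \<le> (real d + 1) ^ (2 * r)"
    "real h \<le> (real d + 1) ^ (2 * r)"
proof -
  show "real h \<le> real r" using s by simp
  have "h \<le> 2 ^ (r - s)" using less_exp[of "r - s"] by (simp add: Suc_le_eq)
  then have "real h \<le> real (2 ^ (r - s))" by (rule of_nat_mono)
  also have "\<dots> = 2 ^ (r - s)" by simp
  also have "\<dots> \<le> (real d + 1) ^ (r - s)" using s by (intro power_mono) auto
  finally have h: "real h \<le> (real d + 1) ^ (r - s)" .
  have "real h * (real d + 1) ^ (2 * s + 1) \<le> (real d + 1) ^ (r - s) * (real d + 1) ^ (2 * s + 1)"
    using h by (intro mult_right_mono) auto
  also have "\<dots> = (real d + 1) ^ ((r - s) + (2 * s + 1))" by (rule power_add[symmetric])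
  also have "\<dots> \<le> (real d + 1) ^ (2 * r)" using s by (intro power_increasing) auto
  finally show "real h * (real d + 1) ^ (2 * s + 1) \<le> (real d + 1) ^ (2 * r)" .
  have "(real d + 1) ^ (r - s) \<le> (real d + 1) ^ (2 * r)" by (intro power_increasing) auto
  with h show "real h \<le> (real d + 1) ^ (2 * r)" by simp
qed

lemma error_terms:
  assumes i: "real i \<le> real h"
  shows "real i * (real h * (\<beta> + 2)) / real q + real i * (2 * real (r - s) / real q) \<le> err"
proof -
  let ?D = "(real d + 1) ^ (2 * r)"
  have "real h * (\<beta> + 2) = 2 * (real h * (real d + 1) ^ (2 * s + 1)) + (\<bar>c\<bar> + 2) * real h"
    by (simp add: \<beta>_def algebra_simps)
  also have "\<dots> \<le> 2 * ?D + (\<bar>c\<bar> + 2) * ?D" using h_bounds by (intro add_mono mult_left_mono) auto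
  finally have 1: "real h * (\<beta> + 2) \<le> (4 + \<bar>c\<bar>) * ?D" by (simp add: algebra_simps)
  have 2: "2 * real (r - s) \<le> 2 * ?D" using h_bounds(3) by simp
  have "real h * (\<beta> + 2) + 2 * real (r - s) \<le> (6 + \<bar>c\<bar>) * ?D" using 1 2 by (simp add: algebra_simps)
  then have "real i * (real h * (\<beta> + 2) + 2 * real (r - s)) \<le> real r * ((6 + \<bar>c\<bar>) * ?D)"
    using i h_bounds(1) \<beta> by (intro mult_mono) auto
  then have "real i * (real h * (\<beta> + 2) + 2 * real (r - s)) / real q \<le> real r * ((6 + \<bar>c\<bar>) * ?D) / real q"
    by (rule divide_right_mono) simp
  then show ?thesis by (simp add: algebra_simps add_divide_distrib)
qed

lemma err_ge:
  assumes "q < 2 * (r - s)" shows "real h \<le> err" "1 \<le> err"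
proof -
  have "real q \<le> 2 * real r" using assms by simp
  then have "real h * real q \<le> (real d + 1) ^ (2 * r) * (2 * real r)"
    using h_bounds(3) by (intro mult_mono) auto
  also have "\<dots> \<le> (6 + \<bar>c\<bar>) * (real r * (real d + 1) ^ (2 * r))"
    using mult_right_mono[of 2 "6 + \<bar>c\<bar>" "real r * (real d + 1) ^ (2 * r)"] by (simp add: mult_ac)
  finally show 1: "real h \<le> err" using q by (simp add: field_simps)
  have "1 \<le> real h" by simp
  with 1 show "1 \<le> err" by linarith
qed

lemma failure_prob_bound:
  assumes m: "m = d \<or> m = d + 1"
  shows "\<bar>failure_prob L K r s d h t solver spec_cost \<Omega> - (1 - mu m) ^ h\<bar> \<le> exp 1 ^ h / fact (d + 1) + err"
proof -
  let ?x = "(1 - mu m) ^ h"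
  have mu: "0 < mu m" "mu m < 1" using mu_bounds[of m] m s by auto
  have x: "0 \<le> ?x" "?x \<le> 1" by (rule zero_le_power, use mu in simp, rule power_le_one) (use mu in simp_all)
  have e0: "0 \<le> exp 1 ^ h / (fact (d + 1) :: real)" by simp
  show ?thesis
  proof (cases "2 * (r - s) \<le> q")
    case False
    have "(\<Sum>as\<in>tuples. p h as) / real (card tuples) \<le> 1"
      using sum_bounded_above[of tuples "p h" 1] p_bounds
      by (cases "card tuples = 0") (auto simp: divide_le_eq)
    moreover have "0 \<le> (\<Sum>as\<in>tuples. p h as) / real (card tuples)" using p_bounds by (simp add: sum_nonneg)
    moreover have "1 \<le> err" using err_ge False by simp
    ultimately show ?thesis using x e0 unfolding failure_prob_eq by linarith
  next
    case True
    note T = few_degenerate[OF True]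
    let ?u = "exp 1 ^ h / fact (d + 1) + real h * (\<beta> + 2) / real q"
    have u: "0 \<le> ?u" using \<beta> by simp
    have pos: "real (card tuples) > 0" using T(1) finite_tuples by (simp add: card_gt_0_iff)
    have eq: "(\<Sum>as\<in>A. f as) / real (card A) - y = (\<Sum>as\<in>A. f as - y) / real (card A)"
      if "real (card A) > 0" for f :: "(nat \<Rightarrow> 'a) list \<Rightarrow> real" and A y
      using that by (simp add: sum_subtractf field_simps)
    from pos have "(\<Sum>as\<in>tuples. p h as) / real (card tuples) - ?x = (\<Sum>as\<in>tuples. p h as - ?x) / real (card tuples)"
      by (intro eq)
    then have "\<bar>(\<Sum>as\<in>tuples. p h as) / real (card tuples) - ?x\<bar> \<le> (\<Sum>as\<in>tuples. \<bar>p h as - ?x\<bar>) / real (card tuples)"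
      by (simp add: abs_divide divide_right_mono)
    also have "\<dots> \<le> ?u + 1 * (2 * real (r - s) / real q)"
    proof (rule average_le[OF finite_tuples T(1) Gen_tuples T(2)])
      show "\<bar>p h as - ?x\<bar> \<le> ?u" if "as \<in> Gen" for as by (rule p_Gen[OF that order_refl m])
      show "\<bar>p h as - ?x\<bar> \<le> ?u + 1" for as using p_bounds[of h as] x u by linarith
    qed simp
    finally show ?thesis using error_terms[of 1] unfolding failure_prob_eq by simp
  qed
qed

lemma average_cost_bound:
  assumes m: "m = d \<or> m = d + 1"
  shows "average_cost L K r s d h t solver spec_cost \<Omega> \<le>
    real t * (inverse (mu m) + real h * (1 - mu m) ^ h + 3 * real h * exp 1 ^ h / fact (d + 1) + err)"
proof -
  have mu: "0 < mu m" "mu m < 1" using mu_bounds[of m] m s by auto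
  let ?a = "inverse (mu m) + 3 * real h * exp 1 ^ h / fact (d + 1)"
  have a: "0 \<le> ?a" using mu by simp
  have p_sum: "(\<Sum>i<h. p i as) \<le> real h" for as
    using sum_bounded_above[of "{..<h}" "\<lambda>i. p i as" 1] p_bounds by simp
  have main: "(\<Sum>as\<in>tuples. \<Sum>i<h. p i as) / real (card tuples) \<le> ?a + err"
  proof (cases "2 * (r - s) \<le> q")
    case False
    have "(\<Sum>as\<in>tuples. \<Sum>i<h. p i as) \<le> real (card tuples) * real h" by (rule sum_bounded_above) (rule p_sum)
    then have "(\<Sum>as\<in>tuples. \<Sum>i<h. p i as) / real (card tuples) \<le> real h"
      by (cases "card tuples = 0") (auto simp: divide_le_eq mult.commute)
    also have "\<dots> \<le> err" using err_ge False by simp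
    finally show ?thesis using a by linarith
  next
    case True
    note T = few_degenerate[OF True]
    let ?u = "?a + real h * (real h * (\<beta> + 2)) / real q"
    have u: "0 \<le> ?u" using \<beta> a by simp
    have "(\<Sum>as\<in>tuples. \<Sum>i<h. p i as) / real (card tuples) \<le> ?u + real h * (2 * real (r - s) / real q)"
    proof (rule average_le[OF finite_tuples T(1) Gen_tuples T(2)])
      fix as
      show "(\<Sum>i<h. p i as) \<le> ?u + real h" using p_sum[of as] u by linarith
      assume as: "as \<in> Gen"
      have "(\<Sum>i<h. p i as) \<le> (\<Sum>i<h. (1 - mu m) ^ i + (exp 1 ^ h / fact (d + 1) + real h * (\<beta> + 2) / real q))"
      proof (rule sum_mono)
        fix i assume i: "i \<in> {..<h}"
        then have "exp 1 ^ i / fact (d + 1) \<le> exp 1 ^ h / (fact (d + 1) :: real)"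
          by (intro divide_right_mono power_increasing) auto
        moreover have "real i * (\<beta> + 2) / real q \<le> real h * (\<beta> + 2) / real q"
          using i \<beta> by (intro divide_right_mono mult_right_mono) auto
        moreover have "i \<le> h" using i by simp
        ultimately show "p i as \<le> (1 - mu m) ^ i + (exp 1 ^ h / fact (d + 1) + real h * (\<beta> + 2) / real q)"
          using p_Gen[OF as _ m, of i] by linarith
      qed
      also have "\<dots> = (\<Sum>i<h. (1 - mu m) ^ i) + real h * (exp 1 ^ h / fact (d + 1) + real h * (\<beta> + 2) / real q)"
        by (simp add: sum.distrib)
      also have "(\<Sum>i<h. (1 - mu m) ^ i) \<le> inverse (mu m)"
      proof -
        have "(\<Sum>i<h. (1 - mu m) ^ i) = (1 - (1 - mu m) ^ h) / mu m" using mu by (subst sum_gp_strict) simp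
        also have "\<dots> \<le> 1 / mu m" using mu by (intro divide_right_mono) auto
        finally show ?thesis by (simp add: inverse_eq_divide)
      qed
      finally have "(\<Sum>i<h. p i as) \<le> inverse (mu m) + real h * (exp 1 ^ h / fact (d + 1)) + real h * (real h * (\<beta> + 2)) / real q"
        by (simp add: algebra_simps)
      moreover have "real h * (exp 1 ^ h / fact (d + 1)) \<le> 3 * real h * exp 1 ^ h / fact (d + 1)"
        by (simp add: divide_right_mono)
      ultimately show "(\<Sum>i<h. p i as) \<le> ?u" by linarith
    qed simp
    then show ?thesis using error_terms[of h] by linarith
  qed
  have "0 \<le> real h * (1 - mu m) ^ h" using mu by simp
  then have "(\<Sum>as\<in>tuples. \<Sum>i<h. p i as) / real (card tuples) \<le>
      inverse (mu m) + real h * (1 - mu m) ^ h + 3 * real h * exp 1 ^ h / fact (d + 1) + err"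
    using main by linarith
  then have "real t * ((\<Sum>as\<in>tuples. \<Sum>i<h. p i as) / real (card tuples)) \<le>
      real t * (inverse (mu m) + real h * (1 - mu m) ^ h + 3 * real h * exp 1 ^ h / fact (d + 1) + err)"
    by (rule mult_left_mono) simp
  with average_cost_le show ?thesis by (rule order_trans)
qed

end

section \<open>The average-case complexity and the failure probability\<close>

theorem theorem1p4:
  "\<forall>c::real. \<exists>C::real.
     \<forall>(L :: 'a ring) K q r s d h (\<tau> :: nat \<Rightarrow> nat \<Rightarrow> nat \<Rightarrow> nat)
       (solver :: ('a, 'w) zero_solver) spec_cost \<Omega>.
       algebraic_closure L K \<and> finite K \<and> card K = q \<and>
       1 < s \<and> s < r \<and> d > s \<and> q > 2 * d ^ s * (d + 1) ^ s \<and> h = r - s + 1 \<and>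
       finite \<Omega> \<and> \<Omega> \<noteq> {} \<and>
       outputs_true_zeros L K r s d solver \<Omega> \<and>
       solver_reliable L K r s d (\<tau> d s q) solver spec_cost \<Omega> c
       \<longrightarrow>
       (let E = average_cost L K r s d h (\<tau> d s q) solver spec_cost \<Omega>;
            P = failure_prob L K r s d h (\<tau> d s q) solver spec_cost \<Omega>;
            err = C * (real r * (real d + 1) ^ (2 * r) / real q)
        in (odd d \<longrightarrow>
              E \<le> real (\<tau> d s q) * (inverse (mu d) + real h * (1 - mu d) ^ h
                     + 3 * real h * exp 1 ^ h / fact (d + 1) + err)) \<and>
           (even d \<longrightarrow>
              E \<le> real (\<tau> d s q) * (inverse (mu (d + 1)) + real h * (1 - mu (d + 1)) ^ h
                     + 3 * real h * exp 1 ^ h / fact (d + 1) + err)) \<and>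
           (odd d \<longrightarrow>
              \<bar>P - (1 - mu d) ^ h\<bar> \<le> exp 1 ^ h / fact (d + 1) + err) \<and>
           (even d \<longrightarrow>
              \<bar>P - (1 - mu (d + 1)) ^ h\<bar> \<le> exp 1 ^ h / fact (d + 1) + err))"
proof
  fix c :: real
  show "\<exists>C::real.
     \<forall>(L :: 'a ring) K q r s d h (\<tau> :: nat \<Rightarrow> nat \<Rightarrow> nat \<Rightarrow> nat)
       (solver :: ('a, 'w) zero_solver) spec_cost \<Omega>.
       algebraic_closure L K \<and> finite K \<and> card K = q \<and>
       1 < s \<and> s < r \<and> d > s \<and> q > 2 * d ^ s * (d + 1) ^ s \<and> h = r - s + 1 \<and>
       finite \<Omega> \<and> \<Omega> \<noteq> {} \<and>
       outputs_true_zeros L K r s d solver \<Omega> \<and>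
       solver_reliable L K r s d (\<tau> d s q) solver spec_cost \<Omega> c
       \<longrightarrow>
       (let E = average_cost L K r s d h (\<tau> d s q) solver spec_cost \<Omega>;
            P = failure_prob L K r s d h (\<tau> d s q) solver spec_cost \<Omega>;
            err = C * (real r * (real d + 1) ^ (2 * r) / real q)
        in (odd d \<longrightarrow>
              E \<le> real (\<tau> d s q) * (inverse (mu d) + real h * (1 - mu d) ^ h
                     + 3 * real h * exp 1 ^ h / fact (d + 1) + err)) \<and>
           (even d \<longrightarrow>
              E \<le> real (\<tau> d s q) * (inverse (mu (d + 1)) + real h * (1 - mu (d + 1)) ^ h
                     + 3 * real h * exp 1 ^ h / fact (d + 1) + err)) \<and>
           (odd d \<longrightarrow>
              \<bar>P - (1 - mu d) ^ h\<bar> \<le> exp 1 ^ h / fact (d + 1) + err) \<and>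
           (even d \<longrightarrow>
              \<bar>P - (1 - mu (d + 1)) ^ h\<bar> \<le> exp 1 ^ h / fact (d + 1) + err))"
  proof (rule exI[of _ "6 + \<bar>c\<bar>"], intro allI impI, elim conjE)
    fix L :: "'a ring" and K q r s d h and \<tau> :: "nat \<Rightarrow> nat \<Rightarrow> nat \<Rightarrow> nat"
      and solver :: "('a, 'w) zero_solver" and spec_cost and \<Omega> :: "'w set"
    assume alg: "algebraic_closure L K" and K: "finite K" "card K = q" and s: "1 < s" "s < r" "d > s"
      and h: "h = r - s + 1" and \<Omega>: "finite \<Omega>" "\<Omega> \<noteq> {}"
      and true_zeros: "outputs_true_zeros L K r s d solver \<Omega>"
      and reliable: "solver_reliable L K r s d (\<tau> d s q) solver spec_cost \<Omega> c"
    interpret A: algebraic_closure L K by (rule alg)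
    have sub: "subfield K L" by (rule A.subfield_axioms)
    have "tame L" by (rule tame[OF A.algebraically_closed_axioms])
    then have stats: "strip_statistics L K r s d"
      unfolding tame_def using sub K(1) s by (meson less_imp_le)
    have ne: "K \<noteq> {}" using subringE(2)[OF subfieldE(1)[OF sub]] by blast
    interpret SV: svs_setting L K r s d "\<tau> d s q" solver spec_cost \<Omega> c
      by (rule svs_setting.intro[OF stats s K(1) ne \<Omega> true_zeros reliable])
    note bounds = SV.average_cost_bound[OF disjI1[OF refl]] SV.average_cost_bound[OF disjI2[OF refl]]
      SV.failure_prob_bound[OF disjI1[OF refl]] SV.failure_prob_bound[OF disjI2[OF refl]]
    show "let E = average_cost L K r s d h (\<tau> d s q) solver spec_cost \<Omega>;
            P = failure_prob L K r s d h (\<tau> d s q) solver spec_cost \<Omega>;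
            err = (6 + \<bar>c\<bar>) * (real r * (real d + 1) ^ (2 * r) / real q)
        in (odd d \<longrightarrow>
              E \<le> real (\<tau> d s q) * (inverse (mu d) + real h * (1 - mu d) ^ h
                     + 3 * real h * exp 1 ^ h / fact (d + 1) + err)) \<and>
           (even d \<longrightarrow>
              E \<le> real (\<tau> d s q) * (inverse (mu (d + 1)) + real h * (1 - mu (d + 1)) ^ h
                     + 3 * real h * exp 1 ^ h / fact (d + 1) + err)) \<and>
           (odd d \<longrightarrow>
              \<bar>P - (1 - mu d) ^ h\<bar> \<le> exp 1 ^ h / fact (d + 1) + err) \<and>
           (even d \<longrightarrow>
              \<bar>P - (1 - mu (d + 1)) ^ h\<bar> \<le> exp 1 ^ h / fact (d + 1) + err)"
      unfolding Let_def h K(2)[symmetric] by (intro conjI impI) (rule bounds[unfolded K(2)[symmetric]])+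
  qed
qed

end
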